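(* Let $\Omega\subset\mathbb{R}^N$ be a bounded $C^1$-domain, let $\mathcal{I}(u,x)=\int_{\mathbb{R}^N}[u(x+z)-u(x)]\,\nu_x(dz)$ satisfy assumptions (M0), (M1), (M2), (M3) of the context with the same $\sigma\in(0,1)$ and the iterative covering property of the context, let $H_0\in C(\bar\Omega\times\mathbb{R}^N)$ satisfy (H2) of the context with $m>1$, and let $c\in\mathbb{R}$. 1. (Parabolic version) Let $u,v$ be bounded and respectively a viscosity subsolution and a viscosity supersolution to the state-constraint problem $$\partial_tu-\mathcal{I}(u)+H_0(x,Du)=c\ \text{in }Q,\qquad\partial_tu-\mathcal{I}(u)+H_0(x,Du)\ge c\ \text{on }\partial Q,$$ with $u(x,t)=\limsup_{(y,s)\to(x,t),\,y\in\Omega}u(y,s)$ for all $(x,t)\in\partial Q$. For $t\ge0$ let $\kappa(t)=\sup_{x\in\bar\Omega}\{u(x,t)-v(x,t)\}$, and assume there exists $t_0>0$ with $\kappa(t_0)=\sup_{t\ge0}\kappa(t)$. Then $u-v$ is constant in $\bar\Omega\times[0,t_0]$; moreover $(u-v)(x,t)=\kappa(0)$ for all $(x,t)\in\bar\Omega\times[0,t_0]$. 2. (Stationary version) Let $u,v$ be bounded and respectively a viscosity subsolution and a viscosity supersolution to the state-constraint problem $$-\mathcal{I}(u)+H_0(x,Du)=c\ \text{in }\Omega,\qquad-\mathcal{I}(u)+H_0(x,Du)\ge c\ \text{on }\partial\Omega,$$ with $u(x)=\limsup_{y\to x,\,y\in\Omega}u(y)$ for all $x\in\partial\Omega$. Then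 $u-v$ is constant in $\bar\Omega$.
   Context: Notation: $Q=\Omega\times(0,\infty)$, $\partial Q=\partial\Omega\times(0,\infty)$, $d(x)=\mathrm{dist}(x,\partial\Omega)$, $B_r(x)$ is the open ball, $B_r=B_r(0)$, $B_r^c$ its complement. "$C^1$-domain" means that the boundary is $C^1$, with the convention that there is $\delta_0>0$ such that $d$ is of class $C^1$ in $\{x\in\Omega:d(x)<\delta_0\}$. For each $x\in\bar\Omega$, $\nu_x$ is a nonnegative regular measure on $\mathbb{R}^N$. For $D\subset\mathbb{R}^N$, $\mathcal{I}[D](u,y)=\int_D[u(y+z)-u(y)]\nu_y(dz)$. (M0): (M0-1) $\bigcup_{x\in\bar\Omega}\{x+\mathrm{supp}\,\nu_x\}\subseteq\bar\Omega$. (M0-2) if $x\in\bar\Omega$, $r>0$ and $u\in L^\infty(\bar\Omega)$ is $C^1$ in $B_r(x)$ (i.e. in $B_r(x)\cap\bar\Omega$), then $\mathcal{I}(u,x)$ is well defined, and for any $D\subset\mathbb{R}^N$ the map $y\mapsto\mathcal{I}[D](u,y)$ is continuous in $B_r(x)$ (i.e. in $B_r(x)\cap\bar\Omega$). (M1): there is $C_1>0$ such that for all $\beta\in[0,2]$ and $\delta>0$, $\sup_{x\in\bar\Omega}\int_{B_\delta^c}\min\{1,|z|^\beta\}\nu_x(dz)\le C_1h_{\beta,\sigma}(\delta)$, where $h_{\beta,\sigma}(\delta)=\delta^{\beta-\sigma}$ if $\beta<\sigma$, $=|\ln\delta|+1$ if $\beta=\sigma$, $=1$ if $\beta>\sigma$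 (convention $|z|^0=1$). (M2): there is $C_2>0$ such that for all $\beta\in(\sigma,2]$ and $\delta\in(0,1)$, $\sup_{x\in\bar\Omega}\int_{B_\delta}|z|^\beta\nu_x(dz)\le C_2\delta^{\beta-\sigma}$. (M3): for each $\beta>0$ there is a modulus of continuity $\omega_{\beta,\sigma}$ such that for all $x,y\in\bar\Omega$, $\delta>0$, $\int_{B_\delta^c}|z|^\beta|\nu_x(dz)-\nu_y(dz)|\le(1+h_{\beta,\sigma}(\delta))\,\omega_{\beta,\sigma}(|x-y|)$, where $|\nu_x-\nu_y|$ is the total variation measure. Iterative covering property: with $X_0(x)=\{x\}$, $X_{n+1}(x)=\bigcup_{\xi\in X_n(x)}\{\xi+\mathrm{supp}\,\nu_\xi\}$ and $\mathcal{X}(x)=\overline{\bigcup_{n\in\mathbb{N}}X_n(x)}$, one has $\mathcal{X}(x)=\bar\Omega$ for all $x\in\bar\Omega$. (H2) for $H_0$ (with exponent $m$): there are $\underline c>0$, $C\ge0$ with $H_0(x,p)\ge\underline c|p|^m-C$ for all $x\in\bar\Omega$, $p\in\mathbb{R}^N$. Viscosity sub/supersolutions of the state-constraint problems. Put $\mathcal{E}_\delta(u,\phi,x,t)=\phi_t(x,t)-\mathcal{I}[B_\delta](\phi(\cdot,t),x)-\mathcal{I}[B_\delta^c](u(\cdot,t),x)+H_0(x,D\phi(x,t))-c$. A subsolution is an upper semicontinuous $u:\bar Q\to\mathbb{R}$ such that for $\phi\in C^1(\bar Q)$, at each maximum point $(x_0,t_0)\in Q$ of $u-\phi$ on $\bar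 Q$, $\mathcal{E}_\delta(u,\phi,x_0,t_0)\le0$ for all $\delta>0$ (no condition on $\partial Q$). A supersolution is a lower semicontinuous $v:\bar Q\to\mathbb{R}$ such that for $\phi\in C^1(\bar Q)$, at each minimum point $(x_0,t_0)\in\bar\Omega\times(0,\infty)$ of $v-\phi$ on $\bar Q$, $\mathcal{E}_\delta(v,\phi,x_0,t_0)\ge0$ for all $\delta>0$. The stationary notions are the same without the time variable (test functions in $C^1(\bar\Omega)$, extrema on $\bar\Omega$; subsolution condition at points of $\Omega$, supersolution condition at points of $\bar\Omega$). *)

theory Defs
  imports "HOL-Analysis.Analysis"
begin

section \<open>Classes of functions\<close>

text \<open>
  Functions on \<open>closure \<Omega>\<close> or on \<open>closure \<Omega> \<times> {0..}\<close> are encoded as total functions whose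
  values off the domain never matter. \<open>S\<close> below is an open set or the closure of one with
  \<open>C\<^sup>1\<close> boundary, possibly cut by a ball or multiplied by \<open>{0..}\<close>; on such sets the gradient
  within \<open>S\<close> is unique.
\<close>

definition has_C1_gradient :: "'a::euclidean_space set \<Rightarrow> ('a \<Rightarrow> real) \<Rightarrow> ('a \<Rightarrow> 'a) \<Rightarrow> bool" where
  "has_C1_gradient S f g \<longleftrightarrow>
     continuous_on S g \<and> (\<forall>x\<in>S. (f has_derivative (\<lambda>h. g x \<bullet> h)) (at x within S))"

definition C1_on :: "'a::euclidean_space set \<Rightarrow> ('a \<Rightarrow> real) \<Rightarrow> bool" where
  "C1_on S f \<longleftrightarrow> (\<exists>g. has_C1_gradient S f g)"

definition usc_on :: "'a::topological_space set \<Rightarrow> ('a \<Rightarrow> real) \<Rightarrow> bool" where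
  "usc_on S f \<longleftrightarrow> (\<forall>x\<in>S. \<forall>a>f x. eventually (\<lambda>y. f y < a) (at x within S))"

definition lsc_on :: "'a::topological_space set \<Rightarrow> ('a \<Rightarrow> real) \<Rightarrow> bool" where
  "lsc_on S f \<longleftrightarrow> (\<forall>x\<in>S. \<forall>a<f x. eventually (\<lambda>y. a < f y) (at x within S))"

definition modulus_of_continuity :: "(real \<Rightarrow> real) \<Rightarrow> bool" where
  "modulus_of_continuity \<omega> \<longleftrightarrow> \<omega> 0 = 0 \<and> mono_on {0..} \<omega> \<and> continuous_on {0..} \<omega>"


section \<open>Bounded \<open>C\<^sup>1\<close>-domains\<close>

text \<open>
  Near each boundary point, \<open>\<Omega>\<close> is the strict epigraph, in some direction \<open>e\<close>, of a \<open>C\<^sup>1\<close> function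
  of the component orthogonal to \<open>e\<close>. That function lives on the hyperplane orthogonal to \<open>e\<close>;
  taking it on the whole space loses nothing, since one may compose with the orthogonal projection.
\<close>

definition C1_boundary :: "'a::euclidean_space set \<Rightarrow> bool" where
  "C1_boundary \<Omega> \<longleftrightarrow>
     (\<forall>x\<in>frontier \<Omega>. \<exists>r>0. \<exists>e \<gamma>. norm e = 1 \<and> C1_on UNIV \<gamma> \<and>
        \<Omega> \<inter> ball x r = {y \<in> ball x r. \<gamma> (y - (y \<bullet> e) *\<^sub>R e) < y \<bullet> e})"

definition bounded_C1_domain :: "'a::euclidean_space set \<Rightarrow> bool" where
  "bounded_C1_domain \<Omega> \<longleftrightarrow>
     open \<Omega> \<and> connected \<Omega> \<and> \<Omega> \<noteq> {} \<and> bounded \<Omega> \<and> C1_boundary \<Omega> \<and>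
     (\<exists>\<delta>\<^sub>0>0. C1_on {x\<in>\<Omega>. infdist x (frontier \<Omega>) < \<delta>\<^sub>0} (\<lambda>x. infdist x (frontier \<Omega>)))"


section \<open>Jump measures\<close>

text \<open>
  Jump measures may have infinite mass near the origin, as \<open>norm z powr (- N - \<sigma>) dz\<close> does. No such
  measure without an atom at \<open>0\<close> is outer regular at the set \<open>{0}\<close>, so outer regularity is only
  asked for sets avoiding the origin.
\<close>

definition regular_jump_measure :: "'a::euclidean_space measure \<Rightarrow> bool" where
  "regular_jump_measure M \<longleftrightarrow> sets M = sets borel \<and>
     (\<forall>A\<in>sets borel. emeasure M A = (SUP K\<in>{K. K \<subseteq> A \<and> compact K}. emeasure M K)) \<and>
     (\<forall>A\<in>sets borel. 0 \<notin> A \<longrightarrow> emeasure M A = (INF U\<in>{U. A \<subseteq> U \<and> open U}. emeasure M U))"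

definition measure_support :: "'a::euclidean_space measure \<Rightarrow> 'a set" where
  "measure_support M = {z. \<forall>r>0. emeasure M (ball z r) > 0}"

text \<open>
  The integral is cut to the \<open>z\<close> with \<open>x + z \<in> closure \<Omega>\<close> because \<open>u\<close> is only meaningful there.
  Under \<open>M0\<close> the discarded \<open>z\<close> form a null set of \<open>\<nu> x\<close>.
\<close>

definition nonlocal ::
  "'a::euclidean_space set \<Rightarrow> ('a \<Rightarrow> 'a measure) \<Rightarrow> 'a set \<Rightarrow> ('a \<Rightarrow> real) \<Rightarrow> 'a \<Rightarrow> real" where
  "nonlocal \<Omega> \<nu> D u x = (LINT z:{z\<in>D. x + z \<in> closure \<Omega>}|\<nu> x. u (x + z) - u x)"

text \<open>
  \<open>L\<^sup>\<infinity>\<close> is read as bounded Borel functions rather than classes modulo Lebesgue null sets: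
  \<open>\<nu> x\<close> need not be absolutely continuous, and the operator uses the value \<open>u x\<close>.
\<close>

definition M0 :: "'a::euclidean_space set \<Rightarrow> ('a \<Rightarrow> 'a measure) \<Rightarrow> bool" where
  "M0 \<Omega> \<nu> \<longleftrightarrow>
     (\<Union>x\<in>closure \<Omega>. (+) x ` measure_support (\<nu> x)) \<subseteq> closure \<Omega> \<and>
     (\<forall>x\<in>closure \<Omega>. \<forall>r>0. \<forall>u.
        set_borel_measurable borel (closure \<Omega>) u \<and> bounded (u ` closure \<Omega>) \<and>
        C1_on (ball x r \<inter> closure \<Omega>) u \<longrightarrow>
          set_integrable (\<nu> x) {z. x + z \<in> closure \<Omega>} (\<lambda>z. u (x + z) - u x) \<and>
          (\<forall>D\<in>sets borel. continuous_on (ball x r \<inter> closure \<Omega>) (nonlocal \<Omega> \<nu> D u)))"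

definition h_rate :: "real \<Rightarrow> real \<Rightarrow> real \<Rightarrow> real" where
  "h_rate \<beta> \<sigma> \<delta> =
     (if \<beta> < \<sigma> then \<delta> powr (\<beta> - \<sigma>) else if \<beta> = \<sigma> then \<bar>ln \<delta>\<bar> + 1 else 1)"

definition M1 :: "'a::euclidean_space set \<Rightarrow> ('a \<Rightarrow> 'a measure) \<Rightarrow> real \<Rightarrow> bool" where
  "M1 \<Omega> \<nu> \<sigma> \<longleftrightarrow> (\<exists>C\<^sub>1>0. \<forall>\<beta>\<in>{0..2}. \<forall>\<delta>>0.
     (SUP x\<in>closure \<Omega>. \<integral>\<^sup>+z\<in>- ball 0 \<delta>. ennreal (min 1 (norm z powr \<beta>)) \<partial>\<nu> x)
       \<le> ennreal (C\<^sub>1 * h_rate \<beta> \<sigma> \<delta>))"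

definition M2 :: "'a::euclidean_space set \<Rightarrow> ('a \<Rightarrow> 'a measure) \<Rightarrow> real \<Rightarrow> bool" where
  "M2 \<Omega> \<nu> \<sigma> \<longleftrightarrow> (\<exists>C\<^sub>2>0. \<forall>\<beta>\<in>{\<sigma><..2}. \<forall>\<delta>\<in>{0<..<1}.
     (SUP x\<in>closure \<Omega>. \<integral>\<^sup>+z\<in>ball 0 \<delta>. ennreal (norm z powr \<beta>) \<partial>\<nu> x)
       \<le> ennreal (C\<^sub>2 * \<delta> powr (\<beta> - \<sigma>)))"

text \<open>
  The total variation measure of \<open>M - N\<close>, for finite measures with the same measurable sets.
\<close>

definition total_variation :: "'a measure \<Rightarrow> 'a measure \<Rightarrow> 'a set \<Rightarrow> ennreal" where
  "total_variation M N A =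
     (SUP P\<in>{P. finite P \<and> P \<subseteq> sets M \<and> disjoint P \<and> \<Union>P = A}.
        \<Sum>B\<in>P. ennreal \<bar>measure M B - measure N B\<bar>)"

definition total_variation_measure :: "'a measure \<Rightarrow> 'a measure \<Rightarrow> 'a measure" where
  "total_variation_measure M N = measure_of (space M) (sets M) (total_variation M N)"

lemma emeasure_total_variation_measure:
  assumes fM: "finite_measure M" and fN: "finite_measure N" and sN: "sets N = sets M"
    and A: "A \<in> sets M"
  shows "emeasure (total_variation_measure M N) A = total_variation M N A"
proof -
  interpret M: finite_measure M by fact
  interpret N: finite_measure N by fact
  obtain Y where Y: "Y \<in> sets M"
    and Yle: "\<And>X. X \<in> sets M \<Longrightarrow> X \<subseteq> Y \<Longrightarrow> measure N X \<le> measure M X"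
    and Yge: "\<And>X. X \<in> sets M \<Longrightarrow> X \<inter> Y = {} \<Longrightarrow> measure M X \<le> measure N X"
    using finite_unsigned_Hahn_decomposition[OF fM fN sN]
    by (auto simp: M.emeasure_eq_measure N.emeasure_eq_measure)
  define g where "g X = (measure M (X \<inter> Y) - measure N (X \<inter> Y))
      + (measure N (X - Y) - measure M (X - Y))" for X
  have in_sets: "X \<inter> Y \<in> sets M" "X - Y \<in> sets M" "X \<inter> Y \<in> sets N" "X - Y \<in> sets N"
    if "X \<in> sets M" for X
    using that Y sN by auto
  have split: "measure M X = measure M (X \<inter> Y) + measure M (X - Y)"
    "measure N X = measure N (X \<inter> Y) + measure N (X - Y)" if "X \<in> sets M" for X
    using in_sets[OF that] that
      M.finite_measure_Union[of "X \<inter> Y" "X - Y"] N.finite_measure_Union[of "X \<inter> Y" "X - Y"]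
    by (auto simp: Int_Diff_Un)
  have nonneg: "measure N (X \<inter> Y) \<le> measure M (X \<inter> Y)" "measure M (X - Y) \<le> measure N (X - Y)"
    if "X \<in> sets M" for X
    using in_sets[OF that] by (auto intro!: Yle Yge)
  have g0: "0 \<le> g X" if "X \<in> sets M" for X
    using nonneg[OF that] by (simp add: g_def)
  have g_sums: "(\<lambda>i. g (F i)) sums g (\<Union>(range F))"
    if F: "range F \<subseteq> sets M" "disjoint_family F" for F :: "nat \<Rightarrow> 'a set"
  proof -
    have d: "disjoint_family (\<lambda>i. F i \<inter> Y)" "disjoint_family (\<lambda>i. F i - Y)"
      using F(2) by (auto simp: disjoint_family_on_def)
    have "range (\<lambda>i. F i \<inter> Y) \<subseteq> sets M" "range (\<lambda>i. F i - Y) \<subseteq> sets M"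
      using F(1) in_sets by auto
    then show ?thesis
      unfolding g_def UN_simps(4)[symmetric] UN_simps(6)[symmetric]
      using d sN by (intro sums_add sums_diff M.finite_measure_UNION N.finite_measure_UNION) auto
  qed
  have tv: "total_variation M N X = ennreal (g X)" if X: "X \<in> sets M" for X
  proof (rule antisym)
    show "total_variation M N X \<le> ennreal (g X)"
      unfolding total_variation_def
    proof (rule SUP_least, clarify)
      fix P assume P: "finite P" "P \<subseteq> sets M" "disjoint P" and "X = \<Union>P"
      have d: "disjoint_family_on (\<lambda>B. B \<inter> Y) P" "disjoint_family_on (\<lambda>B. B - Y) P"
        using P(3) by (auto simp: disjoint_family_on_def disjoint_def)
      have *: "(\<lambda>B. B \<inter> Y) ` P \<subseteq> sets M" "(\<lambda>B. B - Y) ` P \<subseteq> sets M"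
        using P(2) in_sets by auto
      have U: "\<Union>P \<inter> Y = (\<Union>B\<in>P. B \<inter> Y)" "\<Union>P - Y = (\<Union>B\<in>P. B - Y)" by auto
      have "(\<Sum>B\<in>P. ennreal \<bar>measure M B - measure N B\<bar>) \<le> (\<Sum>B\<in>P. ennreal (g B))"
      proof (intro sum_mono ennreal_leI)
        fix B assume "B \<in> P"
        then have "B \<in> sets M" using P(2) by auto
        then show "\<bar>measure M B - measure N B\<bar> \<le> g B"
          using split[of B] nonneg[of B] by (simp add: g_def abs_le_iff)
      qed
      also have "\<dots> = ennreal (\<Sum>B\<in>P. g B)"
        using P(2) g0 by (intro sum_ennreal) auto
      also have "(\<Sum>B\<in>P. g B) = g (\<Union>P)"
        unfolding g_def U M.finite_measure_finite_Union[OF P(1) *(1) d(1)]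
          M.finite_measure_finite_Union[OF P(1) *(2) d(2)]
          N.finite_measure_finite_Union[OF P(1) *(1)[folded sN] d(1)]
          N.finite_measure_finite_Union[OF P(1) *(2)[folded sN] d(2)]
        by (simp add: sum.distrib sum_subtractf)
      finally show "(\<Sum>B\<in>P. ennreal \<bar>measure M B - measure N B\<bar>) \<le> ennreal (g (\<Union>P))" .
    qed
    let ?P = "{X \<inter> Y, X - Y}"
    have "(\<Sum>B\<in>?P. ennreal \<bar>measure M B - measure N B\<bar>) = ennreal (g X)"
    proof (cases "X \<inter> Y = X - Y")
      case True
      then have "X \<inter> Y = {}" "X - Y = {}" by auto
      then show ?thesis unfolding g_def by (simp only: \<open>X \<inter> Y = {}\<close> \<open>X - Y = {}\<close>) simp
    next
      case False
      then show ?thesis using nonneg[OF X] by (simp add: g_def ennreal_plus[symmetric] del: ennreal_plus)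
    qed
    moreover have "?P \<in> {P. finite P \<and> P \<subseteq> sets M \<and> disjoint P \<and> \<Union>P = X}"
      using in_sets[OF X] by (auto simp: disjoint_def)
    ultimately show "ennreal (g X) \<le> total_variation M N X"
      unfolding total_variation_def by (metis (no_types, lifting) SUP_upper)
  qed
  have "countably_additive (sets M) (total_variation M N)"
  proof (rule countably_additiveI)
    fix F :: "nat \<Rightarrow> 'a set"
    assume F: "range F \<subseteq> sets M" "disjoint_family F" "\<Union>(range F) \<in> sets M"
    have "(\<Sum>i. ennreal (g (F i))) = ennreal (g (\<Union>(range F)))"
      using F g0 g_sums by (intro suminf_ennreal_eq) auto
    then show "(\<Sum>i. total_variation M N (F i)) = total_variation M N (\<Union>(range F))"
      using F by (auto simp: tv range_subsetD)
  qed
  moreover have "positive (sets M) (total_variation M N)"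
    by (simp add: positive_def tv g_def)
  ultimately show ?thesis
    unfolding total_variation_measure_def
    using A sets.sigma_sets_eq[of M]
    by (intro emeasure_measure_of_sigma sets.sigma_algebra_axioms) auto
qed

text \<open>
  The variation is taken after restriction to the complement of \<open>ball 0 \<delta>\<close>, where both measures are
  finite by \<open>M1\<close>; on the whole space \<open>\<nu> x - \<nu> y\<close> need not be a signed measure.
\<close>

definition M3 :: "'a::euclidean_space set \<Rightarrow> ('a \<Rightarrow> 'a measure) \<Rightarrow> real \<Rightarrow> bool" where
  "M3 \<Omega> \<nu> \<sigma> \<longleftrightarrow> (\<forall>\<beta>>0. \<exists>\<omega>. modulus_of_continuity \<omega> \<and>
     (\<forall>x\<in>closure \<Omega>. \<forall>y\<in>closure \<Omega>. \<forall>\<delta>>0.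
        (\<integral>\<^sup>+z. ennreal (norm z powr \<beta>) \<partial>total_variation_measure
            (restrict_space (\<nu> x) (- ball 0 \<delta>)) (restrict_space (\<nu> y) (- ball 0 \<delta>)))
          \<le> ennreal ((1 + h_rate \<beta> \<sigma> \<delta>) * \<omega> (dist x y))))"

primrec reach :: "('a::euclidean_space \<Rightarrow> 'a measure) \<Rightarrow> 'a \<Rightarrow> nat \<Rightarrow> 'a set" where
  "reach \<nu> x 0 = {x}"
| "reach \<nu> x (Suc n) = (\<Union>\<xi>\<in>reach \<nu> x n. (+) \<xi> ` measure_support (\<nu> \<xi>))"

definition iterative_covering :: "'a::euclidean_space set \<Rightarrow> ('a \<Rightarrow> 'a measure) \<Rightarrow> bool" where
  "iterative_covering \<Omega> \<nu> \<longleftrightarrow> (\<forall>x\<in>closure \<Omega>. closure (\<Union>n. reach \<nu> x n) = closure \<Omega>)"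

definition H2 :: "'a::euclidean_space set \<Rightarrow> ('a \<Rightarrow> 'a \<Rightarrow> real) \<Rightarrow> real \<Rightarrow> bool" where
  "H2 \<Omega> H\<^sub>0 m \<longleftrightarrow> (\<exists>c\<^sub>0>0. \<exists>C\<ge>0. \<forall>x\<in>closure \<Omega>. \<forall>p. H\<^sub>0 x p \<ge> c\<^sub>0 * norm p powr m - C)"


section \<open>State-constraint viscosity sub- and supersolutions\<close>

text \<open>
  A space-time test function \<open>\<phi>\<close> comes with its gradient \<open>G\<close> on \<open>closure \<Omega> \<times> {0..}\<close>, so that
  \<open>fst (G (x, t))\<close> is \<open>D\<phi>(x, t)\<close> and \<open>snd (G (x, t))\<close> is \<open>\<phi>\<^sub>t(x, t)\<close>.
\<close>

definition parabolic_E ::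
  "'a::euclidean_space set \<Rightarrow> ('a \<Rightarrow> 'a measure) \<Rightarrow> ('a \<Rightarrow> 'a \<Rightarrow> real) \<Rightarrow> real \<Rightarrow> real
    \<Rightarrow> ('a \<times> real \<Rightarrow> real) \<Rightarrow> ('a \<times> real \<Rightarrow> real) \<Rightarrow> ('a \<times> real \<Rightarrow> 'a \<times> real) \<Rightarrow> 'a \<Rightarrow> real \<Rightarrow> real" where
  "parabolic_E \<Omega> \<nu> H\<^sub>0 c \<delta> u \<phi> G x t =
     snd (G (x, t)) - nonlocal \<Omega> \<nu> (ball 0 \<delta>) (\<lambda>y. \<phi> (y, t)) x
       - nonlocal \<Omega> \<nu> (- ball 0 \<delta>) (\<lambda>y. u (y, t)) x + H\<^sub>0 x (fst (G (x, t))) - c"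

definition parabolic_subsolution ::
  "'a::euclidean_space set \<Rightarrow> ('a \<Rightarrow> 'a measure) \<Rightarrow> ('a \<Rightarrow> 'a \<Rightarrow> real) \<Rightarrow> real
    \<Rightarrow> ('a \<times> real \<Rightarrow> real) \<Rightarrow> bool" where
  "parabolic_subsolution \<Omega> \<nu> H\<^sub>0 c u \<longleftrightarrow>
     usc_on (closure \<Omega> \<times> {0..}) u \<and>
     (\<forall>\<phi> G. has_C1_gradient (closure \<Omega> \<times> {0..}) \<phi> G \<longrightarrow>
        (\<forall>x\<in>\<Omega>. \<forall>t>0.
           (\<forall>q\<in>closure \<Omega> \<times> {0..}. u q - \<phi> q \<le> u (x, t) - \<phi> (x, t)) \<longrightarrow>
           (\<forall>\<delta>>0. parabolic_E \<Omega> \<nu> H\<^sub>0 c \<delta> u \<phi> G x t \<le> 0)))"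

definition parabolic_supersolution ::
  "'a::euclidean_space set \<Rightarrow> ('a \<Rightarrow> 'a measure) \<Rightarrow> ('a \<Rightarrow> 'a \<Rightarrow> real) \<Rightarrow> real
    \<Rightarrow> ('a \<times> real \<Rightarrow> real) \<Rightarrow> bool" where
  "parabolic_supersolution \<Omega> \<nu> H\<^sub>0 c v \<longleftrightarrow>
     lsc_on (closure \<Omega> \<times> {0..}) v \<and>
     (\<forall>\<phi> G. has_C1_gradient (closure \<Omega> \<times> {0..}) \<phi> G \<longrightarrow>
        (\<forall>x\<in>closure \<Omega>. \<forall>t>0.
           (\<forall>q\<in>closure \<Omega> \<times> {0..}. v q - \<phi> q \<ge> v (x, t) - \<phi> (x, t)) \<longrightarrow>
           (\<forall>\<delta>>0. parabolic_E \<Omega> \<nu> H\<^sub>0 c \<delta> v \<phi> G x t \<ge> 0)))"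

definition stationary_E ::
  "'a::euclidean_space set \<Rightarrow> ('a \<Rightarrow> 'a measure) \<Rightarrow> ('a \<Rightarrow> 'a \<Rightarrow> real) \<Rightarrow> real \<Rightarrow> real
    \<Rightarrow> ('a \<Rightarrow> real) \<Rightarrow> ('a \<Rightarrow> real) \<Rightarrow> ('a \<Rightarrow> 'a) \<Rightarrow> 'a \<Rightarrow> real" where
  "stationary_E \<Omega> \<nu> H\<^sub>0 c \<delta> u \<phi> G x =
     - nonlocal \<Omega> \<nu> (ball 0 \<delta>) \<phi> x - nonlocal \<Omega> \<nu> (- ball 0 \<delta>) u x + H\<^sub>0 x (G x) - c"

definition stationary_subsolution ::
  "'a::euclidean_space set \<Rightarrow> ('a \<Rightarrow> 'a measure) \<Rightarrow> ('a \<Rightarrow> 'a \<Rightarrow> real) \<Rightarrow> real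
    \<Rightarrow> ('a \<Rightarrow> real) \<Rightarrow> bool" where
  "stationary_subsolution \<Omega> \<nu> H\<^sub>0 c u \<longleftrightarrow>
     usc_on (closure \<Omega>) u \<and>
     (\<forall>\<phi> G. has_C1_gradient (closure \<Omega>) \<phi> G \<longrightarrow>
        (\<forall>x\<in>\<Omega>. (\<forall>y\<in>closure \<Omega>. u y - \<phi> y \<le> u x - \<phi> x) \<longrightarrow>
           (\<forall>\<delta>>0. stationary_E \<Omega> \<nu> H\<^sub>0 c \<delta> u \<phi> G x \<le> 0)))"

definition stationary_supersolution ::
  "'a::euclidean_space set \<Rightarrow> ('a \<Rightarrow> 'a measure) \<Rightarrow> ('a \<Rightarrow> 'a \<Rightarrow> real) \<Rightarrow> real
    \<Rightarrow> ('a \<Rightarrow> real) \<Rightarrow> bool" where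
  "stationary_supersolution \<Omega> \<nu> H\<^sub>0 c v \<longleftrightarrow>
     lsc_on (closure \<Omega>) v \<and>
     (\<forall>\<phi> G. has_C1_gradient (closure \<Omega>) \<phi> G \<longrightarrow>
        (\<forall>x\<in>closure \<Omega>. (\<forall>y\<in>closure \<Omega>. v y - \<phi> y \<ge> v x - \<phi> x) \<longrightarrow>
           (\<forall>\<delta>>0. stationary_E \<Omega> \<nu> H\<^sub>0 c \<delta> v \<phi> G x \<ge> 0)))"

end

(*
  Let M = max (u - v), attained at time t0. Touching u - v by functions of time alone shows that M is
  attained at every time in (0, t0], at some point where the two nonlocal terms cancel. At such a good
  point u - v = M at almost every jump target, and the covering property carries M to the whole
  domain as soon as almost every contact point is again good. Two facts make this work.

  The measures nu x do not charge Lebesgue null sets away from 0, so that negligible sets of contact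
  points may be discarded.

  Since H is only continuous, gradients must be bounded before H (x, p) and H (x, p') can be compared.
  This is achieved by replacing u by its sup-convolution U in time with backward slope L and forward
  slope l: coercivity makes U Lipschitz in space, up to the boundary. If l is of order L powr sigma,
  the argmax is never in the future, and then U = u outside a set of times of measure tending to 0 as
  L grows. A gap between U and u spreads in a forward cone, so the contact points near which U - u is
  not small compared with the distance form a porous, hence negligible, set. At all other contact
  points U can be used instead of u, and the inequality for the touching gives that they are good.

  The stationary case is that of functions independent of time.
*)
theory Submission
  imports Defs
begin


section \<open>Semicontinuous functions\<close>

text \<open>The condition \<open>sg < 1\<close> enters through one balance. Increments bounded by
  \<open>K * norm z\<close> inside \<open>ball 0 d\<close> contribute at most
  \<open>K * N * d powr (1 - sg)\<close> to the nonlocal term, bounded increments outside it a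
  multiple of \<open>d powr - sg\<close>. The space Lipschitz constant of the sup-convolution is of
  order \<open>L\<close>; with \<open>d\<close> of order \<open>1 / L\<close> both contributions are
  of order \<open>L powr sg\<close>, and a forward slope equal to a large multiple of this excludes
  an argmax in the future.

  Contact is then frequent for the following reason. Adding \<open>L * t\<close> to the
  sup-convolution gives a nondecreasing function of time that gains \<open>L\<close> per unit of
  time up to a bounded error. It is constant just before each time without contact and grows at rate
  at most \<open>L + l\<close> elsewhere. As \<open>l\<close> is small compared with
  \<open>L\<close>, contact must fill almost all times.

  One pair of slopes leaves the argmax at a contact point possibly not unique. Contact for a smaller
  pair makes it unique for a larger one, so slopes are indexed by integers and consecutive ones
  compared.\<close>

lemma abs_le_square_plus_one: "\<bar>y\<bar> \<le> y\<^sup>2 + (1::real)"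
proof -
  have "0 \<le> (\<bar>y\<bar> - 1/2)\<^sup>2" by simp
  then show ?thesis by (simp add: power2_eq_square algebra_simps)
qed

lemma usc_on_metric:
  fixes f :: "'a::metric_space \<Rightarrow> real"
  shows "usc_on S f \<longleftrightarrow> (\<forall>x\<in>S. \<forall>e>0. \<exists>d>0. \<forall>y\<in>S. dist y x < d \<longrightarrow> f y < f x + e)"
proof
  assume u: "usc_on S f"
  show "\<forall>x\<in>S. \<forall>e>0. \<exists>d>0. \<forall>y\<in>S. dist y x < d \<longrightarrow> f y < f x + e"
  proof (intro ballI allI impI)
    fix x and e :: real assume x: "x \<in> S" "0 < e"
    then have "eventually (\<lambda>y. f y < f x + e) (at x within S)"
      using u by (auto simp: usc_on_def)
    then obtain d where "d > 0" "\<And>y. y \<in> S \<Longrightarrow> y \<noteq> x \<Longrightarrow> dist y x < d \<Longrightarrow> f y < f x + e"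
      by (auto simp: eventually_at)
    then show "\<exists>d>0. \<forall>y\<in>S. dist y x < d \<longrightarrow> f y < f x + e"
      using x by (metis less_add_same_cancel1)
  qed
next
  assume R: "\<forall>x\<in>S. \<forall>e>0. \<exists>d>0. \<forall>y\<in>S. dist y x < d \<longrightarrow> f y < f x + e"
  show "usc_on S f"
    unfolding usc_on_def
  proof (intro ballI allI impI)
    fix x a assume x: "x \<in> S" "f x < a"
    then obtain d where "d > 0" "\<forall>y\<in>S. dist y x < d \<longrightarrow> f y < f x + (a - f x)"
      using R by (metis diff_gt_0_iff_gt)
    then show "eventually (\<lambda>y. f y < a) (at x within S)"
      by (auto simp: eventually_at)
  qed
qed

lemma usc_onD:
  fixes f :: "'a::metric_space \<Rightarrow> real"
  assumes "usc_on S f" "x \<in> S" "0 < e"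
  obtains d where "d > 0" "\<And>y. y \<in> S \<Longrightarrow> dist y x < d \<Longrightarrow> f y < f x + e"
  using assms unfolding usc_on_metric by metis

lemma lsc_on_iff_usc_on_minus: "lsc_on S f \<longleftrightarrow> usc_on S (\<lambda>x. - f x)"
proof
  assume l: "lsc_on S f"
  show "usc_on S (\<lambda>x. - f x)"
    unfolding usc_on_def
  proof (intro ballI allI impI)
    fix x a assume "x \<in> S" "- f x < a"
    then have "eventually (\<lambda>y. - a < f y) (at x within S)"
      using l unfolding lsc_on_def by (simp add: minus_less_iff)
    then show "eventually (\<lambda>y. - f y < a) (at x within S)"
      by (rule eventually_mono) simp
  qed
next
  assume u: "usc_on S (\<lambda>x. - f x)"
  show "lsc_on S f"
    unfolding lsc_on_def
  proof (intro ballI allI impI)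
    fix x a assume "x \<in> S" "a < f x"
    then show "eventually (\<lambda>y. a < f y) (at x within S)"
      using u[unfolded usc_on_def, rule_format, of x "- a"] by simp
  qed
qed

lemma usc_on_subset: "usc_on S f \<Longrightarrow> T \<subseteq> S \<Longrightarrow> usc_on T (f :: 'a::metric_space \<Rightarrow> real)"
  unfolding usc_on_metric by (meson subsetD)

lemma continuous_on_imp_usc_on:
  fixes f :: "'a::metric_space \<Rightarrow> real"
  assumes "continuous_on S f" shows "usc_on S f"
  unfolding usc_on_metric
proof (intro ballI allI impI)
  fix x and e :: real assume "x \<in> S" "0 < e"
  then obtain d where "d > 0" "\<forall>y\<in>S. dist y x < d \<longrightarrow> dist (f y) (f x) < e"
    using assms unfolding continuous_on_iff by metis
  then show "\<exists>d>0. \<forall>y\<in>S. dist y x < d \<longrightarrow> f y < f x + e"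
    by (intro exI[of _ d]) (auto simp: dist_real_def abs_less_iff)
qed

lemma usc_on_add:
  fixes f g :: "'a::metric_space \<Rightarrow> real"
  assumes "usc_on S f" "usc_on S g"
  shows "usc_on S (\<lambda>x. f x + g x)"
  unfolding usc_on_metric
proof (intro ballI allI impI)
  fix x and e :: real assume x: "x \<in> S" "0 < e"
  obtain d1 where d1: "d1 > 0" "\<And>y. y \<in> S \<Longrightarrow> dist y x < d1 \<Longrightarrow> f y < f x + e/2"
    using usc_onD[OF assms(1) x(1), of "e/2"] x by auto
  obtain d2 where d2: "d2 > 0" "\<And>y. y \<in> S \<Longrightarrow> dist y x < d2 \<Longrightarrow> g y < g x + e/2"
    using usc_onD[OF assms(2) x(1), of "e/2"] x by auto
  show "\<exists>d>0. \<forall>y\<in>S. dist y x < d \<longrightarrow> f y + g y < f x + g x + e"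
  proof (intro exI[of _ "min d1 d2"] conjI ballI impI)
    fix y assume "y \<in> S" "dist y x < min d1 d2"
    then show "f y + g y < f x + g x + e" using d1(2)[of y] d2(2)[of y] by simp
  qed (use d1 d2 in auto)
qed

lemma usc_on_compose:
  fixes f :: "'a::metric_space \<Rightarrow> real" and g :: "'b::metric_space \<Rightarrow> 'a"
  assumes f: "usc_on S f" and g: "continuous_on T g" "g ` T \<subseteq> S"
  shows "usc_on T (\<lambda>x. f (g x))"
  unfolding usc_on_metric
proof (intro ballI allI impI)
  fix x and e :: real assume x: "x \<in> T" "0 < e"
  obtain d where d: "d > 0" "\<And>y. y \<in> S \<Longrightarrow> dist y (g x) < d \<Longrightarrow> f y < f (g x) + e"
    using usc_onD[OF f, of "g x" e] x g(2) by blast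
  then obtain d' where "d' > 0" "\<forall>y\<in>T. dist y x < d' \<longrightarrow> dist (g y) (g x) < d"
    using g(1) x unfolding continuous_on_iff by metis
  then show "\<exists>d>0. \<forall>y\<in>T. dist y x < d \<longrightarrow> f (g y) < f (g x) + e"
    using d g(2) by (metis image_subset_iff)
qed

lemma usc_on_sequentially:
  fixes f :: "'a::metric_space \<Rightarrow> real"
  assumes "usc_on S f" "x \<in> S" "X \<longlonglongrightarrow> x" "\<And>n. X n \<in> S" "f x < a"
  shows "eventually (\<lambda>n. f (X n) < a) sequentially"
proof -
  obtain d where d: "d > 0" "\<And>y. y \<in> S \<Longrightarrow> dist y x < d \<Longrightarrow> f y < f x + (a - f x)"
    using usc_onD[OF assms(1,2), of "a - f x"] assms(5) by auto
  have "eventually (\<lambda>n. dist (X n) x < d) sequentially"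
    using assms(3) d(1) by (simp add: tendstoD)
  then show ?thesis using d(2) assms(4) by (auto elim!: eventually_mono)
qed

lemma usc_on_seq_le:
  fixes f :: "'a::metric_space \<Rightarrow> real"
  assumes "usc_on S f" "x \<in> S" "X \<longlonglongrightarrow> x" "\<And>n. X n \<in> S" "A \<longlonglongrightarrow> a" "\<And>n. A n \<le> f (X n)"
  shows "a \<le> f x"
proof (rule ccontr)
  assume "\<not> a \<le> f x"
  then have *: "f x < (f x + a) / 2" "(f x + a)/2 < a" by auto
  have "eventually (\<lambda>n. f (X n) < (f x + a) / 2) sequentially"
    by (rule usc_on_sequentially[OF assms(1-4) *(1)])
  moreover have "eventually (\<lambda>n. A n > (f x + a) / 2) sequentially"
    using assms(5) *(2) by (rule order_tendstoD)
  ultimately have "eventually (\<lambda>n. False) sequentially"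
  proof eventually_elim
    case (elim n) then show ?case using assms(6)[of n] by linarith
  qed
  then show False by simp
qed

lemma closed_usc_superlevel:
  fixes f :: "'a::metric_space \<Rightarrow> real"
  assumes "usc_on S f" "closed S"
  shows "closed {x\<in>S. a \<le> f x}"
  unfolding closed_sequential_limits
proof (intro allI impI)
  fix X x assume X: "(\<forall>n. X n \<in> {x\<in>S. a \<le> f x}) \<and> X \<longlonglongrightarrow> x"
  then have "x \<in> S" using assms(2) by (auto simp: closed_sequential_limits)
  then show "x \<in> {x\<in>S. a \<le> f x}"
    using usc_on_seq_le[OF assms(1), of x X "\<lambda>_. a" a] X by auto
qed

lemma usc_on_borel_measurable:
  fixes f :: "'a::metric_space \<Rightarrow> real"
  assumes "usc_on S f" "closed S"
  shows "(\<lambda>x. if x \<in> S then f x else b) \<in> borel_measurable borel"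
proof (rule borel_measurableI_ge)
  fix a
  have "{x\<in>S. a \<le> f x} \<in> sets borel" using closed_usc_superlevel[OF assms] by auto
  moreover have "{x \<in> space borel. a \<le> (if x \<in> S then f x else b)} =
    {x\<in>S. a \<le> f x} \<union> (if a \<le> b then - S else {})" by auto
  moreover have "S \<in> sets borel" using assms(2) by auto
  ultimately show "{x \<in> space borel. a \<le> (if x \<in> S then f x else b)} \<in> sets borel"
    by (auto split: if_splits)
qed

text \<open>Only one superlevel set is asked to be bounded, because maxima are sought over
  space-time sets that are unbounded in time. Compactness is used as the finite intersection
  property of the closed superlevel sets of \<open>f\<close>.\<close>

lemma usc_attains_max:
  fixes f :: "'a::heine_borel \<Rightarrow> real"
  assumes u: "usc_on S f" and S: "closed S" and x0: "x0 \<in> S" and b: "bounded {x\<in>S. f x0 \<le> f x}"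
  obtains x where "x \<in> S" "\<And>y. y \<in> S \<Longrightarrow> f y \<le> f x"
proof -
  let ?T = "{x\<in>S. f x0 \<le> f x}"
  have T: "compact ?T" using b closed_usc_superlevel[OF u S] by (simp add: compact_eq_bounded_closed)
  define K where "K y = {x\<in>S. f y \<le> f x}" for y
  have cK: "closed (K y)" for y using closed_usc_superlevel[OF u S] by (simp add: K_def)
  have "?T \<inter> \<Inter>(K ` ?T) \<noteq> {}"
  proof (rule compact_imp_fip)
    show "compact ?T" by fact
    show "closed V" if "V \<in> K ` ?T" for V using that cK by auto
    fix F assume F: "finite F" "F \<subseteq> K ` ?T"
    then obtain Y where Y: "finite Y" "Y \<subseteq> ?T" "F = K ` Y" by (meson finite_subset_image)
    show "?T \<inter> \<Inter>F \<noteq> {}"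
    proof (cases "Y = {}")
      case True then show ?thesis using x0 Y by auto
    next
      case False
      then obtain y where y: "y \<in> Y" "f y = Max (f ` Y)"
        using Y(1) by (metis (mono_tags, lifting) Max_in finite_imageI image_iff image_is_empty)
      then have "\<And>y'. y' \<in> Y \<Longrightarrow> f y' \<le> f y" using Y(1) by simp
      then have "y \<in> ?T \<inter> \<Inter>F" using y(1) Y by (auto simp: K_def)
      then show ?thesis by blast
    qed
  qed
  then obtain x where x: "x \<in> ?T" "\<And>y. y \<in> ?T \<Longrightarrow> f y \<le> f x" by (auto simp: K_def)
  show ?thesis
  proof (rule that)
    show "x \<in> S" using x by auto
    fix y assume "y \<in> S"
    then show "f y \<le> f x" using x(1) x(2)[of y] by (cases "f x0 \<le> f y") auto
  qed
qed

section \<open>Calculus of gradients\<close>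

lemma C1_gradient_add:
  assumes "has_C1_gradient S f g" "has_C1_gradient S f' g'"
  shows "has_C1_gradient S (\<lambda>x. f x + f' x) (\<lambda>x. g x + g' x)"
  using assms unfolding has_C1_gradient_def
  by (auto intro!: continuous_intros derivative_eq_intros simp: inner_add_left)

lemma C1_gradient_minus:
  assumes "has_C1_gradient S f g"
  shows "has_C1_gradient S (\<lambda>x. - f x) (\<lambda>x. - g x)"
  using assms unfolding has_C1_gradient_def
  by (auto intro!: continuous_intros derivative_eq_intros simp: inner_minus_left)

lemma C1_gradient_const: "has_C1_gradient S (\<lambda>x. c) (\<lambda>x. 0)"
  unfolding has_C1_gradient_def
  by (intro conjI ballI continuous_on_const has_derivative_eq_rhs[OF has_derivative_const])
    (simp add: fun_eq_iff)

lemma C1_gradient_space: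
  assumes "has_C1_gradient S f g"
  shows "has_C1_gradient (S \<times> T) (\<lambda>q. f (fst q)) (\<lambda>q. (g (fst q), 0::real))"
  unfolding has_C1_gradient_def
proof (intro conjI ballI)
  show "continuous_on (S \<times> T) (\<lambda>q. (g (fst q), 0::real))"
  proof (intro continuous_on_Pair continuous_on_const)
    show "continuous_on (S \<times> T) (\<lambda>q. g (fst q))"
      by (rule continuous_on_compose2[of S g]) (use assms in \<open>auto simp: has_C1_gradient_def continuous_on_fst\<close>)
  qed
  fix q assume q: "q \<in> S \<times> T"
  then have "(f has_derivative (\<lambda>h. g (fst q) \<bullet> h)) (at (fst q) within S)"
    using assms unfolding has_C1_gradient_def by auto
  then have d: "(f has_derivative (\<lambda>h. g (fst q) \<bullet> h)) (at (fst q) within fst ` (S \<times> T))"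
    by (rule has_derivative_subset) auto
  have "((\<lambda>q. f (fst q)) has_derivative (\<lambda>h. g (fst q) \<bullet> fst h)) (at q within S \<times> T)"
    by (rule has_derivative_in_compose[OF _ d]) (rule derivative_intros)+
  then show "((\<lambda>q. f (fst q)) has_derivative (\<lambda>h. (g (fst q), 0::real) \<bullet> h)) (at q within S \<times> T)"
    by (simp add: inner_prod_def)
qed

text \<open>The common shape of the space-time penalties below: a paraboloid in space, whose opening
  may vary in time, plus a function of time.\<close>

lemma C1_gradient_time_paraboloid:
  fixes k \<rho> k' \<rho>' :: "real \<Rightarrow> real" and a :: "'a::euclidean_space"
  assumes k: "\<And>t. (k has_real_derivative k' t) (at t)" "continuous_on UNIV k'"
    and \<rho>: "\<And>t. (\<rho> has_real_derivative \<rho>' t) (at t)" "continuous_on UNIV \<rho>'"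
  shows "has_C1_gradient S (\<lambda>q. k (snd q) * (norm (fst q - a))\<^sup>2 + \<rho> (snd q))
     (\<lambda>q. ((2 * k (snd q)) *\<^sub>R (fst q - a), k' (snd q) * (norm (fst q - a))\<^sup>2 + \<rho>' (snd q)))"
  unfolding has_C1_gradient_def
proof (intro conjI ballI)
  have ck: "continuous_on UNIV k"
    using k(1) by (auto intro!: continuous_at_imp_continuous_on DERIV_isCont)
  have "continuous_on S (\<lambda>q. k (snd q))" "continuous_on S (\<lambda>q. k' (snd q))"
    "continuous_on S (\<lambda>q. \<rho>' (snd q))"
    using continuous_on_compose2[OF ck, of S snd] continuous_on_compose2[OF k(2), of S snd]
      continuous_on_compose2[OF \<rho>(2), of S snd] by (simp_all add: continuous_on_snd)
  note [continuous_intros] = this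
  show "continuous_on S (\<lambda>q. ((2 * k (snd q)) *\<^sub>R (fst q - a), k' (snd q) * (norm (fst q - a))\<^sup>2 + \<rho>' (snd q)))"
    by (intro continuous_intros)
  fix q assume "q \<in> S"
  have dk: "((\<lambda>q. k (snd q)) has_derivative (\<lambda>h. k' (snd q) * snd h)) (at q within S)"
    by (rule has_derivative_compose[of snd snd q S, OF _ k(1)[unfolded has_field_derivative_def]])
      (rule derivative_intros)+
  have dr: "((\<lambda>q. \<rho> (snd q)) has_derivative (\<lambda>h. \<rho>' (snd q) * snd h)) (at q within S)"
    by (rule has_derivative_compose[of snd snd q S, OF _ \<rho>(1)[unfolded has_field_derivative_def]])
      (rule derivative_intros)+
  show "((\<lambda>q. k (snd q) * (norm (fst q - a))\<^sup>2 + \<rho> (snd q)) has_derivative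
     (\<lambda>h. ((2 * k (snd q)) *\<^sub>R (fst q - a), k' (snd q) * (norm (fst q - a))\<^sup>2 + \<rho>' (snd q)) \<bullet> h)) (at q within S)"
    unfolding power2_norm_eq_inner
    by (rule has_derivative_eq_rhs, (rule derivative_intros dk dr)+)
       (auto simp: fun_eq_iff inner_prod_def algebra_simps inner_commute)
qed

lemma C1_gradient_paraboloid:
  fixes a :: "'a::euclidean_space"
  shows "has_C1_gradient S (\<lambda>y. k * (norm (y - a))\<^sup>2) (\<lambda>y. (2 * k) *\<^sub>R (y - a))"
  unfolding has_C1_gradient_def power2_norm_eq_inner
  by (auto intro!: continuous_intros derivative_eq_intros simp: inner_commute fun_eq_iff)

text \<open>A cone with its vertex rounded at scale \<open>e\<close>. Its slope never exceeds
  \<open>k\<close>, and it is at least \<open>k / 2\<close> at distance \<open>e\<close> or more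
  from the vertex (for \<open>k\<close> nonnegative).\<close>

lemma C1_gradient_smooth_cone:
  fixes a :: "'a::euclidean_space"
  assumes "e > 0"
  shows "has_C1_gradient S (\<lambda>y. k * sqrt ((norm (y - a))\<^sup>2 + e\<^sup>2))
     (\<lambda>y. (k / sqrt ((norm (y - a))\<^sup>2 + e\<^sup>2)) *\<^sub>R (y - a))"
proof -
  have p': "(y - a) \<bullet> (y - a) + e\<^sup>2 > 0" for y
    using assms inner_ge_zero[of "y - a"] by (intro add_nonneg_pos) (auto simp del: inner_ge_zero)
  have alg: "k * ((I + I + 0) * (inverse s / 2)) = k / s * I" for I s :: real
    by (cases "s = 0") (simp_all add: field_simps)
  show ?thesis
    unfolding has_C1_gradient_def power2_norm_eq_inner
  proof (intro conjI ballI)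
    show "continuous_on S (\<lambda>y. (k / sqrt ((y - a) \<bullet> (y - a) + e\<^sup>2)) *\<^sub>R (y - a))"
    proof (intro continuous_on_scaleR continuous_on_divide continuous_on_real_sqrt continuous_on_add
        continuous_on_inner continuous_on_diff continuous_on_const continuous_on_id ballI)
      fix y show "sqrt ((y - a) \<bullet> (y - a) + e\<^sup>2) \<noteq> 0"
        using p'[of y] by (metis less_irrefl real_sqrt_eq_zero_cancel_iff)
    qed
    fix x
    show "((\<lambda>y. k * sqrt ((y - a) \<bullet> (y - a) + e\<^sup>2)) has_derivative
       (\<lambda>h. (k / sqrt ((x - a) \<bullet> (x - a) + e\<^sup>2)) *\<^sub>R (x - a) \<bullet> h)) (at x within S)"
    proof -
      have d: "((\<lambda>y. y - a) has_derivative (\<lambda>h. h)) (at x within S)"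
        using has_derivative_diff[OF has_derivative_ident has_derivative_const] by simp
      have "((\<lambda>y. (y - a) \<bullet> (y - a) + e\<^sup>2) has_derivative (\<lambda>h. (x - a) \<bullet> h + h \<bullet> (x - a) + 0)) (at x within S)"
        by (rule has_derivative_add[OF has_derivative_inner[OF d d] has_derivative_const])
      from has_derivative_mult_right[OF has_derivative_real_sqrt[OF p'[of x] this], of k]
      show ?thesis
      proof (rule has_derivative_eq_rhs, intro ext)
        fix h
        show "k * (((x - a) \<bullet> h + h \<bullet> (x - a) + 0) * (inverse (sqrt ((x - a) \<bullet> (x - a) + e\<^sup>2)) / 2)) =
          (k / sqrt ((x - a) \<bullet> (x - a) + e\<^sup>2)) *\<^sub>R (x - a) \<bullet> h"
          unfolding inner_commute[of h "x - a"] inner_scaleR_left by (rule alg)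
      qed
    qed
  qed
qed

section \<open>Porous sets\<close>

text \<open>No measurability of \<open>Z\<close> is assumed, so the argument runs through open
  supersets: covering by disjoint balls and deleting a hole from each multiplies the measure of a
  superset by at most \<open>1 - c\<close>. Hence the infimum of these measures is at most
  \<open>1 - c\<close> times itself, that is, zero.\<close>

lemma porous_imp_negligible:
  fixes Z :: "'a::euclidean_space set"
  assumes \<theta>: "0 < \<theta>" "\<theta> < 1"
    and por: "\<And>x \<epsilon>. x \<in> Z \<Longrightarrow> 0 < \<epsilon> \<Longrightarrow>
      \<exists>r q. 0 < r \<and> r < \<epsilon> \<and> ball q (\<theta> * r) \<subseteq> ball x r \<and> ball q (\<theta> * r) \<inter> Z = {}"
  shows "negligible Z"
proof -
  \<comment> \<open>The share of the volume of a ball that its hole occupies.\<close>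
  define c where "c = \<theta> ^ DIM('a)"
  have c: "0 < c" "c < 1" using \<theta> by (simp_all add: c_def power_less_one_iff)
  have bdd: "negligible Y" if Y: "Y \<subseteq> Z" "Y \<subseteq> ball 0 R" for Y R
  proof -
    define P where "P G \<longleftrightarrow> open G \<and> Y \<subseteq> G \<and> G \<in> lmeasurable" for G
    define A where "A = measure lebesgue ` {G. P G}"
    have Ane: "A \<noteq> {}" using Y(2) by (auto simp: A_def P_def intro!: exI[of _ "ball 0 R"])
    have Abd: "bdd_below A" by (auto simp: A_def intro!: bdd_belowI[of _ 0])
    \<comment> \<open>Vitali covers \<open>Y\<close>, up to a null set, by disjoint balls inside
      \<open>G\<close>. The holes miss \<open>Y\<close>, so the balls without their holes together
      with the null set still contain \<open>Y\<close>; \<open>e\<close> pays for making this set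
      open again.\<close>
    have step: "\<exists>G'. P G' \<and> measure lebesgue G' \<le> (1 - c) * measure lebesgue G + e"
      if G: "P G" and e: "e > 0" for G e
    proof -
      define K where "K = {(x, r, q). x \<in> Y \<and> 0 < r \<and> ball x r \<subseteq> G \<and>
        ball q (\<theta> * r) \<subseteq> ball x r \<and> ball q (\<theta> * r) \<inter> Y = {}}"
      obtain C where C: "countable C" "C \<subseteq> K"
        "pairwise (\<lambda>i j. disjnt (ball (fst i) (fst (snd i))) (ball (fst j) (fst (snd j)))) C"
        "negligible (Y - (\<Union>i\<in>C. ball (fst i) (fst (snd i))))"
      proof (rule Vitali_covering_theorem_balls[of Y K fst "\<lambda>i. fst (snd i)"])
        fix x d :: real and y assume y: "y \<in> Y" "0 < d"
        obtain s where s: "s > 0" "ball y s \<subseteq> G" using G y(1) unfolding P_def by (meson openE subsetD)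
        obtain r q where "0 < r" "r < min d s" "ball q (\<theta> * r) \<subseteq> ball y r" "ball q (\<theta> * r) \<inter> Z = {}"
          using por[of y "min d s"] y Y(1) s(1) by auto
        then show "\<exists>i. i \<in> K \<and> y \<in> ball (fst i) (fst (snd i)) \<and> fst (snd i) < d"
          using y s Y(1) by (intro exI[of _ "(y, r, q)"]) (auto simp: K_def)
      qed
      define B where "B i = ball (fst i) (fst (snd i))" for i :: "'a \<times> real \<times> 'a"
      define h where "h i = ball (snd (snd i)) (\<theta> * fst (snd i))" for i :: "'a \<times> real \<times> 'a"
      have KB: "B i \<subseteq> G" "h i \<subseteq> B i" "h i \<inter> Y = {}" "fst (snd i) > 0" if "i \<in> C" for i
      proof -
        have "i \<in> K" using that C(2) by blast
        then show "B i \<subseteq> G" "h i \<subseteq> B i" "h i \<inter> Y = {}" "fst (snd i) > 0"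
          unfolding K_def B_def h_def by (cases i; simp)+
      qed
      have mh: "measure lebesgue (B i - h i) = (1 - c) * measure lebesgue (B i)" if "i \<in> C" for i
      proof -
        have "measure lebesgue (B i - h i) = measure lebesgue (B i) - measure lebesgue (h i)"
          using KB(2)[OF that] by (intro measure_Diff) (simp_all add: B_def h_def less_imp_neq[OF emeasure_lborel_ball_finite[unfolded infinity_ennreal_def]])
        also have "measure lebesgue (h i) = c * measure lebesgue (B i)"
          using KB(4)[OF that] \<theta>
          by (simp add: B_def h_def c_def content_ball_conv_unit_ball[of "\<theta> * _"]
              content_ball_conv_unit_ball[of "fst (snd i)" "fst i"] power_mult_distrib)
        finally show ?thesis by (simp add: algebra_simps)
      qed
      define T1 where "T1 = (\<Union>i\<in>C. B i - h i)"
      have fin: "measure lebesgue (\<Union>i\<in>F. B i - h i) \<le> (1 - c) * measure lebesgue G"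
        if F: "F \<subseteq> C" "finite F" for F
      proof -
        have "measure lebesgue (\<Union>i\<in>F. B i - h i) \<le> (\<Sum>i\<in>F. measure lebesgue (B i - h i))"
          using F by (intro measure_UNION_le) (auto simp: B_def h_def)
        also have "\<dots> = (1 - c) * (\<Sum>i\<in>F. measure lebesgue (B i))"
          unfolding sum_distrib_left using F mh by (intro sum.cong) auto
        also have "(\<Sum>i\<in>F. measure lebesgue (B i)) = measure lebesgue (\<Union>i\<in>F. B i)"
          using F C(3) by (intro measure_UNION'[symmetric])
            (auto simp: B_def intro: pairwise_subset)
        also have "(1 - c) * \<dots> \<le> (1 - c) * measure lebesgue G"
        proof (intro mult_left_mono measure_mono_fmeasurable)
          show "(\<Union>i\<in>F. B i) \<subseteq> G" using KB(1) F(1) by blast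
          show "(\<Union>i\<in>F. B i) \<in> sets lebesgue"
            using F(2) by (intro sets.finite_UN) (auto simp: B_def)
        qed (use c G in \<open>auto simp: P_def\<close>)
        finally show ?thesis .
      qed
      have "B i - h i \<in> lmeasurable" for i
        unfolding B_def h_def by (rule fmeasurable.Diff) simp_all
      then have T1: "T1 \<in> lmeasurable" "measure lebesgue T1 \<le> (1 - c) * measure lebesgue G"
        unfolding T1_def using fmeasurable_UN_bound[OF C(1) _ fin] measure_UN_bound[OF C(1) _ fin]
        by blast+
      define N where "N = Y - (\<Union>i\<in>C. B i)"
      have N: "negligible N" using C(4) by (simp add: N_def B_def)
      have T: "T1 \<union> N \<in> lmeasurable" "measure lebesgue (T1 \<union> N) \<le> (1 - c) * measure lebesgue G"
        using T1 N negligible_imp_measurable[OF N] negligible_imp_measure0[OF N]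
          measure_Un_le[of T1 lebesgue N] by (auto simp: fmeasurableD)
      obtain G' where G': "open G'" "T1 \<union> N \<subseteq> G'" "G' - (T1 \<union> N) \<in> lmeasurable"
        "emeasure lebesgue (G' - (T1 \<union> N)) < ennreal e"
        using sets_lebesgue_outer_open[OF fmeasurableD[OF T(1)] e] by blast
      have eq: "G' = (T1 \<union> N) \<union> (G' - (T1 \<union> N))" using G'(2) by auto
      have "measure lebesgue (G' - (T1 \<union> N)) \<le> e"
        using G'(3,4) e by (simp add: emeasure_eq_measure2 ennreal_less_iff)
      then have "measure lebesgue G' \<le> (1 - c) * measure lebesgue G + e"
        using measure_Un_le[of "T1 \<union> N" lebesgue "G' - (T1 \<union> N)"] T G'(3) eq
        by (auto simp: fmeasurableD)
      moreover have "G' \<in> lmeasurable" using T G'(3) eq by (metis fmeasurable.Un)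
      moreover have "Y \<subseteq> T1 \<union> N" using KB(3) by (fastforce simp: T1_def N_def)
      ultimately show ?thesis using G'(1,2) by (intro exI[of _ G']) (auto simp: P_def)
    qed
    have "Inf A \<le> (1 - c) * Inf A"
    proof (rule field_le_epsilon)
      fix e :: real assume e: "e > 0"
      obtain G where G: "P G" "measure lebesgue G < Inf A + e / 2"
        using cInf_lessD[OF Ane, of "Inf A + e/2"] e by (auto simp: A_def)
      obtain G' where G': "P G'" "measure lebesgue G' \<le> (1 - c) * measure lebesgue G + e/2"
        using step[OF G(1), of "e/2"] e by auto
      have "Inf A \<le> measure lebesgue G'" using G'(1) Abd by (intro cInf_lower) (auto simp: A_def)
      also have "\<dots> \<le> (1 - c) * (Inf A + e/2) + e/2"
        using G'(2) G(2) c by (smt (verit) mult_left_mono)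
      also have "\<dots> \<le> (1 - c) * Inf A + e"
      proof -
        have "(1 - c) * (e/2) \<le> 1 * (e/2)" using c e by (intro mult_right_mono) auto
        then show ?thesis unfolding distrib_left by linarith
      qed
      finally show "Inf A \<le> (1 - c) * Inf A + e" .
    qed
    then have "c * Inf A \<le> 0" by (simp add: algebra_simps)
    then have "Inf A \<le> 0" using c by (simp add: mult_le_0_iff)
    show ?thesis
      unfolding negligible_outer
    proof (intro allI impI)
      fix e :: real assume "e > 0"
      then obtain G where "P G" "measure lebesgue G < e"
        using cInf_lessD[OF Ane, of e] \<open>Inf A \<le> 0\<close> by (auto simp: A_def)
      then show "\<exists>T. Y \<subseteq> T \<and> T \<in> lmeasurable \<and> measure lebesgue T < e" by (auto simp: P_def)
    qed
  qed
  have "Z = (\<Union>n::nat. Z \<inter> ball 0 (real n))"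
    by (auto simp: dist_norm intro: reals_Archimedean2)
  moreover have "negligible (\<Union>n::nat. Z \<inter> ball 0 (real n))"
    using bdd[OF Int_lower1 Int_lower2] by (intro negligible_countable_Union) auto
  ultimately show ?thesis by simp
qed


section \<open>The nonlocal operator\<close>

text \<open>The sum is the integer part of \<open>y\<close>, capped at \<open>J\<close>. Written as
  a count it turns the values of a function into measures of its superlevel sets.\<close>

lemma count_le_real:
  fixes y :: real
  assumes "0 \<le> y"
  shows "(\<Sum>j=1..J. if real j \<le> y then 1 else 0 :: real) \<le> y"
    and "y \<le> real J \<Longrightarrow> y - 1 \<le> (\<Sum>j=1..J. if real j \<le> y then 1 else 0 :: real)"
proof -
  let ?S = "\<lambda>J. \<Sum>j=1..J. if real j \<le> y then 1 else 0 :: real"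
  have "(real J \<le> y \<longrightarrow> ?S J = real J) \<and> (y < real J \<longrightarrow> y - 1 < ?S J \<and> ?S J \<le> y)" for J
  proof (induction J)
    case 0 then show ?case using assms by simp
  next
    case (Suc J)
    have "?S (Suc J) = ?S J + (if real (Suc J) \<le> y then 1 else 0)" by simp
    then show ?case using Suc by (cases "real (Suc J) \<le> y"; cases "real J \<le> y") auto
  qed
  from this[of J] assms show "?S J \<le> y" "y \<le> real J \<Longrightarrow> y - 1 \<le> ?S J"
    by (cases "y < real J"; auto)+
qed

text \<open>A layer-cake estimate. With \<open>J\<close> levels of height \<open>b / J\<close>,
  changing the measure of each superlevel set by \<open>e\<close> changes the integral by
  \<open>b * e\<close>, whatever \<open>J\<close> is; the discretization error
  \<open>b / J * measure M A\<close> vanishes as \<open>J\<close> grows.\<close>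

lemma integral_le_of_setwise_close:
  fixes g :: "'a \<Rightarrow> real"
  assumes sets: "sets M' = sets M" and A: "A \<in> sets M"
    and fin: "emeasure M A < \<infinity>" "emeasure M' A < \<infinity>"
    and cl: "\<And>E. E \<in> sets M \<Longrightarrow> E \<subseteq> A \<Longrightarrow> measure M E \<le> measure M' E + e"
    and g: "g \<in> borel_measurable M" "\<And>z. 0 \<le> g z" "\<And>z. g z \<le> b" and b: "0 < b"
  shows "(LINT z|M. indicator A z * g z) \<le> (LINT z|M'. indicator A z * g z) + b * e"
proof (rule field_le_epsilon)
  fix \<epsilon> :: real assume \<epsilon>: "0 < \<epsilon>"
  obtain J0 :: nat where J0: "b * measure M A / \<epsilon> < real J0" using reals_Archimedean2 by blast
  define J where "J = Suc J0"
  have J: "J > 0" "b * measure M A / \<epsilon> < real J" using J0 by (auto simp: J_def)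
  define E where "E j = {z\<in>A. real j * b / J \<le> g z}" for j
  have E: "E j \<in> sets M" "E j \<in> sets M'" "E j \<subseteq> A" for j
    using A g(1) by (auto simp: E_def sets intro!: measurable_sets_Collect borel_measurable_le)
  have Ef: "emeasure M (E j) < \<infinity>" "emeasure M' (E j) < \<infinity>" for j
    using fin emeasure_mono[OF E(3) A, of j] emeasure_mono[OF E(3), of M' j] A sets
    by (auto intro: order.strict_trans1)
  define gm where "gm z = (\<Sum>j=1..J. b / J * indicator (E j) z)" for z
  have key: "gm z \<le> indicator A z * g z" "indicator A z * g z \<le> gm z + b / J * indicator A z" for z
  proof -
    have *: "gm z = indicator A z * (b / J * (\<Sum>j=1..J. if real j \<le> g z * J / b then 1 else 0))"
    proof (cases "z \<in> A")
      case True
      have "real j * b / J \<le> g z \<longleftrightarrow> real j \<le> g z * J / b" for j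
        using b J by (simp add: field_simps)
      then show ?thesis using True unfolding gm_def sum_distrib_left
        by (auto simp: E_def indicator_def intro!: sum.cong)
    qed (auto simp: gm_def E_def)
    have y: "0 \<le> g z * J / b" "g z * J / b \<le> real J"
      using g(2)[of z] g(3)[of z] b J by (auto simp: field_simps)
    have p: "b / J > 0" using b J by simp
    have "b / J * (\<Sum>j=1..J. if real j \<le> g z * J / b then 1 else 0) \<le> b / J * (g z * J / b)"
      using count_le_real(1)[OF y(1)] p by (intro mult_left_mono) auto
    moreover have "b / J * (g z * J / b - 1) \<le> b / J * (\<Sum>j=1..J. if real j \<le> g z * J / b then 1 else 0)"
      using count_le_real(2)[OF y] p by (intro mult_left_mono) auto
    moreover have "b / J * (g z * J / b) = g z" using b J by simp
    ultimately show "gm z \<le> indicator A z * g z" "indicator A z * g z \<le> gm z + b / J * indicator A z"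
      unfolding * by (auto simp: indicator_def right_diff_distrib)
  qed
  have intE: "integrable M (indicator (E j) :: 'a \<Rightarrow> real)" "integrable M' (indicator (E j) :: 'a \<Rightarrow> real)" for j
    using E Ef by (auto intro!: integrable_real_indicator)
  have intA: "integrable M (indicator A :: 'a \<Rightarrow> real)" using A fin by (auto intro!: integrable_real_indicator)
  have gi: "integrable M (\<lambda>z. indicator A z * g z)" "integrable M' (\<lambda>z. indicator A z * g z)"
  proof -
    have A': "A \<in> sets M'" using A sets by simp
    have g': "g \<in> borel_measurable M'" using g(1) measurable_cong_sets[OF sets refl] by blast
    have n: "norm (g z) \<le> b" for z using g(2,3)[of z] by simp
    show "integrable M (\<lambda>z. indicator A z * g z)" "integrable M' (\<lambda>z. indicator A z * g z)"
      using integrableI_bounded_set_indicator[OF A g(1) fin(1), of b]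
        integrableI_bounded_set_indicator[OF A' g' fin(2), of b] n by simp_all
  qed
  have gmi: "integrable M gm" "integrable M' gm" unfolding gm_def using intE by auto
  have gmI: "integral\<^sup>L M gm = (\<Sum>j=1..J. b / J * measure M (E j))"
    "integral\<^sup>L M' gm = (\<Sum>j=1..J. b / J * measure M' (E j))"
    unfolding gm_def using intE E
    by (subst Bochner_Integration.integral_sum; intro integrable_mult_right sum.cong; simp)+
  have "(LINT z|M. indicator A z * g z) \<le> (LINT z|M. gm z + b / J * indicator A z)"
    using key gmi gi intA by (intro integral_mono) auto
  also have "\<dots> = (\<Sum>j=1..J. b / J * measure M (E j)) + b / J * measure M A"
    using gmi intA gmI A by simp
  also have "(\<Sum>j=1..J. b / J * measure M (E j)) \<le> (\<Sum>j=1..J. b / J * (measure M' (E j) + e))"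
    using cl E b J by (intro sum_mono mult_left_mono) auto
  also have "\<dots> = integral\<^sup>L M' gm + b * e"
    using J by (simp add: gmI distrib_left sum.distrib)
  also have "integral\<^sup>L M' gm \<le> (LINT z|M'. indicator A z * g z)"
    using key gmi gi by (intro integral_mono) auto
  also have "b / J * measure M A \<le> \<epsilon>"
    using J \<epsilon> by (simp add: field_simps)
  finally show "(LINT z|M. indicator A z * g z) \<le> (LINT z|M'. indicator A z * g z) + b * e + \<epsilon>"
    by simp
qed

text \<open>A single \<open>N\<close> dominates the constants of \<open>M1\<close> and
  \<open>M2\<close>, the diameter of the domain and \<open>1\<close>. The exponents stay off the
  value \<open>sg\<close>, which keeps the logarithm of \<open>h_rate\<close> out of all
  estimates.\<close>

locale jump_kernel =
  fixes Om :: "'a::euclidean_space set" and nu :: "'a \<Rightarrow> 'a measure" and sg N :: real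
  assumes dom: "bounded_C1_domain Om"
    and reg: "\<And>x. x \<in> closure Om \<Longrightarrow> regular_jump_measure (nu x)"
    and sg: "0 < sg" "sg < 1"
    and M0: "M0 Om nu" and M3: "M3 Om nu sg"
    and N1: "1 \<le> N"
    and diam: "\<And>x y. x \<in> closure Om \<Longrightarrow> y \<in> closure Om \<Longrightarrow> dist x y \<le> N"
    and tail: "\<And>x b d. x \<in> closure Om \<Longrightarrow> 0 \<le> b \<Longrightarrow> b < sg \<Longrightarrow> 0 < d \<Longrightarrow>
      (\<integral>\<^sup>+z\<in>- ball 0 d. ennreal (min 1 (norm z powr b)) \<partial>nu x) \<le> ennreal (N * d powr (b - sg))"
    and tail_finite: "\<And>x b d. x \<in> closure Om \<Longrightarrow> sg < b \<Longrightarrow> b \<le> 1 \<Longrightarrow> 0 < d \<Longrightarrow>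
      (\<integral>\<^sup>+z\<in>- ball 0 d. ennreal (min 1 (norm z powr b)) \<partial>nu x) \<le> ennreal N"
    and small: "\<And>x d. x \<in> closure Om \<Longrightarrow> 0 < d \<Longrightarrow> d < 1 \<Longrightarrow>
      (\<integral>\<^sup>+z\<in>ball 0 d. ennreal (norm z) \<partial>nu x) \<le> ennreal (N * d powr (1 - sg))"
begin

abbreviation "cl \<equiv> closure Om"
abbreviation "nl \<equiv> nonlocal Om nu"

lemma open_Om: "open Om" and bounded_Om: "bounded Om" and Om_ne: "Om \<noteq> {}"
  using dom by (auto simp: bounded_C1_domain_def)

lemma compact_cl: "compact cl" using bounded_Om by (simp add: compact_closure)

lemma Om_cl: "x \<in> Om \<Longrightarrow> x \<in> cl" using closure_subset by blast

lemma sets_nu: "x \<in> cl \<Longrightarrow> sets (nu x) = sets borel"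
  using reg by (simp add: regular_jump_measure_def)

lemma meas_nu: "x \<in> cl \<Longrightarrow> borel_measurable (nu x) = borel_measurable borel"
  by (rule measurable_cong_sets) (auto simp: sets_nu)

lemma mass: assumes "x \<in> cl" "0 < d" shows "emeasure (nu x) (- ball 0 d) \<le> ennreal (N * d powr - sg)"
proof -
  have "emeasure (nu x) (- ball 0 d) = (\<integral>\<^sup>+z\<in>- ball 0 d. 1 \<partial>nu x)"
    using assms by (simp add: sets_nu)
  also have "\<dots> = (\<integral>\<^sup>+z\<in>- ball 0 d. ennreal (min 1 (norm z powr 0)) \<partial>nu x)"
    using assms by (intro nn_integral_cong) (auto simp: indicator_def)
  also have "\<dots> \<le> ennreal (N * d powr (0 - sg))" using tail[of x 0 d] assms sg by simp
  finally show ?thesis by simp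
qed

lemma mass_finite: "x \<in> cl \<Longrightarrow> 0 < d \<Longrightarrow> emeasure (nu x) (- ball 0 d) < \<infinity>"
  using mass[of x d] by (auto intro: order.strict_trans1)

text \<open>The complement of the support is a union of null balls, and by Lindelof countably many
  of them suffice. Thus cutting the integral in \<open>nonlocal\<close> discards a null set.\<close>

lemma AE_jump_cl: assumes x: "x \<in> cl" shows "AE z in nu x. x + z \<in> cl"
proof -
  define F where "F = {ball z r | z r. emeasure (nu x) (ball z r) = 0}"
  obtain F' where F': "F' \<subseteq> F" "countable F'" "\<Union>F' = \<Union>F"
    using Lindelof[of F] by (auto simp: F_def)
  have "\<Union>F' \<in> null_sets (nu x)"
  proof -
    have "S \<in> null_sets (nu x)" if "S \<in> F'" for S
      using that F'(1) x by (auto simp: F_def null_sets_def sets_nu)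
    then show ?thesis using null_sets_UN'[OF F'(2), of "\<lambda>S. S" "nu x"] by simp
  qed
  moreover have "{z. x + z \<notin> cl} \<subseteq> \<Union>F"
  proof
    fix z assume z: "z \<in> {z. x + z \<notin> cl}"
    have "(+) x ` measure_support (nu x) \<subseteq> cl" using M0 x by (auto simp: M0_def)
    then have "z \<notin> measure_support (nu x)" using z by auto
    then obtain r where "r > 0" "\<not> emeasure (nu x) (ball z r) > 0" by (auto simp: measure_support_def)
    then show "z \<in> \<Union>F" by (auto simp: F_def intro!: exI[of _ "ball z r"])
  qed
  ultimately show ?thesis using F'(3) by (intro AE_I'[of "\<Union>F'"]) auto
qed

lemma jump_set_borel: "D \<in> sets borel \<Longrightarrow> {z\<in>D. x + z \<in> cl} \<in> sets borel"
proof -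
  assume D: "D \<in> sets borel"
  have "closed ((\<lambda>z. x + z) -` cl)" by (intro closed_vimage) (auto intro!: continuous_intros)
  then have "D \<inter> (\<lambda>z. x + z) -` cl \<in> sets borel" using D by auto
  also have "D \<inter> (\<lambda>z. x + z) -` cl = {z\<in>D. x + z \<in> cl}" by auto
  finally show ?thesis .
qed

text \<open>Integrability is not assumed: a nonintegrable increment has integral \<open>0\<close> by
  convention, and \<open>0 <= C\<close> covers that case.\<close>

lemma nonlocal_upper:
  assumes "\<And>z. z \<in> D \<Longrightarrow> x + z \<in> cl \<Longrightarrow> f (x + z) - f x \<le> G z"
    and "(\<integral>\<^sup>+z\<in>D. ennreal (G z) \<partial>nu x) \<le> ennreal C" "0 \<le> C"
  shows "nl D f x \<le> C"
proof -
  let ?h = "\<lambda>z. indicator {z\<in>D. x + z \<in> cl} z *\<^sub>R (f (x + z) - f x)"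
  show ?thesis
  proof (cases "integrable (nu x) ?h")
    case True
    have "integral\<^sup>L (nu x) ?h \<le> enn2real (\<integral>\<^sup>+z. ennreal (?h z) \<partial>nu x)"
      using real_lebesgue_integral_def[OF True] by simp
    also have "(\<integral>\<^sup>+z. ennreal (?h z) \<partial>nu x) \<le> (\<integral>\<^sup>+z\<in>D. ennreal (G z) \<partial>nu x)"
      using assms(1) by (intro nn_integral_mono) (auto simp: indicator_def intro!: ennreal_leI)
    then have "enn2real (\<integral>\<^sup>+z. ennreal (?h z) \<partial>nu x) \<le> C"
      using assms(2,3) by (intro enn2real_leI) auto
    finally show ?thesis by (simp add: nonlocal_def set_lebesgue_integral_def)
  next
    case False
    then show ?thesis using assms(3) by (simp add: nonlocal_def set_lebesgue_integral_def not_integrable_integral_eq)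
  qed
qed

lemma nonlocal_minus: "nl D (\<lambda>y. - f y) x = - nl D f x"
proof -
  have "nl D (\<lambda>y. - f y) x = (LINT z|nu x. - (indicator {z\<in>D. x + z \<in> cl} z *\<^sub>R (f (x + z) - f x)))"
    unfolding nonlocal_def set_lebesgue_integral_def by (rule Bochner_Integration.integral_cong) (auto simp: algebra_simps)
  then show ?thesis by (simp add: nonlocal_def set_lebesgue_integral_def)
qed

text \<open>This is where \<open>sg < 1\<close> acts: the integral of \<open>norm z\<close> over a
  small ball is finite and tends to \<open>0\<close> with the radius, so first-order one-sided
  bounds control the singular part.\<close>

lemma nonlocal_annulus_upper:
  assumes "x \<in> cl" "0 < d" "d < 1" "0 \<le> K" "D \<subseteq> ball 0 d"
    and "\<And>z. z \<in> D \<Longrightarrow> x + z \<in> cl \<Longrightarrow> f (x + z) - f x \<le> K * norm z"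
  shows "nl D f x \<le> K * N * d powr (1 - sg)"
proof (rule nonlocal_upper)
  fix z assume "z \<in> D" "x + z \<in> cl" then show "f (x + z) - f x \<le> K * norm z" using assms by auto
next
  have "(\<integral>\<^sup>+z\<in>D. ennreal (K * norm z) \<partial>nu x) \<le> (\<integral>\<^sup>+z\<in>ball 0 d. ennreal (K * norm z) \<partial>nu x)"
    using assms(5) by (intro nn_integral_mono) (auto simp: indicator_def)
  also have "\<dots> = ennreal K * (\<integral>\<^sup>+z\<in>ball 0 d. ennreal (norm z) \<partial>nu x)"
  proof -
    have "(\<lambda>z::'a. ennreal (norm z) * indicator (ball 0 d) z) \<in> borel_measurable borel"
      by (intro borel_measurable_times_ennreal borel_measurable_indicator measurable_compose[OF borel_measurable_norm measurable_ennreal]) auto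
    from nn_integral_cmult[of _ "nu x", unfolded meas_nu[OF assms(1)], OF this, of "ennreal K"]
    show ?thesis using assms(4) by (simp add: ennreal_mult mult.assoc)
  qed
  also have "\<dots> \<le> ennreal K * ennreal (N * d powr (1 - sg))"
    using assms small by (intro mult_left_mono) auto
  also have "\<dots> = ennreal (K * N * d powr (1 - sg))" using assms N1 by (simp add: ennreal_mult mult.assoc)
  finally show "(\<integral>\<^sup>+z\<in>D. ennreal (K * norm z) \<partial>nu x) \<le> ennreal (K * N * d powr (1 - sg))" .
qed (use assms N1 in auto)

lemma nonlocal_ball_upper:
  assumes "x \<in> cl" "0 < d" "d < 1" "0 \<le> K"
    and "\<And>z. norm z < d \<Longrightarrow> x + z \<in> cl \<Longrightarrow> f (x + z) - f x \<le> K * norm z"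
  shows "nl (ball 0 d) f x \<le> K * N * d powr (1 - sg)"
  using assms by (intro nonlocal_annulus_upper) auto

text \<open>What makes every tail of the nonlocal term integrable, since the jump measures are
  finite away from \<open>0\<close>.\<close>

definition tame :: "real \<Rightarrow> ('a \<Rightarrow> real) \<Rightarrow> bool" where
  "tame B f \<longleftrightarrow> set_borel_measurable borel cl f \<and> (\<forall>x\<in>cl. \<bar>f x\<bar> \<le> B)"

lemma usc_imp_tame:
  assumes "usc_on cl f" "\<And>x. x \<in> cl \<Longrightarrow> \<bar>f x\<bar> \<le> B" shows "tame B f"
proof -
  have "(\<lambda>x. if x \<in> cl then f x else 0) \<in> borel_measurable borel"
    by (rule usc_on_borel_measurable[OF assms(1)]) auto
  moreover have "(\<lambda>x. indicator cl x *\<^sub>R f x) = (\<lambda>x. if x \<in> cl then f x else 0)" by (auto simp: fun_eq_iff)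
  ultimately show ?thesis using assms(2) by (simp add: tame_def set_borel_measurable_def)
qed

lemma tame_integrable:
  assumes f: "tame B f" and x: "x \<in> cl" and D: "D \<in> sets borel" "D \<subseteq> - ball 0 d" "0 < d"
  shows "set_integrable (nu x) {z\<in>D. x + z \<in> cl} (\<lambda>z. f (x + z) - f x)"
proof -
  let ?A = "{z\<in>D. x + z \<in> cl}"
  let ?g = "\<lambda>z. indicator cl (x + z) *\<^sub>R f (x + z) - f x"
  have A: "?A \<in> sets (nu x)" using jump_set_borel[OF D(1)] x by (simp add: sets_nu)
  have "emeasure (nu x) ?A \<le> emeasure (nu x) (- ball 0 d)"
    using D x by (intro emeasure_mono) (auto simp: sets_nu)
  then have fin: "emeasure (nu x) ?A < \<infinity>" using mass_finite[OF x D(3)] by (rule order.strict_trans1)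
  have "(\<lambda>y. indicator cl y *\<^sub>R f y) \<in> borel_measurable borel"
    using f by (simp add: tame_def set_borel_measurable_def)
  then have "(\<lambda>z. indicator cl (x + z) *\<^sub>R f (x + z)) \<in> borel_measurable borel"
    by (rule measurable_compose_rev) simp
  then have g: "?g \<in> borel_measurable (nu x)" using x by (simp add: meas_nu)
  have "integrable (nu x) (\<lambda>z. indicator ?A z *\<^sub>R ?g z)"
  proof (rule integrableI_bounded_set_indicator[OF A g fin])
    show "AE z in nu x. z \<in> ?A \<longrightarrow> norm (?g z) \<le> 2 * B"
    proof (intro AE_I2 impI)
      fix z assume "z \<in> ?A"
      then have "\<bar>f (x + z)\<bar> \<le> B" "\<bar>f x\<bar> \<le> B" "x + z \<in> cl" using f x by (auto simp: tame_def)
      then show "norm (?g z) \<le> 2 * B" by simp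
    qed
  qed
  then show ?thesis unfolding set_integrable_def
    by (rule Bochner_Integration.integrable_cong[THEN iffD1, rotated 2]) (auto simp: indicator_def)
qed

lemma nonlocal_split:
  assumes f: "tame B f" and x: "x \<in> cl" and d: "0 < d1" "d1 \<le> d2"
  shows "nl (- ball 0 d1) f x = nl (- ball 0 d2) f x + nl (ball 0 d2 - ball 0 d1) f x"
proof -
  have *: "{z \<in> - ball 0 d1. x + z \<in> cl} =
    {z \<in> - ball 0 d2. x + z \<in> cl} \<union> {z \<in> ball 0 d2 - ball 0 d1. x + z \<in> cl}" using d by auto
  show ?thesis
    unfolding nonlocal_def *
    using tame_integrable[OF f x, of "- ball 0 d2" d2] tame_integrable[OF f x, of "ball 0 d2 - ball 0 d1" d1] d
    by (intro set_integral_Un) auto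
qed

text \<open>Moves the cut-off from a radius that shrinks with the doubling parameter to a fixed one.
  Only an upper bound for the increments is required, which is all that a maximum provides.\<close>

lemma nonlocal_tail_upper:
  assumes f: "tame B f" and x: "x \<in> cl" and d: "0 < d1" "d1 \<le> d2" "d2 < 1" and K: "0 \<le> K"
    and "\<And>z. d1 \<le> norm z \<Longrightarrow> norm z < d2 \<Longrightarrow> x + z \<in> cl \<Longrightarrow> f (x + z) - f x \<le> K * norm z"
  shows "nl (- ball 0 d1) f x \<le> nl (- ball 0 d2) f x + K * N * d2 powr (1 - sg)"
proof -
  have "nl (ball 0 d2 - ball 0 d1) f x \<le> K * N * d2 powr (1 - sg)"
    using assms by (intro nonlocal_annulus_upper) auto
  then show ?thesis using nonlocal_split[OF f x d(1,2)] by simp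
qed

lemma nonlocal_tail_mono:
  assumes f: "tame B f" and x: "x \<in> cl" and d: "0 < d1" "d1 \<le> d2"
    and "\<And>z. x + z \<in> cl \<Longrightarrow> f (x + z) \<le> f x"
  shows "nl (- ball 0 d1) f x \<le> nl (- ball 0 d2) f x"
proof -
  have "nl (ball 0 d2 - ball 0 d1) f x \<le> 0"
    using assms(5) by (intro nonlocal_upper[where G="\<lambda>_. 0"]) auto
  then show ?thesis using nonlocal_split[OF f x d] by simp
qed

lemma nonlocal_add:
  assumes f: "tame B f" and g: "tame B' g" and x: "x \<in> cl" and d: "0 < d"
  shows "nl (- ball 0 d) (\<lambda>y. f y + g y) x = nl (- ball 0 d) f x + nl (- ball 0 d) g x"
proof -
  have "nl (- ball 0 d) f x + nl (- ball 0 d) g x =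
    (LINT z:{z\<in>- ball 0 d. x + z \<in> cl}|nu x. (f (x + z) - f x) + (g (x + z) - g x))"
    unfolding nonlocal_def
    using tame_integrable[OF f x, of "- ball 0 d" d] tame_integrable[OF g x, of "- ball 0 d" d] d
    by (intro set_integral_add(2)[symmetric]) auto
  also have "\<dots> = nl (- ball 0 d) (\<lambda>y. f y + g y) x"
    unfolding nonlocal_def by (rule arg_cong[where f="set_lebesgue_integral _ _"]) (auto simp: fun_eq_iff)
  finally show ?thesis by simp
qed

text \<open>\<open>M3\<close> with exponent \<open>1\<close>: on \<open>E\<close> the weight
  \<open>norm z\<close> is at least \<open>d\<close>, so the weighted total variation controls
  \<open>d\<close> times the difference of the two measures of \<open>E\<close>.\<close>

lemma setwise_close:
  assumes d: "0 < d" and e: "0 < e"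
  obtains r where "r > 0" "\<And>(x::'a) (y::'a) (E::'a set). x \<in> cl \<Longrightarrow> y \<in> cl \<Longrightarrow> dist x y < r \<Longrightarrow> E \<in> sets borel \<Longrightarrow>
    E \<subseteq> - ball 0 d \<Longrightarrow> \<bar>measure (nu x) E - measure (nu y) E\<bar> \<le> e"
proof -
  obtain \<omega> where \<omega>: "modulus_of_continuity \<omega>"
    and W: "\<And>x y. x \<in> cl \<Longrightarrow> y \<in> cl \<Longrightarrow> (\<integral>\<^sup>+z. ennreal (norm z powr 1) \<partial>total_variation_measure
            (restrict_space (nu x) (- ball 0 d)) (restrict_space (nu y) (- ball 0 d)))
          \<le> ennreal ((1 + h_rate 1 sg d) * \<omega> (dist x y))"
    using M3 d unfolding M3_def by (metis zero_less_one)
  have "continuous_on {0..} \<omega>" "\<omega> 0 = 0" using \<omega> by (auto simp: modulus_of_continuity_def)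
  \<comment> \<open>The \<open>2\<close> in \<open>d * e / 2\<close> is
    \<open>1 + h_rate 1 sg d\<close>, because \<open>sg < 1\<close>.\<close>
  then obtain r where r: "r > 0" "\<And>s. 0 \<le> s \<Longrightarrow> s < r \<Longrightarrow> \<bar>\<omega> s\<bar> < d * e / 2"
    unfolding continuous_on_iff using d e
    by (metis (no_types, lifting) atLeast_iff dist_real_def diff_zero order_refl half_gt_zero mult_pos_pos abs_of_nonneg)
  show ?thesis
  proof (rule that[OF r(1)])
    fix x y :: 'a and E :: "'a set" assume x: "x \<in> cl" and y: "y \<in> cl" and xy: "dist x y < r"
      and E: "E \<in> sets borel" "E \<subseteq> - ball 0 d"
    let ?A = "- ball 0 d :: 'a set"
    let ?M = "restrict_space (nu x) ?A" and ?M' = "restrict_space (nu y) ?A"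
    let ?T = "total_variation_measure ?M ?M'"
    have Ax: "?A \<inter> space (nu x) \<in> sets (nu x)" "?A \<inter> space (nu y) \<in> sets (nu y)"
      using x y by (auto simp: sets_nu)
    have f: "finite_measure ?M" "finite_measure ?M'"
      using mass_finite[OF x d] mass_finite[OF y d] Ax x y sets_eq_imp_space_eq[OF sets_nu]
      by (auto intro!: finite_measureI simp: emeasure_restrict_space space_restrict_space)
    have s: "sets ?M' = sets ?M" using x y by (simp add: sets_restrict_space sets_nu)
    have EM: "E \<in> sets ?M" using E x by (auto simp: sets_restrict_space sets_nu)
    have sT: "sets ?T = sets ?M" unfolding total_variation_measure_def
      by (simp add: sets.sigma_sets_eq sets_measure_of sets.space_closed)
    have mE: "measure ?M E = measure (nu x) E" "measure ?M' E = measure (nu y) E"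
      using E Ax by (auto simp: measure_restrict_space)
    have "ennreal \<bar>measure (nu x) E - measure (nu y) E\<bar> \<le> total_variation ?M ?M' E"
      unfolding total_variation_def mE[symmetric]
      using EM by (intro SUP_upper2[of "{E}"]) (auto simp: disjoint_def)
    also have "\<dots> = emeasure ?T E" using emeasure_total_variation_measure[OF f s EM] by simp
    finally have 1: "ennreal \<bar>measure (nu x) E - measure (nu y) E\<bar> \<le> emeasure ?T E" .
    have "ennreal d * emeasure ?T E = (\<integral>\<^sup>+z. ennreal d * indicator E z \<partial>?T)"
      using EM sT by (simp add: nn_integral_cmult_indicator)
    also have "\<dots> \<le> (\<integral>\<^sup>+z. ennreal (norm z powr 1) \<partial>?T)"
      using E d by (intro nn_integral_mono) (auto simp: indicator_def intro!: ennreal_leI)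
    also have "\<dots> \<le> ennreal ((1 + h_rate 1 sg d) * \<omega> (dist x y))" by (rule W[OF x y])
    also have "\<dots> \<le> ennreal (d * e)"
      using r(2)[OF _ xy] sg by (intro ennreal_leI) (auto simp: h_rate_def)
    finally have 2: "ennreal d * emeasure ?T E \<le> ennreal (d * e)" .
    have "ennreal d * ennreal \<bar>measure (nu x) E - measure (nu y) E\<bar> \<le> ennreal (d * e)"
      by (rule order_trans[OF mult_left_mono[OF 1] 2]) simp
    then have "d * \<bar>measure (nu x) E - measure (nu y) E\<bar> \<le> d * e"
      using d e by (simp add: ennreal_mult[symmetric])
    then show "\<bar>measure (nu x) E - measure (nu y) E\<bar> \<le> e" using d by simp
  qed
qed


text \<open>Separates the values at jump targets from the value at the base point. Adding
  \<open>B\<close> makes the first integrand nonnegative and bounded, as needed to compare integrals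
  with respect to two different jump measures.\<close>

lemma nonlocal_tail_eq:
  assumes u: "usc_on cl f" and B: "\<And>y. y \<in> cl \<Longrightarrow> \<bar>f y\<bar> \<le> B" and x: "x \<in> cl" and d: "0 < d"
  shows "nl (- ball 0 d) f x =
    (LINT z|nu x. indicator (- ball 0 d) z * (if x + z \<in> cl then f (x + z) + B else 0)) -
    (f x + B) * measure (nu x) (- ball 0 d)"
proof -
  let ?A = "- ball 0 d :: 'a set"
  let ?g = "\<lambda>y. if y \<in> cl then f y + B else 0"
  have g: "?g \<in> borel_measurable borel"
    by (rule usc_on_borel_measurable[OF usc_on_add[OF u continuous_on_imp_usc_on[OF continuous_on_const]]]) simp
  have gm: "(\<lambda>z. ?g (x + z)) \<in> borel_measurable (nu x)"
    unfolding meas_nu[OF x] by (rule measurable_compose[OF _ g]) simp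
  have A: "?A \<in> sets (nu x)" using x by (simp add: sets_nu)
  have B0: "0 \<le> B" using B[OF x] by simp
  have gb: "norm (?g y) \<le> 2 * B" for y using B[of y] B0 by (auto simp: abs_le_iff)
  have 1: "integrable (nu x) (\<lambda>z. indicator ?A z * ?g (x + z))"
    using integrableI_bounded_set_indicator[OF A gm mass_finite[OF x d], of "2 * B"] gb by simp
  have 2: "integrable (nu x) (\<lambda>z. indicator ?A z * (f x + B))"
    using A mass_finite[OF x d] by (intro integrable_mult_left integrable_real_indicator) auto
  have "nl ?A f x = (LINT z|nu x. indicator ?A z * ?g (x + z) - indicator ?A z * (f x + B))"
    unfolding nonlocal_def set_lebesgue_integral_def
  proof (rule integral_cong_AE)
    show "(\<lambda>z. indicator {z \<in> ?A. x + z \<in> cl} z *\<^sub>R (f (x + z) - f x)) \<in> borel_measurable (nu x)"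
      using tame_integrable[OF usc_imp_tame[OF u B] x, of ?A d] d
      by (auto simp: set_integrable_def dest: borel_measurable_integrable)
    show "(\<lambda>z. indicator ?A z * ?g (x + z) - indicator ?A z * (f x + B)) \<in> borel_measurable (nu x)"
      using 1 2 by (intro borel_measurable_diff borel_measurable_integrable)
    show "AE z in nu x. indicator {z \<in> ?A. x + z \<in> cl} z *\<^sub>R (f (x + z) - f x) =
      indicator ?A z * ?g (x + z) - indicator ?A z * (f x + B)"
      using AE_jump_cl[OF x] by eventually_elim (simp add: indicator_def)
  qed
  also have "\<dots> = (LINT z|nu x. indicator ?A z * ?g (x + z)) - (LINT z|nu x. indicator ?A z * (f x + B))"
    by (rule Bochner_Integration.integral_diff[OF 1 2])
  also have "(LINT z|nu x. indicator ?A z * (f x + B)) = (f x + B) * measure (nu x) ?A"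
    using A by simp
  finally show ?thesis .
qed

lemma usc_slice: "usc_on (cl \<times> {0..}) F \<Longrightarrow> 0 \<le> t \<Longrightarrow> usc_on cl (\<lambda>y. F (y, t))" for t :: real
  by (rule usc_on_compose) (auto intro!: continuous_intros)

text \<open>The measure, the function and the base point all move. First \<open>nu (X n)\<close> is
  replaced by \<open>nu x\<close> through setwise closeness, then Fatou handles the upper
  semicontinuous integrand. Convergence of \<open>F (X n, T n)\<close> is needed because the value
  at the base point enters with a minus sign.\<close>

lemma nonlocal_tail_limsup:
  fixes F :: "'a \<times> real \<Rightarrow> real"
  assumes u: "usc_on (cl \<times> {0..}) F" and B: "\<And>q. q \<in> cl \<times> {0..} \<Longrightarrow> \<bar>F q\<bar> \<le> B"
    and X: "\<And>n. X n \<in> cl" "X \<longlonglongrightarrow> x" and T: "\<And>n. 0 \<le> T n" "T \<longlonglongrightarrow> t"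
    and FX: "(\<lambda>n. F (X n, T n)) \<longlonglongrightarrow> F (x, t)" and d: "0 < d" and e: "0 < e"
  shows "\<forall>\<^sub>F n in sequentially. nl (- ball 0 d) (\<lambda>y. F (y, T n)) (X n) < nl (- ball 0 d) (\<lambda>y. F (y, t)) x + e"
proof -
  let ?A = "- ball 0 d :: 'a set"
  have x: "x \<in> cl" using X closed_closure[of Om] by (auto simp: closed_sequential_limits)
  have t: "0 \<le> t" using T by (auto intro: LIMSEQ_le_const)
  have B0: "0 \<le> B" using B[of "(x, t)"] x t by auto
  define g where "g n z = (if X n + z \<in> cl then F (X n + z, T n) + B else 0)" for n z
  define g0 where "g0 z = (if x + z \<in> cl then F (x + z, t) + B else 0)" for z
  \<comment> \<open>Off \<open>cl\<close> the function takes the value \<open>0\<close>, its lower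
    bound, so closedness of \<open>cl\<close> makes the extension upper semicontinuous.\<close>
  have gb: "0 \<le> g n z" "g n z \<le> 2 * B" for n z
    using B[of "(X n + z, T n)"] T(1) B0 by (auto simp: g_def abs_le_iff)
  have g0b: "0 \<le> g0 z" "g0 z \<le> 2 * B" for z
    using B[of "(x + z, t)"] t B0 by (auto simp: g0_def abs_le_iff)
  have gm: "g n \<in> borel_measurable borel" for n
  proof -
    have "(\<lambda>y. if y \<in> cl then F (y, T n) + B else 0) \<in> borel_measurable borel"
      by (rule usc_on_borel_measurable[OF usc_on_add[OF usc_slice[OF u T(1)]
        continuous_on_imp_usc_on[OF continuous_on_const]]]) simp
    then show ?thesis unfolding g_def by (rule measurable_compose[rotated]) simp
  qed
  have g0m: "g0 \<in> borel_measurable borel"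
  proof -
    have "(\<lambda>y. if y \<in> cl then F (y, t) + B else 0) \<in> borel_measurable borel"
      by (rule usc_on_borel_measurable[OF usc_on_add[OF usc_slice[OF u t]
        continuous_on_imp_usc_on[OF continuous_on_const]]]) simp
    then show ?thesis unfolding g0_def by (rule measurable_compose[rotated]) simp
  qed
  have ptw: "\<forall>\<^sub>F n in sequentially. g n z < c" if c: "g0 z < c" for z c
  proof (cases "x + z \<in> cl")
    case True
    have c0: "F (x + z, t) + B < c" "0 < c" using c True g0b(1)[of z] by (auto simp: g0_def)
    obtain \<delta> where \<delta>: "\<delta> > 0" "\<And>q. q \<in> cl \<times> {0..} \<Longrightarrow> dist q (x + z, t) < \<delta> \<Longrightarrow> F q < F (x + z, t) + (c - B - F (x + z, t))"
      using usc_onD[OF u, of "(x + z, t)" "c - B - F (x + z, t)"] True t c0 by auto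
    have "(\<lambda>n. (X n + z, T n)) \<longlonglongrightarrow> (x + z, t)" using X T by (intro tendsto_intros)
    then have "\<forall>\<^sub>F n in sequentially. dist (X n + z, T n) (x + z, t) < \<delta>" using \<delta>(1) by (simp add: tendstoD)
    then show ?thesis
    proof eventually_elim
      case (elim n) then show ?case using \<delta>(2)[of "(X n + z, T n)"] T(1)[of n] c0 by (auto simp: g_def)
    qed
  next
    case False
    have "(\<lambda>n. X n + z) \<longlonglongrightarrow> x + z" using X by (intro tendsto_intros)
    then have "\<forall>\<^sub>F n in sequentially. X n + z \<in> - cl"
      using False by (intro topological_tendstoD) auto
    then show ?thesis by eventually_elim (use c False in \<open>auto simp: g_def g0_def\<close>)
  qed
  have A: "?A \<in> sets (nu x)" using x by (simp add: sets_nu)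
  note fin = mass_finite[OF x d]
  have int: "integrable (nu x) (\<lambda>z. indicator ?A z * k z)"
    if "k \<in> borel_measurable borel" "\<And>z. 0 \<le> k z" "\<And>z. k z \<le> 2 * B" for k
  proof -
    have "k \<in> borel_measurable (nu x)" "norm (k z) \<le> 2 * B" for z
      using that(1) that(2,3)[of z] meas_nu[OF x] by auto
    then show ?thesis using integrableI_bounded_set_indicator[OF A _ fin, of k "2 * B"] by simp
  qed
  define h where "h n z = indicator ?A z * (2 * B - g n z)" for n z
  define h0 where "h0 z = indicator ?A z * (2 * B - g0 z)" for z
  have hi: "integrable (nu x) (h n)" "integrable (nu x) h0" for n
    unfolding h_def h0_def using gb g0b gm g0m by (auto intro!: int)
  have h0n: "0 \<le> h n z" "0 \<le> h0 z" for n z using gb g0b by (auto simp: h_def h0_def)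
  \<comment> \<open>Fatou for the nonnegative functions \<open>h n\<close>, in which the upper
    semicontinuous integrand appears with reversed sign.\<close>
  have lim_h: "\<forall>\<^sub>F n in sequentially. integral\<^sup>L (nu x) h0 - e' < integral\<^sup>L (nu x) (h n)" if e': "0 < e'" for e'
  proof (cases "integral\<^sup>L (nu x) h0 - e' < 0")
    case True
    have "0 \<le> integral\<^sup>L (nu x) (h n)" for n using h0n by simp
    then show ?thesis using True by (intro always_eventually allI) (meson order.strict_trans2)
  next
    case False
    have "(\<integral>\<^sup>+z. ennreal (h0 z) \<partial>nu x) \<le> (\<integral>\<^sup>+z. liminf (\<lambda>n. ennreal (h n z)) \<partial>nu x)"
    proof (intro nn_integral_mono)
      fix z
      show "ennreal (h0 z) \<le> liminf (\<lambda>n. ennreal (h n z))"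
        unfolding le_Liminf_iff
      proof (intro allI impI)
        fix y assume y: "y < ennreal (h0 z)"
        then obtain r where r: "y = ennreal r" "0 \<le> r" by (cases y) auto
        then have rh: "r < h0 z" using y by (simp add: ennreal_less_iff)
        then have zA: "z \<in> ?A" "r < 2 * B - g0 z" using r unfolding h0_def by (cases "z \<in> ?A"; simp)+
        have "\<forall>\<^sub>F n in sequentially. g n z < 2 * B - r" using zA by (intro ptw) auto
        then show "\<forall>\<^sub>F n in sequentially. y < ennreal (h n z)"
          by eventually_elim (use zA r in \<open>auto simp: h_def ennreal_less_iff\<close>)
      qed
    qed
    also have "\<dots> \<le> liminf (\<lambda>n. \<integral>\<^sup>+z. ennreal (h n z) \<partial>nu x)"
      using hi by (intro nn_integral_liminf) auto
    finally have "ennreal (integral\<^sup>L (nu x) h0) \<le> liminf (\<lambda>n. ennreal (integral\<^sup>L (nu x) (h n)))"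
      using hi h0n by (simp add: nn_integral_eq_integral)
    moreover have "ennreal (integral\<^sup>L (nu x) h0 - e') < ennreal (integral\<^sup>L (nu x) h0)"
      using False e' by (simp add: ennreal_less_iff)
    ultimately have "\<forall>\<^sub>F n in sequentially. ennreal (integral\<^sup>L (nu x) h0 - e') < ennreal (integral\<^sup>L (nu x) (h n))"
      unfolding le_Liminf_iff by blast
    then show ?thesis using False by (auto simp: ennreal_less_iff elim!: eventually_mono)
  qed
  have hI: "integral\<^sup>L (nu x) (h n) = 2 * B * measure (nu x) ?A - (LINT z|nu x. indicator ?A z * g n z)"
    "integral\<^sup>L (nu x) h0 = 2 * B * measure (nu x) ?A - (LINT z|nu x. indicator ?A z * g0 z)" for n
  proof -
    have i: "integrable (nu x) (\<lambda>z. indicator ?A z * (2 * B))"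
      using A fin by (intro integrable_mult_left integrable_real_indicator) auto
    show "integral\<^sup>L (nu x) (h n) = 2 * B * measure (nu x) ?A - (LINT z|nu x. indicator ?A z * g n z)"
      unfolding h_def right_diff_distrib using A
      by (subst Bochner_Integration.integral_diff[OF i int[OF gm gb]]) simp
    show "integral\<^sup>L (nu x) h0 = 2 * B * measure (nu x) ?A - (LINT z|nu x. indicator ?A z * g0 z)"
      unfolding h0_def right_diff_distrib using A
      by (subst Bochner_Integration.integral_diff[OF i int[OF g0m g0b]]) simp
  qed
  \<comment> \<open>Chosen so that the changes of measure in the integral,
    \<open>(2 * B + 1) * e1\<close>, and in the mass term, \<open>2 * B * e1\<close>, add up to
    \<open>e / 4\<close>.\<close>
  define e1 where "e1 = e / (4 * (4 * B + 1))"
  have e1: "e1 > 0" "e1 * (4 * B + 1) = e / 4" 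
  proof -
    have p: "4 * B + 1 > 0" using B0 by simp
    have alg: "e / (4 * P) * P = e / 4" if "P > 0" for P :: real using that by simp
    show "e1 * (4 * B + 1) = e / 4" unfolding e1_def by (rule alg[OF p])
    show "e1 > 0" using e p by (simp add: e1_def)
  qed
  obtain r where r: "r > 0" "\<And>x y E. x \<in> cl \<Longrightarrow> y \<in> cl \<Longrightarrow> dist x y < r \<Longrightarrow> E \<in> sets borel \<Longrightarrow>
    E \<subseteq> ?A \<Longrightarrow> \<bar>measure (nu x) E - measure (nu y) E\<bar> \<le> e1"
    using setwise_close[OF d e1(1)] by blast
  have ev1: "\<forall>\<^sub>F n in sequentially. dist (X n) x < r" using X(2) r(1) by (simp add: tendstoD)
  have ev2: "\<forall>\<^sub>F n in sequentially. integral\<^sup>L (nu x) h0 - e / 4 < integral\<^sup>L (nu x) (h n)"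
    using lim_h e by simp
  define m where "m = measure (nu x) ?A"
  have m0: "0 \<le> m" by (simp add: m_def)
  have "(\<lambda>n. (F (X n, T n) + B) * m) \<longlonglongrightarrow> (F (x, t) + B) * m" using FX by (intro tendsto_intros)
  then have ev3: "\<forall>\<^sub>F n in sequentially. (F (X n, T n) + B) * m > (F (x, t) + B) * m - e / 4"
    using e by (intro order_tendstoD) auto
  show ?thesis
    using ev1 ev2 ev3
  proof eventually_elim
    case (elim n)
    have cm: "\<bar>measure (nu (X n)) E - measure (nu x) E\<bar> \<le> e1" if "E \<in> sets borel" "E \<subseteq> ?A" for E
      using r(2)[OF X(1) x elim(1) that] .
    have k: "nl ?A (\<lambda>y. F (y, T n)) (X n) =
      (LINT z|nu (X n). indicator ?A z * g n z) - (F (X n, T n) + B) * measure (nu (X n)) ?A"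
      unfolding g_def using T(1) B by (intro nonlocal_tail_eq[OF usc_slice[OF u T(1)] _ X(1) d]) auto
    have k0: "nl ?A (\<lambda>y. F (y, t)) x = (LINT z|nu x. indicator ?A z * g0 z) - (F (x, t) + B) * m"
      unfolding g0_def m_def using t B by (intro nonlocal_tail_eq[OF usc_slice[OF u t] _ x d]) auto
    have i1: "(LINT z|nu (X n). indicator ?A z * g n z) \<le> (LINT z|nu x. indicator ?A z * g n z) + (2 * B + 1) * e1"
    proof (rule integral_le_of_setwise_close)
      show "sets (nu x) = sets (nu (X n))" using x X(1) by (simp add: sets_nu)
      show "measure (nu (X n)) E \<le> measure (nu x) E + e1" if "E \<in> sets (nu (X n))" "E \<subseteq> ?A" for E
        using cm[of E] that X(1) by (auto simp: sets_nu abs_le_iff)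
      show "g n z \<le> 2 * B + 1" for z using gb(2)[of n z] by simp
    qed (use X(1) fin mass_finite[OF X(1) d] gm gb B0 in \<open>auto simp: sets_nu meas_nu\<close>)
    have i2: "(F (X n, T n) + B) * measure (nu (X n)) ?A \<ge> (F (X n, T n) + B) * m - 2 * B * e1"
    proof -
      have p: "0 \<le> F (X n, T n) + B" "F (X n, T n) + B \<le> 2 * B"
        using B[of "(X n, T n)"] X(1) T(1) by (auto simp: abs_le_iff)
      have "measure (nu (X n)) ?A \<ge> m - e1" using cm[of ?A] by (auto simp: m_def abs_le_iff)
      then have "(F (X n, T n) + B) * (m - e1) \<le> (F (X n, T n) + B) * measure (nu (X n)) ?A"
        using p by (intro mult_left_mono) auto
      moreover have "(F (X n, T n) + B) * e1 \<le> 2 * B * e1" using p e1 by (intro mult_right_mono) auto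
      ultimately show ?thesis by (simp add: right_diff_distrib)
    qed
    have "(2 * B + 1) * e1 + 2 * B * e1 = e / 4" using e1(2) by (simp add: algebra_simps)
    then show ?case using k k0 i1 i2 elim(2,3) hI e by (simp add: m_def)
  qed
qed

text \<open>For a null set \<open>S'\<close> away from \<open>x\<close>, \<open>M0\<close> applied
  to its indicator makes the \<open>nu y\<close>-measure of the jumps from \<open>y\<close> into
  \<open>S'\<close> continuous at \<open>x\<close>. By Fubini the \<open>nu x\<close>-measure of
  that set of jumps is \<open>0\<close> for almost every \<open>y\<close>, and \<open>M3\<close>
  allows exchanging \<open>nu x\<close> and \<open>nu y\<close>. So the measure at \<open>x\<close>
  itself is a limit of zeros.\<close>

lemma jump_null:
  assumes S: "S \<in> null_sets lborel" and x: "x \<in> cl" and d: "0 < d"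
  shows "emeasure (nu x) {z \<in> - ball 0 d. x + z \<in> S} = 0"
proof -
  define r where "r = d / 4"
  have r: "r > 0" using d by (simp add: r_def)
  \<comment> \<open>Removing \<open>ball x (2 * r)\<close> makes the indicator vanish near
    \<open>x\<close>, hence smooth there. As \<open>2 * r < d\<close>, targets of jumps of length at
    least \<open>d\<close> are kept.\<close>
  define S' where "S' = S \<inter> cl - ball x (2 * r)"
  have Sb: "S \<in> sets borel" using S by (auto simp: null_sets_def)
  have S': "S' \<in> sets borel" "S' \<subseteq> cl" using Sb by (auto simp: S'_def)
  have S'n: "S' \<in> null_sets lborel"
    by (rule null_sets_subset[OF S]) (use S' in \<open>auto simp: S'_def\<close>)
  define u where "u = (indicator S' :: 'a \<Rightarrow> real)"
  have shift: "(\<lambda>z. y + z) -` S' \<in> sets borel" for y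
    using measurable_sets[of "\<lambda>z. y + z" borel borel S'] S' by simp
  have far: "z \<in> - ball 0 r" if "y \<in> ball x r" "y + z \<in> S'" for y z
  proof -
    have "dist x (y + z) \<ge> 2 * r" using that(2) by (auto simp: S'_def)
    moreover have "dist x (y + z) \<le> dist x y + norm z" using dist_triangle[of x "y + z" y] by (simp add: dist_norm)
    ultimately show ?thesis using that(1) by auto
  qed
  have val: "nl UNIV u y = measure (nu y) ((\<lambda>z. y + z) -` S')" if y: "y \<in> ball x r" "y \<in> cl" for y
  proof -
    have "y \<notin> S'" using y(1) r by (auto simp: S'_def)
    then have "nl UNIV u y = (LINT z|nu y. indicator ((\<lambda>z. y + z) -` S') z)"
      unfolding nonlocal_def set_lebesgue_integral_def using S'(2)
      by (intro Bochner_Integration.integral_cong) (auto simp: u_def indicator_def)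
    also have "\<dots> = measure (nu y) ((\<lambda>z. y + z) -` S')"
      using shift[of y] y by (simp add: sets_nu)
    finally show ?thesis .
  qed
  have cont: "continuous_on (ball x (2 * r) \<inter> cl) (nl UNIV u)"
  proof -
    have c1: "C1_on (ball x (2 * r) \<inter> cl) u"
      unfolding C1_on_def
    proof (intro exI[of _ "\<lambda>_. 0"])
      have 0: "has_C1_gradient (ball x (2 * r) \<inter> cl) (\<lambda>_. 0 :: real) (\<lambda>_. 0)" by (rule C1_gradient_const)
      show "has_C1_gradient (ball x (2 * r) \<inter> cl) u (\<lambda>_. 0)"
        unfolding has_C1_gradient_def
      proof (intro conjI ballI)
        fix y assume y: "y \<in> ball x (2 * r) \<inter> cl"
        show "(u has_derivative (\<bullet>) 0) (at y within ball x (2 * r) \<inter> cl)"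
        proof (rule has_derivative_transform[where f = "\<lambda>_. 0" and g = u])
          show "((\<lambda>_. 0 :: real) has_derivative (\<bullet>) 0) (at y within ball x (2 * r) \<inter> cl)"
            using 0 y unfolding has_C1_gradient_def by blast
        qed (use y in \<open>auto simp: u_def S'_def\<close>)
      qed (rule continuous_on_const)
    qed
    have "set_borel_measurable borel cl u" "bounded (u ` cl)"
    proof -
      have "(\<lambda>y. indicator cl y *\<^sub>R u y) = indicator (cl \<inter> S')"
        by (auto simp: fun_eq_iff u_def indicator_def)
      then show "set_borel_measurable borel cl u"
        using S'(1) unfolding set_borel_measurable_def by (simp add: borel_measurable_indicator)
      show "bounded (u ` cl)" by (auto simp: u_def bounded_iff indicator_def intro!: exI[of _ 1])
    qed
    then have "\<forall>D\<in>sets borel. continuous_on (ball x (2 * r) \<inter> cl) (nl D u)"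
      using M0[unfolded M0_def, THEN conjunct2, rule_format, OF x, of "2 * r" u] r c1 by auto
    then show ?thesis by (auto dest: bspec[of _ _ UNIV])
  qed
  \<comment> \<open>The order of integration is exchanged on the tail \<open>- ball 0 r\<close>,
    where \<open>nu x\<close> is finite; translates of a null set are null.\<close>
  have ae0: "AE y in lborel. measure (nu x) ((\<lambda>z. y + z) -` S' \<inter> - ball 0 r) = 0"
  proof -
    let ?R = "restrict_space (nu x) (- ball 0 r)"
    have RA: "- ball 0 r \<inter> space (nu x) \<in> sets (nu x)" using x by (simp add: sets_nu)
    interpret R: finite_measure ?R
      using mass_finite[OF x r] RA x sets_eq_imp_space_eq[OF sets_nu[OF x]]
      by (auto intro!: finite_measureI simp: emeasure_restrict_space space_restrict_space)
    interpret P: pair_sigma_finite lborel ?R ..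
    let ?f = "\<lambda>y z. indicator S' (y + z) :: ennreal"
    have fm: "case_prod ?f \<in> borel_measurable (lborel \<Otimes>\<^sub>M ?R)"
    proof -
      have "(\<lambda>p. fst p + snd p) \<in> borel_measurable (lborel \<Otimes>\<^sub>M ?R)"
      proof (intro borel_measurable_add)
        have "(\<lambda>z. z) \<in> borel_measurable ?R"
          using measurable_restrict_space1[of "\<lambda>z. z" "nu x" borel "- ball 0 r"] x by (simp add: meas_nu)
        then show "snd \<in> borel_measurable (lborel \<Otimes>\<^sub>M ?R)" using measurable_compose[OF measurable_snd] by simp
        show "fst \<in> borel_measurable (lborel \<Otimes>\<^sub>M ?R)"
          using measurable_compose[OF measurable_fst, of "\<lambda>z. z" lborel borel] by simp
      qed
      from measurable_compose[OF this, of "indicator S' :: 'a \<Rightarrow> ennreal"] show ?thesis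
        using S' by (simp add: case_prod_beta borel_measurable_indicator)
    qed
    have inner0: "(\<integral>\<^sup>+y. ?f y z \<partial>lborel) = 0" for z
    proof -
      have "(\<lambda>y. y + z) -` S' \<in> null_sets lborel"
        using null_sets_translation[OF S'n, of "- z"] by (simp add: vimage_def image_def add.commute)
      then have "emeasure lborel ((\<lambda>y. y + z) -` S') = 0" by auto
      moreover have "(\<integral>\<^sup>+y. ?f y z \<partial>lborel) = (\<integral>\<^sup>+y. indicator ((\<lambda>y. y + z) -` S') y \<partial>lborel)"
        by (intro nn_integral_cong) (auto simp: indicator_def)
      moreover have "(\<lambda>y. y + z) -` S' \<in> sets lborel"
        using measurable_sets[of "\<lambda>y. y + z" borel borel S'] S' by simp
      ultimately show ?thesis by simp
    qed
    have "(\<integral>\<^sup>+y. (\<integral>\<^sup>+z. ?f y z \<partial>?R) \<partial>lborel) = (\<integral>\<^sup>+z. (\<integral>\<^sup>+y. ?f y z \<partial>lborel) \<partial>?R)"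
      using P.Fubini'[OF fm] by simp
    then have "(\<integral>\<^sup>+y. (\<integral>\<^sup>+z. ?f y z \<partial>?R) \<partial>lborel) = 0" using inner0 by simp
    moreover have "(\<lambda>y. \<integral>\<^sup>+z. ?f y z \<partial>?R) \<in> borel_measurable lborel"
      using R.borel_measurable_nn_integral[OF fm] by simp
    ultimately have "AE y in lborel. (\<integral>\<^sup>+z. ?f y z \<partial>?R) = 0" by (simp add: nn_integral_0_iff_AE)
    then show ?thesis
    proof eventually_elim
      case (elim y)
      have E: "(\<lambda>z. y + z) -` S' \<inter> - ball 0 r \<in> sets ?R"
        using shift[of y] x by (auto simp: sets_restrict_space sets_nu Int_commute)
      have "emeasure ?R ((\<lambda>z. y + z) -` S' \<inter> - ball 0 r) \<le> (\<integral>\<^sup>+z. ?f y z \<partial>?R)"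
        unfolding nn_integral_indicator[OF E, symmetric] by (intro nn_integral_mono) (auto simp: indicator_def)
      then have "emeasure ?R ((\<lambda>z. y + z) -` S' \<inter> - ball 0 r) = 0" using elim by simp
      then have "emeasure (nu x) ((\<lambda>z. y + z) -` S' \<inter> - ball 0 r) = 0"
        using RA by (simp add: emeasure_restrict_space)
      then show ?case by (simp add: measure_def)
    qed
  qed
  \<comment> \<open>If the value at \<open>x\<close> exceeded \<open>e\<close>, continuity would
    keep it above \<open>e\<close> near \<open>x\<close>. But near \<open>x\<close> there is a
    \<open>y\<close> for which the \<open>nu x\<close>-measure is zero, hence the
    \<open>nu y\<close>-measure is at most \<open>e\<close>.\<close>
  have small: "measure (nu x) ((\<lambda>z. x + z) -` S') \<le> e" if e: "e > 0" for e
  proof (rule ccontr)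
    assume "\<not> ?thesis"
    then have big: "nl UNIV u x > e" using val[of x] r x by simp
    obtain \<rho> where \<rho>: "\<rho> > 0" "\<And>x' y E. x' \<in> cl \<Longrightarrow> y \<in> cl \<Longrightarrow> dist x' y < \<rho> \<Longrightarrow> E \<in> sets borel \<Longrightarrow>
      E \<subseteq> - ball 0 r \<Longrightarrow> \<bar>measure (nu x') E - measure (nu y) E\<bar> \<le> e"
      using setwise_close[OF r e] by blast
    have xin: "x \<in> ball x (2 * r) \<inter> cl" using x r by simp
    from cont[unfolded continuous_on_iff, rule_format, OF xin, of "nl UNIV u x - e"]
    obtain \<eta> where \<eta>: "\<eta> > 0" "\<And>y. y \<in> ball x (2 * r) \<inter> cl \<Longrightarrow> dist y x < \<eta> \<Longrightarrow>
        dist (nl UNIV u y) (nl UNIV u x) < nl UNIV u x - e" using big by auto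
    define s where "s = min \<rho> (min \<eta> r)"
    have s: "s > 0" using \<rho> \<eta> r by (simp add: s_def)
    have op: "open (Om \<inter> ball x s)" "Om \<inter> ball x s \<noteq> {}"
    proof -
      obtain y where "y \<in> Om" "dist y x < s" using x s closure_approachable[of x Om] by blast
      then show "Om \<inter> ball x s \<noteq> {}" by (auto simp: dist_commute)
    qed (use open_Om in auto)
    have "\<not> (AE y in lborel. y \<notin> Om \<inter> ball x s)"
    proof
      assume "AE y in lborel. y \<notin> Om \<inter> ball x s"
      then have "Om \<inter> ball x s \<in> null_sets lborel" using op(1) by (simp add: AE_iff_null_sets)
      then show False
        using op open_not_negligible[of "Om \<inter> ball x s"] null_sets_completionI[of _ lborel] by (auto simp: negligible_iff_null_sets)
    qed
    then obtain y where y: "y \<in> Om \<inter> ball x s" "measure (nu x) ((\<lambda>z. y + z) -` S' \<inter> - ball 0 r) = 0"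
    proof -
      have "\<exists>y. y \<in> Om \<inter> ball x s \<and> measure (nu x) ((\<lambda>z. y + z) -` S' \<inter> - ball 0 r) = 0"
      proof (rule ccontr)
        assume n: "\<not> ?thesis"
        from ae0 have "AE y in lborel. y \<notin> Om \<inter> ball x s"
          by eventually_elim (use n in blast)
        then show False using \<open>\<not> (AE y in lborel. y \<notin> Om \<inter> ball x s)\<close> by blast
      qed
      then show ?thesis using that by blast
    qed
    have yc: "y \<in> cl" "y \<in> ball x r" using y Om_cl by (auto simp: s_def)
    have sub: "(\<lambda>z. y + z) -` S' \<inter> - ball 0 r = (\<lambda>z. y + z) -` S'" using far[OF yc(2)] by auto
    have "(\<lambda>z. y + z) -` S' \<subseteq> - ball 0 r" using sub by blast
    then have "\<bar>measure (nu x) ((\<lambda>z. y + z) -` S') - measure (nu y) ((\<lambda>z. y + z) -` S')\<bar> \<le> e"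
      using y(1) shift[of y] by (intro \<rho>(2)[OF x yc(1)]) (auto simp: s_def)
    then have "nl UNIV u y \<le> e" using y(2) val[OF yc(2,1)] unfolding sub by simp
    moreover have "dist (nl UNIV u y) (nl UNIV u x) < nl UNIV u x - e"
      using y(1) yc r by (intro \<eta>(2)) (auto simp: s_def dist_commute)
    ultimately show False by (simp add: dist_real_def)
  qed
  have m0: "measure (nu x) ((\<lambda>z. x + z) -` S') = 0"
    by (rule antisym) (use field_le_epsilon[of "measure (nu x) ((\<lambda>z. x + z) -` S')" 0] small in auto)
  have "(\<lambda>z. x + z) -` S' \<subseteq> - ball 0 r" using far[of x] r by auto
  then have "emeasure (nu x) ((\<lambda>z. x + z) -` S') \<le> emeasure (nu x) (- ball 0 r)"
    using x by (intro emeasure_mono) (auto simp: sets_nu)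
  then have "emeasure (nu x) ((\<lambda>z. x + z) -` S') < \<infinity>" using mass_finite[OF x r] by (rule order.strict_trans1)
  then have z: "(\<lambda>z. x + z) -` S' \<in> null_sets (nu x)"
    using m0 shift[of x] x by (auto simp: null_sets_def sets_nu emeasure_eq_ennreal_measure)
  have "AE z in nu x. z \<notin> {z \<in> - ball 0 d. x + z \<in> S}"
    using AE_jump_cl[OF x] AE_not_in[OF z]
  proof eventually_elim
    case (elim z)
    then show ?case using d by (auto simp: S'_def r_def dist_norm)
  qed
  moreover have "{z \<in> - ball 0 d. x + z \<in> S} \<in> sets (nu x)"
  proof -
    have "(\<lambda>z. x + z) -` S \<in> sets borel" using measurable_sets[of "\<lambda>z. x + z" borel borel S] Sb by simp
    then have "- ball 0 d \<inter> (\<lambda>z. x + z) -` S \<in> sets borel" by auto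
    also have "- ball 0 d \<inter> (\<lambda>z. x + z) -` S = {z \<in> - ball 0 d. x + z \<in> S}" by auto
    finally show ?thesis using x by (simp add: sets_nu)
  qed
  ultimately have "{z \<in> - ball 0 d. x + z \<in> S} \<in> null_sets (nu x)"
    using AE_iff_null_sets by blast
  then show ?thesis by (rule null_setsD1)
qed

end


section \<open>Geometry of the domain\<close>

context jump_kernel
begin

text \<open>The graph is \<open>K\<close>-Lipschitz near \<open>x0\<close>, so rising by
  \<open>h\<close> in the direction \<open>e\<close> leaves room proportional to \<open>h\<close>
  above it. The bound \<open>norm e <= 1\<close>, rather than equality, admits \<open>e = 0\<close>
  at interior points.\<close>

lemma interior_cone_local:
  assumes x0: "x0 \<in> cl"
  shows "\<exists>e c r. c > 0 \<and> r > 0 \<and> norm e \<le> 1 \<and>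
    (\<forall>y\<in>cl. dist y x0 < r \<longrightarrow> (\<forall>h. 0 < h \<and> h < r \<longrightarrow> ball (y + h *\<^sub>R e) (c * h) \<subseteq> Om))"
proof (cases "x0 \<in> Om")
  case True
  then obtain \<rho> where \<rho>: "\<rho> > 0" "ball x0 \<rho> \<subseteq> Om" using open_Om by (meson openE)
  show ?thesis
  proof (rule exI[of _ "0::'a"], rule exI[of _ "1/2::real"], rule exI[of _ "\<rho>/2"], intro conjI ballI allI impI)
    fix y h assume y: "dist y x0 < \<rho> / 2" and h: "0 < h \<and> h < \<rho> / 2"
    show "ball (y + h *\<^sub>R 0) (1 / 2 * h) \<subseteq> Om"
    proof
      fix p assume "p \<in> ball (y + h *\<^sub>R 0) (1 / 2 * h)"
      then have "dist y p < \<rho> / 2" using h by simp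
      then have "dist x0 p < \<rho>" using y dist_triangle[of x0 p y] by (simp add: dist_commute)
      then show "p \<in> Om" using \<rho> by auto
    qed
  qed (use \<rho> in auto)
next
  case False
  then have "x0 \<in> frontier Om" using x0 open_Om by (simp add: frontier_def interior_open)
  then obtain r e \<gamma> where r: "r > 0" and e: "norm e = 1" and \<gamma>: "C1_on UNIV \<gamma>"
    and graph: "Om \<inter> ball x0 r = {y \<in> ball x0 r. \<gamma> (y - (y \<bullet> e) *\<^sub>R e) < y \<bullet> e}"
    using dom unfolding bounded_C1_domain_def C1_boundary_def by meson
  define pr where "pr y = y - (y \<bullet> e) *\<^sub>R e" for y
  have ee: "e \<bullet> e = 1" using e by (simp add: norm_eq_1)
  have pr_add: "pr (y + h *\<^sub>R e + w) = pr y + pr w" for y h w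
    by (simp add: pr_def inner_add_left ee algebra_simps)
  have pr_norm: "norm (pr w) \<le> 2 * norm w" for w
  proof -
    have "\<bar>w \<bullet> e\<bar> \<le> norm w" using Cauchy_Schwarz_ineq2[of w e] e by simp
    then show ?thesis using norm_triangle_ineq4[of w "(w \<bullet> e) *\<^sub>R e"] e by (simp add: pr_def)
  qed
  have pr_diff: "pr a - pr b = pr (a - b)" for a b by (simp add: pr_def inner_diff_left algebra_simps)
  obtain g where g: "continuous_on UNIV g" "\<And>x. (\<gamma> has_derivative (\<lambda>h. g x \<bullet> h)) (at x)"
    using \<gamma> by (auto simp: C1_on_def has_C1_gradient_def)
  have "compact (g ` cball (pr x0) 1)"
    using g(1) by (intro compact_continuous_image) (auto intro: continuous_on_subset)
  then obtain K where K: "K > 0" "\<And>x. x \<in> cball (pr x0) 1 \<Longrightarrow> norm (g x) \<le> K"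
    using compact_imp_bounded by (metis bounded_pos imageI)
  have lip: "\<bar>\<gamma> a - \<gamma> b\<bar> \<le> K * norm (a - b)" if "a \<in> cball (pr x0) 1" "b \<in> cball (pr x0) 1" for a b
  proof -
    have "norm (\<gamma> a - \<gamma> b) \<le> K * norm (a - b)"
    proof (rule differentiable_bound[where f' = "\<lambda>x h. g x \<bullet> h" and S = "cball (pr x0) 1"])
      fix x assume x: "x \<in> cball (pr x0) 1"
      show "(\<gamma> has_derivative (\<lambda>h. g x \<bullet> h)) (at x within cball (pr x0) 1)"
        using g(2) by (rule has_derivative_at_withinI)
      show "onorm (\<lambda>h. g x \<bullet> h) \<le> K"
      proof (rule onorm_le)
        fix h have "norm (g x \<bullet> h) \<le> norm (g x) * norm h" using Cauchy_Schwarz_ineq2[of "g x" h] by simp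
        also have "\<dots> \<le> K * norm h" using K(2)[OF x] by (intro mult_right_mono) auto
        finally show "norm (g x \<bullet> h) \<le> K * norm h" .
      qed
    qed (use that in auto)
    then show ?thesis by simp
  qed
  define \<rho> where "\<rho> = min r (1/2)"
  have \<rho>: "\<rho> > 0" "\<rho> \<le> r" "\<rho> \<le> 1/2" using r by (auto simp: \<rho>_def)
  have inb: "pr y \<in> cball (pr x0) 1" if "dist y x0 < \<rho>" for y
    using pr_norm[of "x0 - y"] that \<rho> pr_diff[of x0 y] by (simp add: dist_norm norm_minus_commute)
  \<comment> \<open>A perturbation \<open>w\<close> raises the graph by at most
    \<open>2 * K * norm w\<close>, the projection having norm at most \<open>2\<close>, and lowers
    the height by at most \<open>norm w\<close>. Both fit into \<open>h\<close> when
    \<open>(2 * K + 1) * c < 1\<close>.\<close>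
  define c where "c = 1 / (2 * K + 2)"
  have c: "0 < c" "c \<le> 1" "(2 * K + 1) * c < 1" using K(1) by (auto simp: c_def field_simps)
  show ?thesis
  proof (rule exI[of _ e], rule exI[of _ c], rule exI[of _ "\<rho>/3"], intro conjI ballI allI impI)
    fix y h assume yc: "y \<in> cl" and y: "dist y x0 < \<rho> / 3" and h: "0 < h \<and> h < \<rho> / 3"
    have "y \<in> closure (ball x0 r \<inter> Om)"
      using open_Int_closure_subset[of "ball x0 r" Om] yc y \<rho> by (auto simp: dist_commute)
    moreover have "closure (ball x0 r \<inter> Om) \<subseteq> {y. \<gamma> (pr y) \<le> y \<bullet> e}"
    proof (rule closure_minimal)
      have c1: "continuous_on UNIV \<gamma>"
        using g(2) by (auto intro!: continuous_at_imp_continuous_on has_derivative_continuous)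
      have "continuous_on UNIV (\<lambda>y. \<gamma> (pr y))"
        by (rule continuous_on_compose2[OF c1]) (auto simp: pr_def intro!: continuous_intros)
      then show "closed {y. \<gamma> (pr y) \<le> y \<bullet> e}"
        by (intro closed_Collect_le) (auto intro!: continuous_intros)
      show "ball x0 r \<inter> Om \<subseteq> {y. \<gamma> (pr y) \<le> y \<bullet> e}"
        using graph by (auto simp: pr_def intro: less_imp_le)
    qed
    ultimately have gy: "\<gamma> (pr y) \<le> y \<bullet> e" by auto
    show "ball (y + h *\<^sub>R e) (c * h) \<subseteq> Om"
    proof
      fix p assume p: "p \<in> ball (y + h *\<^sub>R e) (c * h)"
      define w where "w = p - (y + h *\<^sub>R e)"
      have pw: "p = y + h *\<^sub>R e + w" by (simp add: w_def)
      have w: "norm w < c * h" using p by (simp add: w_def dist_norm norm_minus_commute)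
      moreover have "c * h \<le> 1 * h" using c h by (intro mult_right_mono) auto
      ultimately have wh: "norm w < h" by simp
      have "dist p y \<le> norm (h *\<^sub>R e) + norm w"
        unfolding dist_norm pw using norm_triangle_ineq[of "h *\<^sub>R e" w] by (simp add: add.assoc)
      then have px: "dist p x0 < \<rho>" using dist_triangle[of p x0 y] wh h y e by simp
      have "\<gamma> (pr p) \<le> \<gamma> (pr y) + K * norm (pr p - pr y)"
        using lip[OF inb[OF px] inb[of y]] y \<rho> by (auto simp: abs_le_iff)
      also have "pr p - pr y = pr w" by (simp add: pw pr_add)
      also have "K * norm (pr w) \<le> K * (2 * norm w)" using pr_norm K(1) by (intro mult_left_mono) auto
      finally have 1: "\<gamma> (pr p) \<le> y \<bullet> e + 2 * K * norm w" using gy by simp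
      have "\<bar>w \<bullet> e\<bar> \<le> norm w" using Cauchy_Schwarz_ineq2[of w e] e by simp
      then have 2: "p \<bullet> e \<ge> y \<bullet> e + h - norm w" by (simp add: pw inner_add_left ee abs_le_iff)
      have "(2 * K + 1) * norm w \<le> (2 * K + 1) * (c * h)" using w K(1) by (intro mult_left_mono) auto
      also have "\<dots> = ((2 * K + 1) * c) * h" by simp
      also have "\<dots> < 1 * h" using c(3) h by (intro mult_strict_right_mono) auto
      finally have "2 * K * norm w < h - norm w" by (simp add: algebra_simps)
      then have "\<gamma> (pr p) < p \<bullet> e" using 1 2 by linarith
      then have "p \<in> Om \<inter> ball x0 r" unfolding graph using px \<rho> by (auto simp: pr_def dist_commute)
      then show "p \<in> Om" by simp
    qed
  qed (use \<rho> c e in auto)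
qed

text \<open>Compactness makes \<open>c\<close> and \<open>r\<close> uniform; the direction still
  depends on \<open>x0\<close> but serves a whole neighbourhood, which lets two nearby points be
  moved in parallel.\<close>

lemma interior_cone:
  obtains c r where "0 < c" "c < 1" "0 < r" "r < 1"
    "\<And>x0. x0 \<in> cl \<Longrightarrow> \<exists>e. norm e \<le> 1 \<and>
      (\<forall>y\<in>cl. dist y x0 < r \<longrightarrow> (\<forall>h. 0 < h \<and> h < r \<longrightarrow> ball (y + h *\<^sub>R e) (c * h) \<subseteq> Om))"
proof -
  obtain E C R where *: "\<And>x0. x0 \<in> cl \<Longrightarrow> C x0 > 0 \<and> R x0 > 0 \<and> norm (E x0) \<le> 1 \<and>
    (\<forall>y\<in>cl. dist y x0 < R x0 \<longrightarrow> (\<forall>h. 0 < h \<and> h < R x0 \<longrightarrow> ball (y + h *\<^sub>R E x0) (C x0 * h) \<subseteq> Om))"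
    using interior_cone_local by metis
  obtain D where D: "D \<subseteq> cl" "finite D" "cl \<subseteq> (\<Union>x\<in>D. ball x (R x / 2))"
  proof (rule compactE_image[OF compact_cl, of cl "\<lambda>x. ball x (R x / 2)"])
    show "cl \<subseteq> (\<Union>x\<in>cl. ball x (R x / 2))" using * by force
  qed auto
  have Dne: "D \<noteq> {}" using D(3) Om_ne Om_cl by auto
  define c where "c = min (1/2) (Min (C ` D))"
  \<comment> \<open>Half of each radius is spent on reaching a centre in \<open>D\<close>, the other
    half remains for the neighbourhood of \<open>x0\<close>.\<close>
  define r where "r = min (1/2) (Min ((\<lambda>x. R x / 2) ` D))"
  have c: "0 < c" "c < 1" "\<And>x. x \<in> D \<Longrightarrow> c \<le> C x"
  proof -
    show "0 < c" using D(1,2) Dne * unfolding c_def by (auto simp: subset_iff)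
    show "c < 1" by (simp add: c_def min_def)
    show "c \<le> C x" if "x \<in> D" for x
    proof -
      have "Min (C ` D) \<le> C x" using D(2) that by (intro Min_le) auto
      then show ?thesis unfolding c_def by linarith
    qed
  qed
  have r: "0 < r" "r < 1" "\<And>x. x \<in> D \<Longrightarrow> r \<le> R x / 2"
  proof -
    show "0 < r" using D(1,2) Dne * unfolding r_def by (auto simp: subset_iff)
    show "r < 1" by (simp add: r_def min_def)
    show "r \<le> R x / 2" if "x \<in> D" for x
    proof -
      have "Min ((\<lambda>x. R x / 2) ` D) \<le> R x / 2" using D(2) that by (intro Min_le) auto
      then show ?thesis unfolding r_def by linarith
    qed
  qed
  show ?thesis
  proof (rule that[OF c(1,2) r(1,2)])
    fix x0 assume "x0 \<in> cl"
    then obtain x where x: "x \<in> D" "dist x x0 < R x / 2" using D(3) by auto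
    then have xc: "x \<in> cl" using D by auto
    show "\<exists>e. norm e \<le> 1 \<and>
      (\<forall>y\<in>cl. dist y x0 < r \<longrightarrow> (\<forall>h. 0 < h \<and> h < r \<longrightarrow> ball (y + h *\<^sub>R e) (c * h) \<subseteq> Om))"
    proof (intro exI[of _ "E x"] conjI ballI allI impI)
      show "norm (E x) \<le> 1" using *[OF xc] by simp
      fix y h assume y: "y \<in> cl" "dist y x0 < r" and h: "0 < h \<and> h < r"
      have "dist y x < R x" using dist_triangle[of y x x0] y x r(3)[OF x(1)] by (simp add: dist_commute)
      moreover have "h < R x" using h r(3)[OF x(1)] by simp
      ultimately have "ball (y + h *\<^sub>R E x) (C x * h) \<subseteq> Om" using *[OF xc] y h by blast
      moreover have "c * h \<le> C x * h" using c(3)[OF x(1)] h by (intro mult_right_mono) auto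
      ultimately show "ball (y + h *\<^sub>R E x) (c * h) \<subseteq> Om" using subset_ball by blast
    qed
  qed
qed

text \<open>Each frontier point sees, at every small scale, a ball inside the open domain of
  comparable size, so the frontier is porous.\<close>

lemma negligible_frontier_Om: "negligible (frontier Om)"
proof -
  obtain c r where c: "0 < c" "c < 1" "0 < r" "r < 1"
    and cone: "\<And>x0. x0 \<in> cl \<Longrightarrow> \<exists>e. norm e \<le> 1 \<and>
      (\<forall>y\<in>cl. dist y x0 < r \<longrightarrow> (\<forall>h. 0 < h \<and> h < r \<longrightarrow> ball (y + h *\<^sub>R e) (c * h) \<subseteq> Om))"
    using interior_cone by blast
  show ?thesis
  proof (rule porous_imp_negligible[of "c / 2"])
    fix x and \<epsilon> :: real assume x: "x \<in> frontier Om" and \<epsilon>: "0 < \<epsilon>"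
    have xc: "x \<in> cl" using x by (simp add: frontier_def)
    define h where "h = min r \<epsilon> / 4"
    have h: "0 < h" "h < r" "2 * h < \<epsilon>" using \<epsilon> c by (auto simp: h_def)
    obtain e where e: "norm e \<le> 1" "ball (x + h *\<^sub>R e) (c * h) \<subseteq> Om"
      using cone[OF xc] xc h c by (metis dist_self)
    have sub: "ball (x + h *\<^sub>R e) (c * h) \<subseteq> ball x (2 * h)"
    proof
      fix p assume "p \<in> ball (x + h *\<^sub>R e) (c * h)"
      then have "dist (x + h *\<^sub>R e) p < c * h" by simp
      moreover have "c * h < 1 * h" using c h by (intro mult_strict_right_mono) auto
      moreover have "dist x (x + h *\<^sub>R e) \<le> h" using e h by (simp add: dist_norm mult_left_le)
      ultimately show "p \<in> ball x (2 * h)" using dist_triangle[of x p "x + h *\<^sub>R e"] by simp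
    qed
    have "frontier Om \<inter> Om = {}" using open_Om by (simp add: frontier_def interior_open Diff_Int_distrib2 disjoint_iff)
    then show "\<exists>r q. 0 < r \<and> r < \<epsilon> \<and> ball q (c / 2 * r) \<subseteq> ball x r \<and> ball q (c / 2 * r) \<inter> frontier Om = {}"
      using h sub e(2) by (intro exI[of _ "2 * h"] exI[of _ "x + h *\<^sub>R e"]) auto
  qed (use c in auto)
qed

section \<open>Lipschitz regularity of coercive subsolutions\<close>

text \<open>
  Abstracts what is known of the sup-convolutions of \<open>u\<close>: the values on the frontier are limits from
  inside, and the gradient term, which by coercivity may carry any constant, absorbs the nonlocal term
  of the linear part of a test function.
\<close>

definition gsub :: "real \<Rightarrow> real \<Rightarrow> ('a \<Rightarrow> real) \<Rightarrow> bool" where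
  "gsub c' b U \<longleftrightarrow> usc_on cl U \<and> (\<forall>x\<in>cl. \<forall>y\<in>cl. U x - U y \<le> b) \<and>
    (\<forall>x\<in>cl. \<forall>\<epsilon>>0. \<exists>x'\<in>Om. dist x' x < \<epsilon> \<and> U x - \<epsilon> < U x') \<and>
    (\<forall>\<phi> g x \<delta>. has_C1_gradient cl \<phi> g \<longrightarrow> x \<in> Om \<longrightarrow> (\<forall>y\<in>cl. U y - \<phi> y \<le> U x - \<phi> x) \<longrightarrow> 0 < \<delta> \<longrightarrow>
      4 * N * norm (g x) \<le> c' + nl (ball 0 \<delta>) \<phi> x + nl (- ball 0 \<delta>) U x)"

text \<open>Exponent \<open>0\<close> encodes an oscillation bound. The convention
  \<open>0 powr 0 = 0\<close> is harmless, the left-hand side being \<open>0\<close> on the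
  diagonal.\<close>

definition hol :: "real \<Rightarrow> real \<Rightarrow> ('a \<Rightarrow> real) \<Rightarrow> bool" where
  "hol \<beta> A U \<longleftrightarrow> (\<forall>x\<in>cl. \<forall>y\<in>cl. U x - U y \<le> A * dist x y powr \<beta>)"

text \<open>Jumps within the domain have length at most \<open>N\<close>, so
  \<open>norm z powr \<beta>\<close> may be replaced by its truncation at the price of a factor
  \<open>N\<close>. The tail is bounded once the exponent exceeds \<open>sg\<close>, and this is
  what stops the loss in the bootstrap.\<close>

lemma hol_tail:
  assumes h: "hol \<beta> A U" and \<beta>: "0 \<le> \<beta>" "\<beta> \<le> 1" "\<beta> \<noteq> sg" and A: "0 \<le> A" and x: "x \<in> cl" and r: "0 < r" "r < 1"
  shows "nl (- ball 0 r) U x \<le> A * N * N * r powr - max 0 (sg - \<beta>)"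
proof (rule nonlocal_upper)
  fix z assume z: "z \<in> - ball 0 r" "x + z \<in> cl"
  have nz: "norm z \<le> N" using diam[OF z(2) x] by (simp add: dist_norm)
  have "norm z powr \<beta> \<le> N * min 1 (norm z powr \<beta>)"
  proof (cases "norm z powr \<beta> \<le> 1")
    case True then show ?thesis using N1 by (simp add: mult_le_cancel_right1)
  next
    case False
    have "norm z powr \<beta> \<le> N powr \<beta>" using nz \<beta> by (intro powr_mono2) auto
    also have "\<dots> \<le> N powr 1" using N1 \<beta> by (intro powr_mono) auto
    finally show ?thesis using False N1 by simp
  qed
  then have "A * norm z powr \<beta> \<le> A * (N * min 1 (norm z powr \<beta>))" using A by (intro mult_left_mono)
  moreover have "U (x + z) - U x \<le> A * norm z powr \<beta>"
    using h x z(2) unfolding hol_def by (metis add_diff_cancel_left' dist_norm)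
  ultimately show "U (x + z) - U x \<le> A * (N * min 1 (norm z powr \<beta>))" by simp
next
  have m: "(\<lambda>z::'a. ennreal (min 1 (norm z powr \<beta>)) * indicator (- ball 0 r) z) \<in> borel_measurable borel"
    by (intro borel_measurable_times_ennreal borel_measurable_indicator measurable_compose[OF _ measurable_ennreal]) auto
  have "(\<integral>\<^sup>+z\<in>- ball 0 r. ennreal (A * (N * min 1 (norm z powr \<beta>))) \<partial>nu x) =
    ennreal (A * N) * (\<integral>\<^sup>+z\<in>- ball 0 r. ennreal (min 1 (norm z powr \<beta>)) \<partial>nu x)"
    using nn_integral_cmult[of _ "nu x", unfolded meas_nu[OF x], OF m, of "ennreal (A * N)"] A N1
    by (simp add: ennreal_mult mult.assoc)
  also have "\<dots> \<le> ennreal (A * N) * ennreal (N * r powr - max 0 (sg - \<beta>))"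
  proof (rule mult_left_mono)
    show "(\<integral>\<^sup>+z\<in>- ball 0 r. ennreal (min 1 (norm z powr \<beta>)) \<partial>nu x) \<le> ennreal (N * r powr - max 0 (sg - \<beta>))"
    proof (cases "\<beta> < sg")
      case True then show ?thesis using tail[OF x \<beta>(1) True r(1)] by simp
    next
      case False then show ?thesis using tail_finite[OF x _ \<beta>(2) r(1)] \<beta>(3) r by simp
    qed
  qed simp
  also have "\<dots> = ennreal (A * N * N * r powr - max 0 (sg - \<beta>))"
    using A N1 by (simp add: ennreal_mult[symmetric] mult.assoc)
  finally show "(\<integral>\<^sup>+z\<in>- ball 0 r. ennreal (A * (N * min 1 (norm z powr \<beta>))) \<partial>nu x) \<le> ennreal (A * N * N * r powr - max 0 (sg - \<beta>))" .
qed (use A N1 in auto)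

lemma sqrt_sum_lipschitz: "sqrt ((norm (a + z))\<^sup>2 + e\<^sup>2) \<le> sqrt ((norm a)\<^sup>2 + e\<^sup>2) + norm z" for a z :: 'a
proof -
  have 1: "sqrt ((norm (a + z))\<^sup>2 + e\<^sup>2) \<le> sqrt ((norm a + norm z)\<^sup>2 + e\<^sup>2)"
    by (intro real_sqrt_le_mono add_right_mono power_mono norm_triangle_ineq) auto
  have "sqrt ((norm a + norm z)\<^sup>2 + (e + 0)\<^sup>2) \<le> sqrt ((norm a)\<^sup>2 + e\<^sup>2) + sqrt ((norm z)\<^sup>2 + 0\<^sup>2)"
    by (rule real_sqrt_sum_squares_triangle_ineq)
  then have "sqrt ((norm a + norm z)\<^sup>2 + e\<^sup>2) \<le> sqrt ((norm a)\<^sup>2 + e\<^sup>2) + norm z" by simp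
  then show ?thesis using 1 by linarith
qed

text \<open>Comparison with a cone of slope \<open>S\<close> at \<open>y\<close> plus a paraboloid.
  The paraboloid dominates the Hoelder bound at distance \<open>r\<close>, so a violation would be
  realized inside \<open>ball y r\<close>, away from the vertex, where the gradient is at least
  \<open>S / 2\<close>. The factor \<open>4 * N\<close> in \<open>gsub\<close> then yields
  \<open>2 * N * S\<close>, of which one half absorbs the nonlocal term of the cone.\<close>

lemma gsub_vertex:
  assumes G: "gsub c' b U" and c': "0 \<le> c'" and H: "hol \<beta> A U" and \<beta>: "0 \<le> \<beta>" "\<beta> \<le> 1" "\<beta> \<noteq> sg" and A: "0 \<le> A"
    and y: "y \<in> Om" "ball y r \<subseteq> Om" and r: "0 < r" "r < 1" and x: "x \<in> cl"
  defines "S \<equiv> (c' + 1 + 4 * N * A) * r powr - max 0 (sg - \<beta>)" and "Q \<equiv> A * r powr (\<beta> - 2)"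
  shows "U x - U y \<le> S * dist x y + Q * (dist x y)\<^sup>2"
proof (rule ccontr)
  let ?ex = "max 0 (sg - \<beta>)"
  have rex: "r powr - ?ex \<ge> 1"
  proof -
    have "r powr 0 \<le> r powr - ?ex" using r by (intro powr_mono') auto
    then show ?thesis using r by simp
  qed
  have S0: "0 \<le> S" "0 \<le> Q" using c' A N1 by (auto simp: S_def Q_def)
  assume neg: "\<not> ?thesis"
  define \<mu> where "\<mu> = U x - U y - S * dist x y - Q * (dist x y)\<^sup>2"
  have \<mu>: "\<mu> > 0" using neg by (simp add: \<mu>_def)
  have usc: "usc_on cl U" using G by (simp add: gsub_def)
  have yc: "y \<in> cl" using y Om_cl by simp
  \<comment> \<open>The rounding scale comes from semicontinuity at \<open>y\<close>: a point whose
    value exceeds \<open>U y\<close> by \<open>\<mu>\<close> is at distance at least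
    \<open>e\<close>, so the rounded vertex is never touched.\<close>
  obtain e where e: "e > 0" "\<And>x'. x' \<in> cl \<Longrightarrow> dist x' y < e \<Longrightarrow> U x' < U y + \<mu>"
    using usc_onD[OF usc yc \<mu>] by blast
  define \<phi> where "\<phi> p = S * sqrt ((norm (p - y))\<^sup>2 + e\<^sup>2) + Q * (norm (p - y))\<^sup>2" for p
  define g where "g p = (S / sqrt ((norm (p - y))\<^sup>2 + e\<^sup>2)) *\<^sub>R (p - y) + (2 * Q) *\<^sub>R (p - y)" for p
  have hg: "has_C1_gradient cl \<phi> g"
    unfolding \<phi>_def[abs_def] g_def[abs_def]
    by (rule C1_gradient_add[OF C1_gradient_smooth_cone[OF e(1)] C1_gradient_paraboloid])
  have "usc_on cl (\<lambda>p. U p + - \<phi> p)"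
    using hg unfolding \<phi>_def
    by (intro usc_on_add[OF usc] continuous_on_imp_usc_on) (auto intro!: continuous_intros)
  then obtain x1 where x1: "x1 \<in> cl" "\<And>p. p \<in> cl \<Longrightarrow> U p + - \<phi> p \<le> U x1 + - \<phi> x1"
    using usc_attains_max[of cl "\<lambda>p. U p + - \<phi> p" x] x bounded_subset[OF compact_imp_bounded[OF compact_cl]]
    by (metis (no_types, lifting) closed_closure mem_Collect_eq subsetI)
  let ?d = "norm (x1 - y)"
  have sq: "sqrt (?d\<^sup>2 + e\<^sup>2) \<ge> e" using e by (simp add: real_le_rsqrt)
  have "sqrt ((dist x y)\<^sup>2 + e\<^sup>2) \<le> dist x y + e"
    using e sqrt_sum_squares_le_sum[of "dist x y" e] by simp
  then have "\<phi> x \<le> S * (dist x y + e) + Q * (dist x y)\<^sup>2"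
    unfolding \<phi>_def dist_norm using S0 by (intro add_right_mono mult_left_mono) auto
  moreover have "\<phi> x1 \<ge> S * e + Q * ?d\<^sup>2" unfolding \<phi>_def using S0 sq by (intro add_right_mono mult_left_mono) auto
  ultimately have big: "U x1 \<ge> U y + \<mu> + Q * ?d\<^sup>2" using x1(2)[OF x] by (simp add: \<mu>_def algebra_simps)
  have Qd: "Q * ?d\<^sup>2 \<ge> 0" using S0 by simp
  have de: "e \<le> ?d" using e(2)[OF x1(1)] big Qd by (cases "?d < e") (auto simp: dist_norm)
  \<comment> \<open>At distance \<open>r\<close> or more the term \<open>Q * ?d\<^sup>2\<close>
    exceeds the Hoelder bound \<open>A * ?d powr \<beta>\<close>; this dictates
    \<open>Q = A * r powr (\<beta> - 2)\<close>.\<close>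
  have dr: "?d < r"
  proof (rule ccontr)
    assume n: "\<not> ?d < r"
    have "?d powr \<beta> * r powr (2 - \<beta>) \<le> ?d powr \<beta> * ?d powr (2 - \<beta>)"
      using n r \<beta> by (intro mult_left_mono powr_mono2) auto
    also have "\<dots> = ?d\<^sup>2" using n r by (simp add: powr_add[symmetric])
    finally have "?d powr \<beta> * (r powr (2 - \<beta>) * r powr (\<beta> - 2)) \<le> ?d\<^sup>2 * r powr (\<beta> - 2)"
      by (simp add: mult_right_mono mult.assoc[symmetric])
    then have "?d powr \<beta> \<le> ?d\<^sup>2 * r powr (\<beta> - 2)" using r by (simp add: powr_add[symmetric])
    then have "A * ?d powr \<beta> \<le> Q * ?d\<^sup>2" using A by (simp add: Q_def mult_left_mono mult.assoc mult.commute[of "?d\<^sup>2"])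
    moreover have "U x1 - U y \<le> A * ?d powr \<beta>" using H x1(1) yc by (auto simp: hol_def dist_norm)
    ultimately show False using big \<mu> by simp
  qed
  have x1O: "x1 \<in> Om" using dr y(2) by (auto simp: dist_norm norm_minus_commute)
  have s0: "0 < sqrt (?d\<^sup>2 + e\<^sup>2)" using sq e by linarith
  have "sqrt (?d\<^sup>2 + e\<^sup>2) \<le> 2 * ?d" using sqrt_sum_squares_le_sum[of ?d e] e de by simp
  then have "S / 2 \<le> S / sqrt (?d\<^sup>2 + e\<^sup>2) * ?d"
    using s0 S0 by (simp add: field_simps mult_left_mono)
  also have "\<dots> \<le> (S / sqrt (?d\<^sup>2 + e\<^sup>2) + 2 * Q) * ?d" using S0 by (intro mult_right_mono) auto
  also have "\<dots> = norm (g x1)"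
    unfolding g_def scaleR_add_left[symmetric] norm_scaleR using S0 s0 by simp
  finally have gn: "S / 2 \<le> norm (g x1)" .
  have "4 * N * norm (g x1) \<le> c' + nl (ball 0 r) \<phi> x1 + nl (- ball 0 r) U x1"
    using G hg x1O x1(2) r unfolding gsub_def by auto
  moreover have "nl (ball 0 r) \<phi> x1 \<le> (S + 3 * Q * r) * N * r powr (1 - sg)"
  proof (rule nonlocal_ball_upper[OF x1(1) r])
    fix z :: 'a assume z: "norm z < r"
    have q: "(norm (x1 + z - y))\<^sup>2 \<le> ?d\<^sup>2 + 3 * r * norm z"
    proof -
      have "norm (x1 + z - y) \<le> ?d + norm z" using norm_triangle_ineq[of "x1 - y" z] by (simp add: algebra_simps)
      then have "(norm (x1 + z - y))\<^sup>2 \<le> (?d + norm z)\<^sup>2" by (intro power_mono) auto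
      also have "\<dots> = ?d\<^sup>2 + (2 * ?d + norm z) * norm z" by (simp add: power2_eq_square algebra_simps)
      also have "\<dots> \<le> ?d\<^sup>2 + (3 * r) * norm z" using dr z by (intro add_left_mono mult_right_mono) auto
      finally show ?thesis .
    qed
    have "sqrt ((norm (x1 + z - y))\<^sup>2 + e\<^sup>2) \<le> sqrt (?d\<^sup>2 + e\<^sup>2) + norm z"
      using sqrt_sum_lipschitz[of "x1 - y" z e] by (simp add: algebra_simps)
    then have "S * sqrt ((norm (x1 + z - y))\<^sup>2 + e\<^sup>2) \<le> S * (sqrt (?d\<^sup>2 + e\<^sup>2) + norm z)"
      using S0 by (intro mult_left_mono)
    moreover have "Q * (norm (x1 + z - y))\<^sup>2 \<le> Q * (?d\<^sup>2 + 3 * r * norm z)" using q S0 by (intro mult_left_mono)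
    ultimately show "\<phi> (x1 + z) - \<phi> x1 \<le> (S + 3 * Q * r) * norm z"
      unfolding \<phi>_def by (simp add: algebra_simps)
  qed (use S0 r in auto)
  \<comment> \<open>The power in \<open>Q\<close> combines with \<open>r * r powr (1 - sg)\<close>
    to \<open>r powr (\<beta> - sg)\<close>, the same blow-up as in the tail estimate.\<close>
  moreover have "(S + 3 * Q * r) * N * r powr (1 - sg) \<le> S * N + 3 * A * N * r powr - ?ex"
  proof -
    have "r powr (1 - sg) \<le> 1" using r sg by (simp add: powr_le1)
    then have f1: "S * N * r powr (1 - sg) \<le> S * N" using S0 N1 by (simp add: mult_left_le)
    have f2: "Q * r * r powr (1 - sg) = A * r powr (\<beta> - sg)"
    proof -
      have "r powr (\<beta> - sg) = r powr ((\<beta> - 2) + 1 + (1 - sg))" by simp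
      also have "\<dots> = r powr (\<beta> - 2) * r * r powr (1 - sg)" using r unfolding powr_add by simp
      finally show ?thesis by (simp add: Q_def mult.assoc)
    qed
    have "r powr (\<beta> - sg) \<le> r powr - ?ex" using r by (intro powr_mono') auto
    then have f3: "3 * N * (A * r powr (\<beta> - sg)) \<le> 3 * N * (A * r powr - ?ex)" using A N1 by (intro mult_left_mono) auto
    have "(S + 3 * Q * r) * N * r powr (1 - sg) = S * N * r powr (1 - sg) + 3 * N * (Q * r * r powr (1 - sg))"
      by (simp add: algebra_simps)
    also have "\<dots> \<le> S * N + 3 * N * (A * r powr - ?ex)" unfolding f2 using f1 f3 by linarith
    finally show ?thesis by (simp add: mult_ac)
  qed
  moreover have "nl (- ball 0 r) U x1 \<le> A * N * N * r powr - ?ex"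
    by (rule hol_tail[OF H \<beta> A x1(1) r])
  moreover have "4 * N * norm (g x1) \<ge> 2 * N * S" using gn N1 mult_left_mono[OF gn, of "4 * N"] by simp
  \<comment> \<open>The coefficient \<open>4 * N * A\<close> in \<open>S\<close> is the sum of
    \<open>3\<close> from the paraboloid and \<open>1\<close> from the tail; the summand
    \<open>c' + 1\<close> leaves the strict inequality.\<close>
  ultimately have "N * S \<le> c' + 3 * A * N * r powr - ?ex + A * N * N * r powr - ?ex" by (simp add: algebra_simps)
  also have "3 * A * N * r powr - ?ex \<le> 3 * A * N * N * r powr - ?ex"
    using A N1 by (intro mult_right_mono) (auto simp: mult_le_cancel_left1)
  also have "c' + 3 * A * N * N * r powr - ?ex + A * N * N * r powr - ?ex = c' + N * (4 * N * A * r powr - ?ex)"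
    by (simp add: algebra_simps)
  also have "c' < N * ((c' + 1) * r powr - ?ex)"
  proof -
    have "(c' + 1) * 1 \<le> (c' + 1) * r powr - ?ex" using c' rex by (intro mult_left_mono) auto
    also have "\<dots> = 1 * ((c' + 1) * r powr - ?ex)" by simp
    also have "\<dots> \<le> N * ((c' + 1) * r powr - ?ex)" using c' N1 by (intro mult_right_mono) auto
    finally show ?thesis by simp
  qed
  finally show False by (simp add: S_def algebra_simps)
qed

text \<open>Cutting the segment into \<open>n\<close> pieces divides the accumulated quadratic error
  by \<open>n\<close>, so only the linear part of the vertex estimate survives.\<close>

lemma gsub_segment:
  assumes G: "gsub c' b U" and c': "0 \<le> c'" and H: "hol \<beta> A U" and \<beta>: "0 \<le> \<beta>" "\<beta> \<le> 1" "\<beta> \<noteq> sg" and A: "0 \<le> A"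
    and r: "0 < r" "r < 1" and seg: "\<And>t. 0 \<le> t \<Longrightarrow> t \<le> 1 \<Longrightarrow> ball (y + t *\<^sub>R (x - y)) r \<subseteq> Om"
  shows "U x - U y \<le> (c' + 1 + 4 * N * A) * r powr - max 0 (sg - \<beta>) * dist x y"
proof (rule field_le_epsilon)
  fix \<epsilon> :: real assume \<epsilon>: "0 < \<epsilon>"
  let ?S = "(c' + 1 + 4 * N * A) * r powr - max 0 (sg - \<beta>)" and ?Q = "A * r powr (\<beta> - 2)"
  let ?d = "dist x y"
  obtain n0 :: nat where n0: "?Q * ?d\<^sup>2 / \<epsilon> < real n0" using reals_Archimedean2 by blast
  define n where "n = Suc n0"
  have n: "0 < real n" "?Q * ?d\<^sup>2 / \<epsilon> < real n" using n0 by (auto simp: n_def)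
  define p where "p k = y + (real k / n) *\<^sub>R (x - y)" for k
  have pO: "ball (p k) r \<subseteq> Om" "p k \<in> Om" if "k \<le> n" for k
  proof -
    show "ball (p k) r \<subseteq> Om" unfolding p_def using that n by (intro seg) auto
    then show "p k \<in> Om" using r by auto
  qed
  have dp: "dist (p (Suc k)) (p k) = ?d / n" for k
  proof -
    have "p (Suc k) - p k = (1 / n) *\<^sub>R (x - y)"
      by (simp add: p_def scaleR_diff_left[symmetric] diff_divide_distrib[symmetric])
    then show ?thesis using n by (simp add: dist_norm)
  qed
  have "k \<le> n \<Longrightarrow> U (p k) - U (p 0) \<le> real k * (?S * (?d / n) + ?Q * (?d / n)\<^sup>2)" for k
  proof (induction k)
    case (Suc k)
    have "U (p (Suc k)) - U (p k) \<le> ?S * (?d / n) + ?Q * (?d / n)\<^sup>2"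
      using gsub_vertex[OF G c' H \<beta> A pO(2)[of k] pO(1)[of k] r Om_cl[OF pO(2)[of "Suc k"]]] Suc(2) dp[of k] by simp
    then show ?case using Suc by (simp add: distrib_right)
  qed simp
  from this[of n] have "U (p n) - U (p 0) \<le> n * (?S * (?d / n) + ?Q * (?d / n)\<^sup>2)" by simp
  moreover have "p n = x" "p 0 = y" using n by (auto simp: p_def)
  moreover have "n * (?S * (?d / n) + ?Q * (?d / n)\<^sup>2) = ?S * ?d + ?Q * ?d\<^sup>2 / n"
    using n by (simp add: distrib_left power2_eq_square)
  moreover have "?Q * ?d\<^sup>2 / n \<le> \<epsilon>" using n \<epsilon> by (simp add: field_simps)
  ultimately show "U x - U y \<le> ?S * dist x y + \<epsilon>" by simp
qed

text \<open>At height \<open>\<tau>\<close> along the cone the domain contains a ball of radius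
  \<open>c * \<tau>\<close>, so the slope there is at most a multiple of
  \<open>\<tau> powr - max 0 (sg - \<beta>)\<close>. Halving the height repeatedly sums a geometric
  series of \<open>\<tau> powr a\<close>; the exponent \<open>a\<close> is positive because
  \<open>sg < 1\<close>.\<close>

lemma gsub_vertical:
  assumes G: "gsub c' b U" and c': "0 \<le> c'" and H: "hol \<beta> A U" and \<beta>: "0 \<le> \<beta>" "\<beta> \<le> 1" "\<beta> \<noteq> sg" and A: "0 \<le> A"
    and c: "0 < c" "c < 1" and r: "r < 1" and e: "norm e \<le> 1"
    and cone: "\<And>h. 0 < h \<Longrightarrow> h < r \<Longrightarrow> ball (x + h *\<^sub>R e) (c * h) \<subseteq> Om"
    and x: "x \<in> Om" and h: "0 < h" "h < r"
  shows "\<bar>U x - U (x + h *\<^sub>R e)\<bar> \<le> (c' + 1 + 4 * N * A) * (2 / c) / (1 - 2 powr - (1 - sg)) * h powr (1 - max 0 (sg - \<beta>))"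
proof -
  let ?ex = "max 0 (sg - \<beta>)"
  define a where "a = 1 - ?ex"
  have a: "1 - sg \<le> a" "a \<le> 1" "0 < a" using \<beta> sg by (auto simp: a_def)
  define M where "M = c' + 1 + 4 * N * A"
  have M: "0 < M" using c' A N1 by (simp add: M_def add_nonneg_pos add_pos_nonneg)
  \<comment> \<open>The ratio in the telescoping: \<open>\<tau> powr a - (\<tau> / 2) powr a\<close>
    is at least \<open>\<kappa> * \<tau> powr a\<close>, with \<open>\<kappa>\<close> independent of
    \<open>\<beta>\<close>.\<close>
  define \<kappa> where "\<kappa> = 1 - 2 powr - (1 - sg)"
  have \<kappa>: "0 < \<kappa>" using powr_less_mono[of "- (1 - sg)" 0 2] sg by (simp add: \<kappa>_def)
  have \<kappa>a: "\<kappa> \<le> 1 - 2 powr - a" using a powr_mono[of "- a" "- (1 - sg)" 2] by (simp add: \<kappa>_def)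
  define \<Gamma> where "\<Gamma> = M * (2 / c) / \<kappa>"
  have \<Gamma>: "0 < \<Gamma>" using M c \<kappa> by (simp add: \<Gamma>_def)
  have seg: "\<bar>U p - U q\<bar> \<le> M * \<rho> powr - ?ex * dist p q"
    if \<rho>: "0 < \<rho>" "\<rho> < 1" and S: "\<And>t. 0 \<le> t \<Longrightarrow> t \<le> 1 \<Longrightarrow> ball (q + t *\<^sub>R (p - q)) \<rho> \<subseteq> Om" for p q \<rho>
  proof -
    have "U p - U q \<le> M * \<rho> powr - ?ex * dist p q"
      unfolding M_def by (rule gsub_segment[OF G c' H \<beta> A \<rho> S])
    moreover have "U q - U p \<le> M * \<rho> powr - ?ex * dist q p"
      unfolding M_def
    proof (rule gsub_segment[OF G c' H \<beta> A \<rho>])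
      fix t :: real assume t: "0 \<le> t" "t \<le> 1"
      have "p + t *\<^sub>R (q - p) = q + (1 - t) *\<^sub>R (p - q)" by (simp add: algebra_simps)
      then show "ball (p + t *\<^sub>R (q - p)) \<rho> \<subseteq> Om" using S[of "1 - t"] t by simp
    qed
    ultimately show ?thesis by (simp add: abs_le_iff dist_commute)
  qed
  have half: "\<bar>U (x + (\<tau> / 2) *\<^sub>R e) - U (x + \<tau> *\<^sub>R e)\<bar> \<le> \<Gamma> * (\<tau> powr a - (\<tau> / 2) powr a)"
    if \<tau>: "0 < \<tau>" "\<tau> < r" for \<tau>
  proof -
    have ct: "0 < c * \<tau> / 2" "c * \<tau> / 2 < 1" using c \<tau> r mult_strict_mono[of c 1 \<tau> 1] by auto
    have "\<bar>U (x + (\<tau> / 2) *\<^sub>R e) - U (x + \<tau> *\<^sub>R e)\<bar> \<le> M * (c * \<tau> / 2) powr - ?ex * dist (x + (\<tau> / 2) *\<^sub>R e) (x + \<tau> *\<^sub>R e)"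
    proof (rule seg[OF ct])
      fix t :: real assume t: "0 \<le> t" "t \<le> 1"
      define s where "s = \<tau> - t * (\<tau> / 2)"
      have "t * (\<tau> / 2) \<le> 1 * (\<tau> / 2)" using t \<tau> by (intro mult_right_mono) auto
      then have s: "\<tau> / 2 \<le> s" "s \<le> \<tau>" using t \<tau> by (auto simp: s_def)
      have eq: "x + \<tau> *\<^sub>R e + t *\<^sub>R (x + (\<tau> / 2) *\<^sub>R e - (x + \<tau> *\<^sub>R e)) = x + s *\<^sub>R e"
        by (simp add: s_def algebra_simps) (simp add: scaleR_add_left[symmetric] flip: scaleR_diff_left)
      have "c * \<tau> / 2 \<le> c * s" using s c by (simp add: mult_left_mono)
      then show "ball (x + \<tau> *\<^sub>R e + t *\<^sub>R (x + (\<tau> / 2) *\<^sub>R e - (x + \<tau> *\<^sub>R e))) (c * \<tau> / 2) \<subseteq> Om"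
        unfolding eq using cone[of s] s \<tau> subset_ball by (metis half_gt_zero less_le_trans le_less_trans subset_trans)
    qed
    also have "dist (x + (\<tau> / 2) *\<^sub>R e) (x + \<tau> *\<^sub>R e) \<le> \<tau> / 2"
    proof -
      have "x + (\<tau> / 2) *\<^sub>R e - (x + \<tau> *\<^sub>R e) = (- (\<tau> / 2)) *\<^sub>R e" by (simp flip: scaleR_diff_left)
      then show ?thesis using e \<tau> by (simp add: dist_norm mult_left_le)
    qed
    also have "M * (c * \<tau> / 2) powr - ?ex * (\<tau> / 2) \<le> M * (2 / c) * \<tau> powr a"
    proof -
      have "(c / 2) powr - ?ex \<le> (c / 2) powr - 1" using c \<beta> sg by (intro powr_mono') auto
      also have "(c / 2) powr - 1 = 2 / c" using c by (simp add: powr_minus_divide)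
      finally have k: "(c / 2) powr - ?ex \<le> 2 / c" .
      have "(c * \<tau> / 2) powr - ?ex * (\<tau> / 2) \<le> (c * \<tau> / 2) powr - ?ex * \<tau>" using \<tau> by (intro mult_left_mono) auto
      also have "\<dots> = (c / 2) powr - ?ex * (\<tau> powr - ?ex * \<tau> powr 1)"
        using c \<tau> powr_mult[of "c / 2" \<tau> "- ?ex"] by simp
      also have "\<tau> powr - ?ex * \<tau> powr 1 = \<tau> powr a" unfolding powr_add[symmetric] a_def by simp
      also have "(c / 2) powr - ?ex * \<tau> powr a \<le> (2 / c) * \<tau> powr a" using k by (intro mult_right_mono) auto
      finally have "M * ((c * \<tau> / 2) powr - ?ex * (\<tau> / 2)) \<le> M * ((2 / c) * \<tau> powr a)"
        using M by (intro mult_left_mono) auto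
      then show ?thesis by (simp only: mult.assoc)
    qed
    also have "\<dots> = \<Gamma> * (\<tau> powr a * \<kappa>)" using \<kappa> by (simp add: \<Gamma>_def)
    also have "\<dots> \<le> \<Gamma> * (\<tau> powr a * (1 - 2 powr - a))" using \<Gamma> \<kappa>a by (intro mult_left_mono) auto
    also have "\<tau> powr a * (1 - 2 powr - a) = \<tau> powr a - (\<tau> / 2) powr a"
      using \<tau> by (simp add: right_diff_distrib powr_divide powr_minus_divide)
    finally show ?thesis using M by (simp add: mult_left_mono)
  qed
  have ind: "\<bar>U (x + (h / 2 ^ n) *\<^sub>R e) - U (x + h *\<^sub>R e)\<bar> \<le> \<Gamma> * (h powr a - (h / 2 ^ n) powr a)" for n
  proof (induction n)
    case (Suc n)
    have "h / 2 ^ n \<le> h" using h by (simp add: field_simps)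
    then have st: "\<bar>U (x + (h / 2 ^ n / 2) *\<^sub>R e) - U (x + (h / 2 ^ n) *\<^sub>R e)\<bar> \<le> \<Gamma> * ((h / 2 ^ n) powr a - (h / 2 ^ n / 2) powr a)"
      using h by (intro half) auto
    have "h / 2 ^ n / 2 = h / 2 ^ Suc n" by simp
    from st[unfolded this] Suc show ?case unfolding right_diff_distrib by linarith
  qed simp
  obtain \<rho> where \<rho>: "\<rho> > 0" "\<rho> < 1" "ball x \<rho> \<subseteq> Om"
  proof -
    obtain \<rho>0 where "\<rho>0 > 0" "ball x \<rho>0 \<subseteq> Om" using x open_Om by (meson openE)
    moreover have "ball x (min \<rho>0 (1/2)) \<subseteq> ball x \<rho>0" by (rule subset_ball) simp
    ultimately show ?thesis using that[of "min \<rho>0 (1/2)"] by (simp add: min_less_iff_disj)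
  qed
  \<comment> \<open>Closes the gap between the last dyadic point and \<open>x\<close>. The constant
    depends on the distance of \<open>x\<close> to the frontier, but it is multiplied by a height
    that tends to \<open>0\<close>.\<close>
  have near: "\<bar>U x - U (x + s *\<^sub>R e)\<bar> \<le> M * (\<rho> / 2) powr - ?ex * s" if s: "0 < s" "s < \<rho> / 2" for s
  proof -
    have se: "norm (s *\<^sub>R e) \<le> s" using e s by (simp add: mult_left_le)
    have "\<bar>U x - U (x + s *\<^sub>R e)\<bar> \<le> M * (\<rho> / 2) powr - ?ex * dist x (x + s *\<^sub>R e)"
    proof (rule seg)
      fix t :: real assume t: "0 \<le> t" "t \<le> 1"
      show "ball (x + s *\<^sub>R e + t *\<^sub>R (x - (x + s *\<^sub>R e))) (\<rho> / 2) \<subseteq> Om"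
      proof
        fix p assume p: "p \<in> ball (x + s *\<^sub>R e + t *\<^sub>R (x - (x + s *\<^sub>R e))) (\<rho> / 2)"
        have eq: "x + s *\<^sub>R e + t *\<^sub>R (x - (x + s *\<^sub>R e)) = x + (1 - t) *\<^sub>R (s *\<^sub>R e)" by (simp add: algebra_simps)
        have "dist (x + (1 - t) *\<^sub>R (s *\<^sub>R e)) p < \<rho> / 2" using p unfolding eq mem_ball .
        moreover have "dist x (x + (1 - t) *\<^sub>R (s *\<^sub>R e)) = (1 - t) * norm (s *\<^sub>R e)" using t unfolding dist_norm by (simp add: abs_mult)
        then have "dist x (x + (1 - t) *\<^sub>R (s *\<^sub>R e)) \<le> 1 * s" using t se mult_mono[of "1 - t" 1 "norm (s *\<^sub>R e)" s] by simp
        ultimately have "dist x p < \<rho>" using s dist_triangle[of x p "x + (1 - t) *\<^sub>R (s *\<^sub>R e)"] by linarith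
        then show "p \<in> Om" using \<rho> by auto
      qed
    qed (use \<rho> in auto)
    also have "\<dots> \<le> M * (\<rho> / 2) powr - ?ex * s" using M se by (intro mult_left_mono) (auto simp: dist_norm)
    finally show ?thesis .
  qed
  have "\<bar>U x - U (x + h *\<^sub>R e)\<bar> \<le> \<Gamma> * h powr a"
  proof (rule field_le_epsilon)
    fix \<epsilon> :: real assume \<epsilon>: "0 < \<epsilon>"
    define Z where "Z = M * (\<rho> / 2) powr - ?ex"
    have Z: "0 < Z" using M \<rho> by (simp add: Z_def)
    have "0 < min (\<rho> / 2) (\<epsilon> / Z) / h" using \<rho> \<epsilon> Z h by simp
    then obtain n where n: "(1/2) ^ n < min (\<rho> / 2) (\<epsilon> / Z) / h" using real_arch_pow_inv[of _ "1/2"] by auto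
    have s: "0 < h / 2 ^ n" "h / 2 ^ n < \<rho> / 2" "h / 2 ^ n < \<epsilon> / Z"
      using n h by (auto simp: field_simps power_divide)
    have "\<bar>U x - U (x + (h / 2 ^ n) *\<^sub>R e)\<bar> \<le> Z * (h / 2 ^ n)" unfolding Z_def by (rule near[OF s(1,2)])
    also have "\<dots> \<le> \<epsilon>" using s(3) Z by (simp add: pos_less_divide_eq mult.commute)
    finally have "\<bar>U x - U (x + (h / 2 ^ n) *\<^sub>R e)\<bar> \<le> \<epsilon>" .
    moreover have "\<Gamma> * (h powr a - (h / 2 ^ n) powr a) \<le> \<Gamma> * h powr a" using \<Gamma> by simp
    ultimately show "\<bar>U x - U (x + h *\<^sub>R e)\<bar> \<le> \<Gamma> * h powr a + \<epsilon>" using ind[of n] by linarith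
  qed
  then show ?thesis by (simp add: \<Gamma>_def M_def \<kappa>_def a_def)
qed

end


section \<open>Bootstrap from bounded oscillation to Lipschitz continuity up to the frontier\<close>

context jump_kernel
begin

text \<open>The larger value \<open>U x\<close> is approached from inside by the frontier condition
  of \<open>gsub\<close>, while semicontinuity alone bounds the values near \<open>y\<close> from
  above, which is the side that suffices there.\<close>

lemma hol_closure:
  assumes u: "usc_on cl U" and fr: "\<And>x \<epsilon>. x \<in> cl \<Longrightarrow> 0 < \<epsilon> \<Longrightarrow> \<exists>x'\<in>Om. dist x' x < \<epsilon> \<and> U x - \<epsilon> < U x'"
    and h: "\<And>x y. x \<in> Om \<Longrightarrow> y \<in> Om \<Longrightarrow> U x - U y \<le> K * dist x y powr a"
  shows "hol a K U"
  unfolding hol_def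
proof (intro ballI)
  fix x y assume x: "x \<in> cl" and y: "y \<in> cl"
  show "U x - U y \<le> K * dist x y powr a"
  proof (cases "x = y")
    case False
    define \<epsilon> where "\<epsilon> n = 1 / real (Suc n)" for n
    have \<epsilon>: "\<epsilon> n > 0" "\<epsilon> \<longlonglongrightarrow> 0" for n
      unfolding \<epsilon>_def using LIMSEQ_inverse_real_of_nat by (auto simp: inverse_eq_divide)
    have "\<exists>x'. x' \<in> Om \<and> dist x' x < \<epsilon> n \<and> U x - \<epsilon> n < U x'" for n
      using fr[OF x \<epsilon>(1)] by blast
    then have "\<exists>X. \<forall>n. X n \<in> Om \<and> dist (X n) x < \<epsilon> n \<and> U x - \<epsilon> n < U (X n)" by (intro choice allI)
    then obtain X where X: "\<And>n. X n \<in> Om" "\<And>n. dist (X n) x < \<epsilon> n" "\<And>n. U x - \<epsilon> n < U (X n)" by blast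
    have "\<exists>y'. y' \<in> Om \<and> dist y' y < \<epsilon> n \<and> U y' < U y + \<epsilon> n" for n
    proof -
      obtain d where d: "d > 0" "\<And>y'. y' \<in> cl \<Longrightarrow> dist y' y < d \<Longrightarrow> U y' < U y + \<epsilon> n"
        using usc_onD[OF u y \<epsilon>(1)] by blast
      obtain y' where "y' \<in> Om" "dist y' y < min d (\<epsilon> n)"
        using y closure_approachable[of y Om] d(1) \<epsilon>(1)[of n] by (metis min_less_iff_conj)
      then show ?thesis using d(2) Om_cl by auto
    qed
    then have "\<exists>Y. \<forall>n. Y n \<in> Om \<and> dist (Y n) y < \<epsilon> n \<and> U (Y n) < U y + \<epsilon> n" by (intro choice allI)
    then obtain Y where Y: "\<And>n. Y n \<in> Om" "\<And>n. dist (Y n) y < \<epsilon> n" "\<And>n. U (Y n) < U y + \<epsilon> n" by blast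
    have "X \<longlonglongrightarrow> x"
    proof (rule tendsto_dist_iff[THEN iffD2], rule tendsto_sandwich[OF _ _ tendsto_const \<epsilon>(2)])
      show "\<forall>\<^sub>F n in sequentially. dist (X n) x \<le> \<epsilon> n" using X(2) by (intro always_eventually allI less_imp_le)
    qed (intro always_eventually allI zero_le_dist)
    moreover have "Y \<longlonglongrightarrow> y"
    proof (rule tendsto_dist_iff[THEN iffD2], rule tendsto_sandwich[OF _ _ tendsto_const \<epsilon>(2)])
      show "\<forall>\<^sub>F n in sequentially. dist (Y n) y \<le> \<epsilon> n" using Y(2) by (intro always_eventually allI less_imp_le)
    qed (intro always_eventually allI zero_le_dist)
    ultimately have "(\<lambda>n. K * dist (X n) (Y n) powr a + 2 * \<epsilon> n) \<longlonglongrightarrow> K * dist x y powr a + 2 * 0"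
      using False by (intro tendsto_intros \<epsilon>) auto
    moreover have "U x - U y \<le> K * dist (X n) (Y n) powr a + 2 * \<epsilon> n" for n
      using h[OF X(1) Y(1), of n n] X(3)[of n] Y(3)[of n] by linarith
    ultimately show ?thesis by (auto intro: LIMSEQ_le_const)
  qed simp
qed

text \<open>One step of the bootstrap. Two close points are lifted in the same direction, joined
  horizontally where the ball around them is large enough, and lowered again. The three legs cost at
  most a multiple of the distance to the power \<open>1 - max 0 (sg - \<beta>)\<close>.\<close>

lemma gsub_improve:
  obtains C where "C \<ge> 1"
    "\<And>c' b U A \<beta>. gsub c' b U \<Longrightarrow> 0 \<le> c' \<Longrightarrow> hol \<beta> A U \<Longrightarrow> 0 \<le> \<beta> \<Longrightarrow> \<beta> \<le> 1 \<Longrightarrow> \<beta> \<noteq> sg \<Longrightarrow> 0 \<le> A \<Longrightarrow>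
      hol (1 - max 0 (sg - \<beta>)) (C * (c' + 1 + A)) U"
proof -
  obtain c r where c: "0 < c" "c < 1" "0 < r" "r < 1"
    and cone: "\<And>x0. x0 \<in> cl \<Longrightarrow> \<exists>e. norm e \<le> 1 \<and>
      (\<forall>y\<in>cl. dist y x0 < r \<longrightarrow> (\<forall>h. 0 < h \<and> h < r \<longrightarrow> ball (y + h *\<^sub>R e) (c * h) \<subseteq> Om))"
    using interior_cone by blast
  define \<kappa> where "\<kappa> = 1 - 2 powr - (1 - sg)"
  have \<kappa>: "0 < \<kappa>" using powr_less_mono[of "- (1 - sg)" 0 2] sg by (simp add: \<kappa>_def)
  \<comment> \<open>Distances below \<open>d0\<close> keep the lifting height
    \<open>2 * d / c\<close> below \<open>r\<close>.\<close>
  define d0 where "d0 = c * r / 2"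
  have cr: "0 < c * r" "c * r < r" using c mult_strict_right_mono[of c 1 r] by auto
  have d0: "0 < d0" "d0 < r" "d0 < 1" unfolding d0_def using cr c by linarith+
  define P where "P = 2 * ((2 / c) / \<kappa>) * (2 / c) + 1"
  have P: "P \<ge> 1" using c \<kappa> by (simp add: P_def)
  define C where "C = 4 * N * P + N / d0"
  have C: "C \<ge> 1"
  proof -
    have "1 * 1 \<le> (4 * N) * P" using N1 P by (intro mult_mono) auto
    then show ?thesis using N1 d0 by (simp add: C_def add_increasing2)
  qed
  show ?thesis
  proof (rule that[OF C])
    fix c' b U A \<beta>
    assume G: "gsub c' b U" and c': "0 \<le> c'" and H: "hol \<beta> A U" and \<beta>: "0 \<le> \<beta>" "\<beta> \<le> 1" "\<beta> \<noteq> sg" and A: "0 \<le> A"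
    let ?ex = "max 0 (sg - \<beta>)"
    define a where "a = 1 - ?ex"
    have a: "0 < a" "a \<le> 1" using \<beta> sg by (auto simp: a_def)
    define M where "M = c' + 1 + 4 * N * A"
    have M: "0 < M" using c' A N1 by (simp add: M_def add_nonneg_pos add_pos_nonneg)
    define \<Gamma> where "\<Gamma> = M * (2 / c) / \<kappa>"
    have \<Gamma>: "0 < \<Gamma>" using M c \<kappa> by (simp add: \<Gamma>_def)
    have MP: "2 * \<Gamma> * (2 / c) + M \<le> 4 * N * P * (c' + 1 + A)"
    proof -
      have "2 * \<Gamma> * (2 / c) + M = M * P" by (simp add: \<Gamma>_def P_def algebra_simps)
      also have "\<dots> \<le> (4 * N * (c' + 1 + A)) * P"
      proof (rule mult_right_mono)
        have "(c' + 1) * 1 \<le> (c' + 1) * (4 * N)" using c' N1 by (intro mult_left_mono) auto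
        then show "M \<le> 4 * N * (c' + 1 + A)" by (simp add: M_def algebra_simps)
      qed (use P in simp)
      finally show ?thesis by (simp add: mult_ac)
    qed
    have "hol a (C * (c' + 1 + A)) U"
    proof (rule hol_closure)
      fix x y assume x: "x \<in> Om" and y: "y \<in> Om"
      define d where "d = dist x y"
      show "U x - U y \<le> C * (c' + 1 + A) * dist x y powr a"
      proof (cases "d = 0")
        case False
        then have dp: "0 < d" by (simp add: d_def)
        show ?thesis
        proof (cases "d < d0")
          case True
          \<comment> \<open>At this height the free ball has radius \<open>c * h = 2 * d\<close>: it
            contains the horizontal segment of length \<open>d\<close> with room \<open>d\<close>
            around it.\<close>
          define h where "h = 2 * d / c"
          have h: "0 < h" "h < r" using dp True c by (auto simp: h_def d0_def field_simps)
          obtain e where e: "norm e \<le> 1" "\<And>y h. y \<in> cl \<Longrightarrow> dist y x < r \<Longrightarrow> 0 < h \<Longrightarrow> h < r \<Longrightarrow> ball (y + h *\<^sub>R e) (c * h) \<subseteq> Om"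
            using cone[OF Om_cl[OF x]] by blast
          have dyx: "dist y x < r" using True d0 by (simp add: d_def dist_commute)
          have vx: "\<bar>U x - U (x + h *\<^sub>R e)\<bar> \<le> \<Gamma> * h powr a"
            unfolding \<Gamma>_def M_def \<kappa>_def a_def
            by (rule gsub_vertical[OF G c' H \<beta> A c(1,2,4) e(1) _ x h]) (use e(2)[OF Om_cl[OF x]] c in auto)
          have vy: "\<bar>U y - U (y + h *\<^sub>R e)\<bar> \<le> \<Gamma> * h powr a"
            unfolding \<Gamma>_def M_def \<kappa>_def a_def
            by (rule gsub_vertical[OF G c' H \<beta> A c(1,2,4) e(1) _ y h]) (use e(2)[OF Om_cl[OF y] dyx] in auto)
          have hz: "U (x + h *\<^sub>R e) - U (y + h *\<^sub>R e) \<le> M * d powr - ?ex * dist (x + h *\<^sub>R e) (y + h *\<^sub>R e)"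
            unfolding M_def
          proof (rule gsub_segment[OF G c' H \<beta> A dp])
            show "d < 1" using True d0 by simp
            fix t :: real assume t: "0 \<le> t" "t \<le> 1"
            show "ball (y + h *\<^sub>R e + t *\<^sub>R (x + h *\<^sub>R e - (y + h *\<^sub>R e))) d \<subseteq> Om"
            proof
              fix p assume p: "p \<in> ball (y + h *\<^sub>R e + t *\<^sub>R (x + h *\<^sub>R e - (y + h *\<^sub>R e))) d"
              have eq: "y + h *\<^sub>R e + t *\<^sub>R (x + h *\<^sub>R e - (y + h *\<^sub>R e)) = y + h *\<^sub>R e + t *\<^sub>R (x - y)" by simp
              have "dist (y + h *\<^sub>R e + t *\<^sub>R (x - y)) p < d" using p unfolding eq mem_ball .
              moreover have "dist (y + h *\<^sub>R e) (y + h *\<^sub>R e + t *\<^sub>R (x - y)) = t * d"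
                using t by (simp add: dist_norm d_def)
              moreover have "t * d \<le> 1 * d" using t dp by (intro mult_right_mono) auto
              ultimately have "dist (y + h *\<^sub>R e) p < 2 * d"
                using dist_triangle[of "y + h *\<^sub>R e" p "y + h *\<^sub>R e + t *\<^sub>R (x - y)"] by linarith
              moreover have "c * h = 2 * d" using c by (simp add: h_def)
              ultimately show "p \<in> Om" using e(2)[OF Om_cl[OF y] dyx h] by auto
            qed
          qed
          have dd: "d powr - ?ex * d = d powr a"
          proof -
            have "d powr a = d powr (- ?ex + 1)" by (simp add: a_def)
            also have "\<dots> = d powr - ?ex * d" using dp unfolding powr_add by simp
            finally show ?thesis by simp
          qed
          have "dist (x + h *\<^sub>R e) (y + h *\<^sub>R e) = d" by (simp add: d_def)
          then have hz': "U (x + h *\<^sub>R e) - U (y + h *\<^sub>R e) \<le> M * d powr a"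
            using hz dd by (simp add: mult.assoc)
          have "h powr a = (2 / c) powr a * d powr a"
            using c dp by (simp add: h_def powr_mult[symmetric])
          also have "(2 / c) powr a \<le> (2 / c) powr 1" using c a by (intro powr_mono) auto
          finally have ha: "h powr a \<le> (2 / c) * d powr a" using c by (simp add: mult_right_mono)
          have "U x - U y \<le> 2 * (\<Gamma> * h powr a) + M * d powr a" using vx vy hz' by linarith
          also have "\<dots> \<le> 2 * (\<Gamma> * ((2 / c) * d powr a)) + M * d powr a"
            using ha \<Gamma> by (intro add_right_mono mult_left_mono) auto
          also have "\<dots> = (2 * \<Gamma> * (2 / c) + M) * d powr a" by (simp add: algebra_simps)
          also have "\<dots> \<le> (C * (c' + 1 + A)) * d powr a"
          proof (rule mult_right_mono)
            have "0 \<le> N / d0 * (c' + 1 + A)" using N1 d0 c' A by simp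
            then show "2 * \<Gamma> * (2 / c) + M \<le> C * (c' + 1 + A)" using MP by (simp add: C_def distrib_right)
          qed simp
          finally show ?thesis by (simp add: d_def)
        next
          \<comment> \<open>Far points: the distance is bounded below by \<open>d0\<close>, so the
            old estimate already has the new form, with the factor \<open>N / d0\<close>.\<close>
          case False
          have dN: "d \<le> N" using diam[OF Om_cl[OF x] Om_cl[OF y]] by (simp add: d_def)
          have "d powr \<beta> \<le> N powr \<beta>" using dN dp \<beta> by (intro powr_mono2) auto
          also have "\<dots> \<le> N powr 1" using N1 \<beta> by (intro powr_mono) auto
          finally have 1: "d powr \<beta> \<le> N" using N1 by simp
          have "d0 = d0 powr 1" using d0 by simp
          also have "d0 powr 1 \<le> d0 powr a" using d0 a by (intro powr_mono') auto
          also have "\<dots> \<le> d powr a" using False d0 a by (intro powr_mono2) auto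
          finally have 2: "d0 \<le> d powr a" .
          have "U x - U y \<le> A * d powr \<beta>" using H x y Om_cl by (auto simp: hol_def d_def)
          also have "\<dots> \<le> A * N" using 1 A by (rule mult_left_mono)
          also have "\<dots> = A * (N / d0) * d0" using d0 by simp
          also have "\<dots> \<le> A * (N / d0) * d powr a" using 2 A N1 d0 by (intro mult_left_mono) auto
          also have "\<dots> \<le> (C * (c' + 1 + A)) * d powr a"
          proof (rule mult_right_mono)
            have "A * (N / d0) \<le> (c' + 1 + A) * (N / d0)" using c' N1 d0 by (intro mult_right_mono) auto
            also have "\<dots> \<le> (c' + 1 + A) * C"
              using c' A N1 P by (intro mult_left_mono) (auto simp: C_def)
            finally show "A * (N / d0) \<le> C * (c' + 1 + A)" by (simp add: mult.commute)
          qed simp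
          finally show ?thesis by (simp add: d_def)
        qed
      qed (simp add: d_def)
    qed (use G in \<open>auto simp: gsub_def\<close>)
    then show "hol (1 - max 0 (sg - \<beta>)) (C * (c' + 1 + A)) U" by (simp add: a_def)
  qed
qed

lemma hol_weaken:
  assumes "hol \<beta>' A U" "0 \<le> \<beta>" "\<beta> \<le> \<beta>'" "\<beta>' \<le> 1" "0 \<le> A"
  shows "hol \<beta> (A * N) U"
  unfolding hol_def
proof (intro ballI)
  fix x y assume x: "x \<in> cl" and y: "y \<in> cl"
  show "U x - U y \<le> A * N * dist x y powr \<beta>"
  proof (cases "x = y")
    case False
    have "dist x y powr \<beta>' = dist x y powr (\<beta>' - \<beta>) * dist x y powr \<beta>" by (simp add: powr_add[symmetric])
    also have "dist x y powr (\<beta>' - \<beta>) \<le> N powr (\<beta>' - \<beta>)" using diam[OF x y] assms by (intro powr_mono2) auto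
    also have "N powr (\<beta>' - \<beta>) \<le> N powr 1" using N1 assms by (intro powr_mono) auto
    finally have "dist x y powr \<beta>' \<le> N * dist x y powr \<beta>" using N1 by (simp add: mult_right_mono)
    then have "A * dist x y powr \<beta>' \<le> A * (N * dist x y powr \<beta>)" using assms(5) by (rule mult_left_mono)
    then show ?thesis using assms(1) x y unfolding hol_def by (metis mult.assoc order_trans)
  qed simp
qed

text \<open>Below \<open>sg\<close> each step gains \<open>1 - sg\<close> in the exponent, and from
  any exponent above \<open>sg\<close> the next step gives exponent \<open>1\<close>. Since the step
  excludes the exponent \<open>sg\<close>, a shorter gain \<open>\<kappa>\<close> is used whose
  multiples straddle \<open>sg\<close>.\<close>

lemma gsub_lipschitz:
  obtains C where "C \<ge> 1"
    "\<And>c' b U x y. gsub c' b U \<Longrightarrow> 0 \<le> c' \<Longrightarrow> x \<in> cl \<Longrightarrow> y \<in> cl \<Longrightarrow> U x - U y \<le> C * (c' + 1 + b) * dist x y"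
proof -
  obtain C1 where C1: "C1 \<ge> 1"
    "\<And>c' b U A \<beta>. gsub c' b U \<Longrightarrow> 0 \<le> c' \<Longrightarrow> hol \<beta> A U \<Longrightarrow> 0 \<le> \<beta> \<Longrightarrow> \<beta> \<le> 1 \<Longrightarrow> \<beta> \<noteq> sg \<Longrightarrow> 0 \<le> A \<Longrightarrow>
      hol (1 - max 0 (sg - \<beta>)) (C1 * (c' + 1 + A)) U"
    using gsub_improve by blast
  obtain n0 :: nat where n0: "sg / (1 - sg) < real n0" using reals_Archimedean2 by blast
  define n where "n = Suc n0"
  \<comment> \<open>The half puts \<open>sg\<close> midway between \<open>n * \<kappa>\<close> and
    \<open>Suc n * \<kappa>\<close>; \<open>n\<close> is large enough for
    \<open>\<kappa> <= 1 - sg\<close>.\<close>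
  define \<kappa> where "\<kappa> = sg / (real n + 1/2)"
  have \<kappa>0: "0 < \<kappa>" using sg by (simp add: \<kappa>_def add_pos_pos)
  have n1: "sg < real n * (1 - sg)"
  proof -
    have "sg < real n0 * (1 - sg)" using n0 sg by (simp add: pos_divide_less_eq)
    then show ?thesis using sg by (simp add: n_def distrib_right)
  qed
  have n\<kappa>: "(real n + 1/2) * \<kappa> = sg" by (simp add: \<kappa>_def)
  have \<kappa>1: "\<kappa> \<le> 1 - sg"
  proof -
    have "real n * (1 - sg) \<le> (real n + 1/2) * (1 - sg)" using sg by (intro mult_right_mono) auto
    then have "sg \<le> (real n + 1/2) * (1 - sg)" using n1 by linarith
    then show ?thesis by (simp add: \<kappa>_def pos_divide_le_eq mult.commute)
  qed
  have below: "real k * \<kappa> < sg" if "k \<le> n" for k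
  proof -
    have "real k * \<kappa> \<le> real n * \<kappa>" using that \<kappa>0 by (intro mult_right_mono) auto
    moreover have "real n * \<kappa> + \<kappa> / 2 = sg" using n\<kappa> by (simp add: distrib_right)
    ultimately show ?thesis using \<kappa>0 by linarith
  qed
  have iter: "k \<le> Suc n \<Longrightarrow> \<exists>C\<ge>1. \<forall>c' b U. gsub c' b U \<longrightarrow> 0 \<le> c' \<longrightarrow> hol (real k * \<kappa>) (C * (c' + 1 + b)) U" for k
  proof (induction k)
    case 0
    show ?case
    proof (rule exI[of _ 1], intro conjI allI impI)
      fix c' b U assume G: "gsub c' b U" and c': "0 \<le> c'"
      have ub: "U x - U y \<le> b" if "x \<in> cl" "y \<in> cl" for x y using G that by (simp add: gsub_def)
      show "hol (real 0 * \<kappa>) (1 * (c' + 1 + b)) U"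
        unfolding hol_def
      proof (intro ballI)
        fix x y assume "x \<in> cl" "y \<in> cl"
        then show "U x - U y \<le> 1 * (c' + 1 + b) * dist x y powr (real 0 * \<kappa>)"
          using ub[of x y] c' by (cases "x = y") auto
      qed
    qed simp
  next
    case (Suc k)
    then obtain C where C: "C \<ge> 1" "\<And>c' b U. gsub c' b U \<Longrightarrow> 0 \<le> c' \<Longrightarrow> hol (real k * \<kappa>) (C * (c' + 1 + b)) U"
      by auto
    have kn: "k \<le> n" using Suc by simp
    show ?case
    proof (rule exI[of _ "C1 * (1 + C) * N"], intro conjI allI impI)
      have "1 * 1 * 1 \<le> C1 * (1 + C) * N" using C1(1) C(1) N1 by (intro mult_mono) auto
      then show "1 \<le> C1 * (1 + C) * N" by simp
      fix c' b U assume G: "gsub c' b U" and c': "0 \<le> c'"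
      obtain x where x: "x \<in> cl" using Om_ne Om_cl by blast
      have b: "0 \<le> b" using G x by (force simp: gsub_def)
      have A: "0 \<le> C * (c' + 1 + b)" using C c' b by simp
      have "hol (1 - max 0 (sg - real k * \<kappa>)) (C1 * (c' + 1 + C * (c' + 1 + b))) U"
        using below[OF kn] sg \<kappa>0 by (intro C1(2)[OF G c' C(2)[OF G c']] A) auto
      then have "hol (real (Suc k) * \<kappa>) (C1 * (c' + 1 + C * (c' + 1 + b)) * N) U"
        using below[OF kn] \<kappa>1 \<kappa>0 sg A C1(1) c' by (intro hol_weaken) (auto simp: distrib_right)
      moreover have "C1 * (c' + 1 + C * (c' + 1 + b)) * N \<le> C1 * (1 + C) * N * (c' + 1 + b)"
      proof -
        have "c' + 1 + C * (c' + 1 + b) \<le> (1 + C) * (c' + 1 + b)" using b by (simp add: algebra_simps)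
        then have "C1 * (c' + 1 + C * (c' + 1 + b)) * N \<le> C1 * ((1 + C) * (c' + 1 + b)) * N"
          using C1(1) N1 by (intro mult_right_mono mult_left_mono) auto
        then show ?thesis by (simp add: mult_ac)
      qed
      ultimately show "hol (real (Suc k) * \<kappa>) (C1 * (1 + C) * N * (c' + 1 + b)) U"
        unfolding hol_def by (meson mult_right_mono order_trans powr_ge_zero)
    qed
  qed
  then obtain C where C: "C \<ge> 1" "\<And>c' b U. gsub c' b U \<Longrightarrow> 0 \<le> c' \<Longrightarrow> hol (real (Suc n) * \<kappa>) (C * (c' + 1 + b)) U"
    by blast
  have last: "sg < real (Suc n) * \<kappa>" "real (Suc n) * \<kappa> \<le> 1"
    using n\<kappa> \<kappa>0 \<kappa>1 by (auto simp: distrib_right)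
  show ?thesis
  proof (rule that[of "C1 * (1 + C)"])
    show "C1 * (1 + C) \<ge> 1" using C1(1) C(1) mult_mono[of 1 C1 1 "1 + C"] by simp
    fix c' b U x y assume G: "gsub c' b U" and c': "0 \<le> c'" and x: "x \<in> cl" and y: "y \<in> cl"
    have b: "0 \<le> b" using G x by (force simp: gsub_def)
    have A: "0 \<le> C * (c' + 1 + b)" using C c' b by simp
    have "hol (1 - max 0 (sg - real (Suc n) * \<kappa>)) (C1 * (c' + 1 + C * (c' + 1 + b))) U"
      using last sg by (intro C1(2)[OF G c' C(2)[OF G c']] A) auto
    then have "U x - U y \<le> C1 * (c' + 1 + C * (c' + 1 + b)) * dist x y"
      using last x y by (simp add: hol_def)
    also have "\<dots> \<le> C1 * ((1 + C) * (c' + 1 + b)) * dist x y"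
      using C1(1) b by (intro mult_right_mono mult_left_mono) (auto simp: algebra_simps)
    finally show "U x - U y \<le> C1 * (1 + C) * (c' + 1 + b) * dist x y" by (simp add: mult_ac)
  qed
qed

end


section \<open>Sup-convolution in time\<close>

text \<open>
  A smoothing at scale \<open>k\<close> of the penalty \<open>max (- L * h) (l * h)\<close>, which is its value for \<open>k = 0\<close>.
  Letting \<open>L\<close> tend to infinity recovers \<open>u\<close> from its sup-convolution; the forward slope \<open>l\<close> only needs
  to exceed the forward time slopes of \<open>u\<close> and can be kept much smaller.
\<close>

definition pen :: "real \<Rightarrow> real \<Rightarrow> real \<Rightarrow> real \<Rightarrow> real" where
  "pen L l k h = (L + l) / 2 * sqrt (h\<^sup>2 + k\<^sup>2) - (L - l) / 2 * h - (L + l) * k / 2"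

definition pen' :: "real \<Rightarrow> real \<Rightarrow> real \<Rightarrow> real \<Rightarrow> real" where
  "pen' L l k h = (L + l) / 2 * (h / sqrt (h\<^sup>2 + k\<^sup>2)) - (L - l) / 2"

lemma pen_self [simp]: "0 \<le> k \<Longrightarrow> pen L l k 0 = 0"
  by (simp add: pen_def)

lemma pen_zero: "pen L l 0 h = (if h \<le> 0 then - L * h else l * h)"
  by (simp add: pen_def field_simps)

text \<open>Smoothing lowers the penalty by at most \<open>L * k\<close>, so sup-convolutions at
  scales \<open>k\<close> and \<open>0\<close> differ by at most \<open>L * k\<close>:
  differentiability of the penalty is bought at a controlled price.\<close>

lemma pen_le_zero:
  assumes "0 < l" "l \<le> L" "0 \<le> k"
  shows "pen L l k h \<le> pen L l 0 h" "pen L l 0 h - L * k \<le> pen L l k h"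
proof -
  have "sqrt (h\<^sup>2 + k\<^sup>2) \<le> \<bar>h\<bar> + k"
    using sqrt_sum_squares_le_sum_abs[of h k] assms by simp
  then have "(L + l) / 2 * sqrt (h\<^sup>2 + k\<^sup>2) \<le> (L + l) / 2 * (\<bar>h\<bar> + k)"
    using assms by (intro mult_left_mono) auto
  then show "pen L l k h \<le> pen L l 0 h" by (simp add: pen_def field_simps)
  have "\<bar>h\<bar> \<le> sqrt (h\<^sup>2 + k\<^sup>2)" by (simp add: real_le_rsqrt)
  then have "(L + l) / 2 * \<bar>h\<bar> \<le> (L + l) / 2 * sqrt (h\<^sup>2 + k\<^sup>2)"
    using assms by (intro mult_left_mono) auto
  moreover have "(L + l) * k / 2 \<le> L * k"
  proof -
    have "l * k \<le> L * k" using assms by (intro mult_right_mono) auto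
    then show ?thesis by (simp add: field_simps)
  qed
  ultimately show "pen L l 0 h - L * k \<le> pen L l k h" by (simp add: pen_def)
qed

lemma pen_lower:
  assumes "0 < l" "l \<le> L" "0 \<le> k" shows "l * \<bar>h\<bar> - L * k \<le> pen L l k h"
proof -
  have "l * \<bar>h\<bar> \<le> pen L l 0 h"
    using assms mult_right_mono[of l L "- h"] by (auto simp: pen_zero abs_if)
  then show ?thesis using pen_le_zero(2)[OF assms, of h] by linarith
qed

lemma pen_lipschitz:
  assumes "0 < l" "l \<le> L" "0 \<le> k" shows "\<bar>pen L l k a - pen L l k b\<bar> \<le> L * \<bar>a - b\<bar>"
proof -
  have s: "\<bar>sqrt (a\<^sup>2 + k\<^sup>2) - sqrt (b\<^sup>2 + k\<^sup>2)\<bar> \<le> \<bar>a - b\<bar>" for a b :: real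
  proof -
    have t: "sqrt (a\<^sup>2 + k\<^sup>2) \<le> sqrt (b\<^sup>2 + k\<^sup>2) + \<bar>a - b\<bar>" for a b :: real
      using real_sqrt_sum_squares_triangle_ineq[of b "a - b" k 0] by simp
    show ?thesis using t[of a b] t[of b a] by linarith
  qed
  have "pen L l k a - pen L l k b =
    (L + l) / 2 * (sqrt (a\<^sup>2 + k\<^sup>2) - sqrt (b\<^sup>2 + k\<^sup>2)) - (L - l) / 2 * (a - b)"
    by (simp add: pen_def field_simps)
  then have "\<bar>pen L l k a - pen L l k b\<bar> =
    \<bar>(L + l) / 2 * (sqrt (a\<^sup>2 + k\<^sup>2) - sqrt (b\<^sup>2 + k\<^sup>2)) - (L - l) / 2 * (a - b)\<bar>"
    by (rule arg_cong)
  also have "\<dots> \<le> (L + l) / 2 * \<bar>sqrt (a\<^sup>2 + k\<^sup>2) - sqrt (b\<^sup>2 + k\<^sup>2)\<bar> + (L - l) / 2 * \<bar>a - b\<bar>"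
    by (rule order_trans[OF abs_triangle_ineq4]) (use assms in \<open>simp add: abs_mult\<close>)
  also have "\<dots> \<le> (L + l) / 2 * \<bar>a - b\<bar> + (L - l) / 2 * \<bar>a - b\<bar>"
    using s[of a b] assms by (intro add_right_mono mult_left_mono) auto
  finally show ?thesis by (simp add: field_simps)
qed

lemma pen_deriv:
  assumes "0 < k"
  shows "(pen L l k has_real_derivative pen' L l k h) (at h)"
proof -
  have "0 < h\<^sup>2 + k\<^sup>2" using assms by (simp add: add_nonneg_pos)
  then have "((\<lambda>h. sqrt (h\<^sup>2 + k\<^sup>2)) has_real_derivative h / sqrt (h\<^sup>2 + k\<^sup>2)) (at h)"
    by (auto intro!: derivative_eq_intros simp: divide_simps)
  from DERIV_diff[OF DERIV_diff[OF DERIV_cmult[OF this, of "(L + l) / 2"] DERIV_cmult[OF DERIV_ident, of "(L - l) / 2"]]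
      DERIV_const[of "(L + l) * k / 2"]]
  show ?thesis unfolding pen_def[abs_def] pen'_def by simp
qed

lemma pen'_bound:
  assumes "0 < l" "l \<le> L" "0 < k" shows "\<bar>pen' L l k h\<bar> \<le> L"
proof -
  have "\<bar>h\<bar> \<le> sqrt (h\<^sup>2 + k\<^sup>2)" by (simp add: real_le_rsqrt)
  moreover have "0 < sqrt (h\<^sup>2 + k\<^sup>2)" using assms by (simp add: add_nonneg_pos)
  ultimately have "\<bar>h / sqrt (h\<^sup>2 + k\<^sup>2)\<bar> \<le> 1" by simp
  then have "(L + l) / 2 * \<bar>h / sqrt (h\<^sup>2 + k\<^sup>2)\<bar> \<le> (L + l) / 2"
    using assms by (intro mult_left_le) auto
  moreover have "\<bar>(L + l) / 2 * (h / sqrt (h\<^sup>2 + k\<^sup>2))\<bar> = (L + l) / 2 * \<bar>h / sqrt (h\<^sup>2 + k\<^sup>2)\<bar>"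
    unfolding abs_mult using assms by simp
  ultimately have "\<bar>(L + l) / 2 * (h / sqrt (h\<^sup>2 + k\<^sup>2))\<bar> \<le> (L + l) / 2" by linarith
  moreover have "\<bar>Z - (L - l) / 2\<bar> \<le> L" if "\<bar>Z\<bar> \<le> (L + l) / 2" for Z
  proof -
    have "Z \<le> (L + l) / 2" "- Z \<le> (L + l) / 2" using that by auto
    then show ?thesis using assms by (auto simp: abs_le_iff field_simps)
  qed
  ultimately show ?thesis unfolding pen'_def by blast
qed

lemma pen'_continuous: "0 < k \<Longrightarrow> continuous_on UNIV (pen' L l k)"
proof -
  assume "0 < k"
  then have "h\<^sup>2 + k\<^sup>2 \<noteq> 0" for h by (metis less_irrefl add_nonneg_pos zero_le_power2 zero_less_power)
  then show ?thesis unfolding pen'_def[abs_def] by (intro continuous_intros) auto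
qed

lemma C1_gradient_time:
  fixes \<rho> \<rho>' :: "real \<Rightarrow> real"
  assumes "\<And>t. (\<rho> has_real_derivative \<rho>' t) (at t)" "continuous_on UNIV \<rho>'"
  shows "has_C1_gradient S (\<lambda>q::'a::euclidean_space \<times> real. \<rho> (snd q)) (\<lambda>q. (0, \<rho>' (snd q)))"
  using C1_gradient_time_paraboloid[where k = "\<lambda>_. 0" and k' = "\<lambda>_. 0" and \<rho> = \<rho> and \<rho>' = \<rho>' and S = S and a = 0] assms
  by simp

text \<open>\<open>superlinear\<close> is the form in which coercivity is used: any prescribed
  coefficient of \<open>norm p\<close> is available up to an additive constant, and each estimate
  picks the coefficient that its nonlocal and time-derivative terms require.\<close>

locale hj_pair = jump_kernel Om nu sg N
  for Om :: "'a::euclidean_space set" and nu sg N +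
  fixes H :: "'a \<Rightarrow> 'a \<Rightarrow> real" and c B :: real and u v :: "'a \<times> real \<Rightarrow> real"
  assumes contH: "continuous_on (closure Om \<times> UNIV) (\<lambda>(x, p). H x p)"
    and superlinear: "\<And>A. \<exists>C\<ge>0. \<forall>x\<in>closure Om. \<forall>p. A * norm p - C \<le> H x p"
    and subsol: "parabolic_subsolution Om nu H c u"
    and supersol: "parabolic_supersolution Om nu H c v"
    and B0: "0 < B"
    and uB: "\<And>q. q \<in> closure Om \<times> {0..} \<Longrightarrow> \<bar>u q\<bar> \<le> B"
    and vB: "\<And>q. q \<in> closure Om \<times> {0..} \<Longrightarrow> \<bar>v q\<bar> \<le> B"
    and u_frontier: "\<And>x t. x \<in> frontier Om \<Longrightarrow> 0 < t \<Longrightarrow>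
      ereal (u (x, t)) = Limsup (at (x, t) within Om \<times> {0..}) (\<lambda>q. ereal (u q))"
begin

lemma uusc: "usc_on (cl \<times> {0..}) u" and vlsc: "usc_on (cl \<times> {0..}) (\<lambda>q. - v q)"
  using subsol supersol
  by (auto simp: parabolic_subsolution_def parabolic_supersolution_def lsc_on_iff_usc_on_minus)

lemma u_tame: "0 \<le> t \<Longrightarrow> tame B (\<lambda>y. u (y, t))"
  using usc_slice[OF uusc] uB by (intro usc_imp_tame) auto

lemma v_tame: "0 \<le> t \<Longrightarrow> tame B (\<lambda>y. - v (y, t))"
  using usc_slice[OF vlsc] vB by (intro usc_imp_tame) auto

lemma sub_test:
  assumes "has_C1_gradient (cl \<times> {0..}) \<phi> G" "x \<in> Om" "0 < t" "0 < \<delta>"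
    and "\<And>q. q \<in> cl \<times> {0..} \<Longrightarrow> u q - \<phi> q \<le> u (x, t) - \<phi> (x, t)"
  shows "snd (G (x, t)) + H x (fst (G (x, t))) - c \<le>
    nl (ball 0 \<delta>) (\<lambda>y. \<phi> (y, t)) x + nl (- ball 0 \<delta>) (\<lambda>y. u (y, t)) x"
proof -
  have "parabolic_E Om nu H c \<delta> u \<phi> G x t \<le> 0"
    using subsol assms unfolding parabolic_subsolution_def by blast
  then show ?thesis by (simp add: parabolic_E_def)
qed

lemma super_test:
  assumes "has_C1_gradient (cl \<times> {0..}) \<phi> G" "x \<in> cl" "0 < t" "0 < \<delta>"
    and "\<And>q. q \<in> cl \<times> {0..} \<Longrightarrow> v q - \<phi> q \<ge> v (x, t) - \<phi> (x, t)"
  shows "snd (G (x, t)) + H x (fst (G (x, t))) - c \<ge>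
    nl (ball 0 \<delta>) (\<lambda>y. \<phi> (y, t)) x + nl (- ball 0 \<delta>) (\<lambda>y. v (y, t)) x"
proof -
  have "parabolic_E Om nu H c \<delta> v \<phi> G x t \<ge> 0"
    using supersol assms unfolding parabolic_supersolution_def by blast
  then show ?thesis by (simp add: parabolic_E_def)
qed

text \<open>The limsup condition on the frontier says that values there are limits from inside.
  Times vary too, which the supremum over time in the sup-convolution tolerates.\<close>

lemma u_interior_approx:
  assumes x: "x \<in> cl" and t: "0 < t" and e: "0 < e"
  shows "\<exists>x'\<in>Om. \<exists>t'\<ge>0. dist x' x < e \<and> \<bar>t' - t\<bar> < e \<and> u (x, t) - e < u (x', t')"
proof (cases "x \<in> Om")
  case True then show ?thesis using t e by (intro bexI[of _ x] exI[of _ t]) auto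
next
  case False
  then have fr: "x \<in> frontier Om" using x open_Om by (simp add: frontier_def interior_open)
  show ?thesis
  proof (rule ccontr)
    assume n: "\<not> ?thesis"
    have "\<forall>\<^sub>F q in at (x, t) within Om \<times> {0..}. ereal (u q) \<le> ereal (u (x, t) - e)"
      unfolding eventually_at
    proof (intro exI[of _ e] conjI ballI impI)
      fix q assume q: "q \<in> Om \<times> {0..}" "q \<noteq> (x, t) \<and> dist q (x, t) < e"
      obtain x' t' where q': "q = (x', t')" by (cases q)
      have "dist x' x < e" "\<bar>t' - t\<bar> < e"
        using q(2) dist_fst_le[of q "(x, t)"] dist_snd_le[of q "(x, t)"] by (auto simp: q' dist_real_def)
      then show "ereal (u q) \<le> ereal (u (x, t) - e)" using n q(1) by (force simp: q')
    qed (rule e)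
    then have "Limsup (at (x, t) within Om \<times> {0..}) (\<lambda>q. ereal (u q)) \<le> ereal (u (x, t) - e)"
      by (rule Limsup_bounded)
    then show False using u_frontier[OF fr t] e by (metis ereal_less_eq(3) diff_ge_0_iff_ge add_le_cancel_left add_diff_eq not_less le_diff_eq add_0_right add.commute less_add_same_cancel1)
  qed
qed

text \<open>The convolution acts at fixed \<open>x\<close>; the difference \<open>s - t\<close> is
  negative when the argmax lies in the past, so \<open>L\<close> weighs past and \<open>l\<close>
  future times.\<close>

definition sc :: "real \<Rightarrow> real \<Rightarrow> real \<Rightarrow> real \<Rightarrow> 'a \<Rightarrow> real" where
  "sc L l k t x = (SUP s\<in>{0..}. u (x, s) - pen L l k (s - t))"

lemma pen_usc: "0 < l \<Longrightarrow> l \<le> L \<Longrightarrow> 0 \<le> k \<Longrightarrow> continuous_on S (\<lambda>q. pen L l k (f q))"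
  if "continuous_on S f" for f :: "'b::metric_space \<Rightarrow> real"
  unfolding pen_def by (intro continuous_intros that)

lemma sc_attained:
  assumes p: "0 < l" "l \<le> L" "0 \<le> k" and x: "x \<in> cl" and t: "0 \<le> t"
  obtains s where "0 \<le> s" "sc L l k t x = u (x, s) - pen L l k (s - t)"
    "\<And>s'. 0 \<le> s' \<Longrightarrow> u (x, s') - pen L l k (s' - t) \<le> sc L l k t x"
proof -
  let ?f = "\<lambda>s. u (x, s) - pen L l k (s - t)"
  have u1: "usc_on {0..} (\<lambda>s. u (x, s))"
    by (rule usc_on_compose[OF uusc]) (use x in \<open>auto intro!: continuous_intros\<close>)
  have f: "usc_on {0..} ?f"
    using usc_on_add[OF u1 continuous_on_imp_usc_on[OF continuous_on_minus[OF pen_usc[OF continuous_on_diff[OF continuous_on_id continuous_on_const] p]]], of t]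
    by simp
  have "{s\<in>{0..}. ?f t \<le> ?f s} \<subseteq> cball t ((2 * B + L * k) / l)"
  proof
    fix s assume s: "s \<in> {s\<in>{0..}. ?f t \<le> ?f s}"
    have "\<bar>u (x, t)\<bar> \<le> B" "\<bar>u (x, s)\<bar> \<le> B" using uB x t s by auto
    then have "l * \<bar>s - t\<bar> \<le> 2 * B + L * k" using s p pen_lower[OF p, of "s - t"] unfolding abs_le_iff by auto
    then show "s \<in> cball t ((2 * B + L * k) / l)" using p by (simp add: dist_real_def field_simps abs_minus_commute)
  qed
  then have b: "bounded {s\<in>{0..}. ?f t \<le> ?f s}" using bounded_cball bounded_subset by blast
  obtain s where s: "s \<in> {0..}" "\<And>s'. s' \<in> {0..} \<Longrightarrow> ?f s' \<le> ?f s"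
    using usc_attains_max[OF f _ _ b] t by auto
  have "sc L l k t x = ?f s" unfolding sc_def using s by (intro cSup_eq_maximum) auto
  then show ?thesis using s that[of s] by auto
qed

lemma sc_ge: "0 < l \<Longrightarrow> l \<le> L \<Longrightarrow> 0 \<le> k \<Longrightarrow> x \<in> cl \<Longrightarrow> 0 \<le> t \<Longrightarrow> 0 \<le> s \<Longrightarrow>
    u (x, s) - pen L l k (s - t) \<le> sc L l k t x"
  using sc_attained by metis

lemma sc_bounds:
  assumes p: "0 < l" "l \<le> L" "0 \<le> k" and x: "x \<in> cl" and t: "0 \<le> t"
  shows "u (x, t) \<le> sc L l k t x" "sc L l k t x \<le> B + L * k" "- B \<le> sc L l k t x"
proof -
  show 1: "u (x, t) \<le> sc L l k t x" using sc_ge[OF p x t t] p by simp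
  show "- B \<le> sc L l k t x" using 1 uB[of "(x, t)"] x t by auto
  obtain s where s: "0 \<le> s" "sc L l k t x = u (x, s) - pen L l k (s - t)" using sc_attained[OF p x t] .
  have "0 \<le> l * \<bar>s - t\<bar>" using p by simp
  then show "sc L l k t x \<le> B + L * k" using s pen_lower[OF p, of "s - t"] uB[of "(x, s)"] x by auto
qed

lemma sc_argmax_bound:
  assumes p: "0 < l" "l \<le> L" "0 \<le> k" and x: "x \<in> cl" and t: "0 \<le> t" and s: "0 \<le> s"
    and a: "sc L l k t x - e \<le> u (x, s) - pen L l k (s - t)"
  shows "\<bar>s - t\<bar> \<le> (2 * B + L * k + e) / l"
proof -
  have "l * \<bar>s - t\<bar> \<le> 2 * B + L * k + e"
    using a sc_bounds(3)[OF p x t] pen_lower[OF p, of "s - t"] uB[of "(x, s)"] x s by auto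
  then show ?thesis using p by (simp add: field_simps)
qed

lemma sc_argmax_pos:
  assumes p: "0 < l" "l \<le> L" "0 \<le> k" and x: "x \<in> cl" and t: "0 \<le> t" and s: "0 \<le> s"
    and a: "sc L l k t x \<le> u (x, s) - pen L l k (s - t)" and big: "2 * B < L * (t - k)"
  shows "0 < s"
proof (rule ccontr)
  assume "\<not> 0 < s"
  then have "s = 0" using s by simp
  then have "sc L l k t x \<le> B - pen L l k (- t)" using a uB[of "(x, 0)"] x by auto
  moreover have "L * t - L * k \<le> pen L l k (- t)"
    using pen_le_zero(2)[OF p, of "- t"] t by (simp add: pen_zero)
  ultimately show False using sc_bounds(3)[OF p x t] big by (simp add: right_diff_distrib)
qed

lemma sc_usc:
  assumes p: "0 < l" "l \<le> L" "0 \<le> k" and t: "0 \<le> t"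
  shows "usc_on cl (sc L l k t)"
  unfolding usc_on_metric
proof (intro ballI allI impI)
  fix x and e :: real assume x: "x \<in> cl" and e: "0 < e"
  show "\<exists>d>0. \<forall>y\<in>cl. dist y x < d \<longrightarrow> sc L l k t y < sc L l k t x + e"
  proof (rule ccontr)
    assume "\<not> ?thesis"
    then have "\<exists>y. y \<in> cl \<and> dist y x < 1 / real (Suc n) \<and> sc L l k t x + e \<le> sc L l k t y" for n
      by (meson not_less of_nat_0_less_iff zero_less_Suc zero_less_divide_1_iff)
    then have "\<exists>X. \<forall>n. X n \<in> cl \<and> dist (X n) x < 1 / real (Suc n) \<and> sc L l k t x + e \<le> sc L l k t (X n)" by (intro choice allI)
    then obtain X where X: "\<And>n. X n \<in> cl" "\<And>n. dist (X n) x < 1 / real (Suc n)" "\<And>n. sc L l k t x + e \<le> sc L l k t (X n)"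
      by blast
    have "\<exists>s\<ge>0. sc L l k t (X n) = u (X n, s) - pen L l k (s - t)" for n
      using sc_attained[OF p X(1)[of n] t] by metis
    then have "\<exists>s. \<forall>n. 0 \<le> s n \<and> sc L l k t (X n) = u (X n, s n) - pen L l k (s n - t)" by (intro choice allI)
    then obtain s where s: "\<And>n. 0 \<le> s n" "\<And>n. sc L l k t (X n) = u (X n, s n) - pen L l k (s n - t)" by blast
    have "bounded (range s)"
    proof -
      have "s n \<in> cball t ((2 * B + L * k + 0) / l)" for n
        using sc_argmax_bound[OF p X(1) t s(1)[of n], of n 0] s(2)[of n] by (simp add: dist_real_def abs_minus_commute)
      then show ?thesis by (intro bounded_subset[OF bounded_cball]) auto
    qed
    then obtain s0 f where f: "strict_mono f" "(s \<circ> f) \<longlonglongrightarrow> s0"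
      using bounded_imp_convergent_subsequence by blast
    have Xx: "X \<longlonglongrightarrow> x"
    proof (rule tendsto_dist_iff[THEN iffD2], rule tendsto_sandwich[OF _ _ tendsto_const LIMSEQ_inverse_real_of_nat])
      show "\<forall>\<^sub>F n in sequentially. dist (X n) x \<le> inverse (real (Suc n))"
        using X(2) by (intro always_eventually allI less_imp_le) (simp add: inverse_eq_divide)
    qed (intro always_eventually allI zero_le_dist)
    have s0: "0 \<le> s0" using f(2) s(1) by (intro LIMSEQ_le_const[of "s \<circ> f"]) auto
    have F: "usc_on (cl \<times> {0..}) (\<lambda>q. u q + - pen L l k (snd q - t))"
      by (intro usc_on_add uusc continuous_on_imp_usc_on continuous_on_minus pen_usc p continuous_intros)
    have "sc L l k t x + e \<le> u (x, s0) + - pen L l k (snd (x, s0) - t)"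
    proof (rule usc_on_seq_le[OF F, of "(x, s0)" "\<lambda>n. (X (f n), s (f n))" "\<lambda>_. sc L l k t x + e"])
      show "(\<lambda>n. (X (f n), s (f n))) \<longlonglongrightarrow> (x, s0)"
        using LIMSEQ_subseq_LIMSEQ[OF Xx f(1)] f(2) by (intro tendsto_Pair) (auto simp: o_def)
      show "sc L l k t x + e \<le> u (X (f n), s (f n)) + - pen L l k (snd (X (f n), s (f n)) - t)" for n
        using X(3)[of "f n"] s(2)[of "f n"] by simp
    qed (use x s0 X(1) s(1) in auto)
    then show False using sc_ge[OF p x t s0] e by simp
  qed
qed

lemma nonlocal_tail_le:
  assumes f: "tame b f" and g: "tame b' g" and x: "x \<in> cl" and d: "0 < d"
    and le: "\<And>z. x + z \<in> cl \<Longrightarrow> f (x + z) - f x \<le> g (x + z) - g x"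
  shows "nl (- ball 0 d) f x \<le> nl (- ball 0 d) g x"
  unfolding nonlocal_def
  using tame_integrable[OF f x, of "- ball 0 d" d] tame_integrable[OF g x, of "- ball 0 d" d] d le
  by (intro set_integral_mono) auto

text \<open>A test function touching the sup-convolution at \<open>x\<close> touches
  \<open>u\<close> at \<open>(x, s)\<close> after adding the penalty in time, \<open>s\<close> being
  an argmax. The time derivative is then bounded by \<open>L\<close>, so that coercivity turns the
  equation into the inequality of \<open>gsub\<close>. Positive \<open>k\<close> makes the penalty
  differentiable.\<close>

lemma sc_lipschitz_pos:
  obtains KK where "KK \<ge> 1"
    "\<And>L l k t x y. 0 < l \<Longrightarrow> l \<le> L \<Longrightarrow> 0 < k \<Longrightarrow> k \<le> 1 \<Longrightarrow> 2 * B < L * (t - k) \<Longrightarrow> x \<in> cl \<Longrightarrow> y \<in> cl \<Longrightarrow>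
      sc L l k t x - sc L l k t y \<le> KK * (1 + L) * dist x y"
proof -
  obtain C where C: "C \<ge> 1"
    "\<And>c' b U x y. gsub c' b U \<Longrightarrow> 0 \<le> c' \<Longrightarrow> x \<in> cl \<Longrightarrow> y \<in> cl \<Longrightarrow> U x - U y \<le> C * (c' + 1 + b) * dist x y"
    using gsub_lipschitz by blast
  obtain CA where CA: "CA \<ge> 0" "\<And>x p. x \<in> cl \<Longrightarrow> 4 * N * norm p - CA \<le> H x p"
    using superlinear[of "4 * N"] by blast
  define KK where "KK = C * (CA + \<bar>c\<bar> + 2 * B + 2)"
  have KK: "KK \<ge> 1"
    using mult_mono[of 1 C 1 "CA + \<bar>c\<bar> + 2 * B + 2"] C(1) CA B0 by (simp add: KK_def)
  show ?thesis
  proof (rule that[OF KK])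
    fix L l k t x y
    assume p: "0 < l" "l \<le> L" and k: "0 < k" "k \<le> 1" and big: "2 * B < L * (t - k)" and x: "x \<in> cl" and y: "y \<in> cl"
    have L: "0 < L" using p by simp
    have tk: "k < t" using big L B0 by (smt (verit) mult_nonneg_nonpos)
    then have t: "0 < t" "0 \<le> t" using k by auto
    have p': "0 < l" "l \<le> L" "0 \<le> k" using p k by auto
    let ?U = "sc L l k t"
    have Ut: "tame (B + L * k) ?U"
    proof (rule usc_imp_tame[OF sc_usc[OF p' t(2)]])
      fix x assume "x \<in> cl"
      then show "\<bar>?U x\<bar> \<le> B + L * k" using sc_bounds(2,3)[OF p' _ t(2), of x] L k by (simp add: abs_le_iff add_increasing2)
    qed
    \<comment> \<open>Both constants are affine in \<open>L\<close>, whence the Lipschitz constant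
      \<open>KK * (1 + L)\<close> with \<open>KK\<close> independent of the slopes, of
      \<open>k\<close> and of \<open>t\<close>.\<close>
    have "gsub (CA + \<bar>c\<bar> + L) (2 * B + L) ?U"
      unfolding gsub_def
    proof (intro conjI ballI allI impI)
      show "usc_on cl ?U" by (rule sc_usc[OF p' t(2)])
    next
      fix x y assume "x \<in> cl" "y \<in> cl"
      moreover have "L * k \<le> L" using k L by (simp add: mult_left_le)
      ultimately show "?U x - ?U y \<le> 2 * B + L"
        using sc_bounds(2)[OF p' _ t(2), of x] sc_bounds(3)[OF p' _ t(2), of y] by linarith
    next
      fix x and \<epsilon> :: real assume x: "x \<in> cl" and \<epsilon>: "0 < \<epsilon>"
      obtain s where s: "0 \<le> s" "?U x = u (x, s) - pen L l k (s - t)" using sc_attained[OF p' x t(2)] .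
      have sp: "0 < s" using sc_argmax_pos[OF p' x t(2) s(1) _ big] s(2) by simp
      define e where "e = \<epsilon> / (1 + L)"
      have e: "0 < e" "e + L * e = \<epsilon>" "e \<le> \<epsilon>"
      proof -
        show "0 < e" using \<epsilon> L by (simp add: e_def)
        have "(1 + L) * e = \<epsilon>" using L by (simp add: e_def)
        then show 2: "e + L * e = \<epsilon>" by (simp add: distrib_right)
        then show "e \<le> \<epsilon>" using \<open>0 < e\<close> L mult_pos_pos[of L e] by linarith
      qed
      obtain x' t' where x': "x' \<in> Om" "0 \<le> t'" "dist x' x < e" "\<bar>t' - s\<bar> < e" "u (x, s) - e < u (x', t')"
        using u_interior_approx[OF x sp e(1)] by blast
      have "?U x' \<ge> u (x', t') - pen L l k (t' - t)" using sc_ge[OF p' Om_cl[OF x'(1)] t(2) x'(2)] .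
      moreover have "\<bar>pen L l k (t' - t) - pen L l k (s - t)\<bar> \<le> L * e"
      proof -
        have "L * \<bar>t' - s\<bar> \<le> L * e" using x'(4) L by (intro mult_left_mono) auto
        then show ?thesis using pen_lipschitz[OF p', of "t' - t" "s - t"] by simp
      qed
      ultimately have "?U x - \<epsilon> < ?U x'" using s(2) x'(5) e(2) by linarith
      then show "\<exists>x'\<in>Om. dist x' x < \<epsilon> \<and> ?U x - \<epsilon> < ?U x'" using x' e(3) by (intro bexI[of _ x']) auto
    next
      fix \<phi> g x \<delta>
      assume hg: "has_C1_gradient cl \<phi> g" and x: "x \<in> Om" and mx: "\<forall>y\<in>cl. ?U y - \<phi> y \<le> ?U x - \<phi> x" and \<delta>: "(0::real) < \<delta>"
      have xc: "x \<in> cl" using x Om_cl by simp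
      obtain s where s: "0 \<le> s" "?U x = u (x, s) - pen L l k (s - t)" using sc_attained[OF p' xc t(2)] .
      have sp: "0 < s" using sc_argmax_pos[OF p' xc t(2) s(1) _ big] s(2) by simp
      let ?\<rho> = "\<lambda>s. pen L l k (s - t)" and ?\<rho>' = "\<lambda>s. pen' L l k (s - t)"
      have d\<rho>: "(?\<rho> has_real_derivative ?\<rho>' s) (at s)" for s
      proof -
        have "((\<lambda>s. s - t) has_real_derivative 1) (at s)" by (auto intro!: derivative_eq_intros)
        from DERIV_chain2[OF pen_deriv[OF k(1), of L l] this] show ?thesis by simp
      qed
      have c\<rho>: "continuous_on UNIV ?\<rho>'"
        by (rule continuous_on_compose2[OF pen'_continuous[OF k(1)]]) (auto intro!: continuous_intros)
      have hG: "has_C1_gradient (cl \<times> {0..}) (\<lambda>q. \<phi> (fst q) + ?\<rho> (snd q)) (\<lambda>q. (g (fst q), 0) + (0, ?\<rho>' (snd q)))"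
        by (rule C1_gradient_add[OF C1_gradient_space[OF hg] C1_gradient_time[OF d\<rho> c\<rho>]])
      have ts: "?\<rho>' s + H x (g x) - c \<le> nl (ball 0 \<delta>) (\<lambda>y. \<phi> y + ?\<rho> s) x + nl (- ball 0 \<delta>) (\<lambda>y. u (y, s)) x"
      proof -
        have "u q - (\<phi> (fst q) + ?\<rho> (snd q)) \<le> u (x, s) - (\<phi> (fst (x, s)) + ?\<rho> (snd (x, s)))" if q: "q \<in> cl \<times> {0..}" for q
        proof -
          obtain y r where qr: "q = (y, r)" "y \<in> cl" "0 \<le> r" using q by auto
          then show ?thesis using sc_ge[OF p' qr(2) t(2) qr(3)] mx s(2) by force
        qed
        from sub_test[OF hG x sp \<delta> this] show ?thesis by simp
      qed
      have "nl (ball 0 \<delta>) (\<lambda>y. \<phi> y + ?\<rho> s) x = nl (ball 0 \<delta>) \<phi> x" by (simp add: nonlocal_def)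
      \<comment> \<open>With the time \<open>s\<close> frozen, \<open>u (\<cdot>, s)\<close> minus a
        constant lies below the sup-convolution and meets it at \<open>x\<close>, so its increments
        are smaller.\<close>
      moreover have "nl (- ball 0 \<delta>) (\<lambda>y. u (y, s)) x \<le> nl (- ball 0 \<delta>) ?U x"
      proof (rule nonlocal_tail_le[OF u_tame[OF s(1)] Ut xc \<delta>])
        fix z assume "x + z \<in> cl"
        then show "u (x + z, s) - u (x, s) \<le> ?U (x + z) - ?U x" using sc_ge[OF p' _ t(2) s(1), of "x + z"] s(2) by simp
      qed
      ultimately show "4 * N * norm (g x) \<le> CA + \<bar>c\<bar> + L + nl (ball 0 \<delta>) \<phi> x + nl (- ball 0 \<delta>) ?U x"
        using ts CA(2)[OF xc, of "g x"] pen'_bound[OF p k(1), of "s - t"] by (simp add: abs_le_iff) linarith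
    qed
    from C(2)[OF this _ x y]
    have "?U x - ?U y \<le> C * (CA + \<bar>c\<bar> + L + 1 + (2 * B + L)) * dist x y" using CA L by simp
    also have "\<dots> \<le> KK * (1 + L) * dist x y"
    proof (rule mult_right_mono)
      have "0 \<le> (CA + \<bar>c\<bar> + 2 * B) * L" using CA B0 L by simp
      then have "CA + \<bar>c\<bar> + L + 1 + (2 * B + L) \<le> (CA + \<bar>c\<bar> + 2 * B + 2) * (1 + L)" by (simp add: algebra_simps)
      then show "C * (CA + \<bar>c\<bar> + L + 1 + (2 * B + L)) \<le> KK * (1 + L)"
        using C(1) by (simp add: KK_def mult.assoc)
    qed simp
    finally show "?U x - ?U y \<le> KK * (1 + L) * dist x y" .
  qed
qed

text \<open>The constant does not depend on \<open>k\<close>, so the estimate passes to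
  \<open>k = 0\<close>.\<close>

lemma sc_lipschitz:
  obtains KK where "KK \<ge> 1"
    "\<And>L l k t x y. 0 < l \<Longrightarrow> l \<le> L \<Longrightarrow> 0 \<le> k \<Longrightarrow> k \<le> 1 \<Longrightarrow> 2 * B < L * (t - k) \<Longrightarrow> x \<in> cl \<Longrightarrow> y \<in> cl \<Longrightarrow>
      \<bar>sc L l k t x - sc L l k t y\<bar> \<le> KK * (1 + L) * dist x y"
proof -
  obtain KK where KK: "KK \<ge> 1"
    "\<And>L l k t x y. 0 < l \<Longrightarrow> l \<le> L \<Longrightarrow> 0 < k \<Longrightarrow> k \<le> 1 \<Longrightarrow> 2 * B < L * (t - k) \<Longrightarrow> x \<in> cl \<Longrightarrow> y \<in> cl \<Longrightarrow>
      sc L l k t x - sc L l k t y \<le> KK * (1 + L) * dist x y"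
    using sc_lipschitz_pos by blast
  show ?thesis
  proof (rule that[OF KK(1)])
    fix L l k t x y
    assume p: "0 < l" "l \<le> L" and k: "0 \<le> k" "k \<le> 1" and big: "2 * B < L * (t - k)" and x: "x \<in> cl" and y: "y \<in> cl"
    have L: "0 < L" using p by simp
    have half: "sc L l k t x - sc L l k t y \<le> KK * (1 + L) * dist x y" if x: "x \<in> cl" and y: "y \<in> cl" for x y
    proof (cases "0 < k")
      case True then show ?thesis using KK(2)[OF p True k(2) big x y] by simp
    next
      case False
      then have k0: "k = 0" using k by simp
      then have t: "0 \<le> t" using big L B0 by (smt (verit) mult_nonneg_nonpos)
      show ?thesis
      proof (rule field_le_epsilon)
        fix e :: real assume e: "0 < e"
        \<comment> \<open>Small enough for an error \<open>e / 2\<close> and for the lower bound on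
          time to survive with \<open>j\<close> in place of \<open>0\<close>.\<close>
        define j where "j = min 1 (min (e / (2 * L)) ((L * t - 2 * B) / (2 * L)))"
        have j: "0 < j" "j \<le> 1" using e L big k0 by (auto simp: j_def)
        have "j \<le> e / (2 * L)" "j \<le> (L * t - 2 * B) / (2 * L)" by (simp_all add: j_def)
        then have j': "L * j \<le> e / 2" "L * j \<le> (L * t - 2 * B) / 2" using L by (simp_all add: field_simps)
        have b: "2 * B < L * (t - j)" using j'(2) big k0 by (simp add: right_diff_distrib)
        have 1: "sc L l 0 t x \<le> sc L l j t x"
        proof -
          obtain s where s: "0 \<le> s" "sc L l 0 t x = u (x, s) - pen L l 0 (s - t)" using sc_attained[OF p order_refl x t] .
          moreover have "u (x, s) - pen L l j (s - t) \<le> sc L l j t x" using sc_ge[OF p _ x t s(1)] j by simp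
          moreover have "pen L l j (s - t) \<le> pen L l 0 (s - t)" using pen_le_zero(1)[OF p] j by simp
          ultimately show ?thesis by linarith
        qed
        have 2: "sc L l j t y \<le> sc L l 0 t y + L * j"
        proof -
          have j0: "0 \<le> j" using j by simp
          obtain s where s: "0 \<le> s" "sc L l j t y = u (y, s) - pen L l j (s - t)" using sc_attained[OF p j0 y t] .
          moreover have "u (y, s) - pen L l 0 (s - t) \<le> sc L l 0 t y" by (rule sc_ge[OF p order_refl y t s(1)])
          moreover have "pen L l 0 (s - t) - L * j \<le> pen L l j (s - t)" by (rule pen_le_zero(2)[OF p j0])
          ultimately show ?thesis by linarith
        qed
        show "sc L l k t x - sc L l k t y \<le> KK * (1 + L) * dist x y + e"
        proof -
          have "sc L l j t x - sc L l j t y \<le> KK * (1 + L) * dist x y" by (rule KK(2)[OF p j b x y])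
          then show ?thesis unfolding k0 using 1 2 j'(1) e by linarith
        qed
      qed
    qed
    show "\<bar>sc L l k t x - sc L l k t y\<bar> \<le> KK * (1 + L) * dist x y"
      using half[OF x y] half[OF y x] by (simp add: abs_le_iff dist_commute)
  qed
qed

end


section \<open>Doubling of variables\<close>

text \<open>
  The doubled points are shifted by \<open>h *\<^sub>R e\<close>, with \<open>e\<close> pointing into the domain, so that the one
  where \<open>u\<close> is evaluated lies in \<open>Om\<close>: at the frontier \<open>u\<close> cannot be tested.
\<close>

locale touching = hj_pair Om nu sg N H c B u v
  for Om :: "'a::euclidean_space set" and nu sg N H c B u v +
  fixes L l K cc r Kx :: real and e xb :: 'a and tb :: real
    and \<psi> :: "'a \<times> real \<Rightarrow> real" and G :: "'a \<times> real \<Rightarrow> 'a \<times> real"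
  assumes lL: "0 < l" "l \<le> L" and K1: "1 \<le> K"
    and lip: "\<And>k t x y. 0 \<le> k \<Longrightarrow> k \<le> 1 \<Longrightarrow> 2 * B < L * (t - k) \<Longrightarrow> x \<in> closure Om \<Longrightarrow> y \<in> closure Om \<Longrightarrow>
      \<bar>sc L l k t x - sc L l k t y\<bar> \<le> K * dist x y"
    and cone: "0 < cc" "cc < 1" "0 < r" "r < 1" "norm e \<le> 1"
      "\<And>y h. y \<in> closure Om \<Longrightarrow> dist y xb < r \<Longrightarrow> 0 < h \<Longrightarrow> h < r \<Longrightarrow> ball (y + h *\<^sub>R e) (cc * h) \<subseteq> Om"
    and chi: "has_C1_gradient (closure Om \<times> {0..}) \<psi> G" "\<And>q. q \<in> closure Om \<times> {0..} \<Longrightarrow> 0 \<le> \<psi> q"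
      "0 \<le> Kx" "\<And>y y' t. y \<in> closure Om \<Longrightarrow> y' \<in> closure Om \<Longrightarrow> 0 \<le> t \<Longrightarrow> \<bar>\<psi> (y, t) - \<psi> (y', t)\<bar> \<le> Kx * dist y y'"
    and xb: "xb \<in> closure Om" and tb: "2 * B < L * tb"
    and mx: "\<And>x t. x \<in> closure Om \<Longrightarrow> 0 \<le> t \<Longrightarrow>
      sc L l 0 t x - v (x, t) - \<psi> (x, t) \<le> sc L l 0 tb xb - v (xb, tb) - \<psi> (xb, tb)"
begin

definition "m0 = sc L l 0 tb xb - v (xb, tb) - \<psi> (xb, tb)"
text \<open>Bounds the sum of the linear growth rates of the four nonlocal pieces in the doubled
  inequality, apart from the contributions carrying \<open>A\<close>.\<close>

definition "K3 = 2 * (K * K + 5 * K + 2 + Kx)"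

lemma L0: "0 < L" and tb0: "0 < tb"
proof -
  show "0 < L" using lL by simp
  then show "0 < tb" using tb B0 by (smt (verit) mult_nonneg_nonpos)
qed

lemma chi_continuous: "continuous_on (cl \<times> {0..}) \<psi>"
  unfolding continuous_on_eq_continuous_within
proof
  fix q :: "'a \<times> real" assume "q \<in> cl \<times> {0..}"
  then have "(\<psi> has_derivative (\<lambda>h. G q \<bullet> h)) (at q within cl \<times> {0..})"
    using chi(1) unfolding has_C1_gradient_def by blast
  then show "continuous (at q within cl \<times> {0..}) \<psi>" by (rule has_derivative_continuous)
qed

text \<open>The weight \<open>1 / h\<^sup>2\<close> faces a shift of length at most
  \<open>h\<close>: for a space-Lipschitz sup-convolution the actual displacement differs from the
  shift by order \<open>h\<^sup>2\<close> only, less than the room \<open>cc * h\<close> around the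
  shifted point. The terms with \<open>A\<close> force the points to return to
  \<open>(xb, tb)\<close>.\<close>

lemma doubled_maximum:
  assumes A: "1 \<le> A" and h: "0 < h" "h \<le> 1"
  obtains x s y t where "x \<in> cl" "0 \<le> s" "y \<in> cl" "0 \<le> t"
    "\<And>x' s' y' t'. x' \<in> cl \<Longrightarrow> 0 \<le> s' \<Longrightarrow> y' \<in> cl \<Longrightarrow> 0 \<le> t' \<Longrightarrow>
      u (x', s') - v (y', t') - pen L l h (s' - t') - \<psi> (y', t') - (norm (x' - y' - h *\<^sub>R e))\<^sup>2 / h\<^sup>2
        - A * (norm (y' - xb))\<^sup>2 - A * (t' - tb)\<^sup>2
      \<le> u (x, s) - v (y, t) - pen L l h (s - t) - \<psi> (y, t) - (norm (x - y - h *\<^sub>R e))\<^sup>2 / h\<^sup>2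
        - A * (norm (y - xb))\<^sup>2 - A * (t - tb)\<^sup>2"
proof -
  let ?S = "(cl \<times> {0::real..}) \<times> (cl \<times> {0::real..})"
  define P where "P q = pen L l h (snd (fst q) - snd (snd q)) + \<psi> (snd q)
    + (norm (fst (fst q) - fst (snd q) - h *\<^sub>R e))\<^sup>2 / h\<^sup>2 + A * (norm (fst (snd q) - xb))\<^sup>2 + A * (snd (snd q) - tb)\<^sup>2"
    for q :: "('a \<times> real) \<times> ('a \<times> real)"
  define F where "F q = u (fst q) + - v (snd q) + - P q" for q
  have h0: "0 \<le> h" using h by simp
  have cP: "continuous_on ?S P"
    unfolding P_def
    by (intro continuous_on_add pen_usc[OF _ lL h0] continuous_on_compose2[OF chi_continuous] continuous_intros)
      (use h in auto)
  have F: "usc_on ?S F"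
    unfolding F_def
    by (intro usc_on_add usc_on_compose[OF uusc] usc_on_compose[OF vlsc] continuous_on_imp_usc_on continuous_on_minus cP continuous_intros) auto
  define q0 where "q0 = ((xb, tb), (xb, tb))"
  have q0: "q0 \<in> ?S" using xb tb0 by (simp add: q0_def)
  define R where "R = 2 * B + L - F q0"
  have sub: "{q\<in>?S. F q0 \<le> F q} \<subseteq> (cl \<times> cball tb ((R + 1) + R / l)) \<times> (cl \<times> cball tb (R + 1))"
  proof
    fix q assume q: "q \<in> {q\<in>?S. F q0 \<le> F q}"
    obtain x s y t where qd: "q = ((x, s), (y, t))" by (metis surj_pair)
    have m: "x \<in> cl" "0 \<le> s" "y \<in> cl" "0 \<le> t" using q by (auto simp: qd)
    have "\<bar>u (x, s)\<bar> \<le> B" "\<bar>v (y, t)\<bar> \<le> B" using uB vB m by auto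
    moreover have "0 \<le> \<psi> (y, t)" using chi(2) m by auto
    moreover have "l * \<bar>s - t\<bar> - L * h \<le> pen L l h (s - t)" by (rule pen_lower[OF lL h0])
    moreover have "L * h \<le> L" using L0 h by (simp add: mult_left_le)
    moreover have "0 \<le> (norm (x - y - h *\<^sub>R e))\<^sup>2 / h\<^sup>2" "0 \<le> A * (norm (y - xb))\<^sup>2" using A by auto
    moreover have "1 * (t - tb)\<^sup>2 \<le> A * (t - tb)\<^sup>2" using A by (intro mult_right_mono) auto
    moreover have "F q0 \<le> u (x, s) - v (y, t) - (pen L l h (s - t) + \<psi> (y, t)
    + (norm (x - y - h *\<^sub>R e))\<^sup>2 / h\<^sup>2 + A * (norm (y - xb))\<^sup>2 + A * (t - tb)\<^sup>2)"
      using q by (simp add: F_def P_def qd)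
    ultimately have k: "l * \<bar>s - t\<bar> + (t - tb)\<^sup>2 \<le> R" unfolding R_def abs_le_iff by linarith
    have nn: "0 \<le> l * \<bar>s - t\<bar>" using lL by simp
    then have "(t - tb)\<^sup>2 \<le> R" using k by linarith
    moreover have "\<bar>t - tb\<bar> \<le> (t - tb)\<^sup>2 + 1"
    proof (cases "\<bar>t - tb\<bar> \<le> 1")
      case True then show ?thesis by (simp add: add_increasing)
    next
      case False
      then have "\<bar>t - tb\<bar> * 1 \<le> \<bar>t - tb\<bar> * \<bar>t - tb\<bar>" by (intro mult_left_mono) auto
      then show ?thesis by (simp add: power2_eq_square)
    qed
    ultimately have t: "\<bar>t - tb\<bar> \<le> R + 1" by linarith
    have "l * \<bar>s - t\<bar> \<le> R" using k zero_le_power2[of "t - tb"] by linarith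
    then have "\<bar>s - t\<bar> \<le> R / l" using lL by (simp add: field_simps)
    then have "\<bar>s - tb\<bar> \<le> (R + 1) + R / l" using t by linarith
    then show "q \<in> (cl \<times> cball tb ((R + 1) + R / l)) \<times> (cl \<times> cball tb (R + 1))"
      using m t by (auto simp: qd dist_real_def abs_minus_commute)
  qed
  have bnd: "bounded {q\<in>?S. F q0 \<le> F q}"
    by (rule bounded_subset[OF _ sub]) (intro bounded_Times compact_imp_bounded[OF compact_cl] bounded_cball)
  have "closed ?S" by (intro closed_Times closed_closure closed_atLeast)
  then obtain q where q: "q \<in> ?S" "\<And>q'. q' \<in> ?S \<Longrightarrow> F q' \<le> F q"
    using usc_attains_max[OF F _ q0 bnd] by blast
  obtain x s y t where qd: "q = ((x, s), (y, t))" by (metis surj_pair)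
  show ?thesis
  proof (rule that[of x s y t])
    fix x' s' y' t' assume "x' \<in> cl" "(0::real) \<le> s'" "y' \<in> cl" "(0::real) \<le> t'"
    then have "F ((x', s'), (y', t')) \<le> F q" by (intro q(2)) auto
    then show "u (x', s') - v (y', t') - pen L l h (s' - t') - \<psi> (y', t') - (norm (x' - y' - h *\<^sub>R e))\<^sup>2 / h\<^sup>2
        - A * (norm (y' - xb))\<^sup>2 - A * (t' - tb)\<^sup>2
      \<le> u (x, s) - v (y, t) - pen L l h (s - t) - \<psi> (y, t) - (norm (x - y - h *\<^sub>R e))\<^sup>2 / h\<^sup>2
        - A * (norm (y - xb))\<^sup>2 - A * (t - tb)\<^sup>2"
      by (simp add: F_def P_def qd)
  qed (use q(1) qd in auto)
qed

lemma sq_increment: "(norm (a + z))\<^sup>2 \<le> (norm a)\<^sup>2 + (2 * norm a + norm z) * norm z" for a z :: 'a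
proof -
  have "(norm (a + z))\<^sup>2 \<le> (norm a + norm z)\<^sup>2" by (intro power_mono norm_triangle_ineq) auto
  then show ?thesis by (simp add: power2_eq_square algebra_simps)
qed

text \<open>The gradient \<open>p\<close> of the doubling term is bounded by \<open>2 * K\<close>
  uniformly in \<open>h\<close>, and the cut-off \<open>d\<close> is also independent of
  \<open>h\<close>; both are required to let \<open>h\<close> tend to \<open>0\<close>. Inside
  \<open>ball 0 (h\<^sup>2)\<close> the test functions are used, between \<open>h\<^sup>2\<close>
  and \<open>d\<close> the linear bounds that maximality and the Lipschitz estimate imply.\<close>

lemma doubled_inequality:
  assumes A: "1 \<le> A" and \<tau>: "0 < \<tau>" "\<tau> \<le> r / 2" "2 * B < L * (tb - \<tau> - \<tau>)"
    and A\<tau>: "2 * B + 2 * L + K - m0 < A * \<tau>\<^sup>2"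
    and h: "0 < h" "h \<le> \<tau>" "K * h < cc"
  obtains x s y t p where "x \<in> cl" "0 \<le> s" "y \<in> cl" "0 \<le> t" "norm p \<le> 2 * K"
    "dist x y \<le> 2 * h" "A * (norm (y - xb))\<^sup>2 + A * (t - tb)\<^sup>2 \<le> (3 * K + L) * h"
    "m0 - K * h \<le> u (x, s) - v (y, t) - pen L l h (s - t) - \<psi> (y, t)"
    "\<bar>s - t\<bar> \<le> (2 * B + L) / l"
    "\<And>d. h\<^sup>2 \<le> d \<Longrightarrow> d < r / 2 \<Longrightarrow> snd (G (y, t)) + 2 * A * (t - tb) \<le>
      H y (p - fst (G (y, t)) - (2 * A) *\<^sub>R (y - xb)) - H x p
      + nl (- ball 0 d) (\<lambda>y. u (y, s)) x + nl (- ball 0 d) (\<lambda>y. - v (y, t)) y + (K3 + 8 * A * N) * N * d powr (1 - sg)"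
proof -
  have h1: "h \<le> 1" "h < r" "0 \<le> h" using h \<tau> cone by auto
  have K0: "0 < K" using K1 by simp
  obtain x s y t where X: "x \<in> cl" "0 \<le> s" "y \<in> cl" "0 \<le> t" and
    M: "\<And>x' s' y' t'. x' \<in> cl \<Longrightarrow> 0 \<le> s' \<Longrightarrow> y' \<in> cl \<Longrightarrow> 0 \<le> t' \<Longrightarrow>
      u (x', s') - v (y', t') - pen L l h (s' - t') - \<psi> (y', t') - (norm (x' - y' - h *\<^sub>R e))\<^sup>2 / h\<^sup>2
        - A * (norm (y' - xb))\<^sup>2 - A * (t' - tb)\<^sup>2
      \<le> u (x, s) - v (y, t) - pen L l h (s - t) - \<psi> (y, t) - (norm (x - y - h *\<^sub>R e))\<^sup>2 / h\<^sup>2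
        - A * (norm (y - xb))\<^sup>2 - A * (t - tb)\<^sup>2"
    using doubled_maximum[OF A h(1) h1(1)] by blast
  define \<xi> where "\<xi> = x - y - h *\<^sub>R e"
  let ?U = "\<lambda>t. sc L l h t"
  define \<Phi> where "\<Phi> = u (x, s) - v (y, t) - pen L l h (s - t) - \<psi> (y, t) - (norm \<xi>)\<^sup>2 / h\<^sup>2
        - A * (norm (y - xb))\<^sup>2 - A * (t - tb)\<^sup>2"
  have M': "?U t' x' - v (y', t') - \<psi> (y', t') - (norm (x' - y' - h *\<^sub>R e))\<^sup>2 / h\<^sup>2
        - A * (norm (y' - xb))\<^sup>2 - A * (t' - tb)\<^sup>2 \<le> \<Phi>" if "x' \<in> cl" "y' \<in> cl" "0 \<le> t'" for x' y' t'
  proof -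
    note m = that
    obtain s' where s': "0 \<le> s'" "?U t' x' = u (x', s') - pen L l h (s' - t')" using sc_attained[OF lL h1(3) m(1,3)] .
    show ?thesis using M[OF m(1) s'(1) m(2,3)] s'(2) by (simp add: \<Phi>_def \<xi>_def)
  qed
  have nn: "0 \<le> (norm \<xi>)\<^sup>2 / h\<^sup>2" "0 \<le> A * (norm (y - xb))\<^sup>2" "0 \<le> A * (t - tb)\<^sup>2" using A by auto
  have U: "?U t x = u (x, s) - pen L l h (s - t)"
  proof (rule antisym)
    show "u (x, s) - pen L l h (s - t) \<le> ?U t x" by (rule sc_ge[OF lL h1(3) X(1,4,2)])
    show "?U t x \<le> u (x, s) - pen L l h (s - t)" using M'[OF X(1,3,4)] by (simp add: \<Phi>_def \<xi>_def)
  qed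
  have tbh: "2 * B < L * (tb - h)"
  proof -
    have "L * (tb - \<tau> - \<tau>) \<le> L * (tb - h)" using L0 h \<tau>(1) by (intro mult_left_mono) auto
    then show ?thesis using \<tau>(3) by linarith
  qed
  have he: "norm (h *\<^sub>R e) \<le> h" using cone(5) h by (simp add: mult_left_le)
  \<comment> \<open>The competitor is \<open>xb\<close> together with its shift
    \<open>xb + h *\<^sub>R e\<close>, for which the doubling term vanishes; the shift costs
    \<open>K * h\<close> by the Lipschitz bound.\<close>
  have lower: "m0 - K * h \<le> \<Phi>"
  proof -
    have in1: "xb + h *\<^sub>R e \<in> cl"
    proof -
      have "xb + h *\<^sub>R e \<in> ball (xb + h *\<^sub>R e) (cc * h)" using cone(1) h by simp
      then show ?thesis using cone(6)[OF xb _ h(1) h1(2)] cone(3) by (intro Om_cl) (simp add: subsetD)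
    qed
    have "?U tb xb - ?U tb (xb + h *\<^sub>R e) \<le> K * dist xb (xb + h *\<^sub>R e)"
      using lip[OF h1(3,1) tbh xb in1] by simp
    also have "\<dots> \<le> K * h" using he K0 by (simp add: dist_norm)
    finally have 1: "?U tb xb - K * h \<le> ?U tb (xb + h *\<^sub>R e)" by simp
    have 2: "sc L l 0 tb xb \<le> ?U tb xb"
    proof -
      obtain s' where s': "0 \<le> s'" "sc L l 0 tb xb = u (xb, s') - pen L l 0 (s' - tb)"
        using sc_attained[OF lL order_refl xb less_imp_le[OF tb0]] .
      have "u (xb, s') - pen L l h (s' - tb) \<le> ?U tb xb" using sc_ge[OF lL h1(3) xb _ s'(1)] tb0 by simp
      then show ?thesis using s'(2) pen_le_zero(1)[OF lL h1(3), of "s' - tb"] by linarith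
    qed
    show ?thesis using M'[OF in1 xb, of tb] tb0 1 2 by (simp add: m0_def)
  qed
  \<comment> \<open>The hypothesis relating \<open>A\<close> and \<open>\<tau>\<close> confines the
    doubled maximum to distance \<open>\<tau>\<close> from \<open>(xb, tb)\<close> for every
    admissible \<open>h\<close>, not just in the limit.\<close>
  have near: "A * (norm (y - xb))\<^sup>2 < A * \<tau>\<^sup>2" "A * (t - tb)\<^sup>2 < A * \<tau>\<^sup>2"
  proof -
    have "\<bar>u (x, s)\<bar> \<le> B" "\<bar>v (y, t)\<bar> \<le> B" "0 \<le> \<psi> (y, t)" using uB vB chi(2) X by auto
    moreover have "- L * h \<le> pen L l h (s - t)"
    proof -
      have "0 \<le> l * \<bar>s - t\<bar>" using lL by simp
      then show ?thesis using pen_lower[OF lL h1(3), of "s - t"] by linarith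
    qed
    moreover have "L * h \<le> L" "K * h \<le> K" using L0 K0 h1 by (simp_all add: mult_left_le)
    ultimately have "A * (norm (y - xb))\<^sup>2 + A * (t - tb)\<^sup>2 \<le> 2 * B + L + K - m0"
      using lower nn unfolding \<Phi>_def abs_le_iff by linarith
    then show "A * (norm (y - xb))\<^sup>2 < A * \<tau>\<^sup>2" "A * (t - tb)\<^sup>2 < A * \<tau>\<^sup>2" using A\<tau> L0 nn by linarith+
  qed
  have ynear: "norm (y - xb) < \<tau>" using near(1) A \<tau>(1) by (simp add: power2_less_imp_less)
  have tnear: "\<bar>t - tb\<bar> < \<tau>" using near(2) A \<tau>(1) abs_square_less_1 by (metis abs_le_square_iff abs_of_pos less_le_trans mult_less_cancel_left_pos not_less zero_less_one)
  have th: "2 * B < L * (t - h)"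
  proof -
    have "L * (tb - \<tau> - \<tau>) \<le> L * (t - h)" using L0 h tnear by (intro mult_left_mono) auto
    then show ?thesis using \<tau>(3) by linarith
  qed
  have t0: "0 < t" using th L0 B0 h by (smt (verit) mult_nonneg_nonpos)
  have s0: "0 < s" using sc_argmax_pos[OF lL h1(3) X(1,4,2) _ th] U by simp
  note lipt = lip[OF h1(3,1) th]
  have yr: "dist y xb < r" using ynear \<tau>(2) cone by (simp add: dist_norm)
  have ball: "ball (y + h *\<^sub>R e) (cc * h) \<subseteq> Om" by (rule cone(6)[OF X(3) yr h(1) h1(2)])
  moreover have "y + h *\<^sub>R e \<in> ball (y + h *\<^sub>R e) (cc * h)" using cone(1) h by simp
  ultimately have in2: "y + h *\<^sub>R e \<in> cl" by (intro Om_cl) (rule subsetD)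
  \<comment> \<open>Comparison with the exact shift \<open>y + h *\<^sub>R e\<close> of the same
    \<open>y\<close>: a quadratic penalty against a linear gain.\<close>
  have \<xi>: "norm \<xi> \<le> K * h\<^sup>2"
  proof -
    have "?U t (y + h *\<^sub>R e) \<le> ?U t x - (norm \<xi>)\<^sup>2 / h\<^sup>2"
      using M'[OF in2 X(3,4)] U by (simp add: \<Phi>_def)
    moreover have "?U t x - ?U t (y + h *\<^sub>R e) \<le> K * dist x (y + h *\<^sub>R e)" using lipt[OF X(1) in2] by simp
    ultimately have "(norm \<xi>)\<^sup>2 / h\<^sup>2 \<le> K * norm \<xi>" by (simp add: dist_norm \<xi>_def algebra_simps)
    then have "norm \<xi> * norm \<xi> \<le> (K * h\<^sup>2) * norm \<xi>" using h by (simp add: power2_eq_square field_simps)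
    then show ?thesis using K0 by (cases "norm \<xi> = 0") auto
  qed
  have xO: "x \<in> Om"
  proof -
    have "dist (y + h *\<^sub>R e) x = norm \<xi>" by (simp add: dist_norm \<xi>_def norm_minus_commute algebra_simps)
    also have "\<dots> \<le> (K * h) * h" using \<xi> by (simp add: power2_eq_square)
    also have "\<dots> < cc * h" using h by (intro mult_strict_right_mono) auto
    finally show ?thesis using ball by auto
  qed
  have Kh1: "K * h\<^sup>2 \<le> h"
  proof -
    have "(K * h) * h \<le> 1 * h" using h cone by (intro mult_right_mono) auto
    then show ?thesis by (simp add: power2_eq_square)
  qed
  have dxy: "dist x y \<le> 2 * h"
  proof -
    have "x - y = \<xi> + h *\<^sub>R e" by (simp add: \<xi>_def)
    then show ?thesis using norm_triangle_ineq[of \<xi> "h *\<^sub>R e"] he \<xi> Kh1 by (simp add: dist_norm)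
  qed
  define p where "p = (2 / h\<^sup>2) *\<^sub>R \<xi>"
  have p: "norm p \<le> 2 * K" using \<xi> h by (simp add: p_def field_simps)
  have upper: "A * (norm (y - xb))\<^sup>2 + A * (t - tb)\<^sup>2 \<le> (3 * K + L) * h"
  proof -
    have "?U t x \<le> ?U t y + K * dist x y" using lipt[OF X(1,3)] by simp
    moreover have "K * dist x y \<le> K * (2 * h)" using dxy K0 by (intro mult_left_mono) auto
    moreover have "?U t y \<le> sc L l 0 t y + L * h"
    proof -
      obtain s' where s': "0 \<le> s'" "?U t y = u (y, s') - pen L l h (s' - t)" using sc_attained[OF lL h1(3) X(3,4)] .
      then show ?thesis using sc_ge[OF lL order_refl X(3,4) s'(1)] pen_le_zero(2)[OF lL h1(3), of "s' - t"] by linarith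
    qed
    moreover have "sc L l 0 t y - v (y, t) - \<psi> (y, t) \<le> m0" using mx[OF X(3,4)] by (simp add: m0_def)
    ultimately have "A * (norm (y - xb))\<^sup>2 + A * (t - tb)\<^sup>2 \<le> K * h + (K * (2 * h) + L * h)"
      using lower nn(1) U unfolding \<Phi>_def by linarith
    then show ?thesis by (simp add: algebra_simps)
  qed
  \<comment> \<open>\<open>s\<close> is an argmax of the sup-convolution at \<open>x\<close>, so it
    cannot move far from \<open>t\<close>. This keeps the argmax times bounded in the limit.\<close>
  have st: "\<bar>s - t\<bar> \<le> (2 * B + L) / l"
  proof -
    have "\<bar>s - t\<bar> \<le> (2 * B + L * h + 0) / l" by (rule sc_argmax_bound[OF lL h1(3) X(1,4,2)]) (use U in simp)
    also have "\<dots> \<le> (2 * B + L) / l" using lL L0 h1 by (intro divide_right_mono) (auto simp: mult_left_le)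
    finally show ?thesis .
  qed
  have h2: "0 < h\<^sup>2" "h\<^sup>2 \<noteq> 0" using h by auto
  have d\<rho>: "((\<lambda>s. pen L l h (s - t)) has_real_derivative pen' L l h (s - t)) (at s)" for s t
  proof -
    have "((\<lambda>s. s - t) has_real_derivative 1) (at s)" by (auto intro!: derivative_eq_intros)
    from DERIV_chain2[OF pen_deriv[OF h(1), of L l] this] show ?thesis by simp
  qed
  have d\<rho>2: "((\<lambda>t. pen L l h (s - t)) has_real_derivative - pen' L l h (s - t)) (at t)" for s t
  proof -
    have "((\<lambda>t. s - t) has_real_derivative - 1) (at t)" by (auto intro!: derivative_eq_intros)
    from DERIV_chain2[OF pen_deriv[OF h(1), of L l] this] show ?thesis by simp
  qed
  have c\<rho>: "continuous_on UNIV (\<lambda>s. pen' L l h (s - t))" "continuous_on UNIV (\<lambda>t. - pen' L l h (s - t))" for s t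
    by (intro continuous_on_minus continuous_on_compose2[OF pen'_continuous[OF h(1)]] continuous_intros; simp)+
  let ?f = "\<lambda>q. 1 / h\<^sup>2 * (norm (fst q - (y + h *\<^sub>R e)))\<^sup>2 + pen L l h (snd q - t)"
  let ?Gf = "\<lambda>q. ((2 * (1 / h\<^sup>2)) *\<^sub>R (fst q - (y + h *\<^sub>R e)), 0 * (norm (fst q - (y + h *\<^sub>R e)))\<^sup>2 + pen' L l h (snd q - t))"
  have Gf: "has_C1_gradient (cl \<times> {0..}) ?f ?Gf"
    by (rule C1_gradient_time_paraboloid[OF _ _ d\<rho> c\<rho>(1)]) auto
  have \<xi>e: "x - (y + h *\<^sub>R e) = \<xi>" by (simp add: \<xi>_def)
  have sub0: "pen' L l h (s - t) + H x p - c \<le> nl (ball 0 (h\<^sup>2)) (\<lambda>y. ?f (y, s)) x + nl (- ball 0 (h\<^sup>2)) (\<lambda>y. u (y, s)) x"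
  proof -
    have "u q - ?f q \<le> u (x, s) - ?f (x, s)" if q: "q \<in> cl \<times> {0..}" for q
    proof -
      obtain x' s' where q': "q = (x', s')" "x' \<in> cl" "0 \<le> s'" using q by auto
      show ?thesis using M[OF q'(2,3) X(3,4)] by (simp add: q' diff_diff_eq[symmetric])
    qed
    from sub_test[OF Gf xO s0 h2(1) this] show ?thesis unfolding fst_conv snd_conv \<xi>e by (simp add: p_def)
  qed
  \<comment> \<open>For \<open>norm z < h\<^sup>2\<close> the paraboloid of opening
    \<open>1 / h\<^sup>2\<close> grows linearly, with a rate that no longer contains
    \<open>h\<close>.\<close>
  have sub1: "nl (ball 0 (h\<^sup>2)) (\<lambda>y. ?f (y, s)) x \<le> (2 * K + 1) * N * (h\<^sup>2) powr (1 - sg)"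
  proof (rule nonlocal_ball_upper[OF X(1) h2(1)])
    show "h\<^sup>2 < 1" using h1 h cone by (simp add: power_less_one_iff)
    fix z :: 'a assume z: "norm z < h\<^sup>2"
    have "(norm (\<xi> + z))\<^sup>2 - (norm \<xi>)\<^sup>2 \<le> (2 * norm \<xi> + norm z) * norm z" using sq_increment[of \<xi> z] by simp
    also have "\<dots> \<le> ((2 * K + 1) * h\<^sup>2) * norm z" using \<xi> z by (intro mult_right_mono) (auto simp: algebra_simps)
    finally have "1 / h\<^sup>2 * ((norm (\<xi> + z))\<^sup>2 - (norm \<xi>)\<^sup>2) \<le> 1 / h\<^sup>2 * (((2 * K + 1) * h\<^sup>2) * norm z)"
      by (rule mult_left_mono) auto
    also have "\<dots> = (2 * K + 1) * norm z" using h by simp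
    finally show "?f (x + z, s) - ?f (x, s) \<le> (2 * K + 1) * norm z"
      unfolding fst_conv snd_conv \<xi>e[symmetric] by (simp add: algebra_simps)
  qed (use K0 in simp)
  let ?g1 = "\<lambda>q. 1 / h\<^sup>2 * (norm (fst q - (x - h *\<^sub>R e)))\<^sup>2 + pen L l h (s - snd q)"
  let ?G1 = "\<lambda>q. ((2 * (1 / h\<^sup>2)) *\<^sub>R (fst q - (x - h *\<^sub>R e)), 0 * (norm (fst q - (x - h *\<^sub>R e)))\<^sup>2 + - pen' L l h (s - snd q))"
  let ?g2 = "\<lambda>q. A * (norm (fst q - xb))\<^sup>2 + A * (snd q - tb)\<^sup>2"
  let ?G2 = "\<lambda>q. ((2 * A) *\<^sub>R (fst q - xb), 0 * (norm (fst q - xb))\<^sup>2 + 2 * A * (snd q - tb))"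
  let ?g = "\<lambda>q. - (\<psi> q + (?g1 q + ?g2 q))"
  let ?Gg = "\<lambda>q. - (G q + (?G1 q + ?G2 q))"
  have Gg: "has_C1_gradient (cl \<times> {0..}) ?g ?Gg"
  proof (intro C1_gradient_minus C1_gradient_add chi(1))
    show "has_C1_gradient (cl \<times> {0..}) ?g1 ?G1"
      by (rule C1_gradient_time_paraboloid[OF _ _ d\<rho>2 c\<rho>(2)]) auto
    show "has_C1_gradient (cl \<times> {0..}) ?g2 ?G2"
      by (rule C1_gradient_time_paraboloid) (auto intro!: derivative_eq_intros continuous_intros)
  qed
  have \<xi>m: "y - (x - h *\<^sub>R e) = - \<xi>" by (simp add: \<xi>_def)
  have sup0: "pen' L l h (s - t) - snd (G (y, t)) - 2 * A * (t - tb) + H y (p - fst (G (y, t)) - (2 * A) *\<^sub>R (y - xb)) - c \<ge>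
    nl (ball 0 (h\<^sup>2)) (\<lambda>y. ?g (y, t)) y + nl (- ball 0 (h\<^sup>2)) (\<lambda>y. v (y, t)) y"
  proof -
    have "v q - ?g q \<ge> v (y, t) - ?g (y, t)" if q: "q \<in> cl \<times> {0..}" for q
    proof -
      obtain y' t' where q': "q = (y', t')" "y' \<in> cl" "0 \<le> t'" using q by auto
      have nm: "norm (y' - (x - h *\<^sub>R e)) = norm (x - y' - h *\<^sub>R e)" for y'
        using norm_minus_cancel[of "x - y' - h *\<^sub>R e"] by (simp add: algebra_simps)
      show ?thesis using M[OF X(1,2) q'(2,3)] unfolding q' fst_conv snd_conv nm by simp
    qed
    from super_test[OF Gg X(3) t0 h2(1) this] show ?thesis
      unfolding fst_conv snd_conv \<xi>m by (simp add: p_def algebra_simps)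
  qed
  have yN: "norm (y - xb) \<le> N" using diam[OF X(3) xb] by (simp add: dist_norm)
  have qN: "(norm (y + z - xb))\<^sup>2 - (norm (y - xb))\<^sup>2 \<le> 3 * N * norm z" if "y + z \<in> cl" for z
  proof -
    have zN: "norm z \<le> N" using diam[OF that X(3)] by (simp add: dist_norm)
    have "(norm (y + z - xb))\<^sup>2 - (norm (y - xb))\<^sup>2 \<le> (2 * norm (y - xb) + norm z) * norm z"
      using sq_increment[of "y - xb" z] by (simp add: algebra_simps)
    also have "\<dots> \<le> (3 * N) * norm z" using yN zN by (intro mult_right_mono) auto
    finally show ?thesis .
  qed
  have sup1: "nl (ball 0 (h\<^sup>2)) (\<lambda>y. - ?g (y, t)) y \<le> (Kx + (2 * K + 1) + 3 * A * N) * N * (h\<^sup>2) powr (1 - sg)"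
  proof (rule nonlocal_ball_upper[OF X(3) h2(1)])
    show "h\<^sup>2 < 1" using h1 h cone by (simp add: power_less_one_iff)
    fix z :: 'a assume z: "norm z < h\<^sup>2" and yz: "y + z \<in> cl"
    have "(norm (- \<xi> + z))\<^sup>2 - (norm \<xi>)\<^sup>2 \<le> (2 * norm \<xi> + norm z) * norm z" using sq_increment[of "- \<xi>" z] by simp
    also have "\<dots> \<le> ((2 * K + 1) * h\<^sup>2) * norm z" using \<xi> z by (intro mult_right_mono) (auto simp: algebra_simps)
    finally have "1 / h\<^sup>2 * ((norm (- \<xi> + z))\<^sup>2 - (norm \<xi>)\<^sup>2) \<le> 1 / h\<^sup>2 * (((2 * K + 1) * h\<^sup>2) * norm z)"
      by (rule mult_left_mono) auto
    also have "\<dots> = (2 * K + 1) * norm z" using h by simp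
    finally have 1: "1 / h\<^sup>2 * (norm (- \<xi> + z))\<^sup>2 - 1 / h\<^sup>2 * (norm (- \<xi>))\<^sup>2 \<le> (2 * K + 1) * norm z"
      by (simp add: right_diff_distrib)
    have 2: "\<psi> (y + z, t) - \<psi> (y, t) \<le> Kx * norm z" using chi(4)[OF yz X(3,4)] by (simp add: dist_norm)
    have "A * ((norm (y + z - xb))\<^sup>2 - (norm (y - xb))\<^sup>2) \<le> A * (3 * N * norm z)"
      using qN[OF yz] A by (intro mult_left_mono) auto
    then have 3: "A * (norm (y + z - xb))\<^sup>2 - A * (norm (y - xb))\<^sup>2 \<le> 3 * A * N * norm z" by (simp add: algebra_simps)
    have e1: "y + z - (x - h *\<^sub>R e) = - \<xi> + z" by (simp add: \<xi>_def)
    show "- ?g (y + z, t) - - ?g (y, t) \<le> (Kx + (2 * K + 1) + 3 * A * N) * norm z"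
      unfolding fst_conv snd_conv e1 \<xi>m using 1 2 3 by (simp add: distrib_right)
  qed (use K0 chi A N1 in simp)
  have fin: "snd (G (y, t)) + 2 * A * (t - tb) \<le>
      H y (p - fst (G (y, t)) - (2 * A) *\<^sub>R (y - xb)) - H x p
      + nl (- ball 0 d) (\<lambda>y. u (y, s)) x + nl (- ball 0 d) (\<lambda>y. - v (y, t)) y + (K3 + 8 * A * N) * N * d powr (1 - sg)"
    if d: "h\<^sup>2 \<le> d" "d < r / 2" for d
  proof -
    have d0: "0 < d" "d < 1" using d h2 cone by linarith+
    have dp: "(h\<^sup>2) powr (1 - sg) \<le> d powr (1 - sg)" using d h2 sg by (intro powr_mono2) auto
    have sub2: "nl (- ball 0 (h\<^sup>2)) (\<lambda>y. u (y, s)) x \<le> nl (- ball 0 d) (\<lambda>y. u (y, s)) x + K * N * d powr (1 - sg)"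
    proof (rule nonlocal_tail_upper[OF u_tame[OF X(2)] X(1) h2(1) d(1) d0(2)])
      fix z assume xz: "x + z \<in> cl"
      have "u (x + z, s) - u (x, s) \<le> ?U t (x + z) - ?U t x"
        using sc_ge[OF lL h1(3) xz X(4,2)] U by simp
      also have "\<dots> \<le> K * norm z" using lipt[OF xz X(1)] by (simp add: dist_norm abs_le_iff)
      finally show "u (x + z, s) - u (x, s) \<le> K * norm z" .
    qed (use K0 in simp)
    \<comment> \<open>There is no Lipschitz bound for \<open>v\<close>. Instead the pair
      \<open>y + z\<close> and its exact shift competes with the maximum; the shift moves
      \<open>x\<close> by at most \<open>norm \<xi> + norm z\<close>, and \<open>norm \<xi>\<close>
      is at most \<open>K * norm z\<close> because \<open>norm z\<close> is at least
      \<open>h\<^sup>2\<close>.\<close>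
    have sup2: "nl (- ball 0 (h\<^sup>2)) (\<lambda>y. - v (y, t)) y \<le> nl (- ball 0 d) (\<lambda>y. - v (y, t)) y + (K + K * K + Kx + 3 * A * N) * N * d powr (1 - sg)"
    proof (rule nonlocal_tail_upper[OF v_tame[OF X(4)] X(3) h2(1) d(1) d0(2)])
      fix z assume z: "h\<^sup>2 \<le> norm z" "norm z < d" and yz: "y + z \<in> cl"
      have "dist (y + z) xb \<le> norm (y - xb) + norm z" using norm_triangle_ineq[of "y - xb" z] by (simp add: dist_norm algebra_simps)
      then have "dist (y + z) xb < r" using ynear \<tau>(2) z d by simp
      from cone(6)[OF yz this h(1) h1(2)] have "ball (y + z + h *\<^sub>R e) (cc * h) \<subseteq> Om" .
      moreover have "y + z + h *\<^sub>R e \<in> ball (y + z + h *\<^sub>R e) (cc * h)" using cone(1) h by simp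
      ultimately have in3: "y + z + h *\<^sub>R e \<in> cl" by (intro Om_cl) (rule subsetD)
      have 1: "?U t (y + z + h *\<^sub>R e) - v (y + z, t) - \<psi> (y + z, t) - A * (norm (y + z - xb))\<^sup>2 \<le>
        ?U t x - v (y, t) - \<psi> (y, t) - A * (norm (y - xb))\<^sup>2"
      proof -
        have zz: "(norm (y + z + h *\<^sub>R e - (y + z) - h *\<^sub>R e))\<^sup>2 / h\<^sup>2 = 0" by simp
        have "0 \<le> A * (t - tb)\<^sup>2" by (rule nn(3))
        then show ?thesis using M'[OF in3 yz X(4)] nn(1) U unfolding \<Phi>_def zz by linarith
      qed
      have "?U t x - ?U t (y + z + h *\<^sub>R e) \<le> K * dist x (y + z + h *\<^sub>R e)" using lipt[OF X(1) in3] by simp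
      moreover have "K * dist x (y + z + h *\<^sub>R e) \<le> K * (K * norm z + norm z)"
      proof (rule mult_left_mono)
        have xe: "x - (y + z + h *\<^sub>R e) = \<xi> - z" by (simp add: \<xi>_def)
        have "K * h\<^sup>2 \<le> K * norm z" using z(1) K0 by (intro mult_left_mono) auto
        then show "dist x (y + z + h *\<^sub>R e) \<le> K * norm z + norm z"
          using norm_triangle_ineq4[of \<xi> z] \<xi> unfolding dist_norm xe by linarith
      qed (use K0 in simp)
      ultimately have "?U t x - ?U t (y + z + h *\<^sub>R e) \<le> K * (K * norm z + norm z)" by linarith
      then have 2: "?U t x - ?U t (y + z + h *\<^sub>R e) \<le> (K + K * K) * norm z" by (simp add: algebra_simps)
      have 3: "\<psi> (y + z, t) - \<psi> (y, t) \<le> Kx * norm z" using chi(4)[OF yz X(3,4)] by (simp add: dist_norm)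
      have "A * ((norm (y + z - xb))\<^sup>2 - (norm (y - xb))\<^sup>2) \<le> A * (3 * N * norm z)"
        using qN[OF yz] A by (intro mult_left_mono) auto
      then have 4: "A * (norm (y + z - xb))\<^sup>2 - A * (norm (y - xb))\<^sup>2 \<le> 3 * A * N * norm z" by (simp add: algebra_simps)
      show "- v (y + z, t) - - v (y, t) \<le> (K + K * K + Kx + 3 * A * N) * norm z"
        using 1 2 3 4 by (simp add: distrib_right)
    qed (use K0 chi A N1 in simp)
    have nm1: "nl (ball 0 (h\<^sup>2)) (\<lambda>y. - ?g (y, t)) y = - nl (ball 0 (h\<^sup>2)) (\<lambda>y. ?g (y, t)) y" by (rule nonlocal_minus)
    have nm2: "nl (- ball 0 (h\<^sup>2)) (\<lambda>y. - v (y, t)) y = - nl (- ball 0 (h\<^sup>2)) (\<lambda>y. v (y, t)) y" by (rule nonlocal_minus)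
    define D where "D = N * d powr (1 - sg)"
    have b1: "(2 * K + 1) * N * (h\<^sup>2) powr (1 - sg) \<le> (2 * K + 1) * D"
      unfolding D_def mult.assoc using dp K0 N1 by (intro mult_left_mono) auto
    have b2: "(Kx + (2 * K + 1) + 3 * A * N) * N * (h\<^sup>2) powr (1 - sg) \<le> (Kx + (2 * K + 1) + 3 * A * N) * D"
      unfolding D_def mult.assoc using dp K0 chi(3) A N1 by (intro mult_left_mono) auto
    have b3: "(2 * K + 1) * D + (Kx + (2 * K + 1) + 3 * A * N) * D + K * D + (K + K * K + Kx + 3 * A * N) * D
      \<le> (K3 + 8 * A * N) * D"
    proof -
      have "2 * K + 1 + (Kx + (2 * K + 1) + 3 * A * N) + K + (K + K * K + Kx + 3 * A * N) \<le> K3 + 8 * A * N"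
        using K0 A N1 chi(3) by (simp add: K3_def)
      then show ?thesis unfolding distrib_right[symmetric] by (rule mult_right_mono) (use N1 in \<open>simp add: D_def\<close>)
    qed
    show ?thesis
      using sub0 sub1 sub2 sup0 sup1 sup2 nm1 nm2 b1 b2 b3 unfolding D_def mult.assoc by linarith
  qed
  have low2: "m0 - K * h \<le> u (x, s) - v (y, t) - pen L l h (s - t) - \<psi> (y, t)"
    using lower nn unfolding \<Phi>_def by linarith
  show ?thesis by (rule that[OF X p dxy upper low2 st fin])
qed

end


section \<open>Passage to the limit in the doubled inequality\<close>

context touching
begin

text \<open>\<open>A\<close> stays fixed while \<open>h\<close> tends to \<open>0\<close>: the terms
  with \<open>A\<close> disappear from the gradient and the time derivative, since the doubled
  points converge to \<open>(xb, tb)\<close>, and survive only in the error, which is small with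
  \<open>d\<close>. Gradients and argmax times converge along a subsequence by their uniform
  bounds.\<close>

lemma touching_inequality:
  assumes A: "1 \<le> A" and \<tau>: "0 < \<tau>" "\<tau> \<le> r / 2" "2 * B < L * (tb - \<tau> - \<tau>)"
    and A\<tau>: "2 * B + 2 * L + K - m0 < A * \<tau>\<^sup>2"
  obtains p s where "norm p \<le> 2 * K" "0 \<le> s" "sc L l 0 tb xb = u (xb, s) - pen L l 0 (s - tb)"
    "\<And>d. 0 < d \<Longrightarrow> d < r / 2 \<Longrightarrow> snd (G (xb, tb)) \<le> H xb (p - fst (G (xb, tb))) - H xb p
      + nl (- ball 0 d) (\<lambda>y. u (y, s)) xb + nl (- ball 0 d) (\<lambda>y. - v (y, tb)) xb + (K3 + 8 * A * N) * N * d powr (1 - sg)"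
proof -
  have K0: "0 < K" using K1 by simp
  \<comment> \<open>Keeps every \<open>h n\<close> admissible for the doubled inequality.\<close>
  define h0 where "h0 = min \<tau> (cc / (2 * K))"
  have h0: "0 < h0" "h0 \<le> \<tau>" using \<tau> cone K0 by (auto simp: h0_def)
  have h0K: "K * h0 < cc"
  proof -
    have "K * h0 \<le> K * (cc / (2 * K))" using K0 by (intro mult_left_mono) (auto simp: h0_def)
    also have "\<dots> = cc / 2" using K0 by simp
    finally show ?thesis using cone by simp
  qed
  define h where "h n = h0 * inverse (real (Suc n))" for n
  have h: "0 < h n" "h n \<le> h0" for n
  proof -
    show "0 < h n" using h0 by (simp add: h_def)
    have "inverse (real (Suc n)) \<le> 1" by (simp add: inverse_eq_divide)
    then show "h n \<le> h0" using h0 by (simp add: h_def mult_left_le)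
  qed
  have hlim: "h \<longlonglongrightarrow> 0" unfolding h_def using tendsto_mult_right_zero[OF LIMSEQ_inverse_real_of_nat] by simp
  define Good where "Good n x s y t p \<longleftrightarrow> x \<in> cl \<and> 0 \<le> s \<and> y \<in> cl \<and> 0 \<le> t \<and> norm p \<le> 2 * K \<and>
    dist x y \<le> 2 * h n \<and> A * (norm (y - xb))\<^sup>2 + A * (t - tb)\<^sup>2 \<le> (3 * K + L) * h n \<and>
    m0 - K * h n \<le> u (x, s) - v (y, t) - pen L l (h n) (s - t) - \<psi> (y, t) \<and>
    \<bar>s - t\<bar> \<le> (2 * B + L) / l \<and>
    (\<forall>d. (h n)\<^sup>2 \<le> d \<longrightarrow> d < r / 2 \<longrightarrow> snd (G (y, t)) + 2 * A * (t - tb) \<le>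
      H y (p - fst (G (y, t)) - (2 * A) *\<^sub>R (y - xb)) - H x p
      + nl (- ball 0 d) (\<lambda>y. u (y, s)) x + nl (- ball 0 d) (\<lambda>y. - v (y, t)) y + (K3 + 8 * A * N) * N * d powr (1 - sg))"
    for n x s y t p
  have "\<exists>w. Good n (fst w) (fst (snd w)) (fst (snd (snd w))) (fst (snd (snd (snd w)))) (snd (snd (snd (snd w))))" for n
  proof -
    have "K * h n \<le> K * h0" using h[of n] K0 by (intro mult_left_mono) auto
    then have hn: "0 < h n" "h n \<le> \<tau>" "K * h n < cc" using h[of n] h0 h0K by auto
    obtain x s y t p where "Good n x s y t p"
      unfolding Good_def by (rule doubled_inequality[OF A \<tau> A\<tau> hn]) blast
    then show ?thesis by (intro exI[of _ "(x, s, y, t, p)"]) simp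
  qed
  then have "\<exists>W. \<forall>n. Good n (fst (W n)) (fst (snd (W n))) (fst (snd (snd (W n)))) (fst (snd (snd (snd (W n))))) (snd (snd (snd (snd (W n)))))"
    by (intro choice allI)
  then obtain W where W: "\<And>n. Good n (fst (W n)) (fst (snd (W n))) (fst (snd (snd (W n)))) (fst (snd (snd (snd (W n))))) (snd (snd (snd (snd (W n)))))"
    by blast
  define X where "X n = fst (W n)" for n
  define S where "S n = fst (snd (W n))" for n
  define Y where "Y n = fst (snd (snd (W n)))" for n
  define T where "T n = fst (snd (snd (snd (W n))))" for n
  define P where "P n = snd (snd (snd (snd (W n))))" for n
  have g: "Good n (X n) (S n) (Y n) (T n) (P n)" for n using W[of n] by (simp add: X_def S_def Y_def T_def P_def)
  have XY: "X n \<in> cl" "0 \<le> S n" "Y n \<in> cl" "0 \<le> T n" "norm (P n) \<le> 2 * K" "dist (X n) (Y n) \<le> 2 * h n"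
    "\<bar>S n - T n\<bar> \<le> (2 * B + L) / l"
    "m0 - K * h n \<le> u (X n, S n) - v (Y n, T n) - pen L l (h n) (S n - T n) - \<psi> (Y n, T n)" for n
    using g[of n] unfolding Good_def by auto
  have ineq: "snd (G (Y n, T n)) + 2 * A * (T n - tb) \<le>
      H (Y n) (P n - fst (G (Y n, T n)) - (2 * A) *\<^sub>R (Y n - xb)) - H (X n) (P n)
      + nl (- ball 0 d) (\<lambda>y. u (y, S n)) (X n) + nl (- ball 0 d) (\<lambda>y. - v (y, T n)) (Y n) + (K3 + 8 * A * N) * N * d powr (1 - sg)"
    if "(h n)\<^sup>2 \<le> d" "d < r / 2" for n d
    using g[of n] that unfolding Good_def by blast
  have sqb: "norm (Y n - xb) \<le> sqrt ((3 * K + L) * h n)" "\<bar>T n - tb\<bar> \<le> sqrt ((3 * K + L) * h n)" for n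
  proof -
    have s: "A * (norm (Y n - xb))\<^sup>2 + A * (T n - tb)\<^sup>2 \<le> (3 * K + L) * h n" using g[of n] unfolding Good_def by blast
    have "1 * (norm (Y n - xb))\<^sup>2 \<le> A * (norm (Y n - xb))\<^sup>2" "1 * (T n - tb)\<^sup>2 \<le> A * (T n - tb)\<^sup>2"
      using A by (intro mult_right_mono; simp)+
    then have "(norm (Y n - xb))\<^sup>2 \<le> (3 * K + L) * h n" "(T n - tb)\<^sup>2 \<le> (3 * K + L) * h n"
      using s zero_le_power2[of "norm (Y n - xb)"] zero_le_power2[of "T n - tb"] by linarith+
    then show "norm (Y n - xb) \<le> sqrt ((3 * K + L) * h n)" "\<bar>T n - tb\<bar> \<le> sqrt ((3 * K + L) * h n)"
      by (auto intro: real_le_rsqrt)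
  qed
  have "(\<lambda>n. sqrt ((3 * K + L) * h n)) \<longlonglongrightarrow> sqrt ((3 * K + L) * 0)" by (intro tendsto_intros hlim)
  then have sq0: "(\<lambda>n. sqrt ((3 * K + L) * h n)) \<longlonglongrightarrow> 0" by simp
  have Yl: "Y \<longlonglongrightarrow> xb"
    by (rule LIM_zero_cancel, rule Lim_transform_bound[OF _ sq0])
      (intro always_eventually allI, unfold real_norm_def, rule order_trans[OF sqb(1) abs_ge_self])
  have Tl: "T \<longlonglongrightarrow> tb"
    by (rule LIM_zero_cancel, rule Lim_transform_bound[OF _ sq0])
      (intro always_eventually allI, unfold real_norm_def, rule order_trans[OF sqb(2) abs_ge_self])
  have XY0: "(\<lambda>n. X n - Y n) \<longlonglongrightarrow> 0"
  proof (rule Lim_transform_bound[where g = "\<lambda>n. 2 * h n"])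
    show "(\<lambda>n. 2 * h n) \<longlonglongrightarrow> 0" using tendsto_mult_right_zero[OF hlim] by simp
    show "\<forall>\<^sub>F n in sequentially. norm (X n - Y n) \<le> norm (2 * h n)"
      using XY(6) h by (intro always_eventually allI) (simp add: dist_norm abs_of_pos)
  qed
  have Xl: "X \<longlonglongrightarrow> xb" using tendsto_add[OF XY0 Yl] by simp
  have "bounded (range (\<lambda>n. (P n, S n)))"
  proof -
    obtain M where M: "\<And>n. \<bar>T n\<bar> \<le> M" using convergent_imp_Bseq[OF convergentI[OF Tl]] by (auto simp: Bseq_def)
    have "(P n, S n) \<in> cball 0 (2 * K) \<times> cball 0 (M + (2 * B + L) / l)" for n
      using XY(5)[of n] XY(7)[of n] M[of n] by auto
    then have "range (\<lambda>n. (P n, S n)) \<subseteq> cball 0 (2 * K) \<times> cball 0 (M + (2 * B + L) / l)" by blast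
    then show ?thesis by (rule bounded_subset[OF bounded_Times[OF bounded_cball bounded_cball]])
  qed
  then obtain w f where f: "strict_mono f" "((\<lambda>n. (P n, S n)) \<circ> f) \<longlonglongrightarrow> w"
    using bounded_imp_convergent_subsequence by blast
  obtain p s where w: "w = (p, s)" by (cases w)
  have Pf: "(\<lambda>n. P (f n)) \<longlonglongrightarrow> p" and Sf: "(\<lambda>n. S (f n)) \<longlonglongrightarrow> s"
    using tendsto_fst[OF f(2)] tendsto_snd[OF f(2)] by (auto simp: o_def w)
  have Xf: "(\<lambda>n. X (f n)) \<longlonglongrightarrow> xb" and Yf: "(\<lambda>n. Y (f n)) \<longlonglongrightarrow> xb" and Tf: "(\<lambda>n. T (f n)) \<longlonglongrightarrow> tb"
    and hf: "(\<lambda>n. h (f n)) \<longlonglongrightarrow> 0"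
    using LIMSEQ_subseq_LIMSEQ[OF Xl f(1)] LIMSEQ_subseq_LIMSEQ[OF Yl f(1)] LIMSEQ_subseq_LIMSEQ[OF Tl f(1)]
      LIMSEQ_subseq_LIMSEQ[OF hlim f(1)] by (auto simp: o_def)
  have s0: "0 \<le> s" using Sf XY(2) by (intro LIMSEQ_le_const) auto
  have pK: "norm p \<le> 2 * K" using tendsto_norm[OF Pf] XY(5) by (intro LIMSEQ_le_const2) auto
  have YT: "(\<lambda>n. (Y (f n), T (f n))) \<longlonglongrightarrow> (xb, tb)" and XS: "(\<lambda>n. (X (f n), S (f n))) \<longlonglongrightarrow> (xb, s)"
    by (intro tendsto_Pair Xf Yf Tf Sf)+
  have tb': "0 \<le> tb" using tb0 by simp
  have YTin: "\<forall>\<^sub>F n in sequentially. (Y (f n), T (f n)) \<in> cl \<times> {0..}" using XY by (intro always_eventually) auto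
  have psil: "(\<lambda>n. \<psi> (Y (f n), T (f n))) \<longlonglongrightarrow> \<psi> (xb, tb)"
    by (rule continuous_on_tendsto_compose[OF chi_continuous YT _ YTin]) (use xb tb' in auto)
  have cG: "continuous_on (cl \<times> {0..}) G" using chi(1) by (simp add: has_C1_gradient_def)
  have Gl: "(\<lambda>n. G (Y (f n), T (f n))) \<longlonglongrightarrow> G (xb, tb)"
    by (rule continuous_on_tendsto_compose[OF cG YT _ YTin]) (use xb tb' in auto)
  have penl: "(\<lambda>n. pen L l (h (f n)) (S (f n) - T (f n))) \<longlonglongrightarrow> pen L l 0 (s - tb)"
    unfolding pen_def by (intro tendsto_intros Sf Tf hf) simp_all
  define a where "a n = m0 - K * h (f n) + pen L l (h (f n)) (S (f n) - T (f n)) + \<psi> (Y (f n), T (f n))" for n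
  have al: "a \<longlonglongrightarrow> m0 - K * 0 + pen L l 0 (s - tb) + \<psi> (xb, tb)"
    unfolding a_def by (intro tendsto_intros hf penl psil)
  define a0 where "a0 = sc L l 0 tb xb + pen L l 0 (s - tb)"
  have al': "a \<longlonglongrightarrow> a0 - v (xb, tb)" using al unfolding m0_def a0_def by (simp add: algebra_simps)
  have uv: "a n \<le> u (X (f n), S (f n)) - v (Y (f n), T (f n))" for n using XY(8)[of "f n"] by (simp add: a_def)
  have evu: "\<forall>\<^sub>F n in sequentially. u (X (f n), S (f n)) < u (xb, s) + \<epsilon>" if "0 < \<epsilon>" for \<epsilon>
    by (rule usc_on_sequentially[OF uusc _ XS]) (use that xb s0 XY in auto)
  have evv: "\<forall>\<^sub>F n in sequentially. - v (Y (f n), T (f n)) < - v (xb, tb) + \<epsilon>" if "0 < \<epsilon>" for \<epsilon>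
    by (rule usc_on_sequentially[OF vlsc _ YT]) (use that xb tb' XY in auto)
  have eva: "\<forall>\<^sub>F n in sequentially. a0 - v (xb, tb) - \<epsilon> < a n" if "0 < \<epsilon>" for \<epsilon>
    by (rule order_tendstoD(1)[OF al']) (use that in simp)
  have ua: "u (xb, s) \<le> a0" using sc_ge[OF lL order_refl xb tb' s0] by (simp add: a0_def)
  \<comment> \<open>The doubled maximum does not drop below \<open>m0\<close> in the limit, so the
    limit time \<open>s\<close> is again an argmax.\<close>
  have au: "a0 \<le> u (xb, s)"
  proof (rule field_le_epsilon)
    fix \<epsilon> :: real assume "0 < \<epsilon>"
    then have e: "0 < \<epsilon> / 3" by simp
    have "\<forall>\<^sub>F n in sequentially. a0 \<le> u (xb, s) + \<epsilon>"
      using evu[OF e] evv[OF e] eva[OF e]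
    proof eventually_elim
      case (elim n) then show ?case using uv[of n] by linarith
    qed
    then show "a0 \<le> u (xb, s) + \<epsilon>" by simp
  qed
  \<comment> \<open>Semicontinuity bounds the limits of \<open>u\<close> and \<open>- v\<close> from
    above, while their sum is bounded below; so neither can lose value. This convergence is a
    hypothesis of the limsup estimate for tails.\<close>
  have ul: "(\<lambda>n. u (X (f n), S (f n))) \<longlonglongrightarrow> u (xb, s)"
  proof (rule order_tendstoI)
    fix b assume "u (xb, s) < b" then show "\<forall>\<^sub>F n in sequentially. u (X (f n), S (f n)) < b" using evu[of "b - u (xb, s)"] by simp
  next
    fix b assume "b < u (xb, s)"
    then have e: "0 < (u (xb, s) - b) / 2" by simp
    show "\<forall>\<^sub>F n in sequentially. b < u (X (f n), S (f n))"
      using evv[OF e] eva[OF e]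
    proof eventually_elim
      case (elim n) then show ?case using uv[of n] ua by (simp add: field_simps)
    qed
  qed
  have vl: "(\<lambda>n. - v (Y (f n), T (f n))) \<longlonglongrightarrow> - v (xb, tb)"
  proof (rule order_tendstoI)
    fix b assume "- v (xb, tb) < b" then show "\<forall>\<^sub>F n in sequentially. - v (Y (f n), T (f n)) < b" using evv[of "b + v (xb, tb)"] by simp
  next
    fix b assume "b < - v (xb, tb)"
    then have e: "0 < (- v (xb, tb) - b) / 2" by simp
    show "\<forall>\<^sub>F n in sequentially. b < - v (Y (f n), T (f n))"
      using evu[OF e] eva[OF e]
    proof eventually_elim
      case (elim n) then show ?case using uv[of n] ua by (simp add: field_simps)
    qed
  qed
  show ?thesis
  proof (rule that[OF pK s0])
    show "sc L l 0 tb xb = u (xb, s) - pen L l 0 (s - tb)" using ua au by (simp add: a0_def)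
    fix d assume d: "0 < d" "d < r / 2"
    let ?nu = "nl (- ball 0 d) (\<lambda>y. u (y, s)) xb" and ?nv = "nl (- ball 0 d) (\<lambda>y. - v (y, tb)) xb"
    let ?E = "(K3 + 8 * A * N) * N * d powr (1 - sg)"
    define q where "q n = snd (G (Y (f n), T (f n))) + 2 * A * (T (f n) - tb)
      - (H (Y (f n)) (P (f n) - fst (G (Y (f n), T (f n))) - (2 * A) *\<^sub>R (Y (f n) - xb)) - H (X (f n)) (P (f n)))" for n
    have H1: "(\<lambda>n. (\<lambda>(x, p). H x p) (Y (f n), P (f n) - fst (G (Y (f n), T (f n))) - (2 * A) *\<^sub>R (Y (f n) - xb)))
      \<longlonglongrightarrow> (\<lambda>(x, p). H x p) (xb, p - fst (G (xb, tb)) - (2 * A) *\<^sub>R (xb - xb))"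
    proof (rule continuous_on_tendsto_compose[OF contH])
      show "(\<lambda>n. (Y (f n), P (f n) - fst (G (Y (f n), T (f n))) - (2 * A) *\<^sub>R (Y (f n) - xb)))
        \<longlonglongrightarrow> (xb, p - fst (G (xb, tb)) - (2 * A) *\<^sub>R (xb - xb))"
        by (intro tendsto_intros Yf Pf Gl)
    qed (use XY xb in auto)
    have H2: "(\<lambda>n. (\<lambda>(x, p). H x p) (X (f n), P (f n))) \<longlonglongrightarrow> (\<lambda>(x, p). H x p) (xb, p)"
      by (rule continuous_on_tendsto_compose[OF contH]) (use XY xb in \<open>auto intro!: tendsto_intros Xf Pf\<close>)
    have "q \<longlonglongrightarrow> snd (G (xb, tb)) + 2 * A * (tb - tb) - (H xb (p - fst (G (xb, tb)) - (2 * A) *\<^sub>R (xb - xb)) - H xb p)"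
      unfolding q_def using H1 H2 by (intro tendsto_intros Gl Tf) auto
    then have ql: "q \<longlonglongrightarrow> snd (G (xb, tb)) - (H xb (p - fst (G (xb, tb))) - H xb p)" by simp
    have "snd (G (xb, tb)) - (H xb (p - fst (G (xb, tb))) - H xb p) \<le> ?nu + ?nv + ?E"
    proof (rule field_le_epsilon)
      fix \<epsilon> :: real assume "0 < \<epsilon>"
      then have e: "0 < \<epsilon> / 2" by simp
      have e1: "\<forall>\<^sub>F n in sequentially. nl (- ball 0 d) (\<lambda>y. u (y, S (f n))) (X (f n)) < ?nu + \<epsilon> / 2"
        by (rule nonlocal_tail_limsup[OF uusc uB XY(1) Xf XY(2) Sf ul d(1) e])
      have vB': "\<bar>- v q\<bar> \<le> B" if "q \<in> cl \<times> {0..}" for q using vB[OF that] by simp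
      have e2: "\<forall>\<^sub>F n in sequentially. nl (- ball 0 d) (\<lambda>y. - v (y, T (f n))) (Y (f n)) < ?nv + \<epsilon> / 2"
        by (rule nonlocal_tail_limsup[OF vlsc vB' XY(3) Yf XY(4) Tf vl d(1) e])
      have "(\<lambda>n. (h (f n))\<^sup>2) \<longlonglongrightarrow> 0\<^sup>2" by (intro tendsto_intros hf)
      then have e3: "\<forall>\<^sub>F n in sequentially. (h (f n))\<^sup>2 < d" using d by (intro order_tendstoD(2)) auto
      show "snd (G (xb, tb)) - (H xb (p - fst (G (xb, tb))) - H xb p) \<le> ?nu + ?nv + ?E + \<epsilon>"
      proof (rule tendsto_upperbound[OF ql])
        show "\<forall>\<^sub>F n in sequentially. q n \<le> ?nu + ?nv + ?E + \<epsilon>"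
          using e1 e2 e3
        proof eventually_elim
          case (elim n)
          then show ?case using ineq[of "f n" d] d(2) by (simp add: q_def)
        qed
      qed simp
    qed
    then show "snd (G (xb, tb)) \<le> H xb (p - fst (G (xb, tb))) - H xb p + ?nu + ?nv + ?E" by simp
  qed
qed

end


section \<open>Propagation of contact in time\<close>

text \<open>Two sequences with one-sided limit bounds whose sum reaches the full limit must both
  converge.\<close>

lemma usc_pair_tendsto:
  fixes f g a :: "nat \<Rightarrow> real"
  assumes f: "\<And>e. 0 < e \<Longrightarrow> \<forall>\<^sub>F n in sequentially. f n < F + e" and g: "\<And>e. 0 < e \<Longrightarrow> \<forall>\<^sub>F n in sequentially. g n < G + e"
    and a: "a \<longlonglongrightarrow> A" "F + G \<le> A" "\<And>n. a n \<le> f n + g n"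
  shows "f \<longlonglongrightarrow> F" "g \<longlonglongrightarrow> G"
proof -
  have *: "f \<longlonglongrightarrow> F" if f: "\<And>e. 0 < e \<Longrightarrow> \<forall>\<^sub>F n in sequentially. f n < F + e"
    and g: "\<And>e. 0 < e \<Longrightarrow> \<forall>\<^sub>F n in sequentially. g n < G + e" and a: "a \<longlonglongrightarrow> A" "F + G \<le> A" "\<And>n. a n \<le> f n + g n"
    for f g F G
  proof (rule order_tendstoI)
    fix b assume "F < b" then show "\<forall>\<^sub>F n in sequentially. f n < b" using f[of "b - F"] by simp
  next
    fix b assume "b < F"
    then have e: "0 < (F - b) / 2" by simp
    have "\<forall>\<^sub>F n in sequentially. A - (F - b) / 2 < a n" by (rule order_tendstoD(1)[OF a(1)]) (use e in simp)
    then show "\<forall>\<^sub>F n in sequentially. b < f n" using g[OF e]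
    proof eventually_elim
      case (elim n) then show ?case using a(2) a(3)[of n] by (simp add: field_simps)
    qed
  qed
  show "f \<longlonglongrightarrow> F" by (rule *[OF f g a])
  show "g \<longlonglongrightarrow> G" by (rule *[OF g f a(1)]) (use a(2,3) in \<open>auto simp: add.commute\<close>)
qed

context hj_pair
begin

abbreviation "tails d s t x \<equiv> nl (- ball 0 d) (\<lambda>y. u (y, s)) x + nl (- ball 0 d) (\<lambda>y. - v (y, t)) x"

text \<open>The lower bound \<open>a n\<close> on the sum supplies convergence of the two values
  separately, without any continuity of \<open>u\<close> or \<open>v\<close>.\<close>

lemma nonlocal_pair_limsup:
  assumes X: "\<And>n. X n \<in> cl" "X \<longlonglongrightarrow> x" and S: "\<And>n. 0 \<le> S n" "S \<longlonglongrightarrow> s" and T: "\<And>n. 0 \<le> T n" "T \<longlonglongrightarrow> t"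
    and a: "a \<longlonglongrightarrow> u (x, s) - v (x, t)" "\<And>n. a n \<le> u (X n, S n) - v (X n, T n)" and d: "0 < d" and e: "0 < e"
  shows "\<forall>\<^sub>F n in sequentially. tails d (S n) (T n) (X n) < tails d s t x + e"
proof -
  have x: "x \<in> cl" using X closed_closure[of Om] by (auto simp: closed_sequential_limits)
  have st: "0 \<le> s" "0 \<le> t" using S T by (auto intro: LIMSEQ_le_const)
  have XS: "(\<lambda>n. (X n, S n)) \<longlonglongrightarrow> (x, s)" "(\<lambda>n. (X n, T n)) \<longlonglongrightarrow> (x, t)" by (intro tendsto_Pair X S T)+
  have evu: "\<forall>\<^sub>F n in sequentially. u (X n, S n) < u (x, s) + \<epsilon>" if "0 < \<epsilon>" for \<epsilon>
    by (rule usc_on_sequentially[OF uusc _ XS(1)]) (use that x st X S in auto)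
  have evv: "\<forall>\<^sub>F n in sequentially. - v (X n, T n) < - v (x, t) + \<epsilon>" if "0 < \<epsilon>" for \<epsilon>
    by (rule usc_on_sequentially[OF vlsc _ XS(2)]) (use that x st X T in auto)
  have "u (x, s) + - v (x, t) \<le> u (x, s) - v (x, t)" "\<And>n. a n \<le> u (X n, S n) + - v (X n, T n)" using a(2) by auto
  note lim = usc_pair_tendsto[OF evu evv a(1) this]
  have vB': "\<bar>- v q\<bar> \<le> B" if "q \<in> cl \<times> {0..}" for q using vB[OF that] by simp
  have "\<forall>\<^sub>F n in sequentially. nl (- ball 0 d) (\<lambda>y. u (y, S n)) (X n) < nl (- ball 0 d) (\<lambda>y. u (y, s)) x + e / 2"
    by (rule nonlocal_tail_limsup[OF uusc uB X(1,2) S(1,2) lim(1) d]) (use e in auto)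
  moreover have "\<forall>\<^sub>F n in sequentially. nl (- ball 0 d) (\<lambda>y. - v (y, T n)) (X n) < nl (- ball 0 d) (\<lambda>y. - v (y, t)) x + e / 2"
    by (rule nonlocal_tail_limsup[OF vlsc vB' X(1,2) T(1,2) lim(2) d]) (use e in auto)
  ultimately show ?thesis by eventually_elim simp
qed

text \<open>The maximum is taken jointly over \<open>x\<close>, \<open>s\<close> and
  \<open>t\<close> with the sup-convolution unfolded, so semicontinuity of \<open>u\<close> and
  \<open>v\<close> suffices.\<close>

lemma sc_touching_point:
  assumes lL: "0 < l" "l \<le> L" and cont: "continuous_on (cl \<times> {0..}) \<psi>" and psi0: "\<And>q. q \<in> cl \<times> {0..} \<Longrightarrow> 0 \<le> \<psi> q"
    and coer: "\<And>R. bounded {t. 0 \<le> t \<and> (\<exists>x\<in>cl. \<psi> (x, t) \<le> R)}"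
  obtains x t where "x \<in> cl" "0 \<le> t"
    "\<And>y s. y \<in> cl \<Longrightarrow> 0 \<le> s \<Longrightarrow> sc L l 0 s y - v (y, s) - \<psi> (y, s) \<le> sc L l 0 t x - v (x, t) - \<psi> (x, t)"
proof -
  let ?S = "(cl \<times> {0::real..}) \<times> {0::real..}"
  define F where "F q = u (fst q) + - v (fst (fst q), snd q) + - (pen L l 0 (snd (fst q) - snd q) + \<psi> (fst (fst q), snd q))"
    for q :: "('a \<times> real) \<times> real"
  have F: "usc_on ?S F"
    unfolding F_def
    by (intro usc_on_add usc_on_compose[OF uusc] usc_on_compose[OF vlsc] continuous_on_imp_usc_on continuous_on_minus
        continuous_on_add pen_usc[OF _ lL order_refl] continuous_on_compose2[OF cont] continuous_intros) auto
  obtain x0 where x0: "x0 \<in> cl" using Om_ne Om_cl by blast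
  define q0 where "q0 = ((x0, 0::real), 0::real)"
  have q0: "q0 \<in> ?S" using x0 by (simp add: q0_def)
  define R where "R = 2 * B - F q0"
  obtain M where M: "\<And>t. 0 \<le> t \<Longrightarrow> (\<exists>x\<in>cl. \<psi> (x, t) \<le> R) \<Longrightarrow> norm t \<le> M" using coer[of R] by (auto simp: bounded_iff)
  have sub: "{q\<in>?S. F q0 \<le> F q} \<subseteq> (cl \<times> cball 0 (M + R / l)) \<times> cball 0 M"
  proof
    fix q assume q: "q \<in> {q\<in>?S. F q0 \<le> F q}"
    obtain x s t where qd: "q = ((x, s), t)" by (metis surj_pair)
    have m: "x \<in> cl" "0 \<le> s" "0 \<le> t" using q by (auto simp: qd)
    have "\<bar>u (x, s)\<bar> \<le> B" "\<bar>v (x, t)\<bar> \<le> B" "0 \<le> \<psi> (x, t)" using uB vB m psi0 by auto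
    moreover have p: "l * \<bar>s - t\<bar> - L * 0 \<le> pen L l 0 (s - t)" by (rule pen_lower[OF lL order_refl])
    moreover have "F q0 \<le> u (x, s) - v (x, t) - (pen L l 0 (s - t) + \<psi> (x, t))" using q by (simp add: F_def qd)
    moreover have nn: "0 \<le> l * \<bar>s - t\<bar>" using lL by simp
    ultimately have "l * \<bar>s - t\<bar> \<le> R" "\<psi> (x, t) \<le> R" unfolding R_def abs_le_iff by linarith+
    then have "\<bar>s - t\<bar> \<le> R / l" "norm t \<le> M" using lL M[OF m(3)] m by (auto simp: field_simps)
    then show "q \<in> (cl \<times> cball 0 (M + R / l)) \<times> cball 0 M" using m by (auto simp: qd)
  qed
  have bnd: "bounded {q\<in>?S. F q0 \<le> F q}"
    by (rule bounded_subset[OF _ sub]) (intro bounded_Times compact_imp_bounded[OF compact_cl] bounded_cball)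
  have "closed ?S" by (intro closed_Times closed_closure closed_atLeast)
  then obtain q where q: "q \<in> ?S" "\<And>q'. q' \<in> ?S \<Longrightarrow> F q' \<le> F q"
    using usc_attains_max[OF F _ q0 bnd] by blast
  obtain x s t where qd: "q = ((x, s), t)" by (metis surj_pair)
  have m: "x \<in> cl" "0 \<le> s" "0 \<le> t" using q(1) by (auto simp: qd)
  show ?thesis
  proof (rule that[OF m(1,3)])
    fix y' :: 'a and s' :: real assume y: "y' \<in> cl" "0 \<le> s'"
    obtain r where r: "0 \<le> r" "sc L l 0 s' y' = u (y', r) - pen L l 0 (r - s')" using sc_attained[OF lL order_refl y] .
    have "F ((y', r), s') \<le> F q" using y r by (intro q(2)) auto
    moreover have "u (x, s) - pen L l 0 (s - t) \<le> sc L l 0 t x" by (rule sc_ge[OF lL order_refl m(1,3,2)])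
    ultimately show "sc L l 0 s' y' - v (y', s') - \<psi> (y', s') \<le> sc L l 0 t x - v (x, t) - \<psi> (x, t)"
      using r(2) by (simp add: F_def qd)
  qed
qed

text \<open>A test function of time alone has no space gradient, so the two values of
  \<open>H\<close> in the touching inequality coincide and cancel. The sup-convolution is needed
  only to reach that inequality; its slopes tend to infinity, which returns
  \<open>u\<close>.\<close>

lemma time_localized:
  assumes a: "0 < a"
    and pos: "\<And>x t. x \<in> cl \<Longrightarrow> 0 \<le> t \<Longrightarrow> (\<And>y s. y \<in> cl \<Longrightarrow> 0 \<le> s \<Longrightarrow>
      u (y, s) - v (y, s) - a * (s - tc)\<^sup>2 \<le> u (x, t) - v (x, t) - a * (t - tc)\<^sup>2) \<Longrightarrow> 0 < t"
  obtains x t where "x \<in> cl" "0 < t"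
    "\<And>y s. y \<in> cl \<Longrightarrow> 0 \<le> s \<Longrightarrow> u (y, s) - v (y, s) - a * (s - tc)\<^sup>2 \<le> u (x, t) - v (x, t) - a * (t - tc)\<^sup>2"
    "\<And>d. 0 < d \<Longrightarrow> 2 * a * (t - tc) \<le> tails d t t x"
proof -
  define \<psi> :: "'a \<times> real \<Rightarrow> real" where "\<psi> q = a * (snd q - tc)\<^sup>2" for q
  define G :: "'a \<times> real \<Rightarrow> 'a \<times> real" where "G q = (0, 2 * a * (snd q - tc))" for q
  have hG: "has_C1_gradient (cl \<times> {0..}) \<psi> G"
    unfolding \<psi>_def G_def
    by (rule C1_gradient_time[where \<rho> = "\<lambda>t. a * (t - tc)\<^sup>2"]) (auto intro!: derivative_eq_intros continuous_intros)
  have cont: "continuous_on (cl \<times> {0..}) \<psi>" unfolding \<psi>_def by (intro continuous_intros)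
  have psi0: "0 \<le> \<psi> q" for q using a by (simp add: \<psi>_def)
  have absq: "\<bar>y\<bar> \<le> y\<^sup>2 + 1" for y :: real by (rule abs_le_square_plus_one)
  have coer: "bounded {t. 0 \<le> t \<and> (\<exists>x\<in>cl. \<psi> (x, t) \<le> R)}" for R
  proof (rule bounded_subset[OF bounded_cball[of tc "R / a + 1"]], clarify)
    fix t x assume "\<psi> (x, t) \<le> R"
    then have "(t - tc)\<^sup>2 \<le> R / a" using a by (simp add: \<psi>_def field_simps)
    then show "t \<in> cball tc (R / a + 1)" using absq[of "t - tc"] by (simp add: dist_real_def abs_minus_commute)
  qed
  \<comment> \<open>Equal slopes in both directions suffice here, as only convergence of the argmax
    times to \<open>t\<close> is required.\<close>
  define Lf where "Lf n = real (Suc n)" for n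
  have Lf: "0 < Lf n" "Lf n \<le> Lf n" for n by (auto simp: Lf_def)
  define Mx where "Mx n z \<longleftrightarrow> fst z \<in> cl \<and> 0 \<le> snd z \<and> (\<forall>y\<in>cl. \<forall>s\<ge>0. sc (Lf n) (Lf n) 0 s y - v (y, s) - \<psi> (y, s)
      \<le> sc (Lf n) (Lf n) 0 (snd z) (fst z) - v z - \<psi> z)" for n and z :: "'a \<times> real"
  have "\<exists>z. Mx n z" for n
  proof -
    obtain x t where "x \<in> cl" "0 \<le> t"
      "\<And>y s. y \<in> cl \<Longrightarrow> 0 \<le> s \<Longrightarrow> sc (Lf n) (Lf n) 0 s y - v (y, s) - \<psi> (y, s) \<le> sc (Lf n) (Lf n) 0 t x - v (x, t) - \<psi> (x, t)"
      using sc_touching_point[OF Lf cont psi0 coer] by blast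
    then show ?thesis by (intro exI[of _ "(x, t)"]) (auto simp: Mx_def)
  qed
  then have "\<exists>Z. \<forall>n. Mx n (Z n)" by (intro choice allI)
  then obtain Z where Z: "\<And>n. Mx n (Z n)" by blast
  define X where "X n = fst (Z n)" for n
  define T where "T n = snd (Z n)" for n
  have XT: "X n \<in> cl" "0 \<le> T n" for n using Z[of n] by (auto simp: Mx_def X_def T_def)
  have mxn: "sc (Lf n) (Lf n) 0 s y - v (y, s) - \<psi> (y, s) \<le> sc (Lf n) (Lf n) 0 (T n) (X n) - v (X n, T n) - \<psi> (X n, T n)"
    if "y \<in> cl" "0 \<le> s" for n y s using Z[of n] that by (auto simp: Mx_def X_def T_def)
  have wle: "u (y, s) - v (y, s) - \<psi> (y, s) \<le> sc (Lf n) (Lf n) 0 (T n) (X n) - v (X n, T n) - \<psi> (X n, T n)"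
    if "y \<in> cl" "0 \<le> s" for n y s
    using mxn[OF that, of n] sc_bounds(1)[OF Lf order_refl that, of n] by linarith
  obtain x0 where x0: "x0 \<in> cl" using Om_ne Om_cl by blast
  define R where "R = 4 * B + \<psi> (x0, 0)"
  have TR: "\<psi> (X n, T n) \<le> R" for n
  proof -
    have "\<bar>u (x0, 0)\<bar> \<le> B" "\<bar>v (x0, 0)\<bar> \<le> B" "\<bar>v (X n, T n)\<bar> \<le> B" using uB vB x0 XT by auto
    then show ?thesis using wle[OF x0 order_refl, of n]
      sc_bounds(2)[OF Lf(1)[of n] Lf(2)[of n] order_refl XT(1)[of n] XT(2)[of n]]
      unfolding R_def abs_le_iff by linarith
  qed
  have "bounded (range (\<lambda>n. (X n, T n)))"
  proof (rule bounded_subset[OF bounded_Times[OF compact_imp_bounded[OF compact_cl] coer[of R]]])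
    show "range (\<lambda>n. (X n, T n)) \<subseteq> cl \<times> {t. 0 \<le> t \<and> (\<exists>x\<in>cl. \<psi> (x, t) \<le> R)}" using XT TR by blast
  qed
  then obtain z f where f: "strict_mono f" "((\<lambda>n. (X n, T n)) \<circ> f) \<longlonglongrightarrow> z"
    using bounded_imp_convergent_subsequence by blast
  obtain x t where z: "z = (x, t)" by (cases z)
  have Xf: "(\<lambda>n. X (f n)) \<longlonglongrightarrow> x" and Tf: "(\<lambda>n. T (f n)) \<longlonglongrightarrow> t"
    using tendsto_fst[OF f(2)] tendsto_snd[OF f(2)] by (auto simp: o_def z)
  have x: "x \<in> cl" by (rule closed_sequentially[OF closed_closure _ Xf]) (rule XT(1))
  have t: "0 \<le> t" using Tf XT(2) by (intro LIMSEQ_le_const) auto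
  have Lfl: "(\<lambda>n. 2 * B / Lf (f n)) \<longlonglongrightarrow> 0"
  proof -
    have "(\<lambda>n. 2 * B / Lf n) \<longlonglongrightarrow> 0"
      using tendsto_mult_right_zero[OF LIMSEQ_inverse_real_of_nat, of "2 * B"] by (simp add: Lf_def field_simps)
    from LIMSEQ_subseq_LIMSEQ[OF this f(1)] show ?thesis by (simp add: o_def)
  qed
  have argl: "(\<lambda>n. S n) \<longlonglongrightarrow> t" if S: "\<And>n. 0 \<le> S n" "\<And>n. sc (Lf (f n)) (Lf (f n)) 0 (T (f n)) (X (f n)) =
      u (X (f n), S n) - pen (Lf (f n)) (Lf (f n)) 0 (S n - T (f n))" for S
  proof -
    have b: "\<bar>S n - T (f n)\<bar> \<le> 2 * B / Lf (f n)" for n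
      using sc_argmax_bound[OF Lf(1)[of "f n"] Lf(2)[of "f n"] order_refl XT(1)[of "f n"] XT(2)[of "f n"] S(1)[of n], of 0] S(2)[of n] by simp
    have "(\<lambda>n. S n - T (f n)) \<longlonglongrightarrow> 0"
      by (rule Lim_transform_bound[OF _ Lfl])
        (intro always_eventually allI, unfold real_norm_def, rule order_trans[OF b abs_ge_self])
    then show ?thesis using tendsto_add[OF _ Tf] by force
  qed
  have pen0: "0 \<le> pen (Lf n) (Lf n) 0 y" for n y
    using pen_lower[OF Lf order_refl, of n y] mult_nonneg_nonneg[of "Lf n" "\<bar>y\<bar>"] Lf(1)[of n] by linarith
  have psil: "(\<lambda>n. \<psi> (X (f n), T (f n))) \<longlonglongrightarrow> \<psi> (x, t)"
    unfolding \<psi>_def snd_conv by (intro tendsto_intros Tf)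
  have limmax: "u (y, s) - v (y, s) - \<psi> (y, s) \<le> u (x, t) - v (x, t) - \<psi> (x, t)" if ys: "y \<in> cl" "0 \<le> s" for y s
  proof -
    have "\<exists>r. 0 \<le> r \<and> sc (Lf (f n)) (Lf (f n)) 0 (T (f n)) (X (f n)) =
      u (X (f n), r) - pen (Lf (f n)) (Lf (f n)) 0 (r - T (f n))" for n
      using sc_attained[OF Lf order_refl XT] by metis
    then have "\<exists>S. \<forall>n. 0 \<le> S n \<and> sc (Lf (f n)) (Lf (f n)) 0 (T (f n)) (X (f n)) =
      u (X (f n), S n) - pen (Lf (f n)) (Lf (f n)) 0 (S n - T (f n))" by (intro choice allI)
    then obtain S where S: "\<And>n. 0 \<le> S n" "\<And>n. sc (Lf (f n)) (Lf (f n)) 0 (T (f n)) (X (f n)) =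
      u (X (f n), S n) - pen (Lf (f n)) (Lf (f n)) 0 (S n - T (f n))" by blast
    have Sl: "S \<longlonglongrightarrow> t" by (rule argl[OF S])
    have "u (y, s) - v (y, s) - \<psi> (y, s) \<le> u (x, t) - v (x, t) - \<psi> (x, t) + \<epsilon>" if e: "0 < \<epsilon>" for \<epsilon>
    proof -
      have e3: "0 < \<epsilon> / 3" using e by simp
      have "\<forall>\<^sub>F n in sequentially. u (X (f n), S n) < u (x, t) + \<epsilon> / 3"
        by (rule usc_on_sequentially[OF uusc _ tendsto_Pair[OF Xf Sl]]) (use e3 x t XT S in auto)
      moreover have "\<forall>\<^sub>F n in sequentially. - v (X (f n), T (f n)) < - v (x, t) + \<epsilon> / 3"
        by (rule usc_on_sequentially[OF vlsc _ tendsto_Pair[OF Xf Tf]]) (use e3 x t XT in auto)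
      moreover have "\<forall>\<^sub>F n in sequentially. \<psi> (x, t) - \<epsilon> / 3 < \<psi> (X (f n), T (f n))"
        by (rule order_tendstoD(1)[OF psil]) (use e3 in simp)
      ultimately have "\<forall>\<^sub>F n in sequentially. u (y, s) - v (y, s) - \<psi> (y, s) \<le> u (x, t) - v (x, t) - \<psi> (x, t) + \<epsilon>"
      proof eventually_elim
        case (elim n)
        then show ?case using wle[OF ys, of "f n"] S(2)[of n] pen0[of "f n" "S n - T (f n)"] by linarith
      qed
      then show ?thesis by simp
    qed
    then show ?thesis by (rule field_le_epsilon)
  qed
  have tpos: "0 < t" by (rule pos[OF x t]) (use limmax in \<open>simp add: \<psi>_def\<close>)
  obtain KK where KK: "KK \<ge> 1"
    "\<And>L l k t x y. 0 < l \<Longrightarrow> l \<le> L \<Longrightarrow> 0 \<le> k \<Longrightarrow> k \<le> 1 \<Longrightarrow> 2 * B < L * (t - k) \<Longrightarrow> x \<in> cl \<Longrightarrow> y \<in> cl \<Longrightarrow>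
      \<bar>sc L l k t x - sc L l k t y\<bar> \<le> KK * (1 + L) * dist x y"
    using sc_lipschitz by blast
  obtain cc r where cc: "0 < cc" "cc < 1" "0 < r" "r < 1"
    "\<And>x0. x0 \<in> cl \<Longrightarrow> \<exists>e. norm e \<le> 1 \<and>
      (\<forall>y\<in>cl. dist y x0 < r \<longrightarrow> (\<forall>h. 0 < h \<and> h < r \<longrightarrow> ball (y + h *\<^sub>R e) (cc * h) \<subseteq> Om))"
    using interior_cone by blast
  have ev: "\<forall>\<^sub>F n in sequentially. t / 2 < T (f n) \<and> 2 * B < Lf (f n) * (t / 4)"
  proof (rule eventually_conj)
    show "\<forall>\<^sub>F n in sequentially. t / 2 < T (f n)" by (rule order_tendstoD(1)[OF Tf]) (use tpos in simp)
    have "\<forall>\<^sub>F n in sequentially. 2 * B / Lf (f n) < t / 4" by (rule order_tendstoD(2)[OF Lfl]) (use tpos in simp)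
    then show "\<forall>\<^sub>F n in sequentially. 2 * B < Lf (f n) * (t / 4)"
      by eventually_elim (use Lf(1) in \<open>simp add: field_simps\<close>)
  qed
  then obtain n0 where n0: "\<And>n. n0 \<le> n \<Longrightarrow> t / 2 < T (f n) \<and> 2 * B < Lf (f n) * (t / 4)"
    unfolding eventually_sequentially by blast
  have key: "\<exists>s. 0 \<le> s \<and> sc (Lf (f n)) (Lf (f n)) 0 (T (f n)) (X (f n)) =
      u (X (f n), s) - pen (Lf (f n)) (Lf (f n)) 0 (s - T (f n)) \<and> (n0 \<le> n \<longrightarrow> (\<forall>d>0. 2 * a * (T (f n) - tc) \<le>
      tails d s (T (f n)) (X (f n))))" for n
  proof (cases "n0 \<le> n")
    case False
    then show ?thesis using sc_attained[OF Lf order_refl XT, of "f n" "f n"] by metis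
  next
    case True
    let ?L = "Lf (f n)" and ?x = "X (f n)" and ?t = "T (f n)"
    obtain e where e: "norm e \<le> 1" "\<And>y h. y \<in> cl \<Longrightarrow> dist y ?x < r \<Longrightarrow> 0 < h \<Longrightarrow> h < r \<Longrightarrow> ball (y + h *\<^sub>R e) (cc * h) \<subseteq> Om"
      using cc(5)[OF XT(1)[of "f n"]] by blast
    have Lt: "2 * B < ?L * (?t - t / 8 - t / 8)"
    proof -
      have "?L * (t / 4) \<le> ?L * (?t - t / 8 - t / 8)" using n0[OF True] Lf(1)[of "f n"] by (intro mult_left_mono) auto
      then show ?thesis using n0[OF True] by linarith
    qed
    interpret touching Om nu sg N H c B u v ?L ?L "KK * (1 + ?L)" cc r 0 e ?x ?t \<psi> G
    proof unfold_locales
      show "1 \<le> KK * (1 + ?L)" using mult_mono[of 1 KK 1 "1 + ?L"] KK(1) Lf(1)[of "f n"] by simp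
      show "2 * B < ?L * ?t"
      proof -
        have "?L * (?t - t / 8 - t / 8) \<le> ?L * ?t" using tpos Lf(1)[of "f n"] by (intro mult_left_mono) auto
        then show ?thesis using Lt by linarith
      qed
      show "0 \<le> \<psi> q" for q by (rule psi0)
    qed (use Lf cc e KK hG XT mxn in \<open>auto simp: \<psi>_def\<close>)
    define \<tau> where "\<tau> = min (r / 2) (t / 8)"
    have \<tau>: "0 < \<tau>" "\<tau> \<le> r / 2" "\<tau> \<le> t / 8" using cc tpos by (auto simp: \<tau>_def)
    have \<tau>3: "2 * B < ?L * (?t - \<tau> - \<tau>)"
    proof -
      have "?L * (?t - t / 8 - t / 8) \<le> ?L * (?t - \<tau> - \<tau>)" using \<tau> Lf(1)[of "f n"] by (intro mult_left_mono) auto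
      then show ?thesis using Lt by linarith
    qed
    \<comment> \<open>Any value large enough for the touching inequality; it depends on
      \<open>n\<close> but is gone after \<open>d'\<close> tends to \<open>0\<close>.\<close>
    define A where "A = max 1 ((2 * B + 2 * ?L + KK * (1 + ?L) - m0 + 1) / \<tau>\<^sup>2)"
    have A: "1 \<le> A" "2 * B + 2 * ?L + KK * (1 + ?L) - m0 < A * \<tau>\<^sup>2"
    proof -
      have "(2 * B + 2 * ?L + KK * (1 + ?L) - m0 + 1) / \<tau>\<^sup>2 * \<tau>\<^sup>2 \<le> A * \<tau>\<^sup>2" by (intro mult_right_mono) (auto simp: A_def)
      then show "2 * B + 2 * ?L + KK * (1 + ?L) - m0 < A * \<tau>\<^sup>2" using \<tau> by simp
    qed (simp add: A_def)
    have "\<exists>p s. 0 \<le> s \<and> sc ?L ?L 0 ?t ?x = u (?x, s) - pen ?L ?L 0 (s - ?t) \<and>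
      (\<forall>d. 0 < d \<longrightarrow> d < r / 2 \<longrightarrow> snd (G (?x, ?t)) \<le> H ?x (p - fst (G (?x, ?t))) - H ?x p
      + nl (- ball 0 d) (\<lambda>y. u (y, s)) ?x + nl (- ball 0 d) (\<lambda>y. - v (y, ?t)) ?x + (K3 + 8 * A * N) * N * d powr (1 - sg))"
      by (rule touching_inequality[OF A(1) \<tau>(1,2) \<tau>3 A(2)]) blast
    then obtain p s where ps: "0 \<le> s" "sc ?L ?L 0 ?t ?x = u (?x, s) - pen ?L ?L 0 (s - ?t)"
      "\<And>d. 0 < d \<Longrightarrow> d < r / 2 \<Longrightarrow> snd (G (?x, ?t)) \<le> H ?x (p - fst (G (?x, ?t))) - H ?x p
      + nl (- ball 0 d) (\<lambda>y. u (y, s)) ?x + nl (- ball 0 d) (\<lambda>y. - v (y, ?t)) ?x + (K3 + 8 * A * N) * N * d powr (1 - sg)"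
      by blast
    let ?E = "(K3 + 8 * A * N) * N"
    have in1: "2 * a * (?t - tc) \<le> nl (- ball 0 d) (\<lambda>y. u (y, s) + - v (y, ?t)) ?x + ?E * d powr (1 - sg)" if "0 < d" "d < r / 2" for d
      using ps(3)[OF that] nonlocal_add[OF u_tame[OF ps(1)] v_tame[OF XT(2)] XT(1) that(1)] by (simp add: G_def)
    have tm: "tame (2 * B) (\<lambda>y. u (y, s) + - v (y, ?t))"
    proof (rule usc_imp_tame)
      show "usc_on cl (\<lambda>y. u (y, s) + - v (y, ?t))"
        by (intro usc_on_add usc_slice[OF uusc ps(1)] usc_slice[OF vlsc XT(2)])
      show "\<bar>u (y, s) + - v (y, ?t)\<bar> \<le> 2 * B" if "y \<in> cl" for y
        using uB[of "(y, s)"] vB[of "(y, ?t)"] that ps(1) XT(2)[of "f n"] by (auto simp: abs_le_iff)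
    qed
    \<comment> \<open>At the fixed times \<open>s\<close> and \<open>?t\<close> the base point
      maximizes in space, because \<open>\<psi>\<close> depends on time only. Hence shrinking the
      cut-off lowers the tails, and the error at \<open>d'\<close> can be removed for every
      \<open>d\<close>.\<close>
    have top: "u (y, s) + - v (y, ?t) \<le> u (?x, s) + - v (?x, ?t)" if "y \<in> cl" for y
      using mxn[OF that XT(2)[of "f n"], of "f n"] sc_ge[OF Lf order_refl that XT(2) ps(1), of "f n" "f n"] ps(2)
      by (simp add: \<psi>_def)
    have "2 * a * (?t - tc) \<le> nl (- ball 0 d) (\<lambda>y. u (y, s)) ?x + nl (- ball 0 d) (\<lambda>y. - v (y, ?t)) ?x" if d: "0 < d" for d
    proof -
      have "2 * a * (?t - tc) \<le> nl (- ball 0 d) (\<lambda>y. u (y, s) + - v (y, ?t)) ?x"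
      proof (rule tendsto_lowerbound)
        show "((\<lambda>d'. nl (- ball 0 d) (\<lambda>y. u (y, s) + - v (y, ?t)) ?x + ?E * d' powr (1 - sg)) \<longlongrightarrow>
          nl (- ball 0 d) (\<lambda>y. u (y, s) + - v (y, ?t)) ?x) (at_right 0)"
        proof -
          have "((\<lambda>d'. d' powr (1 - sg)) \<longlongrightarrow> 0) (at_right 0)"
            by (rule tendsto_zero_powrI[OF _ tendsto_const]) (use sg in \<open>auto simp: eventually_at_right_less intro: eventually_mono[OF eventually_at_right_less]\<close>)
          from tendsto_add[OF tendsto_const tendsto_mult_right_zero[OF this]] show ?thesis by fastforce
        qed
        have "\<forall>\<^sub>F d' in at_right (0::real). d' \<in> {0<..<min d (r / 2)}"
          by (rule eventually_at_right_real) (use d cc in simp)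
        then show "\<forall>\<^sub>F d' in at_right 0. 2 * a * (?t - tc) \<le> nl (- ball 0 d) (\<lambda>y. u (y, s) + - v (y, ?t)) ?x + ?E * d' powr (1 - sg)"
        proof eventually_elim
          case (elim d')
          then have d': "0 < d'" "d' < r / 2" "d' \<le> d" by auto
          have "nl (- ball 0 d') (\<lambda>y. u (y, s) + - v (y, ?t)) ?x \<le> nl (- ball 0 d) (\<lambda>y. u (y, s) + - v (y, ?t)) ?x"
            by (rule nonlocal_tail_mono[OF tm XT(1) d'(1,3)]) (rule top)
          then show ?case using in1[OF d'(1,2)] by linarith
        qed
      qed simp
      then show ?thesis using nonlocal_add[OF u_tame[OF ps(1)] v_tame[OF XT(2)] XT(1) d] by simp
    qed
    then show ?thesis using ps(1,2) by blast
  qed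
  then have "\<exists>S. \<forall>n. 0 \<le> S n \<and> sc (Lf (f n)) (Lf (f n)) 0 (T (f n)) (X (f n)) =
      u (X (f n), S n) - pen (Lf (f n)) (Lf (f n)) 0 (S n - T (f n)) \<and> (n0 \<le> n \<longrightarrow> (\<forall>d>0. 2 * a * (T (f n) - tc) \<le>
      tails d (S n) (T (f n)) (X (f n))))"
    by (intro choice allI)
  then obtain S where S: "\<And>n. 0 \<le> S n" "\<And>n. sc (Lf (f n)) (Lf (f n)) 0 (T (f n)) (X (f n)) =
      u (X (f n), S n) - pen (Lf (f n)) (Lf (f n)) 0 (S n - T (f n))" and
    Sd: "\<And>n d. n0 \<le> n \<Longrightarrow> 0 < d \<Longrightarrow> 2 * a * (T (f n) - tc) \<le>
      tails d (S n) (T (f n)) (X (f n))" by blast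
  have Sl: "S \<longlonglongrightarrow> t" by (rule argl[OF S])
  show ?thesis
  proof (rule that[OF x tpos])
    show "u (y, s) - v (y, s) - a * (s - tc)\<^sup>2 \<le> u (x, t) - v (x, t) - a * (t - tc)\<^sup>2" if "y \<in> cl" "0 \<le> s" for y s
      using limmax[OF that] by (simp add: \<psi>_def)
    fix d :: real assume d: "0 < d"
    define al where "al n = u (x, t) - v (x, t) - \<psi> (x, t) + \<psi> (X (f n), T (f n))" for n
    have all: "al \<longlonglongrightarrow> u (x, t) - v (x, t) - \<psi> (x, t) + \<psi> (x, t)" unfolding al_def by (intro tendsto_intros psil)
    have alu: "al n \<le> u (X (f n), S n) - v (X (f n), T (f n))" for n
      using wle[OF x t, of "f n"] S(2)[of n] pen0[of "f n" "S n - T (f n)"] by (simp add: al_def)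
    show "2 * a * (t - tc) \<le> tails d t t x"
    proof (rule field_le_epsilon)
      fix \<epsilon> :: real assume e: "0 < \<epsilon>"
      show "2 * a * (t - tc) \<le> tails d t t x + \<epsilon>"
      proof (rule tendsto_upperbound)
        show "(\<lambda>n. 2 * a * (T (f n) - tc)) \<longlonglongrightarrow> 2 * a * (t - tc)" by (intro tendsto_intros Tf)
        have all': "al \<longlonglongrightarrow> u (x, t) - v (x, t)" using all by simp
        show "\<forall>\<^sub>F n in sequentially. 2 * a * (T (f n) - tc) \<le> tails d t t x + \<epsilon>"
          using nonlocal_pair_limsup[OF XT(1) Xf S(1) Sl XT(2) Tf all' alu d e] eventually_ge_at_top[of n0]
        proof eventually_elim
          case (elim n) then show ?case using Sd[OF elim(2) d] by linarith
        qed
      qed simp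
    qed
  qed
qed

end


text \<open>\<open>k\<close> is constant just to the left of each time outside \<open>Z\<close>, so
  it grows only on \<open>Z\<close>. An open set slightly larger than \<open>Z\<close> makes points
  of \<open>Z\<close> manageable as well: there a whole left neighbourhood counts.\<close>

lemma lag_measure:
  fixes k :: "real \<Rightarrow> real"
  assumes t12: "t1 \<le> t2" and \<Lambda>: "0 \<le> \<Lambda>"
    and mono: "\<And>t t'. t1 \<le> t' \<Longrightarrow> t' \<le> t \<Longrightarrow> t \<le> t2 \<Longrightarrow> k t' \<le> k t"
    and lip: "\<And>t t'. t1 \<le> t' \<Longrightarrow> t' \<le> t \<Longrightarrow> t \<le> t2 \<Longrightarrow> k t - k t' \<le> \<Lambda> * (t - t')"
    and Z: "Z \<in> lmeasurable"
    and lag: "\<And>t. t1 < t \<Longrightarrow> t \<le> t2 \<Longrightarrow> t \<notin> Z \<Longrightarrow> \<exists>s<t. \<forall>\<tau>. s \<le> \<tau> \<longrightarrow> t1 \<le> \<tau> \<longrightarrow> \<tau> \<le> t \<longrightarrow> k \<tau> = k t"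
  shows "k t2 - k t1 \<le> \<Lambda> * measure lebesgue Z"
proof (rule field_le_epsilon)
  fix \<epsilon> :: real assume \<epsilon>: "0 < \<epsilon>"
  define \<epsilon>' where "\<epsilon>' = \<epsilon> / (\<Lambda> + 1)"
  have \<epsilon>': "0 < \<epsilon>'" "\<Lambda> * \<epsilon>' \<le> \<epsilon>"
    using \<epsilon> \<Lambda> by (auto simp: \<epsilon>'_def field_simps)
  obtain G where G: "open G" "Z \<subseteq> G" "G - Z \<in> lmeasurable" "emeasure lebesgue (G - Z) < ennreal \<epsilon>'"
    using sets_lebesgue_outer_open[OF fmeasurableD[OF Z] \<epsilon>'(1)] by blast
  define F where "F t = measure lebesgue (G \<inter> {t1..t})" for t
  have Gm: "G \<inter> {a..b} \<in> lmeasurable" for a b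
  proof -
    have "{a..b} \<inter> G \<in> lmeasurable" using G(1) by (intro fmeasurable_Int_fmeasurable) auto
    then show ?thesis by (simp add: Int_commute)
  qed
  have Fmono: "F t' \<le> F t" if "t' \<le> t" for t t'
    unfolding F_def using that Gm by (intro measure_mono_fmeasurable) (auto simp: fmeasurableD)
  have Flip: "F t \<le> F t' + (t - t')" if "t' \<le> t" for t t'
  proof -
    have "F t \<le> measure lebesgue ((G \<inter> {t1..t'}) \<union> {t'..t})"
      unfolding F_def using Gm by (intro measure_mono_fmeasurable fmeasurable.Un) (auto simp: fmeasurableD)
    also have "\<dots> \<le> F t' + measure lebesgue {t'..t}"
      unfolding F_def using Gm by (intro measure_Un_le) (auto simp: fmeasurableD)
    finally show ?thesis using that by simp
  qed
  have Fup: "F t' + (t - t') \<le> F t" if "t1 \<le> t'" "t' \<le> t" "{t'<..t} \<subseteq> G" for t t'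
  proof -
    have "F t' + measure lebesgue {t'<..t} = measure lebesgue ((G \<inter> {t1..t'}) \<union> {t'<..t})"
    proof -
      have "(G \<inter> {t1..t'}) \<inter> {t'<..t} = {}" by auto
      moreover have "{t'<..t} \<in> lmeasurable" by (rule fmeasurableI2[OF lmeasurable_cbox[of t' t]]) auto
      ultimately show ?thesis unfolding F_def using measure_Un3[OF Gm[of t1 t'], of "{t'<..t}"] by simp
    qed
    also have "\<dots> \<le> F t"
      unfolding F_def using that Gm by (intro measure_mono_fmeasurable) (auto simp: fmeasurableD)
    finally show ?thesis using that by simp
  qed
  \<comment> \<open>At every time after \<open>t1\<close> this function takes a value no larger at
    some earlier time. The leftmost point of the sublevel set \<open>T\<close> is therefore
    \<open>t1\<close>.\<close>
  define m where "m t = \<Lambda> * F t - k t" for t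
  define T where "T = {t\<in>{t1..t2}. m t \<le> m t2}"
  have mcont: "continuous_on {t1..t2} m"
  proof -
    have "\<bar>m t - m t'\<bar> \<le> 2 * \<Lambda> * \<bar>t - t'\<bar>" if "t \<in> {t1..t2}" "t' \<in> {t1..t2}" for t t'
    proof -
      have *: "\<bar>m t - m t'\<bar> \<le> 2 * \<Lambda> * \<bar>t - t'\<bar>" if "t \<in> {t1..t2}" "t' \<in> {t1..t2}" "t' \<le> t" for t t'
      proof -
        have "0 \<le> \<Lambda> * (F t - F t')" "\<Lambda> * (F t - F t') \<le> \<Lambda> * (t - t')"
          using Fmono[OF that(3)] Flip[OF that(3)] \<Lambda> by (auto intro: mult_left_mono)
        moreover have "0 \<le> k t - k t'" "k t - k t' \<le> \<Lambda> * (t - t')" using mono[of t' t] lip[of t' t] that by auto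
        moreover have "m t - m t' = \<Lambda> * (F t - F t') - (k t - k t')" by (simp add: m_def algebra_simps)
        ultimately show ?thesis using that(3) by simp
      qed
      show ?thesis using *[of t t'] *[of t' t] that abs_minus_commute[of t t'] abs_minus_commute[of "m t" "m t'"] by (cases "t' \<le> t") simp_all
    qed
    then have "(2 * \<Lambda>)-lipschitz_on {t1..t2} m"
      using \<Lambda> by (intro lipschitz_onI) (auto simp: dist_real_def)
    then show ?thesis by (rule lipschitz_on_continuous_on)
  qed
  have "closed T"
  proof -
    have "closed ({t1..t2} \<inter> m -` {..m t2})" by (rule continuous_closed_preimage[OF mcont]) auto
    moreover have "{t1..t2} \<inter> m -` {..m t2} = T" unfolding T_def by blast
    ultimately show ?thesis by simp
  qed
  have Tne: "t2 \<in> T" using t12 by (simp add: T_def)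
  have Tb: "bdd_below T" by (intro bdd_belowI[of _ t1]) (simp add: T_def)
  define a where "a = Inf T"
  have a: "a \<in> T" unfolding a_def using \<open>closed T\<close> Tne Tb by (intro closed_contains_Inf) auto
  have "a = t1"
  proof (rule ccontr)
    assume "a \<noteq> t1"
    then have at: "t1 < a" "a \<le> t2" using a by (auto simp: T_def)
    have "\<exists>s. t1 \<le> s \<and> s < a \<and> m s \<le> m a"
    \<comment> \<open>Outside \<open>Z\<close> the term \<open>k\<close> is stationary and
      \<open>F\<close> does not increase to the left; inside, \<open>F\<close> changes at full rate
      and beats the Lipschitz bound of \<open>k\<close>.\<close>
    proof (cases "a \<in> Z")
      case False
      then obtain s where s: "s < a" "\<And>\<tau>. s \<le> \<tau> \<Longrightarrow> t1 \<le> \<tau> \<Longrightarrow> \<tau> \<le> a \<Longrightarrow> k \<tau> = k a" using lag[OF at False] by blast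
      define s' where "s' = max s t1"
      have s': "s \<le> s'" "t1 \<le> s'" "s' < a" using s at by (auto simp: s'_def)
      then have "k s' = k a" "F s' \<le> F a" using s(2)[of s'] Fmono[of s' a] by auto
      then have "m s' \<le> m a" using \<Lambda> by (simp add: m_def mult_left_mono)
      then show ?thesis using s' by blast
    next
      case True
      then obtain e where e: "e > 0" "ball a e \<subseteq> G" using G by (meson openE subsetD)
      define s where "s = max t1 (a - e / 2)"
      have s: "t1 \<le> s" "s < a" "a - e / 2 \<le> s" using at e by (auto simp: s_def)
      have "{s<..a} \<subseteq> G"
      proof
        fix y assume "y \<in> {s<..a}" then have "dist a y < e" using s e by (auto simp: dist_real_def)
        then show "y \<in> G" using e(2) by auto
      qed
      then have "F s + (a - s) \<le> F a" using s by (intro Fup) auto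
      then have "\<Lambda> * (F s + (a - s)) \<le> \<Lambda> * F a" using \<Lambda> by (rule mult_left_mono)
      moreover have "k a - k s \<le> \<Lambda> * (a - s)" using lip[of s a] s at by simp
      ultimately have "m s \<le> m a" by (simp add: m_def distrib_left)
      then show ?thesis using s by blast
    qed
    then obtain s where s: "t1 \<le> s" "s < a" "m s \<le> m a" by blast
    then have "s \<in> T" using a at by (auto simp: T_def)
    then have "a \<le> s" unfolding a_def using Tb by (rule cInf_lower)
    then show False using s by simp
  qed
  then have "m t1 \<le> m t2" using a by (simp add: T_def)
  then have "k t2 - k t1 \<le> \<Lambda> * F t2 - \<Lambda> * F t1" by (simp add: m_def)
  also have "\<dots> \<le> \<Lambda> * (measure lebesgue Z + \<epsilon>')"
  proof -
    have "0 \<le> F t1" by (simp add: F_def)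
    moreover have "F t2 \<le> measure lebesgue Z + \<epsilon>'"
    proof -
      have "F t2 \<le> measure lebesgue (Z \<union> (G - Z))"
        unfolding F_def using Gm Z G(3) by (intro measure_mono_fmeasurable fmeasurable.Un) (auto simp: fmeasurableD)
      also have "\<dots> \<le> measure lebesgue Z + measure lebesgue (G - Z)"
        using Z G(3) by (intro measure_Un_le) (auto simp: fmeasurableD)
      also have "measure lebesgue (G - Z) \<le> \<epsilon>'"
        using G(3,4) \<epsilon>'(1) by (simp add: emeasure_eq_measure2 ennreal_less_iff)
      finally show ?thesis by simp
    qed
    ultimately have "F t2 - F t1 \<le> measure lebesgue Z + \<epsilon>'" by simp
    then show ?thesis using \<Lambda> by (simp add: mult_left_mono flip: right_diff_distrib)
  qed
  also have "\<dots> \<le> \<Lambda> * measure lebesgue Z + \<epsilon>" using \<epsilon>'(2) by (simp add: distrib_left)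
  finally show "k t2 - k t1 \<le> \<Lambda> * measure lebesgue Z + \<epsilon>" .
qed

section \<open>Forward slopes and contact times of the sup-convolution\<close>

context hj_pair
begin

lemma nonlocal_tail_bounded:
  assumes x: "x \<in> cl" and d: "0 < d" and b: "0 \<le> b" and le: "\<And>z. x + z \<in> cl \<Longrightarrow> f (x + z) - f x \<le> b"
  shows "nl (- ball 0 d) f x \<le> b * N * d powr - sg"
proof (rule nonlocal_upper[where G = "\<lambda>_. b"])
  have "(\<integral>\<^sup>+z\<in>- ball 0 d. ennreal b \<partial>nu x) = ennreal b * emeasure (nu x) (- ball 0 d)"
    using x by (intro nn_integral_cmult_indicator) (simp add: sets_nu)
  also have "\<dots> \<le> ennreal b * ennreal (N * d powr - sg)" using mass[OF x d] by (intro mult_left_mono) auto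
  also have "\<dots> = ennreal (b * N * d powr - sg)" using b N1 by (simp add: ennreal_mult[symmetric] mult.assoc)
  finally show "(\<integral>\<^sup>+z\<in>- ball 0 d. ennreal b \<partial>nu x) \<le> ennreal (b * N * d powr - sg)" .
qed (use le b N1 in auto)

text \<open>
  Time slopes of \<open>u\<close> are bounded from above: an argmax \<open>s > t\<close> would be a point where the
  subsolution has time derivative \<open>l\<close>.
\<close>

lemma forward_argmax:
  assumes lL: "0 < l" "l \<le> L" and K1: "1 \<le> K"
    and lip: "\<And>y. y \<in> cl \<Longrightarrow> \<bar>sc L l 0 t x - sc L l 0 t y\<bar> \<le> K * dist x y"
    and x: "x \<in> Om" and t: "0 < t" and s: "t < s1" and am: "sc L l 0 t x = u (x, s1) - pen L l 0 (s1 - t)"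
    and CH: "\<And>x p. x \<in> cl \<Longrightarrow> - CH \<le> H x p" and d: "0 < d" "d < 1"
  shows "l \<le> CH + \<bar>c\<bar> + 5 * K * N * d powr (1 - sg) + 2 * B * N * d powr - sg"
proof (rule field_le_epsilon)
  fix \<eta> :: real assume \<eta>: "0 < \<eta>"
  have xc: "x \<in> cl" using x Om_cl by simp
  have K0: "0 < K" using K1 by simp
  define D where "D = s1 - t"
  have D: "0 < D" using s by (simp add: D_def)
  \<comment> \<open>The parabola \<open>Q * (s - s1)\<^sup>2\<close> added to the line of slope
    \<open>l\<close> must dominate the steeper penalty before \<open>t\<close>; its slope gain
    \<open>2 * Q * D\<close> at \<open>t\<close> is exactly \<open>L + l\<close>.\<close>
  define Q where "Q = (L + l) / (2 * D)"
  have Q: "0 < Q" "2 * Q * D = L + l" using lL D by (auto simp: Q_def)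
  obtain \<rho> where \<rho>: "\<rho> > 0" "ball x \<rho> \<subseteq> Om" using x open_Om by (meson openE)
  \<comment> \<open>Four demands on the space penalty: the maximum stays after \<open>t\<close>, its
    time is close enough to \<open>s1\<close>, and its point stays in \<open>Om\<close> and within
    distance \<open>d\<close> of \<open>x\<close>.\<close>
  define E where "E = min (min (Q * D\<^sup>2 / (2 * K\<^sup>2)) (Q * (\<eta> / (2 * Q))\<^sup>2 / K\<^sup>2)) (min (\<rho> / (2 * K)) (d / (2 * K)))"
  have E: "0 < E" "K\<^sup>2 * E < Q * D\<^sup>2" "K\<^sup>2 * E \<le> Q * (\<eta> / (2 * Q))\<^sup>2" "K * E < \<rho>" "K * E < d"
  proof -
    show E0: "0 < E" using Q D K0 \<eta> \<rho> d by (simp add: E_def)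
    have "K\<^sup>2 * E \<le> K\<^sup>2 * (Q * D\<^sup>2 / (2 * K\<^sup>2))" by (intro mult_left_mono) (auto simp: E_def)
    also have "\<dots> = Q * D\<^sup>2 / 2" using K0 by simp
    also have "\<dots> < Q * D\<^sup>2" using Q D by simp
    finally show "K\<^sup>2 * E < Q * D\<^sup>2" .
    have "K\<^sup>2 * E \<le> K\<^sup>2 * (Q * (\<eta> / (2 * Q))\<^sup>2 / K\<^sup>2)" by (intro mult_left_mono) (auto simp: E_def)
    also have "\<dots> = Q * (\<eta> / (2 * Q))\<^sup>2" using K0 by simp
    finally show "K\<^sup>2 * E \<le> Q * (\<eta> / (2 * Q))\<^sup>2" .
    have "K * E \<le> K * (\<rho> / (2 * K))" using K0 by (intro mult_left_mono) (auto simp: E_def)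
    also have "\<dots> < \<rho>" using K0 \<rho> by simp
    finally show "K * E < \<rho>" .
    have "K * E \<le> K * (d / (2 * K))" using K0 by (intro mult_left_mono) (auto simp: E_def)
    also have "\<dots> < d" using K0 d by simp
    finally show "K * E < d" .
  qed
  let ?U = "sc L l 0 t"
  define \<rho>t where "\<rho>t s = l * (s - t) + Q * (s - s1)\<^sup>2" for s
  define \<phi> :: "'a \<times> real \<Rightarrow> real" where "\<phi> q = 1 / E * (norm (fst q - x))\<^sup>2 + \<rho>t (snd q)" for q
  define G :: "'a \<times> real \<Rightarrow> 'a \<times> real" where
    "G q = ((2 * (1 / E)) *\<^sub>R (fst q - x), 0 * (norm (fst q - x))\<^sup>2 + (l + 2 * Q * (snd q - s1)))" for q
  have hG: "has_C1_gradient (cl \<times> {0..}) \<phi> G"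
    unfolding \<phi>_def G_def
    by (rule C1_gradient_time_paraboloid) (auto simp: \<rho>t_def intro!: derivative_eq_intros continuous_intros)
  have below: "u (y, s) - l * (s - t) - Q * (s - s1)\<^sup>2 \<le> ?U y - (if t \<le> s then Q * (s - s1)\<^sup>2 else Q * D\<^sup>2)"
    if y: "y \<in> cl" "0 \<le> s" for y s
  proof -
    have g: "u (y, s) - pen L l 0 (s - t) \<le> ?U y" using sc_ge[OF lL order_refl y(1) less_imp_le[OF t] y(2)] .
    show ?thesis
    proof (cases "t \<le> s")
      case True then show ?thesis using g by (cases "t = s") (auto simp: pen_zero)
    next
      case False
      have "(s - s1)\<^sup>2 = D\<^sup>2 + 2 * D * (t - s) + (t - s)\<^sup>2" by (simp add: D_def power2_eq_square algebra_simps)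
      then have "Q * (D\<^sup>2 + 2 * D * (t - s)) \<le> Q * (s - s1)\<^sup>2" using Q by (intro mult_left_mono) auto
      moreover have "Q * (D\<^sup>2 + 2 * D * (t - s)) = Q * D\<^sup>2 + (2 * Q * D) * (t - s)" by (simp add: algebra_simps)
      ultimately have "Q * D\<^sup>2 + (L + l) * (t - s) \<le> Q * (s - s1)\<^sup>2" unfolding Q(2) by simp
      moreover have "pen L l 0 (s - t) = L * (t - s)" using False by (simp add: pen_zero algebra_simps)
      moreover have "(L + l) * (t - s) = L * (t - s) + l * (t - s)" "l * (s - t) = - (l * (t - s))" by (simp_all add: algebra_simps)
      ultimately show ?thesis using g False by simp
    qed
  qed
  define F where "F q = u q + - \<phi> q" for q
  have F: "usc_on (cl \<times> {0..}) F"
    unfolding F_def \<phi>_def \<rho>t_def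
    by (intro usc_on_add uusc continuous_on_imp_usc_on continuous_on_minus continuous_intros)
  have q0: "(x, s1) \<in> cl \<times> {0..}" using xc s t by simp
  have V: "F (x, s1) = ?U x" using am s by (simp add: F_def \<phi>_def \<rho>t_def pen_zero)
  have sub: "{q\<in>cl \<times> {0..}. F (x, s1) \<le> F q} \<subseteq> cl \<times> cball s1 (2 * B / Q + 1 + D + t)"
  proof
    fix q assume q: "q \<in> {q\<in>cl \<times> {0..}. F (x, s1) \<le> F q}"
    obtain y s where qd: "q = (y, s)" "y \<in> cl" "0 \<le> s" using q by auto
    have "0 \<le> 1 / E * (norm (y - x))\<^sup>2" using E by simp
    then have "?U x \<le> ?U y - (if t \<le> s then Q * (s - s1)\<^sup>2 else Q * D\<^sup>2)"
      using below[OF qd(2,3)] q V by (simp add: F_def \<phi>_def \<rho>t_def qd)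
    moreover have "?U y \<le> B" "- B \<le> ?U x"
      using sc_bounds(2)[OF lL order_refl qd(2) less_imp_le[OF t]] sc_bounds(3)[OF lL order_refl xc less_imp_le[OF t]] by auto
    ultimately have k: "t \<le> s \<Longrightarrow> Q * (s - s1)\<^sup>2 \<le> 2 * B" by simp
    have "\<bar>s - s1\<bar> \<le> 2 * B / Q + 1 + D + t"
    proof (cases "t \<le> s")
      case True
      then have "(s - s1)\<^sup>2 \<le> 2 * B / Q" using k Q by (simp add: field_simps)
      moreover have "\<bar>s - s1\<bar> \<le> (s - s1)\<^sup>2 + 1" by (rule abs_le_square_plus_one)
      ultimately show ?thesis using D t by simp
    next
      case False
      have "0 \<le> 2 * B / Q" using B0 Q by simp
      then show ?thesis using False qd s by (simp add: D_def)
    qed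
    then show "q \<in> cl \<times> cball s1 (2 * B / Q + 1 + D + t)" using qd by (auto simp: dist_real_def abs_minus_commute)
  qed
  have bnd: "bounded {q\<in>cl \<times> {0..}. F (x, s1) \<le> F q}"
    by (rule bounded_subset[OF _ sub]) (intro bounded_Times compact_imp_bounded[OF compact_cl] bounded_cball)
  have "closed (cl \<times> {0::real..})" by (intro closed_Times closed_closure closed_atLeast)
  then obtain q where q: "q \<in> cl \<times> {0..}" "\<And>q'. q' \<in> cl \<times> {0..} \<Longrightarrow> F q' \<le> F q"
    using usc_attains_max[OF F _ q0 bnd] by blast
  obtain y s where qd: "q = (y, s)" "y \<in> cl" "0 \<le> s" using q(1) by auto
  have Vle: "?U x \<le> u (y, s) - 1 / E * (norm (y - x))\<^sup>2 - (l * (s - t) + Q * (s - s1)\<^sup>2)"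
    using q(2)[OF q0] V by (simp add: F_def \<phi>_def \<rho>t_def qd)
  have lipy: "?U y - ?U x \<le> K * norm (y - x)" using lip[OF qd(2)] by (simp add: dist_norm norm_minus_commute abs_le_iff)
  \<comment> \<open>From here the quadratic space penalty is weighed against the Lipschitz bound of
    the sup-convolution, which confines the maximum to distance \<open>K * E\<close> from
    \<open>x\<close>.\<close>
  have pos: "0 \<le> (if t \<le> s then Q * (s - s1)\<^sup>2 else Q * D\<^sup>2)" using Q by simp
  have "1 / E * (norm (y - x))\<^sup>2 \<le> K * norm (y - x)" using Vle below[OF qd(2,3)] lipy pos by linarith
  then have "norm (y - x) * norm (y - x) \<le> (K * E) * norm (y - x)" using E by (simp add: field_simps power2_eq_square)
  then have yx: "norm (y - x) \<le> K * E" using K0 E by (cases "norm (y - x) = 0") auto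
  have sq: "(if t \<le> s then Q * (s - s1)\<^sup>2 else Q * D\<^sup>2) \<le> K\<^sup>2 * E"
  proof -
    have "K * norm (y - x) \<le> K * (K * E)" using yx K0 by (intro mult_left_mono) auto
    moreover have "0 \<le> 1 / E * (norm (y - x))\<^sup>2" using E by simp
    ultimately show ?thesis using Vle below[OF qd(2,3)] lipy by (simp add: power2_eq_square mult.assoc)
  qed
  have ts: "t \<le> s" using sq E(2) by (auto split: if_splits)
  have s0: "0 < s" using ts t by simp
  \<comment> \<open>Makes the time derivative of the test function,
    \<open>l + 2 * Q * (s - s1)\<close>, at least \<open>l - \<eta>\<close>.\<close>
  have "Q * (s - s1)\<^sup>2 \<le> Q * (\<eta> / (2 * Q))\<^sup>2" using sq ts E(3) by simp
  then have "(s - s1)\<^sup>2 \<le> (\<eta> / (2 * Q))\<^sup>2" using Q by simp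
  then have "\<bar>s - s1\<bar> \<le> \<bar>\<eta> / (2 * Q)\<bar>" by (simp only: abs_le_square_iff)
  also have "\<bar>\<eta> / (2 * Q)\<bar> = \<eta> / (2 * Q)" using Q \<eta> by simp
  finally have "- (\<eta> / (2 * Q)) \<le> s - s1" by linarith
  then have "2 * Q * (- (\<eta> / (2 * Q))) \<le> 2 * Q * (s - s1)" using Q by (intro mult_left_mono) auto
  then have ss: "2 * Q * (s - s1) \<ge> - \<eta>" using Q by simp
  have yO: "y \<in> Om" using yx E(4) \<rho>(2) by (auto simp: dist_norm norm_minus_commute)
  have \<delta>: "0 < K * E" "K * E < 1" "K * E \<le> d" using K0 E d by auto
  have mxq: "u q' - \<phi> q' \<le> u (y, s) - \<phi> (y, s)" if "q' \<in> cl \<times> {0..}" for q' using q(2)[OF that] by (simp add: F_def qd)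
  have T: "l + 2 * Q * (s - s1) + H y (fst (G (y, s))) - c \<le> nl (ball 0 (K * E)) (\<lambda>y. \<phi> (y, s)) y + nl (- ball 0 (K * E)) (\<lambda>y. u (y, s)) y"
    using sub_test[OF hG yO s0 \<delta>(1) mxq] by (simp add: G_def)
  have 1: "nl (ball 0 (K * E)) (\<lambda>y. \<phi> (y, s)) y \<le> (3 * K) * N * (K * E) powr (1 - sg)"
  proof (rule nonlocal_ball_upper[OF qd(2) \<delta>(1,2)])
    fix z :: 'a assume z: "norm z < K * E"
    have "(norm (y + z - x))\<^sup>2 \<le> (norm (y - x) + norm z)\<^sup>2"
      using norm_triangle_ineq[of "y - x" z] by (intro power_mono) (auto simp: algebra_simps)
    then have "(norm (y + z - x))\<^sup>2 - (norm (y - x))\<^sup>2 \<le> (2 * norm (y - x) + norm z) * norm z"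
      by (simp add: power2_eq_square algebra_simps)
    also have "\<dots> \<le> (3 * K * E) * norm z" using yx z by (intro mult_right_mono) auto
    finally have "1 / E * ((norm (y + z - x))\<^sup>2 - (norm (y - x))\<^sup>2) \<le> 1 / E * ((3 * K * E) * norm z)"
      using E by (intro mult_left_mono) auto
    then show "\<phi> (y + z, s) - \<phi> (y, s) \<le> 3 * K * norm z" using E by (simp add: \<phi>_def right_diff_distrib)
  qed (use K0 in simp)
  \<comment> \<open>Jumps longer than \<open>K * E\<close> exceed the displacement from
    \<open>x\<close>, so the Lipschitz bound centred at \<open>x\<close> becomes a bound by
    \<open>2 * K * norm z\<close> centred at \<open>y\<close>.\<close>
  have 2: "nl (- ball 0 (K * E)) (\<lambda>y. u (y, s)) y \<le> nl (- ball 0 d) (\<lambda>y. u (y, s)) y + (2 * K) * N * d powr (1 - sg)"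
  proof (rule nonlocal_tail_upper[OF u_tame[OF qd(3)] qd(2) \<delta>(1,3) d(2)])
    fix z assume z: "K * E \<le> norm z" and yz: "y + z \<in> cl"
    have "u (y + z, s) - l * (s - t) \<le> ?U (y + z)" using below[OF yz qd(3)] ts by simp
    moreover have "?U (y + z) - ?U x \<le> K * norm (y + z - x)" using lip[OF yz] by (simp add: dist_norm norm_minus_commute abs_le_iff)
    moreover have "norm (y + z - x) \<le> 2 * norm z" using norm_triangle_ineq[of "y - x" z] yx z by (simp add: algebra_simps)
    then have "K * norm (y + z - x) \<le> K * (2 * norm z)" using K0 by (intro mult_left_mono) auto
    moreover have "0 \<le> 1 / E * (norm (y - x))\<^sup>2" "0 \<le> Q * (s - s1)\<^sup>2" using E Q by auto
    ultimately show "u (y + z, s) - u (y, s) \<le> 2 * K * norm z" using Vle by linarith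
  qed (use K0 in simp)
  have 3: "nl (- ball 0 d) (\<lambda>y. u (y, s)) y \<le> 2 * B * N * d powr - sg"
  proof (rule nonlocal_tail_bounded[OF qd(2) d(1)])
    fix z assume "y + z \<in> cl"
    then have "\<bar>u (y + z, s)\<bar> \<le> B" "\<bar>u (y, s)\<bar> \<le> B" using uB qd by auto
    then show "u (y + z, s) - u (y, s) \<le> 2 * B" by simp
  qed (use B0 in simp)
  have 4: "(3 * K) * N * (K * E) powr (1 - sg) \<le> (3 * K) * N * d powr (1 - sg)"
    using \<delta> K0 N1 sg by (intro mult_left_mono powr_mono2) auto
  have "5 * K * N * d powr (1 - sg) = (3 * K) * N * d powr (1 - sg) + (2 * K) * N * d powr (1 - sg)" by (simp add: algebra_simps)
  then show "l \<le> CH + \<bar>c\<bar> + 5 * K * N * d powr (1 - sg) + 2 * B * N * d powr - sg + \<eta>"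
    using T 1 2 3 4 ss CH[OF qd(2), of "fst (G (y, s))"] by linarith
qed

lemma sc_time_lipschitz:
  assumes lL: "0 < l" "l \<le> L" and x: "x \<in> cl" and t: "0 \<le> t" "t \<le> t'"
  shows "sc L l 0 t x - L * (t' - t) \<le> sc L l 0 t' x" "sc L l 0 t' x \<le> sc L l 0 t x + l * (t' - t)"
proof -
  have t': "0 \<le> t'" using t by simp
  have p: "pen L l 0 (s - t') \<le> pen L l 0 (s - t) + L * (t' - t)" "pen L l 0 (s - t) \<le> pen L l 0 (s - t') + l * (t' - t)" for s
  proof -
    show "pen L l 0 (s - t') \<le> pen L l 0 (s - t) + L * (t' - t)"
      using pen_lipschitz[OF lL order_refl, of "s - t'" "s - t"] t by simp
    show "pen L l 0 (s - t) \<le> pen L l 0 (s - t') + l * (t' - t)"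
    proof (cases "s \<le> t")
      case True
      have "L * (t' - t) \<ge> 0" "l * (t' - t) \<ge> 0" using lL t by auto
      then show ?thesis using True t by (simp add: pen_zero algebra_simps)
    next
      case False
      then show ?thesis
      proof (cases "s \<le> t'")
        case True
        have "l * (s - t) \<le> l * (t' - t)" "0 \<le> L * (t' - s)" using True lL by (auto intro!: mult_left_mono)
        then show ?thesis using True False by (simp add: pen_zero algebra_simps)
      qed (simp add: pen_zero algebra_simps)
    qed
  qed
  obtain s where s: "0 \<le> s" "sc L l 0 t x = u (x, s) - pen L l 0 (s - t)" using sc_attained[OF lL order_refl x t(1)] .
  show "sc L l 0 t x - L * (t' - t) \<le> sc L l 0 t' x"
    using s(2) sc_ge[OF lL order_refl x t' s(1)] p(1)[of s] by linarith
  obtain s' where s': "0 \<le> s'" "sc L l 0 t' x = u (x, s') - pen L l 0 (s' - t')" using sc_attained[OF lL order_refl x t'] .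
  show "sc L l 0 t' x \<le> sc L l 0 t x + l * (t' - t)"
    using s'(2) sc_ge[OF lL order_refl x t(1) s'(1)] p(2)[of s'] by linarith
qed

text \<open>At a time without contact every argmax lies strictly in the past, and from there on
  \<open>sc\<close> decreases at exactly the rate \<open>L\<close>; adding \<open>L * t\<close>
  makes it stationary. As the total gain is at least \<open>L * (t2 - t1) - 2 * B\<close>, contact
  must occupy all but a fraction of order \<open>(l + 1) / L\<close> of the time.\<close>

lemma noncontact_measure:
  assumes lL: "0 < l" "l \<le> L" and x: "x \<in> cl" and t: "0 \<le> t1" "t1 \<le> t2"
    and nofwd: "\<And>t s. t1 \<le> t \<Longrightarrow> t \<le> t2 \<Longrightarrow> sc L l 0 t x = u (x, s) - pen L l 0 (s - t) \<Longrightarrow> s \<le> t"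
    and Z: "{t\<in>{t1..t2}. sc L l 0 t x = u (x, t)} \<in> lmeasurable"
  shows "L * (t2 - t1) - 2 * B \<le> (L + l) * measure lebesgue {t\<in>{t1..t2}. sc L l 0 t x = u (x, t)}"
proof -
  define k where "k t = sc L l 0 t x + L * t" for t
  have "k t2 - k t1 \<le> (L + l) * measure lebesgue {t\<in>{t1..t2}. sc L l 0 t x = u (x, t)}"
  proof (rule lag_measure[OF t(2) _ _ _ Z])
    fix t t' assume "t1 \<le> t'" "t' \<le> t"
    then have t': "0 \<le> t'" "t' \<le> t" using t by auto
    show "k t' \<le> k t" using sc_time_lipschitz(1)[OF lL x t'] by (simp add: k_def algebra_simps)
    show "k t - k t' \<le> (L + l) * (t - t')" using sc_time_lipschitz(2)[OF lL x t'] by (simp add: k_def algebra_simps)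
  next
    fix \<tau> assume \<tau>: "t1 < \<tau>" "\<tau> \<le> t2" "\<tau> \<notin> {t\<in>{t1..t2}. sc L l 0 t x = u (x, t)}"
    have \<tau>0: "0 \<le> \<tau>" using \<tau> t by simp
    obtain s where s: "0 \<le> s" "sc L l 0 \<tau> x = u (x, s) - pen L l 0 (s - \<tau>)" using sc_attained[OF lL order_refl x \<tau>0] .
    have "s \<noteq> \<tau>" using s(2) \<tau> by auto
    then have st: "s < \<tau>" using nofwd[OF _ \<tau>(2) s(2)] \<tau> by simp
    show "\<exists>s<\<tau>. \<forall>\<tau>'. s \<le> \<tau>' \<longrightarrow> t1 \<le> \<tau>' \<longrightarrow> \<tau>' \<le> \<tau> \<longrightarrow> k \<tau>' = k \<tau>"
    proof (intro exI[of _ s] conjI allI impI st)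
      fix r assume r: "s \<le> r" "t1 \<le> r" "r \<le> \<tau>"
      have r0: "0 \<le> r" using r t by simp
      have "k r \<le> k \<tau>" using sc_time_lipschitz(1)[OF lL x r0 r(3)] by (simp add: k_def algebra_simps)
      \<comment> \<open>The argmax \<open>s\<close> of the later time competes at \<open>r\<close>
        too, with its penalty reduced by \<open>L * (\<tau> - r)\<close>.\<close>
      moreover have "k \<tau> \<le> k r"
        using sc_ge[OF lL order_refl x r0 s(1)] s(2) r st by (simp add: k_def pen_zero algebra_simps)
      ultimately show "k r = k \<tau>" by simp
    qed
  qed (use lL in simp)
  moreover have "k t2 - k t1 \<ge> L * (t2 - t1) - 2 * B"
    using sc_bounds(3)[OF lL order_refl x, of t2] sc_bounds(2)[OF lL order_refl x, of t1] t by (simp add: k_def algebra_simps)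
  ultimately show ?thesis by linarith
qed

end


section \<open>Points of maximal difference\<close>

context hj_pair
begin

lemma pair_tail_nonpos:
  assumes x: "x \<in> cl" and t: "0 \<le> t" and d: "0 < d"
    and max: "\<And>y. y \<in> cl \<Longrightarrow> u (y, t) - v (y, t) \<le> u (x, t) - v (x, t)"
  shows "tails d t t x \<le> 0"
proof -
  have "nl (- ball 0 d) (\<lambda>y. u (y, t) + - v (y, t)) x \<le> 0"
  proof (rule nonlocal_upper[where G = "\<lambda>_. 0"])
    fix z assume "x + z \<in> cl"
    from max[OF this] show "u (x + z, t) + - v (x + z, t) - (u (x, t) + - v (x, t)) \<le> 0" by simp
  qed simp_all
  then show ?thesis using nonlocal_add[OF u_tame[OF t] v_tame[OF t] x d] by simp
qed

end

locale hj_contact = hj_pair Om nu sg N H c B u v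
  for Om :: "'a::euclidean_space set" and nu sg N H c B u v +
  fixes M t0 :: real
  assumes wM: "\<And>q. q \<in> closure Om \<times> {0..} \<Longrightarrow> u q - v q \<le> M"
    and t0: "0 < t0"
    and contact0: "\<exists>x\<in>closure Om. u (x, t0) - v (x, t0) = M"
begin

lemma w_usc: "usc_on (cl \<times> {0..}) (\<lambda>q. u q - v q)"
  using usc_on_add[OF uusc vlsc] by simp

text \<open>If contact were missing at \<open>t1\<close>, there would be a first later contact time
  \<open>\<beta>\<close>. A parabola in time with vertex between them forces a maximum on its
  increasing branch, where the time derivative is positive although the nonlocal terms are
  nonpositive.\<close>

lemma contact_before:
  assumes "0 < t1" "t1 \<le> t0"
  shows "\<exists>x\<in>cl. u (x, t1) - v (x, t1) = M"
proof (rule ccontr)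
  assume no: "\<not> ?thesis"
  define C where "C = {q\<in>cl \<times> {t1..t0}. M \<le> u q - v q}"
  have sub: "cl \<times> {t1..t0} \<subseteq> cl \<times> {0..}" using assms by auto
  have cpt: "compact (cl \<times> {t1..t0})" by (intro compact_Times compact_cl) auto
  have "closed C"
    unfolding C_def by (rule closed_usc_superlevel[OF usc_on_subset[OF w_usc sub] compact_imp_closed[OF cpt]])
  then have "compact C" using compact_Int_closed[OF cpt, of C] by (simp add: C_def Int_absorb1 Collect_conj_eq)
  then have E: "compact (snd ` C)" by (intro compact_continuous_image continuous_intros)
  obtain x0 where x0: "x0 \<in> cl" "u (x0, t0) - v (x0, t0) = M" using contact0 by blast
  have "(x0, t0) \<in> C" using x0 assms by (simp add: C_def)
  then have ne: "snd ` C \<noteq> {}" by blast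
  obtain \<beta> where \<beta>: "\<beta> \<in> snd ` C" "\<And>t. t \<in> snd ` C \<Longrightarrow> \<beta> \<le> t" using compact_attains_inf[OF E ne] by blast
  obtain xb where xb: "xb \<in> cl" "t1 \<le> \<beta>" "\<beta> \<le> t0" "M \<le> u (xb, \<beta>) - v (xb, \<beta>)" using \<beta>(1) by (auto simp: C_def)
  have wb: "u (xb, \<beta>) - v (xb, \<beta>) = M" using xb wM[of "(xb, \<beta>)"] assms by auto
  have "t1 < \<beta>" using no wb xb by (cases "t1 = \<beta>") auto
  define \<tau> where "\<tau> = (\<beta> - t1) / 2"
  have \<tau>: "0 < \<tau>" "t1 + \<tau> + \<tau> = \<beta>" using \<open>t1 < \<beta>\<close> by (auto simp: \<tau>_def)
  let ?S = "cl \<times> {t1..t1 + \<tau>}"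
  have cS: "compact ?S" by (intro compact_Times compact_cl) auto
  have S: "?S \<subseteq> cl \<times> {0..}" using assms by auto
  obtain q1 where q1: "q1 \<in> ?S" "\<And>q. q \<in> ?S \<Longrightarrow> u q - v q \<le> u q1 - v q1"
  proof (rule usc_attains_max[OF usc_on_subset[OF w_usc S] compact_imp_closed[OF cS], of "(xb, t1)"])
    show "(xb, t1) \<in> ?S" using xb \<tau> by simp
    show "bounded {x\<in>?S. u (xb, t1) - v (xb, t1) \<le> u x - v x}"
      by (rule bounded_subset[OF compact_imp_bounded[OF cS]]) auto
  qed (rule that)
  define m where "m = u q1 - v q1"
  have "m < M"
  proof (rule ccontr)
    assume "\<not> m < M"
    then have "q1 \<in> C" using q1(1) \<tau> xb by (auto simp: C_def m_def)
    then have "\<beta> \<le> snd q1" using \<beta>(2) by blast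
    then show False using q1(1) \<tau> by auto
  qed
  \<comment> \<open>At \<open>\<beta>\<close> the parabola costs half of \<open>M - m\<close>, so
    the value there still beats everything on the slab just after \<open>t1\<close>.\<close>
  define a where "a = (M - m) / (2 * \<tau>\<^sup>2)"
  have a: "0 < a" "a * \<tau>\<^sup>2 = (M - m) / 2" using \<open>m < M\<close> \<tau> by (auto simp: a_def)
  have pos: "t1 + \<tau> < t" if x: "x \<in> cl" "0 \<le> t"
    and mx: "\<And>y s. y \<in> cl \<Longrightarrow> 0 \<le> s \<Longrightarrow>
      u (y, s) - v (y, s) - a * (s - (t1 + \<tau>))\<^sup>2 \<le> u (x, t) - v (x, t) - a * (t - (t1 + \<tau>))\<^sup>2" for x t
  proof (rule ccontr)
    assume n: "\<not> t1 + \<tau> < t"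
    have "\<beta> - (t1 + \<tau>) = \<tau>" using \<tau> by simp
    then have V: "M - (M - m) / 2 \<le> u (x, t) - v (x, t) - a * (t - (t1 + \<tau>))\<^sup>2"
      using mx[OF xb(1), of \<beta>] xb(2) assms(1) wb unfolding \<open>\<beta> - (t1 + \<tau>) = \<tau>\<close> a(2) by simp
    show False
    proof (cases "t1 \<le> t")
      case True
      then have "u (x, t) - v (x, t) \<le> m" using q1(2)[of "(x, t)"] x n by (simp add: m_def)
      moreover have "0 \<le> a * (t - (t1 + \<tau>))\<^sup>2" using a by simp
      ultimately show False using V \<open>m < M\<close> by (simp add: field_simps)
    next
      case False
      have "\<tau>\<^sup>2 < (t1 + \<tau> - t)\<^sup>2" using False \<tau> by (intro power_strict_mono) auto
      then have "a * \<tau>\<^sup>2 < a * (t - (t1 + \<tau>))\<^sup>2" using a by (simp add: power2_commute)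
      moreover have "u (x, t) - v (x, t) \<le> M" using wM[of "(x, t)"] x by simp
      ultimately show False using V a(2) by linarith
    qed
  qed
  obtain x t where xt: "x \<in> cl" "0 < t"
    "\<And>y s. y \<in> cl \<Longrightarrow> 0 \<le> s \<Longrightarrow>
      u (y, s) - v (y, s) - a * (s - (t1 + \<tau>))\<^sup>2 \<le> u (x, t) - v (x, t) - a * (t - (t1 + \<tau>))\<^sup>2"
    "\<And>d. 0 < d \<Longrightarrow> 2 * a * (t - (t1 + \<tau>)) \<le> tails d t t x"
  proof (rule time_localized[OF a(1), of "t1 + \<tau>"])
    fix x t assume "x \<in> cl" "0 \<le> t" "\<And>y s. y \<in> cl \<Longrightarrow> 0 \<le> s \<Longrightarrow>
      u (y, s) - v (y, s) - a * (s - (t1 + \<tau>))\<^sup>2 \<le> u (x, t) - v (x, t) - a * (t - (t1 + \<tau>))\<^sup>2"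
    from pos[OF this] show "0 < t" using \<tau> assms by simp
  qed (rule that)
  have "t1 + \<tau> < t" using pos[OF xt(1) less_imp_le[OF xt(2)] xt(3)] .
  then have "0 < 2 * a * (t - (t1 + \<tau>))" using a by simp
  also have "\<dots> \<le> 0"
  proof (rule order_trans[OF xt(4)[of 1] pair_tail_nonpos[OF xt(1)]])
    fix y assume "y \<in> cl"
    then show "u (y, t) - v (y, t) \<le> u (x, t) - v (x, t)" using xt(3)[of y t] xt(2) by simp
  qed (use xt in auto)
  finally show False by simp
qed

text \<open>
  At a maximum point of \<open>u(\<cdot>,t) - v(\<cdot>,t)\<close> with value \<open>M\<close> the two nonlocal terms can only add up to
  something nonpositive; at a good one they add up to \<open>0\<close>, so that the maximum propagates along jumps.
\<close>

definition good :: "real \<Rightarrow> 'a \<Rightarrow> bool" where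
  "good t x \<longleftrightarrow> x \<in> cl \<and> u (x, t) - v (x, t) = M \<and>
    (\<forall>d>0. 0 \<le> tails d t t x)"

text \<open>A parabola centred at \<open>t\<close> is stationary there, and a contact point at time
  \<open>t\<close> forces the maximum of the penalized difference to occur exactly at
  \<open>t\<close> with value \<open>M\<close>.\<close>

lemma good_exists:
  assumes t: "0 < t" "t \<le> t0"
  shows "\<exists>x. good t x"
proof -
  obtain x1 where x1: "x1 \<in> cl" "u (x1, t) - v (x1, t) = M" using contact_before[OF t] by blast
  have eq: "s = t \<and> u (x, s) - v (x, s) = M" if x: "x \<in> cl" "0 \<le> s"
    and mx: "\<And>y r. y \<in> cl \<Longrightarrow> 0 \<le> r \<Longrightarrow>
      u (y, r) - v (y, r) - 1 * (r - t)\<^sup>2 \<le> u (x, s) - v (x, s) - 1 * (s - t)\<^sup>2" for x s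
  proof -
    have V: "M \<le> u (x, s) - v (x, s) - (s - t)\<^sup>2" using mx[OF x1(1), of t] t x1(2) by simp
    have W: "u (x, s) - v (x, s) \<le> M" using wM[of "(x, s)"] x by simp
    have "(s - t)\<^sup>2 \<le> 0" using V W by linarith
    then have "s = t" by simp
    then show ?thesis using V W by simp
  qed
  obtain x s where xs: "x \<in> cl" "0 < s"
    "\<And>y r. y \<in> cl \<Longrightarrow> 0 \<le> r \<Longrightarrow> u (y, r) - v (y, r) - 1 * (r - t)\<^sup>2 \<le> u (x, s) - v (x, s) - 1 * (s - t)\<^sup>2"
    "\<And>d. 0 < d \<Longrightarrow> 2 * 1 * (s - t) \<le> tails d s s x"
  proof (rule time_localized[of 1 t])
    fix x s assume "x \<in> cl" "0 \<le> s" "\<And>y r. y \<in> cl \<Longrightarrow> 0 \<le> r \<Longrightarrow>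
      u (y, r) - v (y, r) - 1 * (r - t)\<^sup>2 \<le> u (x, s) - v (x, s) - 1 * (s - t)\<^sup>2"
    from eq[OF this] show "0 < s" using t by simp
  qed (simp, rule that)
  have st: "s = t" "u (x, s) - v (x, s) = M" using eq[OF xs(1) less_imp_le[OF xs(2)] xs(3)] by auto
  have "good t x" unfolding good_def using xs(1,4) st by auto
  then show ?thesis ..
qed

text \<open>The integrand is nonpositive because \<open>M\<close> is the maximum, and its integral
  is nonnegative at a good point; so it vanishes almost everywhere.\<close>

lemma good_jump:
  assumes g: "good t x" and t: "0 \<le> t" and d: "0 < d"
  shows "AE z in nu x. z \<in> - ball 0 d \<longrightarrow> x + z \<in> cl \<longrightarrow> u (x + z, t) - v (x + z, t) = M"
proof -
  have x: "x \<in> cl" "u (x, t) - v (x, t) = M" using g by (auto simp: good_def)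
  let ?A = "{z\<in>- ball 0 d. x + z \<in> cl}"
  have D: "- ball 0 d \<in> sets borel" by simp
  have i: "set_integrable (nu x) ?A (\<lambda>z. u (x + z, t) - u (x, t))" "set_integrable (nu x) ?A (\<lambda>z. - v (x + z, t) - - v (x, t))"
    using tame_integrable[OF u_tame[OF t] x(1) D order_refl d] tame_integrable[OF v_tame[OF t] x(1) D order_refl d] by auto
  let ?f = "\<lambda>z. indicator ?A z *\<^sub>R ((u (x + z, t) - u (x, t)) + (- v (x + z, t) - - v (x, t)))"
  have int: "integrable (nu x) ?f" using set_integral_add(1)[OF i] by (simp add: set_integrable_def)
  have "0 \<le> tails d t t x"
    using g d by (simp add: good_def)
  also have "\<dots> = (LINT z|nu x. ?f z)"
    using set_integral_add(2)[OF i] by (simp add: nonlocal_def set_lebesgue_integral_def)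
  finally have ge: "(LINT z|nu x. - ?f z) \<le> 0" using int by simp
  have nn: "0 \<le> - ?f z" for z
    using wM[of "(x + z, t)"] t x(2) by (auto simp: indicator_def)
  have "AE z in nu x. - ?f z = 0"
  proof (rule integral_nonneg_eq_0_iff_AE[THEN iffD1])
    show "integrable (nu x) (\<lambda>z. - ?f z)" using int by simp
    show "AE z in nu x. 0 \<le> - ?f z" using nn by simp
    show "(LINT z|nu x. - ?f z) = 0" by (rule antisym[OF ge Bochner_Integration.integral_nonneg[OF nn]])
  qed
  then show ?thesis by (rule eventually_mono) (use x(2) in \<open>auto simp: indicator_def\<close>)
qed

text \<open>Along good points the difference has the constant value \<open>M\<close>, which is the
  lower bound that the limsup estimate for tails requires.\<close>

lemma good_closed:
  assumes t: "0 \<le> t" shows "closed {x. good t x}"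
  unfolding closed_sequential_limits
proof (intro allI impI, elim conjE)
  fix X x assume "\<forall>n. X n \<in> {x. good t x}" and Xx: "X \<longlonglongrightarrow> x"
  then have X: "\<And>n. good t (X n)" by simp
  have Xc: "\<And>n. X n \<in> cl" using X by (simp add: good_def)
  have x: "x \<in> cl" using Xc Xx closed_closure[of Om] by (auto simp: closed_sequential_limits)
  have lim: "(\<lambda>n. (X n, t)) \<longlonglongrightarrow> (x, t)" by (intro tendsto_Pair Xx tendsto_const)
  have "M \<le> u (x, t) - v (x, t)"
    by (rule usc_on_seq_le[OF w_usc _ lim _ tendsto_const]) (use x t X Xc in \<open>auto simp: good_def\<close>)
  then have w: "u (x, t) - v (x, t) = M" using wM[of "(x, t)"] x t by simp
  have "0 \<le> tails d t t x" if d: "0 < d" for d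
  proof (rule field_le_epsilon)
    fix e :: real assume e: "0 < e"
    have "\<forall>\<^sub>F n in sequentially. tails d t t (X n) < tails d t t x + e"
      by (rule nonlocal_pair_limsup[OF Xc Xx _ tendsto_const _ tendsto_const tendsto_const _ d e, where t = t])
        (use t w X in \<open>auto simp: good_def\<close>)
    then obtain n where "tails d t t (X n) < tails d t t x + e"
      by (auto simp: eventually_sequentially)
    moreover have "0 \<le> tails d t t (X n)"
      using X[of n] d by (simp add: good_def)
    ultimately show "0 \<le> tails d t t x + e" by linarith
  qed
  then show "x \<in> {x. good t x}" using x w by (simp add: good_def)
qed

text \<open>From a good point almost every jump lands on a contact point outside \<open>S\<close>,
  as jump measures do not charge null sets, hence on a good point. Each point of the support is a
  limit of such targets, and the good set is closed, so it contains everything that can be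
  reached.\<close>

lemma good_everywhere:
  assumes t: "0 < t" "t \<le> t0" and cover: "iterative_covering Om nu"
    and S: "S \<in> null_sets lborel" and gS: "\<And>x. x \<in> cl \<Longrightarrow> u (x, t) - v (x, t) = M \<Longrightarrow> x \<notin> S \<Longrightarrow> good t x"
    and x: "x \<in> cl"
  shows "u (x, t) - v (x, t) = M"
proof -
  have tn: "0 \<le> t" using t by simp
  have step: "good t (x + z)" if g: "good t x" and z: "z \<in> measure_support (nu x)" for x z
  proof (cases "z = 0")
    case False
    have x: "x \<in> cl" using g by (simp add: good_def)
    have "x + z \<in> closure {x. good t x}"
    proof (subst closure_approachable, intro allI impI)
      fix e :: real assume e: "0 < e"
      \<comment> \<open>Half of \<open>norm z\<close> keeps the ball around \<open>z\<close> outside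
        \<open>ball 0 d\<close>, where the statement about jumps applies.\<close>
      define \<epsilon> where "\<epsilon> = min e (norm z / 2)"
      have \<epsilon>: "0 < \<epsilon>" "\<epsilon> \<le> e" "\<epsilon> \<le> norm z / 2" using e False by (auto simp: \<epsilon>_def)
      define d where "d = norm z / 2"
      have d: "0 < d" using False by (simp add: d_def)
      have pos: "0 < emeasure (nu x) (ball z \<epsilon>)" using z \<epsilon> by (simp add: measure_support_def)
      have "AE y in nu x. y \<notin> {y\<in>- ball 0 d. x + y \<in> S}"
      proof (rule AE_not_in)
        have "{y\<in>- ball 0 d. x + y \<in> S} \<in> sets borel"
        proof -
          have "(\<lambda>y. x + y) -` S \<inter> space borel \<in> sets borel"
            using S by (intro measurable_sets[of _ borel borel]) (auto simp: null_sets_def)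
          then have "- ball 0 d \<inter> (\<lambda>y. x + y) -` S \<in> sets borel" by auto
          also have "- ball 0 d \<inter> (\<lambda>y. x + y) -` S = {y\<in>- ball 0 d. x + y \<in> S}" by auto
          finally show ?thesis .
        qed
        then show "{y\<in>- ball 0 d. x + y \<in> S} \<in> null_sets (nu x)"
          using jump_null[OF S x d] x by (auto simp: null_sets_def sets_nu)
      qed
      then have ae: "AE y in nu x. y \<in> - ball 0 d \<longrightarrow> good t (x + y)"
        using good_jump[OF g tn d] AE_jump_cl[OF x]
        by eventually_elim (use gS in auto)
      have "\<exists>y\<in>ball z \<epsilon>. good t (x + y)"
      proof (rule ccontr)
        assume n: "\<not> ?thesis"
        have "AE y in nu x. y \<notin> ball z \<epsilon>"
          using ae
        proof (rule eventually_mono)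
          fix y assume y: "y \<in> - ball 0 d \<longrightarrow> good t (x + y)"
          show "y \<notin> ball z \<epsilon>"
          proof
            assume b: "y \<in> ball z \<epsilon>"
            have "norm z \<le> norm y + norm (z - y)" using norm_triangle_ineq[of y "z - y"] by simp
            then have "y \<in> - ball 0 d" using b \<epsilon>(3) by (simp add: d_def dist_norm)
            then show False using y b n by blast
          qed
        qed
        then have "emeasure (nu x) (ball z \<epsilon>) = 0"
          using x by (subst (asm) AE_iff_measurable[where N = "ball z \<epsilon>"]) (auto simp: sets_nu sets_eq_imp_space_eq[OF sets_nu[OF x]])
        then show False using pos by simp
      qed
      then obtain y where "y \<in> ball z \<epsilon>" "good t (x + y)" by blast
      then show "\<exists>y\<in>{x. good t x}. dist y (x + z) < e"
        using \<epsilon> by (intro bexI[of _ "x + y"]) (auto simp: dist_norm norm_minus_commute)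
    qed
    then show ?thesis using closure_closed[OF good_closed[OF tn]] by simp
  qed (use g in simp)
  obtain x1 where x1: "good t x1" using good_exists[OF t] by blast
  have reach: "reach nu x1 n \<subseteq> {x. good t x}" for n
  proof (induction n)
    case 0 then show ?case using x1 by simp
  next
    case (Suc n) then show ?case using step by auto
  qed
  have "closure (\<Union>n. reach nu x1 n) \<subseteq> {x. good t x}"
    using reach good_closed[OF tn] by (intro closure_minimal) auto
  moreover have "closure (\<Union>n. reach nu x1 n) = cl"
    using cover x1 by (simp add: iterative_covering_def good_def)
  ultimately show ?thesis using x by (auto simp: good_def)
qed

end


section \<open>The sup-convolution near contact points\<close>

text \<open>Supplies a \<open>C\<^sup>1\<close> penalty that acts on one side of a given time
  only.\<close>

lemma max0_square_deriv:
  "((\<lambda>t::real. (max 0 t)\<^sup>2) has_real_derivative 2 * max 0 t) (at t)"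
proof -
  consider "t < 0" | "t = 0" | "0 < t" by linarith
  then show ?thesis
  proof cases
    case 1
    have "((\<lambda>t::real. 0) has_real_derivative 2 * max 0 t) (at t)" using 1 by simp
    then show ?thesis
      by (rule has_field_derivative_transform_within_open[OF _ open_lessThan[of 0]]) (use 1 in auto)
  next
    case 3
    have "((\<lambda>t::real. t\<^sup>2) has_real_derivative 2 * max 0 t) (at t)"
      using 3 by (auto intro!: derivative_eq_intros)
    then show ?thesis
      by (rule has_field_derivative_transform_within_open[OF _ open_greaterThan[of 0]]) (use 3 in auto)
  next
    case 2
    have "((\<lambda>h. ((max 0 h)\<^sup>2 - (max 0 0)\<^sup>2) / (h - 0)) \<longlongrightarrow> (0::real)) (at 0)"
    proof (rule tendsto_0_le[where K = 1])
      show "((\<lambda>h::real. h) \<longlongrightarrow> 0) (at 0)" by simp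
      have "norm ((max 0 h)\<^sup>2 / h) \<le> norm h" for h :: real
        by (cases "h \<le> 0") (auto simp: max_def power2_eq_square)
      then show "\<forall>\<^sub>F h in at 0. norm (((max 0 h)\<^sup>2 - (max 0 0)\<^sup>2) / (h - 0)) \<le> norm (h::real) * 1" by simp
    qed
    then show ?thesis using 2 by (simp add: has_field_derivative_iff)
  qed
qed

context hj_pair
begin

text \<open>
  A gap \<open>D\<close> at \<open>(x0, tq)\<close> persists, in a forward cone, for times of order \<open>D\<close>. The barrier is a paraboloid
  whose opening \<open>g\<close> grows like the elapsed time; the coercivity of \<open>H\<close> absorbs its time derivative and
  the \<open>C4\<close>-term absorbs the jumps.
\<close>

lemma gap_barrier:
  assumes lL: "0 < l" "l \<le> L" and K1: "1 \<le> K"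
    and lip: "\<And>t x y. 2 * B < L * t \<Longrightarrow> x \<in> cl \<Longrightarrow> y \<in> cl \<Longrightarrow> \<bar>sc L l 0 t x - sc L l 0 t y\<bar> \<le> K * dist x y"
    and R: "R = 1 + 4 * K" and A: "\<And>x p. x \<in> cl \<Longrightarrow> (R + N) * norm p - CA \<le> H x p" "0 \<le> CA"
    and C3: "C3 = L + CA + \<bar>c\<bar> + K * N * N + 1" and C4: "C4 = 2 * (2 + K * R) * N / (1 - sg)"
    and tq: "2 * B < L * tq" "0 < tq" and ball: "ball x0 (3 * R * h1) \<subseteq> Om" and h1: "0 < h1" "3 * h1 < 1"
    and D: "D = sc L l 0 tq x0 - u (x0, tq)" "3 * h1 \<le> D"
    and y: "y1 \<in> cl" and s1: "tq < s1" "s1 \<le> tq + h1"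
  shows "u (y1, s1) \<le> u (x0, tq) + D / 16 + D * (norm (y1 - x0))\<^sup>2 / (s1 - tq)\<^sup>2 + C3 * (s1 - tq) + C4 * D * (2 * (s1 - tq)) powr (1 - sg)"
proof -
  have R5: "5 \<le> R" using R K1 by simp
  have D0: "0 < D" using D(2) h1 by simp
  have K0: "0 < K" and L0: "0 < L" using K1 lL by auto
  have KNN: "0 \<le> K * N * N" using K0 N1 by simp
  have C30: "0 < C3" "L \<le> C3" using C3 L0 A(2) KNN by linarith+
  have C40: "0 < C4" using C4 R5 K0 N1 sg by (simp add: add_pos_nonneg)
  define b where "b = u (x0, tq)"
  have "x0 \<in> ball x0 (3 * R * h1)" using R5 h1 by simp
  then have x0: "x0 \<in> cl" using ball Om_cl by blast
  \<comment> \<open>Bounds \<open>u\<close> by the sup-convolution, which is Lipschitz in space and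
    time and equals \<open>b + D\<close> at the vertex.\<close>
  have growth: "u (y, s) \<le> b + D + K * norm (y - x0) + L * \<bar>s - tq\<bar>" if "y \<in> cl" "0 \<le> s" for y s
  proof -
    have "u (y, s) \<le> sc L l 0 s y" using sc_bounds(1)[OF lL order_refl that] .
    moreover have "sc L l 0 s y \<le> sc L l 0 tq y + L * \<bar>s - tq\<bar>"
    proof (cases "tq \<le> s")
      case True
      have "l * (s - tq) \<le> L * (s - tq)" using lL True by (intro mult_right_mono) auto
      then show ?thesis using sc_time_lipschitz(2)[OF lL that(1) less_imp_le[OF tq(2)] True] True by simp
    next
      case False
      then show ?thesis using sc_time_lipschitz(1)[OF lL that(1,2), of tq] by simp
    qed
    moreover have "sc L l 0 tq y \<le> sc L l 0 tq x0 + K * norm (y - x0)"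
      using lip[OF tq(1) that(1) x0] by (simp add: dist_norm abs_le_iff)
    ultimately show ?thesis using D(1) by (simp add: b_def)
  qed
  have bB: "\<bar>b\<bar> \<le> B" using uB[of "(x0, tq)"] x0 tq by (simp add: b_def)
  \<comment> \<open>A margin above \<open>u (x0, tq)\<close>: semicontinuity then separates
    \<open>u\<close> from the barrier near the vertex.\<close>
  define \<beta> where "\<beta> = D / 16"
  have \<beta>: "0 < \<beta>" using D0 by (simp add: \<beta>_def)
  obtain \<delta> where \<delta>: "\<delta> > 0" "\<And>q. q \<in> cl \<times> {0..} \<Longrightarrow> dist q (x0, tq) < \<delta> \<Longrightarrow> u q < b + \<beta> / 2"
    using usc_onD[OF uusc, of "(x0, tq)" "\<beta> / 2"] x0 tq \<beta> by (auto simp: b_def)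
  \<comment> \<open>Rounds the elapsed time near \<open>tq\<close>. It is small against the
    semicontinuity radius, against the margin \<open>\<beta>\<close>, and against the time
    \<open>s1 - tq\<close> at which the barrier is evaluated.\<close>
  define e where "e = min (min (\<delta> / (4 * R)) (\<beta> / (2 * C3))) (s1 - tq)"
  have e: "0 < e" "4 * R * e \<le> \<delta>" "2 * C3 * e \<le> \<beta>" "e \<le> s1 - tq"
  proof -
    show "0 < e" using \<delta> \<beta> C30 R5 s1 by (simp add: e_def)
    have "4 * R * e \<le> 4 * R * (\<delta> / (4 * R))" using R5 by (intro mult_left_mono) (auto simp: e_def)
    then show "4 * R * e \<le> \<delta>" using R5 by simp
    have "2 * C3 * e \<le> 2 * C3 * (\<beta> / (2 * C3))" using C30 by (intro mult_left_mono) (auto simp: e_def)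
    then show "2 * C3 * e \<le> \<beta>" using C30 by simp
  qed (simp add: e_def)
  have eh1: "e \<le> h1" using e s1 by simp
  \<comment> \<open>\<open>Qp\<close> lifts the barrier above \<open>u\<close> after
    \<open>tq + 2 * h1\<close>, \<open>Qm\<close> before \<open>tq - e\<close>; in between, after
    \<open>tq\<close> and up to \<open>tq + h1\<close>, both terms vanish.\<close>
  define Qp where "Qp = (2 * B + 1) / h1\<^sup>2"
  define Qm where "Qm = (C3 + (2 * B + 1) / e) / e"
  have Qp: "0 \<le> Qp" "Qp * h1\<^sup>2 = 2 * B + 1" using B0 h1 by (auto simp: Qp_def)
  have Qm: "0 \<le> Qm" "Qm * e = C3 + (2 * B + 1) / e" using B0 e C30 by (auto simp: Qm_def)
  define E where "E t = (t - tq)\<^sup>2 + e\<^sup>2" for t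
  have E0: "0 < E t" for t using e by (simp add: E_def add_nonneg_pos)
  \<comment> \<open>The rounded elapsed time, which is the radius scale of the paraboloid.\<close>
  define g where "g t = sqrt (E t)" for t
  have g0: "0 < g t" and gE: "(g t)\<^sup>2 = E t" and gh: "\<bar>t - tq\<bar> \<le> g t" for t
    using E0[of t] by (auto simp: g_def E_def real_le_rsqrt)
  have gpow: "E t powr a = g t powr (2 * a)" for t a
    using g0[of t] gE[of t] by (metis powr_powr powr_numeral less_imp_le)
  define k where "k t = D / E t" for t
  define \<rho> where "\<rho> t = b + \<beta> + C3 * (t - tq) + C4 * D * E t powr ((1 - sg) / 2) + Qp * (max 0 (t - tq - h1))\<^sup>2 + Qm * (max 0 (tq - t))\<^sup>2" for t
  define k' where "k' t = - (D * (2 * (t - tq))) / (E t)\<^sup>2" for t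
  define \<rho>' where "\<rho>' t = C3 + C4 * D * ((1 - sg) / 2 * E t powr ((1 - sg) / 2 - 1) * (2 * (t - tq))) + Qp * (2 * max 0 (t - tq - h1)) + Qm * (- (2 * max 0 (tq - t)))" for t
  have Ed: "(E has_real_derivative 2 * (t - tq)) (at t)" for t
    unfolding E_def[abs_def] by (auto intro!: derivative_eq_intros)
  have Ec: "continuous_on UNIV E" unfolding E_def[abs_def] by (intro continuous_intros)
  have En: "E t \<noteq> 0" for t using E0[of t] by simp
  have kd: "(k has_real_derivative k' t) (at t)" for t
    unfolding k_def[abs_def] k'_def using En[of t]
    by (auto intro!: derivative_eq_intros Ed simp: power2_eq_square)
  have kc: "continuous_on UNIV k'" unfolding k'_def[abs_def] by (intro continuous_intros Ec) (auto simp: En)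
  have m1: "((\<lambda>t. (max 0 (t - tq - h1))\<^sup>2) has_real_derivative 2 * max 0 (t - tq - h1)) (at t)" for t
  proof -
    have "((\<lambda>t. t - tq - h1) has_real_derivative 1) (at t)" by (auto intro!: derivative_eq_intros)
    from DERIV_chain2[OF max0_square_deriv this] show ?thesis by simp
  qed
  have m2: "((\<lambda>t. (max 0 (tq - t))\<^sup>2) has_real_derivative - (2 * max 0 (tq - t))) (at t)" for t
  proof -
    have "((\<lambda>t. tq - t) has_real_derivative -1) (at t)" by (auto intro!: derivative_eq_intros)
    from DERIV_chain2[OF max0_square_deriv this] show ?thesis by simp
  qed
  have pd: "((\<lambda>t. E t powr ((1 - sg) / 2)) has_real_derivative ((1 - sg) / 2 * E t powr ((1 - sg) / 2 - 1) * (2 * (t - tq)))) (at t)" for t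
    using DERIV_fun_powr[OF Ed E0[of t], of "(1 - sg) / 2"] by simp
  have l1: "((\<lambda>t. b + \<beta> + C3 * (t - tq)) has_real_derivative C3) (at t)" for t
    by (auto intro!: derivative_eq_intros)
  have \<rho>d: "(\<rho> has_real_derivative \<rho>' t) (at t)" for t
    unfolding \<rho>_def[abs_def] \<rho>'_def by (intro DERIV_add DERIV_cmult l1 pd m1 m2)
  have \<rho>c: "continuous_on UNIV \<rho>'" unfolding \<rho>'_def[abs_def]
    by (intro continuous_intros Ec) (auto simp: En)
  define \<phi> :: "'a \<times> real \<Rightarrow> real" where "\<phi> q = k (snd q) * (norm (fst q - x0))\<^sup>2 + \<rho> (snd q)" for q
  define G :: "'a \<times> real \<Rightarrow> 'a \<times> real" where
    "G q = ((2 * k (snd q)) *\<^sub>R (fst q - x0), k' (snd q) * (norm (fst q - x0))\<^sup>2 + \<rho>' (snd q))" for q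
  have hG: "has_C1_gradient (cl \<times> {0..}) \<phi> G"
    unfolding \<phi>_def G_def by (rule C1_gradient_time_paraboloid[OF kd kc \<rho>d \<rho>c])
  have k0: "0 \<le> k t" for t using D0 E0[of t] by (simp add: k_def)
  have pw0: "0 \<le> C4 * D * E t powr ((1 - sg) / 2)" for t using C40 D0 by simp
  have low: "b + \<beta> + C3 * (t - tq) + k t * (norm (y - x0))\<^sup>2 \<le> \<phi> (y, t)" for y t
    using Qp(1) Qm(1) pw0[of t] by (simp add: \<phi>_def \<rho>_def)
  \<comment> \<open>Outside radius \<open>R * g t\<close> the paraboloid exceeds the growth bound
    \<open>D + K * norm (y - x0)\<close>, so the touching point lies in a cone. The condition
    \<open>g t <= D\<close> limits the barrier to times of order \<open>D\<close>.\<close>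
  have outer: "D + K * norm (y - x0) \<le> k t * (norm (y - x0))\<^sup>2" if r: "R * g t < norm (y - x0)" and gD: "g t \<le> D" for y t
  proof -
    let ?r = "norm (y - x0)"
    have r0: "0 \<le> R * g t" using R5 g0[of t] by simp
    have "(R * g t)\<^sup>2 \<le> ?r\<^sup>2" using r r0 by (intro power_mono) auto
    moreover have "25 * (g t)\<^sup>2 \<le> R\<^sup>2 * (g t)\<^sup>2"
      using R5 power_mono[of 5 R 2] by (intro mult_right_mono) auto
    moreover have "(R * g t)\<^sup>2 = R\<^sup>2 * (g t)\<^sup>2" by (rule power_mult_distrib)
    ultimately have 1: "2 * E t \<le> ?r\<^sup>2" using gE[of t] E0[of t] by linarith
    have "2 * K * (g t * g t) \<le> R * g t * D"
    proof -
      have "2 * K * (g t * g t) \<le> R * (g t * D)"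
        using R K0 g0[of t] gD D0 by (intro mult_mono) auto
      then show ?thesis by (simp add: mult.assoc)
    qed
    also have "\<dots> \<le> ?r * D" using r D0 by (intro mult_right_mono) auto
    finally have 2: "2 * K * E t \<le> ?r * D" using gE[of t] by (simp add: power2_eq_square)
    have "D * (2 * E t) \<le> D * ?r\<^sup>2" using 1 D0 by (intro mult_left_mono) auto
    moreover have "?r * (2 * K * E t) \<le> ?r * (?r * D)" using 2 by (intro mult_left_mono) auto
    ultimately have "(D + K * ?r) * E t \<le> D * ?r\<^sup>2"
      by (simp add: power2_eq_square algebra_simps)
    then show ?thesis using E0[of t] by (simp add: k_def pos_le_divide_eq)
  qed
  have main: "u q \<le> \<phi> q" if q: "q \<in> cl \<times> {0..}" for q
  proof (rule ccontr)
    assume nle: "\<not> u q \<le> \<phi> q"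
    define F where "F q = u q + - \<phi> q" for q
    have c\<rho>: "continuous_on UNIV \<rho>" by (rule DERIV_continuous_on[OF DERIV_subset[OF \<rho>d]]) auto
    have ck: "continuous_on UNIV k" by (rule DERIV_continuous_on[OF DERIV_subset[OF kd]]) auto
    have Fu: "usc_on (cl \<times> {0..}) F"
      unfolding F_def \<phi>_def
      by (intro usc_on_add uusc continuous_on_imp_usc_on continuous_on_minus continuous_on_add continuous_on_mult
          continuous_on_compose2[OF ck] continuous_on_compose2[OF c\<rho>] continuous_intros) auto
    have late: "u (y, s) \<le> \<phi> (y, s)" if ys: "y \<in> cl" "tq + 2 * h1 \<le> s" for y s
    proof -
      have "h1\<^sup>2 \<le> (max 0 (s - tq - h1))\<^sup>2" using ys h1 by (intro power_mono) auto
      then have "Qp * h1\<^sup>2 \<le> Qp * (max 0 (s - tq - h1))\<^sup>2" using Qp by (intro mult_left_mono) auto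
      moreover have "0 \<le> C3 * (s - tq)" "0 \<le> k s * (norm (y - x0))\<^sup>2" "0 \<le> Qm * (max 0 (tq - s))\<^sup>2"
        using C30 ys h1 k0[of s] Qm by auto
      ultimately have "b + 2 * B + 1 \<le> \<phi> (y, s)" using Qp(2) pw0[of s] \<beta> by (simp add: \<phi>_def \<rho>_def)
      moreover have "\<bar>u (y, s)\<bar> \<le> B" using uB[of "(y, s)"] ys tq h1 by simp
      ultimately show ?thesis using bB by simp
    qed
    have Fq: "0 < F q" using nle by (simp add: F_def)
    have sub: "{q'\<in>cl \<times> {0..}. F q \<le> F q'} \<subseteq> cl \<times> {0..tq + 2 * h1}"
    proof
      fix q' assume q': "q' \<in> {q'\<in>cl \<times> {0..}. F q \<le> F q'}"
      then have "\<not> u q' \<le> \<phi> q'" using Fq by (simp add: F_def)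
      then have "\<not> tq + 2 * h1 \<le> snd q'" using late[of "fst q'" "snd q'"] q' by auto
      then show "q' \<in> cl \<times> {0..tq + 2 * h1}" using q' by (auto simp: mem_Times_iff)
    qed
    have bnd: "bounded {q'\<in>cl \<times> {0..}. F q \<le> F q'}"
      by (rule bounded_subset[OF _ sub]) (intro bounded_Times compact_imp_bounded[OF compact_cl] bounded_closed_interval)
    have "closed (cl \<times> {0::real..})" by (intro closed_Times closed_closure closed_atLeast)
    then obtain qm where qm: "qm \<in> cl \<times> {0..}" "\<And>q'. q' \<in> cl \<times> {0..} \<Longrightarrow> F q' \<le> F qm"
      using usc_attains_max[OF Fu _ q bnd] by blast
    obtain y s where qd: "qm = (y, s)" "y \<in> cl" "0 \<le> s" using qm(1) by auto
    have pos: "\<phi> (y, s) < u (y, s)" using qm(2)[OF q] Fq by (simp add: F_def qd)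
    let ?r = "norm (y - x0)"
    have u1: "u (y, s) \<le> b + D + K * ?r + L * \<bar>s - tq\<bar>" using growth[OF qd(2,3)] .
    have notearly: "- e \<le> s - tq"
    proof (rule ccontr)
      assume n: "\<not> - e \<le> s - tq"
      have "Qm * e * (tq - s) \<le> Qm * (max 0 (tq - s))\<^sup>2"
      proof -
        have "Qm * (e * (tq - s)) \<le> Qm * ((tq - s) * (tq - s))"
          using n e Qm(1) by (intro mult_left_mono mult_right_mono) auto
        then show ?thesis using n e by (simp only: max_absorb2 power2_eq_square mult.assoc)
      qed
      moreover have "Qm * e * (tq - s) = C3 * (tq - s) + (2 * B + 1) / e * (tq - s)" unfolding Qm(2) by (simp add: algebra_simps)
      moreover have "(2 * B + 1) / e * e \<le> (2 * B + 1) / e * (tq - s)" using n B0 e by (intro mult_left_mono) auto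
      moreover have "(2 * B + 1) / e * e = 2 * B + 1" using e by simp
      moreover have "0 \<le> k s * ?r\<^sup>2" "0 \<le> Qp * (max 0 (s - tq - h1))\<^sup>2" using k0[of s] Qp by auto
      moreover have "C3 * (s - tq) = - (C3 * (tq - s))" by (simp add: algebra_simps)
      moreover have "\<phi> (y, s) = k s * ?r\<^sup>2 + (b + \<beta> + C3 * (s - tq) + C4 * D * E s powr ((1 - sg) / 2) + Qp * (max 0 (s - tq - h1))\<^sup>2 + Qm * (max 0 (tq - s))\<^sup>2)"
        by (simp add: \<phi>_def \<rho>_def)
      moreover have "\<bar>u (y, s)\<bar> \<le> B" using uB[of "(y, s)"] qd by simp
      ultimately show False using pos pw0[of s] \<beta> bB by linarith
    qed
    have s2: "s - tq < 2 * h1" using late[OF qd(2), of s] pos by linarith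
    have g3: "g s \<le> 3 * h1"
    proof -
      have "g s \<le> \<bar>s - tq\<bar> + e" using sqrt_sum_squares_le_sum_abs[of "s - tq" e] e by (simp add: g_def E_def)
      then show ?thesis using s2 notearly eh1 h1 by linarith
    qed
    have gD: "g s \<le> D" using g3 D by simp
    have rR: "?r \<le> R * g s"
    proof (rule ccontr)
      assume "\<not> ?r \<le> R * g s"
      then have o: "D + K * ?r \<le> k s * ?r\<^sup>2" using outer[OF _ gD] by simp
      show False
      proof (cases "0 \<le> s - tq")
        case True
        then have "L * \<bar>s - tq\<bar> \<le> C3 * (s - tq)" using C30 by (simp add: mult_right_mono)
        then show False using o u1 low[of s y] pos \<beta> by linarith
      next
        case False
        have "C3 * (- e) \<le> C3 * (s - tq)" using notearly C30 by (intro mult_left_mono) auto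
        moreover have "L * \<bar>s - tq\<bar> \<le> C3 * e" using C30 L0 False notearly by (intro mult_mono) auto
        ultimately show False using o u1 low[of s y] pos \<beta> e(3) by linarith
      qed
    qed
    \<comment> \<open>At times within \<open>e\<close> of \<open>tq\<close> the cone lies inside the
      ball where \<open>u\<close> is below \<open>b + \<beta> / 2\<close>, which the barrier
      exceeds.\<close>
    have se: "e < s - tq"
    proof (rule ccontr)
      assume n: "\<not> e < s - tq"
      have "g s \<le> 2 * e"
        using sqrt_sum_squares_le_sum_abs[of "s - tq" e] e n notearly by (simp add: g_def E_def abs_le_iff)
      then have "R * g s \<le> R * (2 * e)" using R5 by (intro mult_left_mono) auto
      moreover have "dist (y, s) (x0, tq) \<le> ?r + \<bar>s - tq\<bar>"
        using sqrt_sum_squares_le_sum_abs[of "dist y x0" "s - tq"] by (simp add: dist_Pair_Pair dist_real_def flip: dist_norm)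
      moreover have "5 * e \<le> R * e" using R5 e by (intro mult_right_mono) auto
      ultimately have "dist (y, s) (x0, tq) < \<delta>" using rR n notearly e(1,2) by linarith
      then have "u (y, s) < b + \<beta> / 2" using \<delta>(2)[of "(y, s)"] qd by simp
      moreover have "C3 * (- e) \<le> C3 * (s - tq)" using notearly C30 by (intro mult_left_mono) auto
      moreover have "0 \<le> k s * ?r\<^sup>2" using k0[of s] by simp
      ultimately show False using low[of s y] pos e(3) by linarith
    qed
    have h: "0 < s - tq" "g s \<le> 2 * (s - tq)"
    proof -
      show "0 < s - tq" using se e by simp
      show "g s \<le> 2 * (s - tq)"
        using sqrt_sum_squares_le_sum_abs[of "s - tq" e] se e by (simp add: g_def E_def)
    qed
    have s0: "0 < s" using h tq by simp
    have g1: "g s < 1" using g3 h1 by simp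
    have "R * g s \<le> R * (3 * h1)" using g3 R5 by (intro mult_left_mono) auto
    \<comment> \<open>The strict inequality \<open>g s < 3 * h1\<close> uses
      \<open>s - tq < 2 * h1\<close> and \<open>e <= h1\<close>; the point must be interior for the
      subsolution to be tested.\<close>
    have yO: "y \<in> Om"
    proof -
      have "g s < 3 * h1"
      proof -
        have "(s - tq)\<^sup>2 < (2 * h1)\<^sup>2" using s2 h by (intro power_strict_mono) auto
        moreover have "e\<^sup>2 \<le> h1\<^sup>2" using eh1 e by (intro power_mono) auto
        moreover have "(2 * h1)\<^sup>2 = 4 * h1\<^sup>2" "(3 * h1)\<^sup>2 = 9 * h1\<^sup>2" "0 < h1\<^sup>2" using h1 by (auto simp: power_mult_distrib)
        ultimately have "(g s)\<^sup>2 < (3 * h1)\<^sup>2" using gE[of s] unfolding E_def by linarith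
        then show ?thesis by (rule power_less_imp_less_base) (use h1 in simp)
      qed
      then have "R * g s < R * (3 * h1)" using R5 by (intro mult_strict_left_mono) auto
      then have "dist x0 y < 3 * R * h1" using rR by (simp add: dist_norm norm_minus_commute mult.commute mult.left_commute)
      then show ?thesis using ball by auto
    qed
    have mxq: "u q' - \<phi> q' \<le> u (y, s) - \<phi> (y, s)" if "q' \<in> cl \<times> {0..}" for q' using qm(2)[OF that] by (simp add: F_def qd)
    define X where "X = 2 * k s * ?r"
    have X0: "0 \<le> X" using k0[of s] by (simp add: X_def)
    have nG: "norm (fst (G (y, s))) = X" using k0[of s] by (simp add: G_def X_def)
    have T: "snd (G (y, s)) + H y (fst (G (y, s))) - c \<le> nl (ball 0 (g s)) (\<lambda>y. \<phi> (y, s)) y + nl (- ball 0 (g s)) (\<lambda>y. u (y, s)) y"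
      using sub_test[OF hG yO s0 g0 mxq] by simp
    have Hl: "(R + N) * X - CA \<le> H y (fst (G (y, s)))" using A(1)[OF qd(2)] nG by metis
    have gd: "D / g s * g s powr (1 - sg) = D * g s powr - sg"
    proof -
      have "g s powr (1 - sg) = g s * g s powr (- sg)" using g0[of s] by (simp add: powr_diff powr_minus field_simps)
      then show ?thesis using g0[of s] by simp
    qed
    \<comment> \<open>Inside \<open>ball 0 (g s)\<close> the paraboloid contributes a multiple of
      the gradient norm \<open>X\<close>, absorbed by the coefficient \<open>N\<close> in the
      coercivity, and a multiple of \<open>D * g s powr - sg\<close>.\<close>
    have 1: "nl (ball 0 (g s)) (\<lambda>y. \<phi> (y, s)) y \<le> N * X + N * D * g s powr - sg"
    proof -
      have "nl (ball 0 (g s)) (\<lambda>y. \<phi> (y, s)) y \<le> (X + D / g s) * N * g s powr (1 - sg)"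
      proof (rule nonlocal_ball_upper[OF qd(2) g0 g1])
        show "0 \<le> X + D / g s" using X0 D0 g0[of s] by simp
        fix z :: 'a assume z: "norm z < g s"
        have "(norm (y + z - x0))\<^sup>2 \<le> (?r + norm z)\<^sup>2"
          using norm_triangle_ineq[of "y - x0" z] by (intro power_mono) (auto simp: algebra_simps)
        then have "(norm (y + z - x0))\<^sup>2 - ?r\<^sup>2 \<le> 2 * ?r * norm z + norm z * norm z"
          by (simp add: power2_eq_square algebra_simps)
        also have "\<dots> \<le> 2 * ?r * norm z + g s * norm z" using z by (simp add: mult_right_mono)
        finally have "k s * ((norm (y + z - x0))\<^sup>2 - ?r\<^sup>2) \<le> k s * (2 * ?r * norm z + g s * norm z)"
          using k0 by (intro mult_left_mono) auto
        also have "\<dots> = (X + D / g s) * norm z"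
        proof -
          have "k s * g s = D / g s" using gE[of s] g0[of s] unfolding k_def by (simp add: power2_eq_square flip: gE)
          then have "k s * (g s * norm z) = D / g s * norm z" by (simp flip: mult.assoc)
          then show ?thesis by (simp add: X_def algebra_simps)
        qed
        finally show "\<phi> (y + z, s) - \<phi> (y, s) \<le> (X + D / g s) * norm z" by (simp add: \<phi>_def algebra_simps)
      qed
      also have "\<dots> = X * N * g s powr (1 - sg) + N * (D / g s * g s powr (1 - sg))" by (simp add: algebra_simps)
      also have "\<dots> = X * N * g s powr (1 - sg) + N * D * g s powr - sg" unfolding gd by simp
      also have "X * N * g s powr (1 - sg) \<le> X * N * 1"
        using X0 N1 g1 g0[of s] sg by (intro mult_left_mono powr_le1) auto
      finally show ?thesis by (simp add: mult.commute)
    qed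
    \<comment> \<open>A jump can recover the gap and the slope of the cone, of order
      \<open>D\<close>, on a set of mass \<open>g s powr - sg\<close>. The remaining increment
      \<open>K * norm z\<close> has a bounded integral, accounted for in \<open>C3\<close>.\<close>
    have 2: "nl (- ball 0 (g s)) (\<lambda>y. u (y, s)) y \<le> (1 + K * R) * N * D * g s powr - sg + K * N * N"
    proof (rule nonlocal_upper[where G = "\<lambda>z. (1 + K * R) * D + K * N * min 1 (norm z)"])
      fix z assume z: "z \<in> - ball 0 (g s)" and yz: "y + z \<in> cl"
      have zN: "norm z \<le> N" using diam[OF qd(2) yz] by (simp add: dist_norm)
      have "norm z \<le> N * min 1 (norm z)"
      proof (cases "norm z \<le> 1")
        case True then show ?thesis using N1 mult_right_mono[of 1 N "norm z"] by simp
      qed (use zN in simp)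
      then have "K * norm z \<le> K * (N * min 1 (norm z))" using K0 by (intro mult_left_mono) auto
      moreover have "K * ?r \<le> K * (R * D)" using rR gD R5 K0 by (intro mult_left_mono order_trans[OF rR]) auto
      moreover have "norm (y + z - x0) \<le> ?r + norm z" using norm_triangle_ineq[of "y - x0" z] by (simp add: algebra_simps)
      then have "K * norm (y + z - x0) \<le> K * (?r + norm z)" using K0 by (intro mult_left_mono) auto
      moreover have "u (y + z, s) \<le> b + D + K * norm (y + z - x0) + L * \<bar>s - tq\<bar>" using growth[OF yz qd(3)] .
      moreover have "L * \<bar>s - tq\<bar> \<le> C3 * (s - tq)" using C30 h by (simp add: mult_right_mono)
      moreover have "0 \<le> k s * ?r\<^sup>2" using k0[of s] by simp
      ultimately have "u (y + z, s) - u (y, s) \<le> D + K * (R * D) + K * (N * min 1 (norm z))"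
        using low[of s y] pos \<beta> by (simp add: distrib_left)
      then show "u (y + z, s) - u (y, s) \<le> (1 + K * R) * D + K * N * min 1 (norm z)" by (simp add: algebra_simps)
    next
      have KR: "0 \<le> (1 + K * R) * D" "0 \<le> K * N" using K0 R5 D0 N1 by auto
      have tf: "(\<integral>\<^sup>+z\<in>- ball 0 (g s). ennreal (min 1 (norm z)) \<partial>nu y) \<le> ennreal N"
        using tail_finite[OF qd(2), of 1 "g s"] sg g0[of s] by (simp add: powr_one')
      have mb: "borel_measurable (nu y) = borel_measurable borel" by (rule measurable_cong_sets) (simp_all add: sets_nu[OF qd(2)])
      have ms0: "(\<lambda>z. ennreal a * indicator (- ball 0 (g s)) z) \<in> borel_measurable (nu y)" for a :: real
        unfolding mb by measurable
      have ms: "(\<lambda>z. ennreal (min 1 (norm z)) * indicator (- ball 0 (g s)) z) \<in> borel_measurable (nu y)"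
        unfolding mb by measurable
      have "(\<integral>\<^sup>+z\<in>- ball 0 (g s). ennreal ((1 + K * R) * D + K * N * min 1 (norm z)) \<partial>nu y) =
        (\<integral>\<^sup>+z. (ennreal ((1 + K * R) * D) * indicator (- ball 0 (g s)) z + ennreal (K * N) * (ennreal (min 1 (norm z)) * indicator (- ball 0 (g s)) z)) \<partial>nu y)"
        using KR by (intro nn_integral_cong) (auto simp: indicator_def ennreal_mult ennreal_plus)
      also have "\<dots> = (\<integral>\<^sup>+z. ennreal ((1 + K * R) * D) * indicator (- ball 0 (g s)) z \<partial>nu y) + (\<integral>\<^sup>+z. ennreal (K * N) * (ennreal (min 1 (norm z)) * indicator (- ball 0 (g s)) z) \<partial>nu y)"
        by (intro nn_integral_add ms0 borel_measurable_times_ennreal[OF _ ms]) simp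
      also have "\<dots> = ennreal ((1 + K * R) * D) * emeasure (nu y) (- ball 0 (g s)) + ennreal (K * N) * (\<integral>\<^sup>+z\<in>- ball 0 (g s). ennreal (min 1 (norm z)) \<partial>nu y)"
        using nn_integral_cmult[OF ms, of "ennreal (K * N)"] nn_integral_cmult_indicator[of "- ball 0 (g s)" "nu y" "ennreal ((1 + K * R) * D)"]
        by (simp add: sets_nu[OF qd(2)])
      also have "\<dots> \<le> ennreal ((1 + K * R) * D) * ennreal (N * g s powr - sg) + ennreal (K * N) * ennreal N"
        using mass[OF qd(2) g0] tf by (intro add_mono mult_left_mono) auto
      also have "\<dots> = ennreal ((1 + K * R) * N * D * g s powr - sg + K * N * N)"
      proof -
        have "(1 + K * R) * N * D * g s powr - sg = (1 + K * R) * D * (N * g s powr - sg)" by (simp add: algebra_simps)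
        then show ?thesis using KR N1 by (simp only: ennreal_mult ennreal_plus mult_nonneg_nonneg powr_ge_zero)
      qed
      finally show "(\<integral>\<^sup>+z\<in>- ball 0 (g s). ennreal ((1 + K * R) * D + K * N * min 1 (norm z)) \<partial>nu y) \<le> ennreal ((1 + K * R) * N * D * g s powr - sg + K * N * N)" .
      show "0 \<le> (1 + K * R) * N * D * g s powr - sg + K * N * N" using K0 R5 D0 N1 by simp
    qed
    \<comment> \<open>Widening of the paraboloid with time lowers the barrier at rate at most
      \<open>R * X\<close> inside the cone; this is why the coercivity is invoked with coefficient
      \<open>R + N\<close>.\<close>
    have 3: "- (R * X) \<le> k' s * ?r\<^sup>2"
    proof -
      have "k' s * ?r\<^sup>2 = - (X * (?r * (s - tq) / E s))" using En[of s] by (simp add: k'_def X_def k_def power2_eq_square field_simps)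
      moreover have "?r * (s - tq) \<le> (R * g s) * g s" using rR gh[of s] h R5 g0[of s] by (intro mult_mono) auto
      then have "?r * (s - tq) / E s \<le> R" using E0[of s] gE[of s] by (simp add: pos_divide_le_eq power2_eq_square mult.assoc)
      then have "X * (?r * (s - tq) / E s) \<le> X * R" using X0 by (intro mult_left_mono) auto
      ultimately show ?thesis by (simp add: mult.commute)
    qed
    \<comment> \<open>The power \<open>(1 - sg) / 2\<close> of \<open>E\<close> is chosen so that
      its derivative has the size \<open>g s powr - sg\<close> of the jump terms; since
      \<open>s - tq >= g s / 2\<close>, the constant \<open>C4\<close> makes it dominate
      them.\<close>
    have 4: "C3 + (2 + K * R) * N * D * g s powr - sg \<le> \<rho>' s"
    proof -
      have "E s powr ((1 - sg) / 2 - 1) = g s powr (- sg) / g s"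
      proof -
        have "2 * ((1 - sg) / 2 - 1) = - sg - 1" by (simp add: field_simps)
        then have "E s powr ((1 - sg) / 2 - 1) = g s powr (- sg - 1)" using gpow[of s "(1 - sg) / 2 - 1"] by metis
        also have "\<dots> = g s powr (- sg) / g s powr 1" by (rule powr_diff)
        finally show ?thesis using g0[of s] by simp
      qed
      then have "(1 - sg) / 2 * E s powr ((1 - sg) / 2 - 1) * (2 * (s - tq)) = (1 - sg) / 2 * (g s powr - sg / g s) * (2 * (s - tq))" by simp
      also have "\<dots> = (1 - sg) * g s powr - sg * ((s - tq) / g s)"
      proof -
        have "(1 - sg) / 2 * (P / Q) * (2 * h) = (1 - sg) * P * (h / Q)" for P Q h :: real by simp
        then show ?thesis .
      qed
      finally have "(1 - sg) / 2 * E s powr ((1 - sg) / 2 - 1) * (2 * (s - tq)) = (1 - sg) * g s powr - sg * ((s - tq) / g s)" .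
      moreover have "1 / 2 \<le> (s - tq) / g s" using h g0[of s] by (simp add: field_simps)
      then have "(1 - sg) * g s powr - sg * (1 / 2) \<le> (1 - sg) * g s powr - sg * ((s - tq) / g s)" using sg by (intro mult_left_mono) auto
      ultimately have "C4 * D * ((1 - sg) * g s powr - sg * (1 / 2)) \<le> C4 * D * ((1 - sg) / 2 * E s powr ((1 - sg) / 2 - 1) * (2 * (s - tq)))"
        using C40 D0 by (intro mult_left_mono) auto
      moreover have "C4 * D * ((1 - sg) * g s powr - sg * (1 / 2)) = (2 + K * R) * N * D * g s powr - sg"
      proof -
        have "C4 * (1 - sg) = 2 * (2 + K * R) * N" using sg by (simp add: C4)
        moreover have "C4 * D * ((1 - sg) * P * (1 / 2)) = C4 * (1 - sg) * (D * P / 2)" for P by simp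
        moreover have "2 * (2 + K * R) * N * (D * P / 2) = (2 + K * R) * N * D * P" for P by simp
        ultimately show ?thesis by metis
      qed
      moreover have "0 \<le> Qp * (2 * max 0 (s - tq - h1))" using Qp by simp
      moreover have "Qm * (- (2 * max 0 (tq - s))) = 0" using h by simp
      moreover have "\<rho>' s = C3 + C4 * D * ((1 - sg) / 2 * E s powr ((1 - sg) / 2 - 1) * (2 * (s - tq))) + Qp * (2 * max 0 (s - tq - h1)) + Qm * (- (2 * max 0 (tq - s)))"
        by (simp only: \<rho>'_def)
      ultimately show ?thesis by linarith
    qed
    have 5: "(2 + K * R) * N * D * g s powr - sg = N * D * g s powr - sg + (1 + K * R) * N * D * g s powr - sg"
      "(R + N) * X = R * X + N * X" by (simp_all add: algebra_simps)
    have "snd (G (y, s)) = k' s * ?r\<^sup>2 + \<rho>' s" by (simp add: G_def)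
    then show False using T Hl 1 2 3 4 5 C3 L0 by linarith
  qed
  have y1: "u (y1, s1) \<le> \<phi> (y1, s1)" using main[of "(y1, s1)"] y s1 tq by simp
  have "\<phi> (y1, s1) = k s1 * (norm (y1 - x0))\<^sup>2 + (b + \<beta> + C3 * (s1 - tq) + C4 * D * E s1 powr ((1 - sg) / 2))"
    using s1 by (simp add: \<phi>_def \<rho>_def)
  moreover have "k s1 * (norm (y1 - x0))\<^sup>2 \<le> D * (norm (y1 - x0))\<^sup>2 / (s1 - tq)\<^sup>2"
  proof -
    have "(s1 - tq)\<^sup>2 \<le> E s1" by (simp add: E_def)
    then have "D * (norm (y1 - x0))\<^sup>2 / E s1 \<le> D * (norm (y1 - x0))\<^sup>2 / (s1 - tq)\<^sup>2"
      using D0 s1 E0[of s1] by (intro divide_left_mono mult_pos_pos) auto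
    then show ?thesis by (simp add: k_def)
  qed
  moreover have "C4 * D * E s1 powr ((1 - sg) / 2) \<le> C4 * D * (2 * (s1 - tq)) powr (1 - sg)"
  proof -
    have "g s1 \<le> 2 * (s1 - tq)"
      using sqrt_sum_squares_le_sum_abs[of "s1 - tq" e] e s1 by (simp add: g_def E_def)
    have "E s1 powr ((1 - sg) / 2) \<le> (2 * (s1 - tq)) powr (1 - sg)"
    proof -
      have "2 * ((1 - sg) / 2) = 1 - sg" by simp
      then have "E s1 powr ((1 - sg) / 2) = g s1 powr (1 - sg)" using gpow[of s1 "(1 - sg) / 2"] by metis
      moreover have "g s1 powr (1 - sg) \<le> (2 * (s1 - tq)) powr (1 - sg)" using \<open>g s1 \<le> 2 * (s1 - tq)\<close> g0[of s1] sg by (intro powr_mono2) auto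
      ultimately show ?thesis by simp
    qed
    then show ?thesis using C40 D0 by (intro mult_left_mono) auto
  qed
  ultimately show ?thesis using y1 by (simp add: b_def \<beta>_def)
qed

text \<open>At \<open>h\<close> small compared with \<open>h1\<close>, the four corrections of the
  barrier and the loss of the sup-convolution through its Lipschitz bounds use up at most
  \<open>5 / 8\<close> of the gap \<open>D\<close>, so a strict gap remains.\<close>

lemma gap_spreads:
  assumes lL: "0 < l" "l \<le> L" and K1: "1 \<le> K"
    and lip: "\<And>t x y. 2 * B < L * t \<Longrightarrow> x \<in> cl \<Longrightarrow> y \<in> cl \<Longrightarrow> \<bar>sc L l 0 t x - sc L l 0 t y\<bar> \<le> K * dist x y"
  obtains \<tau> C where "0 < \<tau>" "\<tau> < 1" "1 \<le> C"
    "\<And>x0 tq h1 h y. 2 * B < L * tq \<Longrightarrow> 0 < tq \<Longrightarrow> ball x0 (C * h1) \<subseteq> Om \<Longrightarrow> 0 < h1 \<Longrightarrow> C * h1 \<le> 1 \<Longrightarrow>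
      C * h1 \<le> sc L l 0 tq x0 - u (x0, tq) \<Longrightarrow> 0 < h \<Longrightarrow> h \<le> \<tau> * h1 \<Longrightarrow> y \<in> cl \<Longrightarrow> dist y x0 \<le> h / 4 \<Longrightarrow>
      u (y, tq + h) < sc L l 0 (tq + h) y"
proof -
  define R where "R = 1 + 4 * K"
  obtain CA where CA: "0 \<le> CA" "\<And>x p. x \<in> cl \<Longrightarrow> (R + N) * norm p - CA \<le> H x p" using superlinear[of "R + N"] by blast
  define C3 where "C3 = L + CA + \<bar>c\<bar> + K * N * N + 1"
  define C4 where "C4 = 2 * (2 + K * R) * N / (1 - sg)"
  have R5: "5 \<le> R" using K1 by (simp add: R_def)
  have L0: "0 < L" using lL by simp
  have "0 \<le> K * N * N" using K1 N1 by simp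
  then have C30: "0 < C3" using L0 CA(1) by (simp add: C3_def)
  have C40: "0 < C4" using R5 K1 N1 sg by (simp add: C4_def add_pos_nonneg)
  \<comment> \<open>The last two entries make the linear losses at most a quarter of
    \<open>h1\<close>, hence of \<open>D\<close>, and the jump correction at most a quarter of
    \<open>D\<close>.\<close>
  define \<tau> where "\<tau> = min (1 / 2) (min (1 / (4 * (C3 + L + K))) ((1 / (4 * C4)) powr (1 / (1 - sg)) / 2))"
  have \<tau>: "0 < \<tau>" "\<tau> < 1" "(C3 + L + K) * \<tau> \<le> 1 / 4" "C4 * (2 * \<tau>) powr (1 - sg) \<le> 1 / 4"
  proof -
    have S: "0 < C3 + L + K" using C30 L0 K1 by simp
    show t0: "0 < \<tau>" using S C40 by (simp add: \<tau>_def)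
    show "\<tau> < 1" by (simp add: \<tau>_def)
    have "(C3 + L + K) * \<tau> \<le> (C3 + L + K) * (1 / (4 * (C3 + L + K)))" using S by (intro mult_left_mono) (auto simp: \<tau>_def)
    also have "\<dots> = 1 / 4" 
    proof -
      have "a * (1 / (4 * a)) = 1 / 4" if "0 < a" for a :: real using that by simp
      then show ?thesis using S .
    qed
    finally show "(C3 + L + K) * \<tau> \<le> 1 / 4" .
    have "2 * \<tau> \<le> (1 / (4 * C4)) powr (1 / (1 - sg))" by (simp add: \<tau>_def)
    then have "(2 * \<tau>) powr (1 - sg) \<le> ((1 / (4 * C4)) powr (1 / (1 - sg))) powr (1 - sg)"
      using t0 sg by (intro powr_mono2) auto
    also have "\<dots> = 1 / (4 * C4)" using sg C40 by (simp add: powr_powr)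
    finally show "C4 * (2 * \<tau>) powr (1 - sg) \<le> 1 / 4" using C40 by (simp add: field_simps)
  qed
  show thesis
  proof (rule that[of \<tau> "3 * R"])
    show "0 < \<tau>" "\<tau> < 1" "1 \<le> 3 * R" using \<tau> R5 by auto
    fix x0 tq h1 h y
    assume tq: "2 * B < L * tq" "0 < tq" and ball: "ball x0 (3 * R * h1) \<subseteq> Om" and h1: "0 < h1" "3 * R * h1 \<le> 1"
      and D': "3 * R * h1 \<le> sc L l 0 tq x0 - u (x0, tq)" and h: "0 < h" "h \<le> \<tau> * h1"
      and y: "y \<in> cl" "dist y x0 \<le> h / 4"
    define D where "D = sc L l 0 tq x0 - u (x0, tq)"
    have Rh: "5 * h1 \<le> R * h1" using R5 h1 by (intro mult_right_mono) auto
    have D: "15 * h1 \<le> D" using D' Rh by (simp add: D_def)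
    have D0: "0 < D" using D h1 by simp
    have h1s: "3 * h1 < 1" using h1 Rh by linarith
    have "x0 \<in> ball x0 (3 * R * h1)" using R5 h1 by simp
    then have x0: "x0 \<in> cl" using ball Om_cl by blast
    have \<tau>h1: "\<tau> * h1 \<le> h1" using mult_right_mono[of \<tau> 1 h1] \<tau> h1 by linarith
    have hh: "h \<le> h1" using h \<tau>h1 by linarith
    have "u (y, tq + h) \<le> u (x0, tq) + D / 16 + D * (norm (y - x0))\<^sup>2 / (tq + h - tq)\<^sup>2 + C3 * (tq + h - tq) + C4 * D * (2 * (tq + h - tq)) powr (1 - sg)"
      by (rule gap_barrier[OF lL K1 lip R_def CA(2,1) C3_def C4_def tq ball h1(1) h1s D_def _ y(1)]) (use D h1 hh h in auto)
    then have u1: "u (y, tq + h) \<le> u (x0, tq) + D / 16 + D * (norm (y - x0))\<^sup>2 / h\<^sup>2 + C3 * h + C4 * D * (2 * h) powr (1 - sg)" by simp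
    have "(norm (y - x0))\<^sup>2 \<le> (h / 4)\<^sup>2" using y(2) by (intro power_mono) (auto simp: dist_norm)
    then have "D * (norm (y - x0))\<^sup>2 \<le> D * (h\<^sup>2 / 16)" using D0 by (intro mult_left_mono) (auto simp: power_divide)
    then have u2: "D * (norm (y - x0))\<^sup>2 / h\<^sup>2 \<le> D / 16" using h by (simp add: pos_divide_le_eq)
    have "(C3 + L + K) * h \<le> (C3 + L + K) * (\<tau> * h1)" using h C30 L0 K1 by (intro mult_left_mono) auto
    also have "\<dots> \<le> 1 / 4 * h1" using \<tau>(3) h1 by (simp add: mult_right_mono flip: mult.assoc)
    finally have u3: "C3 * h + L * h + K * h \<le> D / 4" using D h1 by (simp add: algebra_simps)
    have "2 * h \<le> 2 * \<tau>" using h h1s h1 \<tau> mult_left_mono[of h1 1 \<tau>] by linarith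
    then have "(2 * h) powr (1 - sg) \<le> (2 * \<tau>) powr (1 - sg)" using h sg by (intro powr_mono2) auto
    then have "C4 * (2 * h) powr (1 - sg) \<le> 1 / 4" using \<tau>(4) C40 mult_left_mono[of "(2 * h) powr (1 - sg)" "(2 * \<tau>) powr (1 - sg)" C4] by linarith
    then have "D * (C4 * (2 * h) powr (1 - sg)) \<le> D * (1 / 4)" using D0 by (intro mult_left_mono) auto
    then have u4: "C4 * D * (2 * h) powr (1 - sg) \<le> D / 4" by (simp add: mult.commute mult.left_commute)
    have "sc L l 0 tq y - L * (tq + h - tq) \<le> sc L l 0 (tq + h) y"
      by (rule sc_time_lipschitz(1)[OF lL y(1)]) (use tq h in auto)
    moreover have "\<bar>sc L l 0 tq y - sc L l 0 tq x0\<bar> \<le> K * dist y x0" by (rule lip[OF tq(1) y(1) x0])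
    moreover have "K * dist y x0 \<le> K * h" using y(2) h K1 by (intro mult_left_mono) auto
    ultimately have "u (x0, tq) + D - K * h - L * h \<le> sc L l 0 (tq + h) y" by (simp add: D_def)
    then show "u (y, tq + h) < sc L l 0 (tq + h) y" using u1 u2 u3 u4 D0 by linarith
  qed
qed

text \<open>
  A gap at \<open>q\<close> larger than \<open>\<eta> * dist q p\<close> excludes contact in a ball of radius and distance to \<open>p\<close>
  comparable to \<open>dist q p\<close>, so the set is porous.
\<close>

lemma steep_gap_negligible:
  assumes lL: "0 < l" "l \<le> L" and K1: "1 \<le> K"
    and lip: "\<And>t x y. 2 * B < L * t \<Longrightarrow> x \<in> cl \<Longrightarrow> y \<in> cl \<Longrightarrow> \<bar>sc L l 0 t x - sc L l 0 t y\<bar> \<le> K * dist x y"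
    and \<eta>: "0 < \<eta>"
  shows "negligible {p \<in> Om \<times> {t. 2 * B < L * t}. sc L l 0 (snd p) (fst p) = u p \<and>
    (\<forall>\<delta>>0. \<exists>q\<in>cl \<times> {0..}. dist q p < \<delta> \<and> \<eta> * dist q p < sc L l 0 (snd q) (fst q) - u q)}" (is "negligible ?P")
proof -
  obtain \<tau> C where \<tau>: "0 < \<tau>" "\<tau> < 1" "1 \<le> C"
    "\<And>x0 tq h1 h y. 2 * B < L * tq \<Longrightarrow> 0 < tq \<Longrightarrow> ball x0 (C * h1) \<subseteq> Om \<Longrightarrow> 0 < h1 \<Longrightarrow> C * h1 \<le> 1 \<Longrightarrow>
      C * h1 \<le> sc L l 0 tq x0 - u (x0, tq) \<Longrightarrow> 0 < h \<Longrightarrow> h \<le> \<tau> * h1 \<Longrightarrow> y \<in> cl \<Longrightarrow> dist y x0 \<le> h / 4 \<Longrightarrow>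
      u (y, tq + h) < sc L l 0 (tq + h) y"
    using gap_spreads[OF lL K1 lip] by blast
  have L0: "0 < L" using lL by simp
  \<comment> \<open>Gives \<open>C * h1 = min \<eta> 1 * d\<close>, which lies below the assumed gap
    and below the distance available inside \<open>Om\<close>.\<close>
  define \<zeta> where "\<zeta> = min \<eta> 1 / C"
  have \<zeta>: "0 < \<zeta>" "\<zeta> \<le> 1" "C * \<zeta> = min \<eta> 1" using \<eta> \<tau> by (auto simp: \<zeta>_def divide_le_eq min_def)
  define \<theta> where "\<theta> = \<tau> * \<zeta> / 16"
  have \<tau>\<zeta>: "0 < \<tau> * \<zeta>" "\<tau> * \<zeta> \<le> 1" using \<tau> \<zeta> mult_mono[of \<tau> 1 \<zeta> 1] by auto
  show ?thesis
  proof (rule porous_imp_negligible[of \<theta>])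
    show "0 < \<theta>" "\<theta> < 1" using \<tau>\<zeta> by (auto simp: \<theta>_def)
    fix p \<epsilon> assume p: "p \<in> ?P" and \<epsilon>: "0 < (\<epsilon>::real)"
    obtain xc tc where pd: "p = (xc, tc)" by (cases p)
    have xc: "xc \<in> Om" "2 * B < L * tc" "sc L l 0 tc xc = u (xc, tc)" using p by (auto simp: pd)
    obtain \<rho> where \<rho>: "0 < \<rho>" "ball xc \<rho> \<subseteq> Om" using xc(1) open_Om by (meson openE)
    define \<omega> where "\<omega> = tc - 2 * B / L"
    have \<omega>: "0 < \<omega>" using xc(2) L0 by (simp add: \<omega>_def field_simps)
    define \<delta> where "\<delta> = min (min (\<epsilon> / 2) (\<rho> / 2)) (min \<omega> 1)"
    have "0 < \<delta>" using \<epsilon> \<rho> \<omega> by (simp add: \<delta>_def)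
    then obtain q where q: "q \<in> cl \<times> {0..}" "dist q p < \<delta>" "\<eta> * dist q p < sc L l 0 (snd q) (fst q) - u q"
      using p by blast
    obtain x0 tq where qd: "q = (x0, tq)" by (cases q)
    define d where "d = dist q p"
    have "q \<noteq> p" using q(3) xc(3) by (auto simp: pd)
    then have d: "0 < d" "2 * d < \<epsilon>" "2 * d < \<rho>" "d < \<omega>" "d < 1" using q(2) by (auto simp: d_def \<delta>_def)
    have dx: "dist x0 xc \<le> d" "\<bar>tq - tc\<bar> \<le> d"
      using dist_fst_le[of q p] dist_snd_le[of q p] by (auto simp: qd pd d_def dist_real_def)
    have "2 * B / L < tq" using dx(2) d(4) by (simp add: \<omega>_def)
    then have tq: "2 * B < L * tq" using L0 by (simp add: field_simps)
    then have tq0: "0 < tq" using L0 B0 by (smt (verit) mult_nonneg_nonpos)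
    define h1 where "h1 = \<zeta> * d"
    have h1: "0 < h1" "h1 \<le> d" "C * h1 = min \<eta> 1 * d"
      using \<zeta> d by (auto simp: h1_def mult_le_cancel_right1 simp flip: mult.assoc)
    have Ch: "C * h1 \<le> d" "C * h1 \<le> \<eta> * d" using d unfolding h1(3) by (auto simp: mult_le_cancel_right1)
    have sub: "ball x0 (C * h1) \<subseteq> Om"
    proof
      fix y assume "y \<in> ball x0 (C * h1)"
      then have "dist xc y < \<rho>" using dist_triangle[of xc y x0] dx(1) Ch(1) d(3) by (simp add: dist_commute)
      then show "y \<in> Om" using \<rho> by auto
    qed
    define r where "r = 2 * d"
    have \<theta>r: "\<theta> * r = \<tau> * h1 / 8" by (simp add: \<theta>_def r_def h1_def)
    have \<tau>h: "0 < \<tau> * h1" "\<tau> * h1 \<le> h1" using \<tau> h1 by (auto simp: mult_le_cancel_right1)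
    \<comment> \<open>With centre at \<open>3 / 4\<close> and radius \<open>1 / 8\<close> of
      \<open>\<tau> * h1\<close>, times in the hole are at least
      \<open>5 / 8 * (\<tau> * h1)\<close> after \<open>tq\<close>, and a quarter of that exceeds
      the radius: the whole hole lies in the cone where the gap persists.\<close>
    let ?p = "(x0, tq + 3 / 4 * (\<tau> * h1))"
    have hole: "ball ?p (\<theta> * r) \<inter> ?P = {}"
    proof (rule ccontr)
      assume "\<not> ?thesis"
      then obtain y s where ys: "dist ?p (y, s) < \<theta> * r" "y \<in> Om" "sc L l 0 s y = u (y, s)" by auto
      have ds: "dist y x0 < \<tau> * h1 / 8" "\<bar>tq + 3 / 4 * (\<tau> * h1) - s\<bar> < \<tau> * h1 / 8"
        using ys(1) dist_fst_le[of ?p "(y, s)"] dist_snd_le[of ?p "(y, s)"]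
        unfolding \<theta>r fst_conv snd_conv dist_real_def dist_commute[of x0 y] by linarith+
      then have h: "0 < s - tq" "s - tq \<le> \<tau> * h1" "dist y x0 \<le> (s - tq) / 4" 
      proof -
        have "5 / 8 * (\<tau> * h1) < s - tq" "s - tq < 7 / 8 * (\<tau> * h1)" using ds(2) unfolding abs_less_iff by linarith+
        then show "0 < s - tq" "s - tq \<le> \<tau> * h1" using \<tau>h(1) by linarith+
        have "\<tau> * h1 / 8 \<le> (s - tq) / 4" using \<open>5 / 8 * (\<tau> * h1) < s - tq\<close> \<tau>h(1) by simp
        then show "dist y x0 \<le> (s - tq) / 4" using ds(1) by simp
      qed
      have "u (y, tq + (s - tq)) < sc L l 0 (tq + (s - tq)) y"
        by (rule \<tau>(4)[OF tq tq0 sub h1(1) _ _ h(1,2) _ h(3)]) (use Ch d q(3) ys(2) Om_cl in \<open>auto simp: qd d_def\<close>)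
      then show False using ys(3) by simp
    qed
    have "ball ?p (\<theta> * r) \<subseteq> ball p r"
    proof
      fix z assume z: "z \<in> ball ?p (\<theta> * r)"
      have "dist ?p q = 3 / 4 * (\<tau> * h1)" using \<tau>h by (simp add: qd dist_Pair_Pair dist_real_def)
      then have "dist ?p p \<le> 3 / 4 * (\<tau> * h1) + d" using dist_triangle[of ?p p q] by (simp add: d_def)
      then have "dist z p < 3 / 4 * (\<tau> * h1) + d + \<tau> * h1 / 8"
        using z dist_triangle[of z p ?p] by (simp add: \<theta>r dist_commute)
      then have "dist z p < 2 * d" using \<tau>h h1(2) by linarith
      then show "z \<in> ball p r" by (simp add: r_def dist_commute)
    qed
    then show "\<exists>r q. 0 < r \<and> r < \<epsilon> \<and> ball q (\<theta> * r) \<subseteq> ball p r \<and> ball q (\<theta> * r) \<inter> ?P = {}"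
      using hole d by (intro exI[of _ r] exI[of _ ?p]) (simp add: r_def)
  qed
qed

end


section \<open>Contact points with a small gap nearby\<close>

context hj_pair
begin

lemma pair_tail_mono:
  assumes x: "x \<in> cl" and t: "0 \<le> t" and d: "0 < d1" "d1 \<le> d2"
    and max: "\<And>y. y \<in> cl \<Longrightarrow> u (y, t) - v (y, t) \<le> u (x, t) - v (x, t)"
  shows "tails d1 t t x \<le> tails d2 t t x"
proof -
  have "usc_on cl (\<lambda>y. u (y, t) + - v (y, t))"
    using t by (intro usc_on_add usc_slice[OF uusc] usc_slice[OF vlsc]) auto
  then have "tame (2 * B) (\<lambda>y. u (y, t) + - v (y, t))"
  proof (rule usc_imp_tame)
    fix y assume "y \<in> cl"
    then show "\<bar>u (y, t) + - v (y, t)\<bar> \<le> 2 * B" using uB[of "(y, t)"] vB[of "(y, t)"] t by auto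
  qed
  then have "nl (- ball 0 d1) (\<lambda>y. u (y, t) + - v (y, t)) x \<le> nl (- ball 0 d2) (\<lambda>y. u (y, t) + - v (y, t)) x"
  proof (rule nonlocal_tail_mono[OF _ x d])
    fix z assume "x + z \<in> cl"
    from max[OF this] show "u (x + z, t) + - v (x + z, t) \<le> u (x, t) + - v (x, t)" by simp
  qed
  then show ?thesis
    using nonlocal_add[OF u_tame[OF t] v_tame[OF t] x, of d1] nonlocal_add[OF u_tame[OF t] v_tame[OF t] x, of d2] d by simp
qed

lemma sc_tendsto:
  assumes lL: "0 < l" "l \<le> L" and X: "\<And>n. X n \<in> cl" "X \<longlonglongrightarrow> x" and T: "\<And>n. 0 \<le> T n" "T \<longlonglongrightarrow> t"
    and x: "x \<in> cl" and t: "0 \<le> t" and big: "2 * B < L * t"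
    and lip: "\<And>t x y. 2 * B < L * t \<Longrightarrow> x \<in> cl \<Longrightarrow> y \<in> cl \<Longrightarrow> \<bar>sc L l 0 t x - sc L l 0 t y\<bar> \<le> K * dist x y"
  shows "(\<lambda>n. sc L l 0 (T n) (X n)) \<longlonglongrightarrow> sc L l 0 t x"
proof (rule Lim_transform_bound[where g = "\<lambda>n. K * dist (X n) x + L * \<bar>T n - t\<bar>", THEN LIM_zero_cancel])
  have "norm (sc L l 0 (T n) (X n) - sc L l 0 t x) \<le> K * dist (X n) x + L * \<bar>T n - t\<bar>" for n
  proof -
    have *: "\<bar>sc L l 0 s y - sc L l 0 r y\<bar> \<le> L * (s - r)" if "0 \<le> r" "r \<le> s" "y \<in> cl" for s r y
    proof -
      have "l * (s - r) \<le> L * (s - r)" using lL that by (intro mult_right_mono) auto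
      then show ?thesis using sc_time_lipschitz[OF lL that(3,1,2)] by (simp add: abs_le_iff)
    qed
    have "\<bar>sc L l 0 (T n) (X n) - sc L l 0 t (X n)\<bar> \<le> L * \<bar>T n - t\<bar>"
    proof (cases "t \<le> T n")
      case True then show ?thesis using *[OF t True X(1)[of n]] by simp
    next
      case False
      then have "T n \<le> t" by simp
      from *[OF T(1) this X(1)[of n]] show ?thesis using False by (simp add: abs_minus_commute)
    qed
    then show ?thesis using lip[OF big X(1)[of n] x] by (simp add: abs_le_iff)
  qed
  then show "\<forall>\<^sub>F n in sequentially. norm (sc L l 0 (T n) (X n) - sc L l 0 t x) \<le> norm (K * dist (X n) x + L * \<bar>T n - t\<bar>)"
    by (intro always_eventually allI) (smt (verit) real_norm_def)
  have "(\<lambda>n. K * dist (X n) x + L * \<bar>T n - t\<bar>) \<longlonglongrightarrow> K * dist x x + L * \<bar>t - t\<bar>"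
    by (intro tendsto_intros X T)
  then show "(\<lambda>n. K * dist (X n) x + L * \<bar>T n - t\<bar>) \<longlonglongrightarrow> 0" by simp
qed

end

context hj_contact
begin

text \<open>
  The contact at \<open>c\<^sub>0\<close> for the smaller slopes \<open>l1 < l\<close>, \<open>L1 < L\<close> makes \<open>tc\<close> the only argmax in the
  sup-convolution with slopes \<open>l\<close>, \<open>L\<close>; the argmax times \<open>s\<close> of nearby touching points then converge to \<open>tc\<close>.
\<close>

lemma dense_contact_good:
  assumes lL: "0 < l" "l \<le> L" and lL1: "0 < l1" "l1 \<le> L1" "l1 < l" "L1 < L"
    and xc: "xc \<in> cl" and tc: "0 < tc" "2 * B < L * tc"
    and w: "u (xc, tc) - v (xc, tc) = M"
    and contact: "sc L l 0 tc xc = u (xc, tc)" "sc L1 l1 0 tc xc = u (xc, tc)"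
    and dens: "\<And>\<eta>. 0 < \<eta> \<Longrightarrow> \<exists>\<delta>>0. \<forall>q\<in>cl \<times> {0..}. dist q (xc, tc) < \<delta> \<longrightarrow> sc L l 0 (snd q) (fst q) - u q \<le> \<eta> * dist q (xc, tc)"
  shows "good tc xc"
proof -
  let ?c = "(xc, tc)"
  have L0: "0 < L" using lL by simp
  have cq: "?c \<in> cl \<times> {0..}" using xc tc by simp
  have wB: "\<bar>u q - v q\<bar> \<le> 2 * B" if "q \<in> cl \<times> {0..}" for q using uB[OF that] vB[OF that] by simp
  have MB: "- 2 * B \<le> M" using wB[OF cq] w by simp
  obtain KK where KK: "KK \<ge> 1"
    "\<And>L l k t x y. 0 < l \<Longrightarrow> l \<le> L \<Longrightarrow> 0 \<le> k \<Longrightarrow> k \<le> 1 \<Longrightarrow> 2 * B < L * (t - k) \<Longrightarrow> x \<in> cl \<Longrightarrow> y \<in> cl \<Longrightarrow>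
      \<bar>sc L l k t x - sc L l k t y\<bar> \<le> KK * (1 + L) * dist x y"
    using sc_lipschitz by blast
  define K where "K = KK * (1 + L)"
  have K1: "1 \<le> K" using KK(1) L0 mult_mono[of 1 KK 1 "1 + L"] by (simp add: K_def)
  have lip: "\<bar>sc L l k t x - sc L l k t y\<bar> \<le> K * dist x y"
    if "0 \<le> k" "k \<le> 1" "2 * B < L * (t - k)" "x \<in> cl" "y \<in> cl" for k t x y
    unfolding K_def by (rule KK(2)[OF lL that])
  have lip0: "\<bar>sc L l 0 t x - sc L l 0 t y\<bar> \<le> K * dist x y" if "2 * B < L * t" "x \<in> cl" "y \<in> cl" for t x y
    using lip[of 0 t x y] that by simp
  obtain cc r where cone: "0 < cc" "cc < 1" "0 < r" "r < 1"
    "\<And>x0. x0 \<in> cl \<Longrightarrow> \<exists>e. norm e \<le> 1 \<and>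
      (\<forall>y\<in>cl. dist y x0 < r \<longrightarrow> (\<forall>h. 0 < h \<and> h < r \<longrightarrow> ball (y + h *\<^sub>R e) (cc * h) \<subseteq> Om))"
    using interior_cone by blast
  define \<tau> where "\<tau> = min (r / 2) ((tc - 2 * B / L) / 4)"
  have tcL: "0 < tc - 2 * B / L" using tc L0 by (simp add: field_simps)
  have \<tau>: "0 < \<tau>" "\<tau> \<le> r / 2" "2 * B < L * (tc - 3 * \<tau>)"
  proof -
    show "0 < \<tau>" "\<tau> \<le> r / 2" using tcL cone by (auto simp: \<tau>_def)
    have "3 * \<tau> < tc - 2 * B / L" 
    proof -
      have "\<tau> \<le> (tc - 2 * B / L) / 4" unfolding \<tau>_def by (rule min.cobounded2)
      moreover have "3 * a < b" if "a \<le> b / 4" "0 < b" for a b :: real using that by simp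
      ultimately show ?thesis using tcL by blast
    qed
    then have "2 * B / L < tc - 3 * \<tau>" by simp
    then show "2 * B < L * (tc - 3 * \<tau>)" using L0 by (simp add: pos_divide_less_eq mult.commute)
  qed
  \<comment> \<open>Fits the touching inequality at every touching point near
    \<open>(xc, tc)\<close> at once, using only that the maximal value there is at least
    \<open>- 2 * B\<close>.\<close>
  define A where "A = (4 * B + 2 * L + K + 1) / \<tau>\<^sup>2 + 1"
  have A: "1 \<le> A" "4 * B + 2 * L + K < A * \<tau>\<^sup>2" 
  proof -
    have "(4 * B + 2 * L + K + 1) / \<tau>\<^sup>2 * \<tau>\<^sup>2 = 4 * B + 2 * L + K + 1" using \<tau>(1) by simp
    moreover have "0 < \<tau>\<^sup>2" "0 \<le> (4 * B + 2 * L + K + 1) / \<tau>\<^sup>2" using \<tau>(1) B0 L0 K1 by auto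
    ultimately show "1 \<le> A" "4 * B + 2 * L + K < A * \<tau>\<^sup>2"
      unfolding A_def distrib_right mult_1 by linarith+
  qed
  have pair: "0 \<le> tails D tc tc xc" if D: "0 < D" for D
  proof (rule field_le_epsilon)
    fix \<epsilon>' :: real assume \<epsilon>': "0 < \<epsilon>'"
    define \<epsilon> where "\<epsilon> = \<epsilon>' / 8"
    have \<epsilon>: "0 < \<epsilon>" using \<epsilon>' by (simp add: \<epsilon>_def)
    let ?HS = "cl \<times> cball (0::'a) (2 * K + 1)"
    have "uniformly_continuous_on ?HS (\<lambda>(x, p). H x p)"
      by (intro compact_uniformly_continuous continuous_on_subset[OF contH] compact_Times compact_cl compact_cball) auto
    then obtain \<delta>H where \<delta>H: "0 < \<delta>H" "\<And>z z'. z \<in> ?HS \<Longrightarrow> z' \<in> ?HS \<Longrightarrow> dist z' z < \<delta>H \<Longrightarrow> dist ((\<lambda>(x, p). H x p) z') ((\<lambda>(x, p). H x p) z) < \<epsilon>"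
      unfolding uniformly_continuous_on_def using \<epsilon> by meson
    \<comment> \<open>The test functions below have gradient at most \<open>3 * \<eta>\<close>. This
      keeps the change in \<open>H\<close> below \<open>\<epsilon>\<close> on the compact set of
      gradients and bounds the time derivative by \<open>3 * \<epsilon>\<close>.\<close>
    define \<eta> where "\<eta> = min \<epsilon> (min (\<delta>H / 4) (1 / 4))"
    have \<eta>: "0 < \<eta>" "\<eta> \<le> \<epsilon>" "4 * \<eta> \<le> \<delta>H" "4 * \<eta> \<le> 1" using \<epsilon> \<delta>H by (auto simp: \<eta>_def)
    obtain \<delta> where \<delta>: "0 < \<delta>" "\<And>q. q \<in> cl \<times> {0..} \<Longrightarrow> dist q ?c < \<delta> \<Longrightarrow> sc L l 0 (snd q) (fst q) - u q \<le> \<eta> * dist q ?c"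
      using dens[OF \<eta>(1)] by blast
    \<comment> \<open>At distance \<open>\<delta>\<close> the paraboloid alone exceeds every
      possible difference of values, so touching happens where the gap estimate holds.\<close>
    define A2 where "A2 = (4 * B + 1) / \<delta>\<^sup>2"
    have A2: "0 < A2" "A2 * \<delta>\<^sup>2 = 4 * B + 1" using B0 \<delta> by (auto simp: A2_def)
    define Kx where "Kx = 2 * \<eta> + 2 * A2 * N"
    have Kx: "0 \<le> Kx" using \<eta> A2 N1 by (simp add: Kx_def)
    define \<rho>0 where "\<rho>0 = min (\<tau> / 2) (\<eta> / (4 * A2))"
    have \<rho>0: "0 < \<rho>0" "2 * \<rho>0 \<le> \<tau>" "4 * A2 * \<rho>0 \<le> \<eta>"
    proof -
      show "0 < \<rho>0" "2 * \<rho>0 \<le> \<tau>" using \<tau> \<eta> A2 by (auto simp: \<rho>0_def)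
      have "4 * A2 * \<rho>0 \<le> 4 * A2 * (\<eta> / (4 * A2))" using A2 by (intro mult_left_mono) (auto simp: \<rho>0_def)
      then show "4 * A2 * \<rho>0 \<le> \<eta>" using A2 by simp
    qed
    \<comment> \<open>A rounded cone of slope \<open>2 * \<eta>\<close> against a gap that grows
      with slope at most \<open>\<eta>\<close>: the touching point is confined to the scale
      \<open>\<rho>\<close> of the rounding. The paraboloid only localizes.\<close>
    define \<psi> :: "real \<Rightarrow> 'a \<times> real \<Rightarrow> real" where
      "\<psi> \<rho> q = 2 * \<eta> * sqrt ((norm (q - ?c))\<^sup>2 + \<rho>\<^sup>2) + - (2 * \<eta> * \<rho>) + A2 * (norm (q - ?c))\<^sup>2" for \<rho> q
    define G :: "real \<Rightarrow> 'a \<times> real \<Rightarrow> 'a \<times> real" where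
      "G \<rho> q = (2 * \<eta> / sqrt ((norm (q - ?c))\<^sup>2 + \<rho>\<^sup>2)) *\<^sub>R (q - ?c) + 0 + (2 * A2) *\<^sub>R (q - ?c)" for \<rho> q
    have hG: "has_C1_gradient (cl \<times> {0..}) (\<psi> \<rho>) (G \<rho>)" if "0 < \<rho>" for \<rho>
      unfolding \<psi>_def[abs_def] G_def[abs_def]
      by (intro C1_gradient_add C1_gradient_smooth_cone C1_gradient_const C1_gradient_paraboloid that)
    have cone0: "\<rho> \<le> sqrt (a\<^sup>2 + \<rho>\<^sup>2)" for a \<rho> :: real by (rule real_le_rsqrt) simp
    have psi_ge: "A2 * (norm (q - ?c))\<^sup>2 \<le> \<psi> \<rho> q" for q \<rho>
      using mult_left_mono[OF cone0[of \<rho> "norm (q - ?c)"], of "2 * \<eta>"] \<eta> by (simp add: \<psi>_def)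
    have psi0: "0 \<le> \<psi> \<rho> q" for q \<rho>
    proof -
      have "0 \<le> A2 * (norm (q - ?c))\<^sup>2" using A2 by simp
      then show ?thesis using psi_ge[of q \<rho>] by linarith
    qed
    have psi_c: "\<psi> \<rho> ?c = 0" if "0 < \<rho>" for \<rho> using that by (simp add: \<psi>_def)
    have psi_lip: "\<bar>\<psi> \<rho> (y, t) - \<psi> \<rho> (y', t)\<bar> \<le> Kx * dist y y'" if y: "y \<in> cl" "y' \<in> cl" for \<rho> y y' t
    proof -
      let ?a = "norm ((y, t) - ?c)" and ?b = "norm ((y', t) - ?c)"
      have ab: "\<bar>?a - ?b\<bar> \<le> dist y y'"
      proof -
        have "\<bar>?a - ?b\<bar> \<le> norm (((y, t) - ?c) - ((y', t) - ?c))" by (rule norm_triangle_ineq3)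
        then show ?thesis by (simp add: norm_Pair dist_norm)
      qed
      have "\<bar>sqrt (?a\<^sup>2 + \<rho>\<^sup>2) - sqrt (?b\<^sup>2 + \<rho>\<^sup>2)\<bar> \<le> \<bar>?a - ?b\<bar>"
      proof -
        have t: "sqrt (a\<^sup>2 + \<rho>\<^sup>2) \<le> sqrt (b\<^sup>2 + \<rho>\<^sup>2) + \<bar>a - b\<bar>" for a b :: real
          using real_sqrt_sum_squares_triangle_ineq[of b "a - b" \<rho> 0] by simp
        show ?thesis using t[of ?a ?b] t[of ?b ?a] by linarith
      qed
      then have 1: "2 * \<eta> * \<bar>sqrt (?a\<^sup>2 + \<rho>\<^sup>2) - sqrt (?b\<^sup>2 + \<rho>\<^sup>2)\<bar> \<le> 2 * \<eta> * dist y y'"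
        using ab \<eta> by (intro mult_left_mono) auto
      have sq: "?a\<^sup>2 - ?b\<^sup>2 = (norm (y - xc) - norm (y' - xc)) * (norm (y - xc) + norm (y' - xc))"

      proof -
        have "(norm ((y, t) - ?c))\<^sup>2 = (norm (y - xc))\<^sup>2 + (t - tc)\<^sup>2" for y by (simp add: norm_Pair)
        then show ?thesis by (simp only:) (simp add: power2_eq_square algebra_simps)
      qed
      have "\<bar>norm (y - xc) - norm (y' - xc)\<bar> \<le> dist y y'"
        using norm_triangle_ineq3[of "y - xc" "y' - xc"] by (simp add: dist_norm)
      moreover have "norm (y - xc) + norm (y' - xc) \<le> 2 * N" using diam[OF y(1) xc] diam[OF y(2) xc] by (simp add: dist_norm)
      ultimately have "\<bar>?a\<^sup>2 - ?b\<^sup>2\<bar> \<le> dist y y' * (2 * N)" unfolding sq abs_mult by (intro mult_mono) auto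
      then have 2: "A2 * \<bar>?a\<^sup>2 - ?b\<^sup>2\<bar> \<le> A2 * (dist y y' * (2 * N))" using A2 by (intro mult_left_mono) auto
      have "\<psi> \<rho> (y, t) - \<psi> \<rho> (y', t) = 2 * \<eta> * (sqrt (?a\<^sup>2 + \<rho>\<^sup>2) - sqrt (?b\<^sup>2 + \<rho>\<^sup>2)) + A2 * (?a\<^sup>2 - ?b\<^sup>2)"
        by (simp only: \<psi>_def right_diff_distrib)
      then have "\<bar>\<psi> \<rho> (y, t) - \<psi> \<rho> (y', t)\<bar> \<le> \<bar>2 * \<eta> * (sqrt (?a\<^sup>2 + \<rho>\<^sup>2) - sqrt (?b\<^sup>2 + \<rho>\<^sup>2))\<bar> + \<bar>A2 * (?a\<^sup>2 - ?b\<^sup>2)\<bar>"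
        by (simp only: abs_triangle_ineq)
      also have "\<dots> = 2 * \<eta> * \<bar>sqrt (?a\<^sup>2 + \<rho>\<^sup>2) - sqrt (?b\<^sup>2 + \<rho>\<^sup>2)\<bar> + A2 * \<bar>?a\<^sup>2 - ?b\<^sup>2\<bar>"
        using \<eta> A2 by (simp add: abs_mult)
      finally show ?thesis using 1 2 by (simp add: Kx_def algebra_simps)
    qed
    have coer: "bounded {t. 0 \<le> t \<and> (\<exists>x\<in>cl. \<psi> \<rho> (x, t) \<le> R)}" for R \<rho>
    proof (rule bounded_subset[OF bounded_cball[of tc "R / A2 + 1"]], clarify)
      fix t x assume le: "\<psi> \<rho> (x, t) \<le> R"
      have "\<bar>t - tc\<bar>\<^sup>2 \<le> (norm ((x, t) - ?c))\<^sup>2" by (intro power_mono) (auto simp: norm_Pair real_le_rsqrt)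
      then have "A2 * (t - tc)\<^sup>2 \<le> A2 * (norm ((x, t) - ?c))\<^sup>2" using A2 by (intro mult_left_mono) auto
      then have "A2 * (t - tc)\<^sup>2 \<le> R" using psi_ge[of "(x, t)" \<rho>] le by linarith
      then have "(t - tc)\<^sup>2 \<le> R / A2" using A2 by (simp add: field_simps)
      moreover have "\<bar>t - tc\<bar> \<le> (t - tc)\<^sup>2 + 1" by (rule abs_le_square_plus_one)
      ultimately show "t \<in> cball tc (R / A2 + 1)" by (simp add: dist_real_def abs_minus_commute)
    qed
    define CD where "CD = (2 * (K * K + 5 * K + 2 + Kx) + 8 * A * N) * N"
    define \<rho> where "\<rho> n = \<rho>0 * inverse (real (Suc n))" for n
    have \<rho>: "0 < \<rho> n" "\<rho> n \<le> \<rho>0" for n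
      using \<rho>0 mult_left_mono[of "inverse (real (Suc n))" 1 \<rho>0] by (auto simp: \<rho>_def inverse_le_1_iff)
    have \<rho>lim: "\<rho> \<longlonglongrightarrow> 0" unfolding \<rho>_def[abs_def] using tendsto_mult[OF tendsto_const[of \<rho>0] LIMSEQ_inverse_real_of_nat] by simp
    have step: "\<exists>x t p s. x \<in> cl \<and> 0 \<le> t \<and> dist (x, t) ?c \<le> 2 * \<rho> n \<and> M \<le> sc L l 0 t x - v (x, t) \<and> norm p \<le> 2 * K \<and> 0 \<le> s \<and>
      sc L l 0 t x = u (x, s) - pen L l 0 (s - t) \<and>
      (\<forall>d. 0 < d \<longrightarrow> d < r / 2 \<longrightarrow> snd (G (\<rho> n) (x, t)) \<le> H x (p - fst (G (\<rho> n) (x, t))) - H x p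
        + nl (- ball 0 d) (\<lambda>y. u (y, s)) x + nl (- ball 0 d) (\<lambda>y. - v (y, t)) x + CD * d powr (1 - sg))" for n
    proof -
      have contpsi: "continuous_on (cl \<times> {0..}) (\<psi> (\<rho> n))" unfolding \<psi>_def[abs_def] by (intro continuous_intros)
      have "\<exists>x t. x \<in> cl \<and> 0 \<le> t \<and> (\<forall>y s. y \<in> cl \<longrightarrow> 0 \<le> s \<longrightarrow>
         sc L l 0 s y - v (y, s) - \<psi> (\<rho> n) (y, s) \<le> sc L l 0 t x - v (x, t) - \<psi> (\<rho> n) (x, t))"
        by (rule sc_touching_point[OF lL contpsi psi0 coer]) blast
      then obtain x t where xt: "x \<in> cl" "0 \<le> t"
        "\<And>y s. y \<in> cl \<Longrightarrow> 0 \<le> s \<Longrightarrow> sc L l 0 s y - v (y, s) - \<psi> (\<rho> n) (y, s) \<le> sc L l 0 t x - v (x, t) - \<psi> (\<rho> n) (x, t)" by blast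
      let ?d = "dist (x, t) ?c"
      have V: "M \<le> sc L l 0 t x - v (x, t) - \<psi> (\<rho> n) (x, t)"
        using xt(3)[OF xc, of tc] tc contact(1) w psi_c[OF \<rho>(1)[of n]] by simp
      have dd: "?d < \<delta>"
      proof (rule ccontr)
        assume "\<not> ?d < \<delta>"
        then have "\<delta>\<^sup>2 \<le> ?d\<^sup>2" using \<delta> by (intro power_mono) auto
        then have "A2 * \<delta>\<^sup>2 \<le> A2 * ?d\<^sup>2" using A2 by (intro mult_left_mono) auto
        then have "4 * B + 1 \<le> \<psi> (\<rho> n) (x, t)" using psi_ge[of "(x, t)" "\<rho> n"] A2(2) unfolding dist_norm by linarith
        moreover have "sc L l 0 t x \<le> B" using sc_bounds(2)[OF lL order_refl xt(1,2)] by simp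
        moreover have "\<bar>v (x, t)\<bar> \<le> B" using vB[of "(x, t)"] xt by simp
        ultimately show False using V MB by linarith
      qed
      have "sc L l 0 t x - u (x, t) \<le> \<eta> * ?d" using \<delta>(2)[of "(x, t)"] dd xt by simp
      moreover have "u (x, t) - v (x, t) \<le> M" using wM[of "(x, t)"] xt by simp
      moreover have "0 \<le> A2 * ?d\<^sup>2" using A2 by simp
      ultimately have "2 * \<eta> * sqrt (?d\<^sup>2 + (\<rho> n)\<^sup>2) - 2 * \<eta> * \<rho> n \<le> \<eta> * ?d" using V by (simp add: \<psi>_def dist_norm)
      then have "\<eta> * (2 * sqrt (?d\<^sup>2 + (\<rho> n)\<^sup>2)) \<le> \<eta> * (?d + 2 * \<rho> n)" by (simp add: algebra_simps)
      then have sq: "2 * sqrt (?d\<^sup>2 + (\<rho> n)\<^sup>2) \<le> ?d + 2 * \<rho> n" using \<eta> by simp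
      \<comment> \<open>Squaring the previous inequality bounds the distance by
        \<open>4 / 3 * \<rho> n\<close>.\<close>
      have d2: "?d \<le> 2 * \<rho> n"
      proof (rule ccontr)
        assume n: "\<not> ?d \<le> 2 * \<rho> n"
        have "(2 * sqrt (?d\<^sup>2 + (\<rho> n)\<^sup>2))\<^sup>2 \<le> (?d + 2 * \<rho> n)\<^sup>2" using sq by (intro power_mono) auto
        then have "4 * (?d\<^sup>2 + (\<rho> n)\<^sup>2) \<le> (?d + 2 * \<rho> n)\<^sup>2" by (simp add: power_mult_distrib)
        then have "?d * (3 * ?d) \<le> ?d * (4 * \<rho> n)" by (simp add: power2_eq_square algebra_simps)
        then have "3 * ?d \<le> 4 * \<rho> n" using n \<rho>(1)[of n] by (simp add: mult_le_cancel_left)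
        then show False using n \<rho>(1)[of n] by simp
      qed
      have "\<bar>t - tc\<bar> \<le> \<tau>"
        using dist_snd_le[of "(x, t)" ?c] d2 \<rho>(2)[of n] \<rho>0(2) by (simp add: dist_real_def)
      then have "L * (tc - 3 * \<tau>) \<le> L * (t - \<tau> - \<tau>)" using L0 by (intro mult_left_mono) auto
      then have big: "2 * B < L * (t - \<tau> - \<tau>)" using \<tau>(3) by linarith
      have "L * (t - \<tau> - \<tau>) \<le> L * t" using L0 \<tau>(1) by (intro mult_left_mono) auto
      then have bigt: "2 * B < L * t" using big by linarith
      obtain e where e: "norm e \<le> 1" "\<And>y h. y \<in> cl \<Longrightarrow> dist y x < r \<Longrightarrow> 0 < h \<Longrightarrow> h < r \<Longrightarrow> ball (y + h *\<^sub>R e) (cc * h) \<subseteq> Om"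
        using cone(5)[OF xt(1)] by blast
      interpret T: touching Om nu sg N H c B u v L l K cc r Kx e x t "\<psi> (\<rho> n)" "G (\<rho> n)"
      proof unfold_locales
        show "0 \<le> \<psi> (\<rho> n) q" for q by (rule psi0)
        show "\<bar>\<psi> (\<rho> n) (y, t') - \<psi> (\<rho> n) (y', t')\<bar> \<le> Kx * dist y y'" if "y \<in> cl" "y' \<in> cl" for y y' t'
          by (rule psi_lip[OF that])
        show "sc L l 0 t' x' - v (x', t') - \<psi> (\<rho> n) (x', t') \<le> sc L l 0 t x - v (x, t) - \<psi> (\<rho> n) (x, t)"
          if "x' \<in> cl" "0 \<le> t'" for x' t' by (rule xt(3)[OF that])
      qed (fact lL K1 lip cone(1-4) e hG[OF \<rho>(1)] Kx xt(1) bigt)+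
      have "2 * B + 2 * L + K - T.m0 < A * \<tau>\<^sup>2" using V MB A(2) unfolding T.m0_def by linarith
      note ti = T.touching_inequality[OF A(1) \<tau>(1,2) big this]
      have "\<exists>p s. norm p \<le> 2 * K \<and> 0 \<le> s \<and> sc L l 0 t x = u (x, s) - pen L l 0 (s - t) \<and>
        (\<forall>d. 0 < d \<longrightarrow> d < r / 2 \<longrightarrow> snd (G (\<rho> n) (x, t)) \<le> H x (p - fst (G (\<rho> n) (x, t))) - H x p
        + nl (- ball 0 d) (\<lambda>y. u (y, s)) x + nl (- ball 0 d) (\<lambda>y. - v (y, t)) x + CD * d powr (1 - sg))"
        unfolding CD_def T.K3_def[symmetric] by (rule ti) blast
      then obtain p s where ps: "norm p \<le> 2 * K" "0 \<le> s" "sc L l 0 t x = u (x, s) - pen L l 0 (s - t)"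
        "\<And>d. 0 < d \<Longrightarrow> d < r / 2 \<Longrightarrow> snd (G (\<rho> n) (x, t)) \<le> H x (p - fst (G (\<rho> n) (x, t))) - H x p
        + nl (- ball 0 d) (\<lambda>y. u (y, s)) x + nl (- ball 0 d) (\<lambda>y. - v (y, t)) x + CD * d powr (1 - sg)" by blast
      have "M \<le> sc L l 0 t x - v (x, t)" using V psi0[of "\<rho> n" "(x, t)"] by linarith
      then show ?thesis using xt(1,2) d2 ps by blast
    qed
    then obtain X T P S where XT: "\<And>n. X n \<in> cl" "\<And>n. 0 \<le> T n" "\<And>n. dist (X n, T n) ?c \<le> 2 * \<rho> n"
      "\<And>n. M \<le> sc L l 0 (T n) (X n) - v (X n, T n)" "\<And>n. norm (P n) \<le> 2 * K" "\<And>n. 0 \<le> S n"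
      "\<And>n. sc L l 0 (T n) (X n) = u (X n, S n) - pen L l 0 (S n - T n)"
      "\<And>n d. 0 < d \<Longrightarrow> d < r / 2 \<Longrightarrow> snd (G (\<rho> n) (X n, T n)) \<le> H (X n) (P n - fst (G (\<rho> n) (X n, T n))) - H (X n) (P n)
        + nl (- ball 0 d) (\<lambda>y. u (y, S n)) (X n) + nl (- ball 0 d) (\<lambda>y. - v (y, T n)) (X n) + CD * d powr (1 - sg)"
      by metis
    have XTlim: "(\<lambda>n. (X n, T n)) \<longlonglongrightarrow> ?c"
    proof (rule metric_tendsto_imp_tendsto[of "\<lambda>n. 2 * \<rho> n" 0])
      show "(\<lambda>n. 2 * \<rho> n) \<longlonglongrightarrow> 0" using tendsto_mult[OF tendsto_const[of 2] \<rho>lim] by simp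
      show "\<forall>\<^sub>F n in sequentially. dist (X n, T n) ?c \<le> dist (2 * \<rho> n) 0"
        using XT(3) \<rho>(1) by (intro always_eventually allI) (simp add: less_imp_le)
    qed
    have Xl: "X \<longlonglongrightarrow> xc" and Tl: "T \<longlonglongrightarrow> tc" using tendsto_fst[OF XTlim] tendsto_snd[OF XTlim] by auto
    have "bounded (range S)"
    proof (rule bounded_subset[OF bounded_cball[of tc "2 * B / l + \<tau>"]], clarify)
      fix n
      have "\<bar>S n - T n\<bar> \<le> (2 * B + L * 0 + 0) / l"
        by (rule sc_argmax_bound[OF lL order_refl XT(1)[of n] XT(2)[of n] XT(6)[of n]]) (use XT(7)[of n] in simp)
      moreover have "\<bar>T n - tc\<bar> \<le> \<tau>"
        using dist_snd_le[of "(X n, T n)" ?c] XT(3)[of n] \<rho>(2)[of n] \<rho>0(2) by (simp add: dist_real_def)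
      ultimately show "S n \<in> cball tc (2 * B / l + \<tau>)" by (simp add: dist_real_def abs_le_iff)
    qed
    then obtain s\<^sub>0 f where f: "strict_mono f" "(S \<circ> f) \<longlonglongrightarrow> s\<^sub>0" using bounded_imp_convergent_subsequence by blast
    have Xf: "(\<lambda>n. X (f n)) \<longlonglongrightarrow> xc" and Tf: "(\<lambda>n. T (f n)) \<longlonglongrightarrow> tc" and Sf: "(\<lambda>n. S (f n)) \<longlonglongrightarrow> s\<^sub>0"
      using LIMSEQ_subseq_LIMSEQ[OF Xl f(1)] LIMSEQ_subseq_LIMSEQ[OF Tl f(1)] f(2) by (auto simp: o_def)
    have s00: "0 \<le> s\<^sub>0" by (rule LIMSEQ_le_const[OF Sf]) (use XT(6) in auto)
    have "sc L l 0 tc xc + pen L l 0 (s\<^sub>0 - tc) \<le> u (xc, s\<^sub>0)"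
    proof (rule usc_on_seq_le[OF uusc])
      show "(\<lambda>n. (X (f n), S (f n))) \<longlonglongrightarrow> (xc, s\<^sub>0)" by (intro tendsto_Pair Xf Sf)
      have pc: "continuous_on UNIV (\<lambda>h. pen L l 0 h)" by (rule pen_usc[OF continuous_on_id lL order_refl])
      show "(\<lambda>n. sc L l 0 (T (f n)) (X (f n)) + pen L l 0 (S (f n) - T (f n))) \<longlonglongrightarrow> sc L l 0 tc xc + pen L l 0 (s\<^sub>0 - tc)"
        by (intro tendsto_add sc_tendsto[OF lL XT(1) Xf XT(2) Tf xc _ tc(2) lip0] continuous_on_tendsto_compose[OF pc] tendsto_diff Sf Tf)
          (use tc in auto)
    qed (use XT(1,6,7) xc s00 in auto)
    then have arg: "u (xc, tc) + pen L l 0 (s\<^sub>0 - tc) \<le> u (xc, s\<^sub>0)" using contact by simp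
    have "u (xc, s\<^sub>0) - pen L1 l1 0 (s\<^sub>0 - tc) \<le> sc L1 l1 0 tc xc"
      by (rule sc_ge[OF lL1(1,2) order_refl xc less_imp_le[OF tc(1)] s00])
    \<comment> \<open>A limit of argmax times is an argmax at the contact point for the larger
      slopes; contact for the smaller slopes bounds the same value from above. The penalties can
      satisfy this only at \<open>0\<close>.\<close>
    then have pp: "pen L l 0 (s\<^sub>0 - tc) \<le> pen L1 l1 0 (s\<^sub>0 - tc)" using arg contact by simp
    have "s\<^sub>0 = tc"
    proof (rule ccontr)
      assume ne: "s\<^sub>0 \<noteq> tc"
      show False
      proof (cases "s\<^sub>0 < tc")
        case True
        have "L1 * (tc - s\<^sub>0) < L * (tc - s\<^sub>0)" using True lL1 by (intro mult_strict_right_mono) auto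
        then show False using pp True by (simp add: pen_zero algebra_simps)
      next
        case False
        have "l1 * (s\<^sub>0 - tc) < l * (s\<^sub>0 - tc)" using False ne lL1 by (intro mult_strict_right_mono) auto
        then show False using pp False ne by (simp add: pen_zero)
      qed
    qed
    then have Sf: "(\<lambda>n. S (f n)) \<longlonglongrightarrow> tc" using Sf by simp
    \<comment> \<open>The touching inequality is available only for cut-offs below
      \<open>r / 2\<close>; monotonicity of the tails at a maximum recovers the given
      \<open>D\<close>.\<close>
    define d1 where "d1 = min D (r / 4)"
    have d1: "0 < d1" "d1 \<le> D" "d1 < r / 2" using D cone by (auto simp: d1_def)
    have "CD * d powr (1 - sg) \<ge> - (\<epsilon>' + tails D tc tc xc)" if d: "0 < d" "d < d1" for d
    proof -
      have "\<forall>\<^sub>F n in sequentially. tails d (S (f n)) (T (f n)) (X (f n)) < tails d tc tc xc + \<epsilon>"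
      proof (rule nonlocal_pair_limsup[OF XT(1) Xf XT(6) Sf XT(2) Tf _ _ d(1) \<epsilon>])
        show "(\<lambda>n. M) \<longlonglongrightarrow> u (xc, tc) - v (xc, tc)" using w by simp
        fix n
        have "0 \<le> pen L l 0 (S (f n) - T (f n))"
          using pen_lower[OF lL order_refl, of "S (f n) - T (f n)"] lL by (smt (verit) mult_nonneg_nonneg abs_ge_zero)
        then show "M \<le> u (X (f n), S (f n)) - v (X (f n), T (f n))" using XT(4,7)[of "f n"] by linarith
      qed
      then obtain n where n: "tails d (S n) (T n) (X n) < tails d tc tc xc + \<epsilon>"
        by (auto simp: eventually_sequentially)
      let ?G = "G (\<rho> n) (X n, T n)"
      have nG: "norm ?G \<le> 3 * \<eta>"
      proof -
        let ?y = "(X n, T n) - ?c" and ?s = "sqrt ((norm ((X n, T n) - ?c))\<^sup>2 + (\<rho> n)\<^sup>2)"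
        have s: "norm ?y \<le> ?s" "0 < ?s" using \<rho>(1)[of n] by (auto intro: real_le_rsqrt simp: add_nonneg_pos)
        have "norm ((2 * \<eta> / ?s) *\<^sub>R ?y) = 2 * \<eta> * (norm ?y / ?s)" unfolding norm_scaleR using \<eta> s(2) by simp
        also have "\<dots> \<le> 2 * \<eta> * 1" using \<eta> s by (intro mult_left_mono) (auto simp: divide_le_eq)
        finally have 1: "norm ((2 * \<eta> / ?s) *\<^sub>R ?y) \<le> 2 * \<eta>" by simp
        have "norm ((2 * A2) *\<^sub>R ?y) = 2 * A2 * dist (X n, T n) ?c" unfolding norm_scaleR dist_norm using A2 by simp
        also have "\<dots> \<le> 2 * A2 * (2 * \<rho>0)" using XT(3)[of n] \<rho>(2)[of n] A2 by (intro mult_left_mono) auto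
        finally have 2: "norm ((2 * A2) *\<^sub>R ?y) \<le> \<eta>" using \<rho>0(3) by simp
        have "norm ?G \<le> norm ((2 * \<eta> / ?s) *\<^sub>R ?y) + norm ((2 * A2) *\<^sub>R ?y)"
          unfolding G_def add_0_right by (rule norm_triangle_ineq)
        then show ?thesis using 1 2 by linarith
      qed
      have f3: "norm (fst ?G) \<le> 3 * \<eta>" "\<bar>snd ?G\<bar> \<le> 3 * \<eta>"
        using norm_fst_le[of "fst ?G" "snd ?G"] norm_snd_le[of "snd ?G" "fst ?G"] nG by auto
      have "dist ((\<lambda>(x, p). H x p) (X n, P n - fst ?G)) ((\<lambda>(x, p). H x p) (X n, P n)) < \<epsilon>"
      proof (rule \<delta>H(2))
        show "(X n, P n) \<in> ?HS" using XT(1,5)[of n] by simp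
        have "norm (P n - fst ?G) \<le> norm (P n) + norm (fst ?G)" by (rule norm_triangle_ineq4)
        then show "(X n, P n - fst ?G) \<in> ?HS" using XT(1,5)[of n] f3(1) \<eta> by simp
        show "dist (X n, P n - fst ?G) (X n, P n) < \<delta>H" using f3(1) \<eta> by (simp add: dist_Pair_Pair dist_norm)
      qed
      then have "H (X n) (P n - fst ?G) - H (X n) (P n) < \<epsilon>" by (simp add: dist_real_def)
      moreover have "snd ?G \<le> H (X n) (P n - fst ?G) - H (X n) (P n)
        + nl (- ball 0 d) (\<lambda>y. u (y, S n)) (X n) + nl (- ball 0 d) (\<lambda>y. - v (y, T n)) (X n) + CD * d powr (1 - sg)"
        using XT(8)[of d n] d d1 by simp
      moreover have "tails d tc tc xc \<le> tails D tc tc xc"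
      proof (rule pair_tail_mono[OF xc less_imp_le[OF tc(1)] d(1)])
        show "d \<le> D" using d d1 by simp
        fix y assume "y \<in> cl" then show "u (y, tc) - v (y, tc) \<le> u (xc, tc) - v (xc, tc)" using wM[of "(y, tc)"] w tc by simp
      qed
      ultimately show ?thesis using n f3(2) \<eta>(2) unfolding \<epsilon>_def by linarith
    qed
    \<comment> \<open>The gradients were made small at fixed \<open>d\<close>; letting
      \<open>d\<close> tend to \<open>0\<close> now removes the error, whose constant depends on
      \<open>\<epsilon>'\<close> only.\<close>
    then have ev: "\<forall>\<^sub>F d in at_right 0. - (\<epsilon>' + tails D tc tc xc) \<le> CD * d powr (1 - sg)"
      using d1(1) by (auto simp: eventually_at_right_field)
    have "((\<lambda>d. CD * d powr (1 - sg)) \<longlongrightarrow> CD * 0 powr (1 - sg)) (at_right 0)"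
      using sg by (intro tendsto_intros tendsto_powr2) (auto intro: eventually_at_rightI[of 0 1])
    from tendsto_lowerbound[OF this ev] sg
    show "0 \<le> tails D tc tc xc + \<epsilon>'" by simp
  qed
  then show ?thesis using xc w by (simp add: good_def)
qed

end


section \<open>Almost every point is a contact point\<close>

context hj_pair
begin

text \<open>With \<open>d\<close> of order \<open>1 / n\<close> in the estimate for a future argmax,
  all terms are at most a constant times \<open>(1 + n) powr sg\<close>. A larger multiple of this
  power is a slope that no future argmax admits, and divided by \<open>n\<close> it tends to
  \<open>0\<close>.\<close>

lemma backward_slopes:
  obtains lw :: "nat \<Rightarrow> real" and n0 :: nat where "1 \<le> n0" "\<And>n. 0 < lw n" "\<And>n. lw n < lw (Suc n)"
    "\<And>n. n0 \<le> n \<Longrightarrow> lw n \<le> real n" "(\<lambda>n. lw n / real n) \<longlonglongrightarrow> 0"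
    "\<And>n t x s. n0 \<le> n \<Longrightarrow> 2 * B < real n * t \<Longrightarrow> x \<in> Om \<Longrightarrow>
      sc (real n) (lw n) 0 t x = u (x, s) - pen (real n) (lw n) 0 (s - t) \<Longrightarrow> s \<le> t"
proof -
  obtain KK where KK: "KK \<ge> 1"
    "\<And>L l k t x y. 0 < l \<Longrightarrow> l \<le> L \<Longrightarrow> 0 \<le> k \<Longrightarrow> k \<le> 1 \<Longrightarrow> 2 * B < L * (t - k) \<Longrightarrow> x \<in> cl \<Longrightarrow> y \<in> cl \<Longrightarrow>
      \<bar>sc L l k t x - sc L l k t y\<bar> \<le> KK * (1 + L) * dist x y"
    using sc_lipschitz by blast
  obtain CH where CH: "0 \<le> CH" "\<And>x p. x \<in> cl \<Longrightarrow> - CH \<le> H x p" using superlinear[of 0] by auto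
  define E where "E = CH + \<bar>c\<bar> + 5 * N + 2 * B * N"
  have BN: "0 \<le> B * N" using B0 N1 by simp
  have E0: "0 \<le> E" using CH(1) N1 BN by (simp add: E_def)
  \<comment> \<open>The factor \<open>2 * KK\<close> converts powers of \<open>K + 1\<close> into
    powers of \<open>1 + real n\<close>; the \<open>1\<close> gives the strict inequality.\<close>
  define C where "C = E * (2 * KK) + 1"
  have C1: "1 \<le> C" using E0 KK by (simp add: C_def)
  define lw where "lw n = C * (1 + real n) powr sg" for n
  have lwpos: "0 < lw n" for n using C1 by (simp add: lw_def)
  have lim: "(\<lambda>n. lw n / real n) \<longlonglongrightarrow> 0"
  proof (rule tendsto_0_le[where K = "2 * C" and f = "\<lambda>n. real (Suc n) powr (sg - 1)"])
    show "(\<lambda>n. real (Suc n) powr (sg - 1)) \<longlonglongrightarrow> 0"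
      using sg by (intro tendsto_neg_powr filterlim_compose[OF filterlim_real_sequentially] filterlim_Suc) auto
    have "norm (lw n / real n) \<le> norm (real (Suc n) powr (sg - 1)) * (2 * C)" if "1 \<le> n" for n
    proof -
      have n: "0 < real n" "1 + real n \<le> 2 * real n" using that by auto
      have "(1 + real n) powr sg = (1 + real n) * (1 + real n) powr (sg - 1)" by (simp add: powr_diff)
      also have "\<dots> \<le> 2 * real n * (1 + real n) powr (sg - 1)" using n by (intro mult_right_mono) auto
      finally have "C * (1 + real n) powr sg \<le> C * (2 * real n * (1 + real n) powr (sg - 1))" using C1 by (intro mult_left_mono) auto
      then have "lw n / real n \<le> 2 * C * (1 + real n) powr (sg - 1)" using n by (simp add: lw_def pos_divide_le_eq mult_ac)
      moreover have "0 \<le> lw n / real n" using lwpos[of n] n by simp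
      ultimately show ?thesis by (simp add: mult.commute add.commute)
    qed
    then show "\<forall>\<^sub>F n in sequentially. norm (lw n / real n) \<le> norm (real (Suc n) powr (sg - 1)) * (2 * C)"
      by (auto simp: eventually_sequentially)
  qed
  have "\<forall>\<^sub>F n in sequentially. lw n / real n < 1" by (rule order_tendstoD(2)[OF lim]) simp
  then obtain n1 where n1: "\<And>n. n1 \<le> n \<Longrightarrow> lw n / real n < 1" by (auto simp: eventually_sequentially)
  show thesis
  proof (rule that[of "max n1 1" lw])
    show "0 < lw n" for n by (rule lwpos)
    show "lw n < lw (Suc n)" for n using C1 sg by (simp add: lw_def powr_less_mono2)
    show "lw n \<le> real n" if "max n1 1 \<le> n" for n using n1[of n] that by (simp add: divide_less_eq)
    show "(\<lambda>n. lw n / real n) \<longlonglongrightarrow> 0" by (rule lim)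
    fix n t x s assume n: "max n1 1 \<le> n" and t: "2 * B < real n * t" and x: "x \<in> Om"
      and s: "sc (real n) (lw n) 0 t x = u (x, s) - pen (real n) (lw n) 0 (s - t)"
    have ll: "lw n \<le> real n" using n1[of n] n by (simp add: divide_less_eq)
    have "0 < real n * t" using t B0 by linarith
    then have t0: "0 < t" by (simp add: zero_less_mult_iff)
    show "s \<le> t"
    proof (rule ccontr)
      assume "\<not> s \<le> t"
      then have st: "t < s" by simp
      define K where "K = KK * (1 + real n)"
      have K1: "1 \<le> K" using KK(1) mult_mono[of 1 KK 1 "1 + real n"] by (simp add: K_def)
      \<comment> \<open>Balances \<open>K * d powr (1 - sg)\<close> against
        \<open>d powr - sg\<close>: both become at most \<open>(K + 1) powr sg\<close>.\<close>
      define d where "d = 1 / (K + 1)"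
      have d: "0 < d" "d < 1" using K1 by (auto simp: d_def)
      let ?P = "(K + 1) powr sg"
      have d1: "d powr - sg = ?P"
      proof -
        have "d powr - sg = inverse (K + 1) powr - sg" by (simp add: d_def inverse_eq_divide)
        also have "\<dots> = ?P" using K1 by (simp add: powr_minus inverse_powr)
        finally show ?thesis .
      qed
      have d2: "d powr (1 - sg) = d * ?P"
      proof -
        have "d powr (1 + - sg) = d powr 1 * d powr - sg" by (rule powr_add)
        then show ?thesis using d d1 by simp
      qed
      have P1: "1 \<le> ?P" using K1 sg by (intro ge_one_powr_ge_zero) auto
      have "K * d \<le> 1" using K1 by (simp add: d_def)
      then have Kd: "(K * d) * (5 * N * ?P) \<le> 1 * (5 * N * ?P)" using N1 by (intro mult_right_mono) auto
      have "lw n \<le> CH + \<bar>c\<bar> + 5 * K * N * d powr (1 - sg) + 2 * B * N * d powr - sg"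
        by (rule forward_argmax[OF lwpos ll K1 _ x t0 st s CH(2) d]) (use KK(2)[OF lwpos ll order_refl, of t x] t x Om_cl in \<open>auto simp: K_def\<close>)
      also have "5 * K * N * d powr (1 - sg) = (K * d) * (5 * N * ?P)" unfolding d2 by simp
      also have "CH + \<bar>c\<bar> + (K * d) * (5 * N * ?P) + 2 * B * N * d powr - sg \<le> (CH + \<bar>c\<bar>) * ?P + 5 * N * ?P + 2 * B * N * ?P"
      proof -
        have "(CH + \<bar>c\<bar>) * 1 \<le> (CH + \<bar>c\<bar>) * ?P" using P1 CH(1) by (intro mult_left_mono) auto
        then show ?thesis using Kd unfolding d1 by simp
      qed
      also have "\<dots> = E * ?P" by (simp add: E_def algebra_simps)
      also have "E * ?P \<le> E * (2 * KK * (1 + real n) powr sg)"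
      proof (rule mult_left_mono[OF _ E0])
        have "?P \<le> ((2 * KK) * (1 + real n)) powr sg" using K1 sg by (intro powr_mono2) (auto simp: K_def)
        also have "\<dots> = (2 * KK) powr sg * (1 + real n) powr sg" using KK by (simp add: powr_mult)
        also have "\<dots> \<le> (2 * KK) powr 1 * (1 + real n) powr sg" using KK sg by (intro mult_right_mono powr_mono) auto
        finally show "?P \<le> 2 * KK * (1 + real n) powr sg" using KK by simp
      qed
      also have "\<dots> < lw n"
      proof -
        have "0 < (1 + real n) powr sg" by simp
        then show ?thesis by (simp add: lw_def C_def algebra_simps)
      qed
      finally show False by simp
    qed
  qed simp
qed

lemma sc_continuous:
  assumes lL: "0 < l" "l \<le> L" and T: "2 * B < L * T"
    and lip: "\<And>t x y. 2 * B < L * t \<Longrightarrow> x \<in> cl \<Longrightarrow> y \<in> cl \<Longrightarrow> \<bar>sc L l 0 t x - sc L l 0 t y\<bar> \<le> K * dist x y"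
  shows "continuous_on (cl \<times> {T..}) (\<lambda>q. sc L l 0 (snd q) (fst q))"
  unfolding continuous_on_sequentially
proof (intro allI ballI impI, elim conjE)
  fix X q assume q: "q \<in> cl \<times> {T..}" and X: "\<forall>n. X n \<in> cl \<times> {T..}" "X \<longlonglongrightarrow> q"
  have L0: "0 < L" using lL by simp
  have "0 < L * T" using T B0 by linarith
  then have T0: "0 < T" using L0 by (simp add: zero_less_mult_iff)
  have "L * T \<le> L * snd q" using q L0 by (intro mult_left_mono) auto
  then have "2 * B < L * snd q" using T by linarith
  then show "((\<lambda>q. sc L l 0 (snd q) (fst q)) \<circ> X) \<longlonglongrightarrow> sc L l 0 (snd q) (fst q)"
    unfolding o_def
    by (intro sc_tendsto[OF lL _ _ _ _ _ _ _ lip] tendsto_fst tendsto_snd X) (use q X T0 in \<open>auto simp: mem_Times_iff intro: order_trans[OF less_imp_le]\<close>)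
qed

lemma sc_space_lipschitz:
  assumes l: "0 < l" "l \<le> L"
  obtains K where "1 \<le> K" "\<And>t x y. 2 * B < L * t \<Longrightarrow> x \<in> cl \<Longrightarrow> y \<in> cl \<Longrightarrow> \<bar>sc L l 0 t x - sc L l 0 t y\<bar> \<le> K * dist x y"
proof -
  obtain KK where KK: "KK \<ge> 1"
    "\<And>L l k t x y. 0 < l \<Longrightarrow> l \<le> L \<Longrightarrow> 0 \<le> k \<Longrightarrow> k \<le> 1 \<Longrightarrow> 2 * B < L * (t - k) \<Longrightarrow> x \<in> cl \<Longrightarrow> y \<in> cl \<Longrightarrow>
      \<bar>sc L l k t x - sc L l k t y\<bar> \<le> KK * (1 + L) * dist x y"
    using sc_lipschitz by blast
  show thesis
  proof (rule that[of "KK * (1 + L)"])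
    show "1 \<le> KK * (1 + L)" using KK(1) l mult_mono[of 1 KK 1 "1 + L"] by simp
    show "\<bar>sc L l 0 t x - sc L l 0 t y\<bar> \<le> KK * (1 + L) * dist x y" if "2 * B < L * t" "x \<in> cl" "y \<in> cl" for t x y
      using KK(2)[OF l order_refl, of t x y] that by simp
  qed
qed

text \<open>On each fixed time interval and above each \<open>x\<close> in \<open>Om\<close>, the
  times without contact have measure tending to \<open>0\<close> as \<open>n\<close> grows, so
  almost every time is a contact time for some \<open>n\<close>. The contact sets are closed, which
  makes the exceptional set Borel and Fubini applicable.\<close>

lemma contact_ae:
  fixes lw :: "nat \<Rightarrow> real" and n0 :: nat
  assumes n0: "1 \<le> n0" and pos: "\<And>n. 0 < lw n" and le: "\<And>n. n0 \<le> n \<Longrightarrow> lw n \<le> real n"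
    and lim: "(\<lambda>n. lw n / real n) \<longlonglongrightarrow> 0"
    and bwd: "\<And>n t x s. n0 \<le> n \<Longrightarrow> 2 * B < real n * t \<Longrightarrow> x \<in> Om \<Longrightarrow>
      sc (real n) (lw n) 0 t x = u (x, s) - pen (real n) (lw n) 0 (s - t) \<Longrightarrow> s \<le> t"
  obtains W where "W \<in> null_sets (lborel :: ('a \<times> real) measure)"
    "\<And>x t. x \<in> Om \<Longrightarrow> 0 < t \<Longrightarrow> (x, t) \<notin> W \<Longrightarrow> \<exists>n\<ge>n0. 2 * B < real n * t \<and> sc (real n) (lw n) 0 t x = u (x, t)"
proof -
  define T where "T n = (2 * B + 1) / real n" for n :: nat
  define C where "C n = {q\<in>cl \<times> {T n..}. 0 \<le> u q + - sc (real n) (lw n) 0 (snd q) (fst q)}" for n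
  have T: "0 < T n" "2 * B < real n * T n" if "n0 \<le> n" for n
    using that n0 B0 by (auto simp: T_def add_pos_pos)
  have closedC: "closed (C n)" if n: "n0 \<le> n" for n
  proof -
    obtain K where "1 \<le> K" and lip: "\<And>t x y. 2 * B < real n * t \<Longrightarrow> x \<in> cl \<Longrightarrow> y \<in> cl \<Longrightarrow>
        \<bar>sc (real n) (lw n) 0 t x - sc (real n) (lw n) 0 t y\<bar> \<le> K * dist x y"
      using sc_space_lipschitz[OF pos[of n] le[OF n]] by blast
    have "usc_on (cl \<times> {T n..}) (\<lambda>q. u q + - sc (real n) (lw n) 0 (snd q) (fst q))"
      by (intro usc_on_add usc_on_subset[OF uusc] continuous_on_imp_usc_on continuous_on_minus
          sc_continuous[OF pos le[OF n] T(2)[OF n] lip]) (use T(1)[OF n] in auto)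
    then show ?thesis unfolding C_def by (rule closed_usc_superlevel) (intro closed_Times closed_closure closed_atLeast)
  qed
  have Ceq: "2 * B < real n * t \<and> sc (real n) (lw n) 0 t x = u (x, t)" if "(x, t) \<in> C n" "n0 \<le> n" for x t n
  proof
    have xt: "x \<in> cl" "T n \<le> t" "sc (real n) (lw n) 0 t x \<le> u (x, t)" using that(1) by (auto simp: C_def)
    have "0 \<le> t" using xt(2) T(1)[OF that(2)] by simp
    then show "sc (real n) (lw n) 0 t x = u (x, t)"
      using xt sc_bounds(1)[OF pos le[OF that(2)] order_refl xt(1)] by (intro antisym) auto
    have "real n * T n \<le> real n * t" using xt by (intro mult_left_mono) auto
    then show "2 * B < real n * t" using T(2)[OF that(2)] by linarith
  qed
  define W where "W = Om \<times> {0<..} - (\<Union>n\<in>{n0..}. C n)"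
  have Wb: "W \<in> sets borel"
    unfolding W_def by (intro sets.Diff sets.countable_UN' borel_open open_Times open_Om open_greaterThan)
      (use closedC in \<open>auto intro: borel_closed\<close>)
  have sec: "emeasure lborel (Pair x -` W) = 0" for x
  proof (cases "x \<in> Om")
    case False
    then have "Pair x -` W = {}" by (auto simp: W_def)
    then show ?thesis by simp
  next
    case True
    then have xc: "x \<in> cl" using Om_cl by blast
    have Sb: "Pair x -` W \<in> sets borel"
      using measurable_sets[of "Pair x" borel "borel :: ('a \<times> real) measure" W] Wb by (simp add: borel_measurable_continuous_onI continuous_on_Pair)
    have part: "Pair x -` W \<inter> {a..b} \<in> null_sets lborel" if ab: "0 < a" "a \<le> b" for a b
    proof -
      let ?S = "Pair x -` W \<inter> {a..b}"
      have S1: "?S \<in> sets borel" using Sb by auto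
      have S: "?S \<in> lmeasurable"
        using fmeasurable_Int_fmeasurable[of "{a..b}" lebesgue "Pair x -` W"] Sb by (simp add: Int_commute)
      \<comment> \<open>The bound on contact time from below, rewritten for the complement; it tends
        to \<open>0\<close> since both \<open>lw n / real n\<close> and \<open>1 / real n\<close>
        do.\<close>
      have bd: "measure lebesgue ?S \<le> (b - a) * (lw n / real n) + 2 * B / real n" if n: "n0 \<le> n" "2 * B + 1 \<le> real n * a" for n
      proof -
        let ?Z = "{t\<in>{a..b}. sc (real n) (lw n) 0 t x = u (x, t)}"
        have rn: "0 < real n" using n n0 by simp
        have Ta: "T n \<le> a" using n(2) rn by (simp add: T_def pos_divide_le_eq mult.commute)
        have Z: "?Z = {a..b} \<inter> Pair x -` C n"
        proof (intro set_eqI iffI)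
          fix t assume "t \<in> ?Z" then show "t \<in> {a..b} \<inter> Pair x -` C n" using Ta xc by (auto simp: C_def)
        next
          fix t assume "t \<in> {a..b} \<inter> Pair x -` C n" then show "t \<in> ?Z" using Ceq[OF _ n(1), of x t] by auto
        qed
        have "closed (Pair x -` C n)" by (intro closed_vimage closedC n(1) continuous_intros)
        then have Zm: "?Z \<in> lmeasurable" unfolding Z by (intro fmeasurable_Int_fmeasurable) auto
        have "real n * (b - a) - 2 * B \<le> (real n + lw n) * measure lebesgue ?Z"
        proof (rule noncontact_measure[OF pos le[OF n(1)] xc _ ab(2) _ Zm])
          show "0 \<le> a" using ab by simp
          fix t s assume t: "a \<le> t" "t \<le> b" and s: "sc (real n) (lw n) 0 t x = u (x, s) - pen (real n) (lw n) 0 (s - t)"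
          have "real n * a \<le> real n * t" using t by (intro mult_left_mono) auto
          then have "2 * B < real n * t" using n(2) by linarith
          then show "s \<le> t" using bwd[OF n(1) _ True s] by simp
        qed
        moreover have "measure lebesgue ?S + measure lebesgue ?Z \<le> b - a"
        proof -
          have d: "?S \<inter> ?Z = {}" unfolding Z using n(1) by (auto simp: W_def)
          have "measure lebesgue ?S + measure lebesgue ?Z = measure lebesgue (?S \<union> ?Z)"
            using measure_Un3[OF S Zm] unfolding d by simp
          also have "\<dots> \<le> measure lebesgue {a..b}"
            using S Zm by (intro measure_mono_fmeasurable) (auto simp: fmeasurableD)
          finally show ?thesis using ab by simp
        qed
        then have "(real n + lw n) * (measure lebesgue ?S + measure lebesgue ?Z) \<le> (real n + lw n) * (b - a)"
          using pos[of n] by (intro mult_left_mono) auto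
        ultimately have "(real n + lw n) * measure lebesgue ?S \<le> lw n * (b - a) + 2 * B" by (simp add: algebra_simps)
        moreover have "real n * measure lebesgue ?S \<le> (real n + lw n) * measure lebesgue ?S"
          using pos[of n] by (intro mult_right_mono) auto
        ultimately have "real n * measure lebesgue ?S \<le> lw n * (b - a) + 2 * B" by linarith
        then have "measure lebesgue ?S \<le> (lw n * (b - a) + 2 * B) / real n" using rn by (simp add: pos_le_divide_eq mult.commute)
        then show ?thesis by (simp add: add_divide_distrib mult.commute)
      qed
      have ev: "\<forall>\<^sub>F n in sequentially. measure lebesgue ?S \<le> (b - a) * (lw n / real n) + 2 * B / real n"
      proof -
        obtain m where m: "(2 * B + 1) / a \<le> real m" using real_arch_simple by blast
        have "measure lebesgue ?S \<le> (b - a) * (lw n / real n) + 2 * B / real n" if "max n0 m \<le> n" for n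
        proof (rule bd)
          have "(2 * B + 1) / a \<le> real n" using m that by linarith
          then show "2 * B + 1 \<le> real n * a" using ab by (simp add: pos_divide_le_eq)
        qed (use that in simp)
        then show ?thesis unfolding eventually_sequentially by blast
      qed
      have "(\<lambda>n. (b - a) * (lw n / real n) + 2 * B / real n) \<longlonglongrightarrow> (b - a) * 0 + 0"
        by (intro tendsto_add tendsto_mult tendsto_const lim tendsto_divide_0[OF tendsto_const] filterlim_at_top_imp_at_infinity filterlim_real_sequentially)
      from tendsto_lowerbound[OF this ev] have "measure lebesgue ?S \<le> 0" by simp
      then have "measure lebesgue ?S = 0" by (simp add: measure_le_0_iff)
      then have "emeasure lebesgue ?S = 0" using S by (simp add: emeasure_eq_measure2)
      then show ?thesis using S1 by (auto simp: null_sets_def)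
    qed
    \<comment> \<open>The intervals avoid time \<open>0\<close>, where the estimates for fixed
      \<open>n\<close> fail, and exhaust the positive times.\<close>
    have "(\<Union>k. Pair x -` W \<inter> {inverse (real (Suc k)).. real (Suc k)}) \<in> null_sets lborel"
      by (intro null_sets_UN part) (auto simp: inverse_le_1_iff intro: order_trans[of _ 1])
    moreover have "(\<Union>k. Pair x -` W \<inter> {inverse (real (Suc k)).. real (Suc k)}) = Pair x -` W"
    proof (intro equalityI subsetI)
      fix t assume t: "t \<in> Pair x -` W"
      then have "0 < t" by (auto simp: W_def)
      then obtain k1 where k1: "inverse (real (Suc k1)) < t" using reals_Archimedean by blast
      obtain k2 where k2: "t \<le> real k2" using real_arch_simple by blast
      let ?k = "max k1 k2"
      have "inverse (real (Suc ?k)) \<le> inverse (real (Suc k1))" by (intro le_imp_inverse_le) auto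
      moreover have "real k2 \<le> real (Suc ?k)" unfolding of_nat_le_iff by simp
      ultimately have "inverse (real (Suc ?k)) \<le> t \<and> t \<le> real (Suc ?k)" using k1 k2 by linarith
      then have "t \<in> Pair x -` W \<inter> {inverse (real (Suc ?k)).. real (Suc ?k)}"
        unfolding Int_iff atLeastAtMost_iff using t by blast
      then show "t \<in> (\<Union>k. Pair x -` W \<inter> {inverse (real (Suc k)).. real (Suc k)})" by blast
    qed auto
    ultimately show ?thesis by (simp add: null_sets_def)
  qed
  have "emeasure (lborel :: ('a \<times> real) measure) W = emeasure (lborel \<Otimes>\<^sub>M lborel) W" by (simp add: lborel_prod)
  also have "\<dots> = (\<integral>\<^sup>+x. emeasure lborel (Pair x -` W) \<partial>lborel)"
    by (rule lborel.emeasure_pair_measure_alt) (simp only: lborel_prod sets_lborel Wb)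
  also have "\<dots> = 0" unfolding sec by simp
  finally have "W \<in> null_sets (lborel :: ('a \<times> real) measure)" using Wb by (simp add: null_sets_def)
  then show thesis
  proof (rule that)
    fix x t assume xt: "x \<in> Om" "0 < t" "(x, t) \<notin> W"
    then obtain n where "n0 \<le> n" "(x, t) \<in> C n" by (auto simp: W_def)
    then show "\<exists>n\<ge>n0. 2 * B < real n * t \<and> sc (real n) (lw n) 0 t x = u (x, t)" using Ceq by blast
  qed
qed

end

section \<open>The exceptional null set and the parabolic conclusion\<close>

context hj_contact
begin

text \<open>A point outside the null set is in contact for some \<open>n\<close>, hence also for
  \<open>Suc n\<close> with its steeper penalty. These are the two pairs of slopes that make the
  argmax unique.\<close>

lemma bad_contacts_null:
  obtains S where "S \<in> null_sets (lborel :: ('a \<times> real) measure)"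
    "\<And>x t. x \<in> Om \<Longrightarrow> 0 < t \<Longrightarrow> u (x, t) - v (x, t) = M \<Longrightarrow> (x, t) \<notin> S \<Longrightarrow> good t x"
proof -
  obtain lw :: "nat \<Rightarrow> real" and n0 :: nat where n0: "1 \<le> n0" and pos: "\<And>n. 0 < lw n" and inc: "\<And>n. lw n < lw (Suc n)"
    and le: "\<And>n. n0 \<le> n \<Longrightarrow> lw n \<le> real n" and lim: "(\<lambda>n. lw n / real n) \<longlonglongrightarrow> 0"
    and bwd: "\<And>n t x s. n0 \<le> n \<Longrightarrow> 2 * B < real n * t \<Longrightarrow> x \<in> Om \<Longrightarrow>
      sc (real n) (lw n) 0 t x = u (x, s) - pen (real n) (lw n) 0 (s - t) \<Longrightarrow> s \<le> t"
  proof -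
    have "\<exists>(lw :: nat \<Rightarrow> real) n0 :: nat. 1 \<le> n0 \<and> (\<forall>n. 0 < lw n) \<and> (\<forall>n. lw n < lw (Suc n)) \<and> (\<forall>n\<ge>n0. lw n \<le> real n) \<and>
      (\<lambda>n. lw n / real n) \<longlonglongrightarrow> 0 \<and> (\<forall>n t x s. n0 \<le> n \<longrightarrow> 2 * B < real n * t \<longrightarrow> x \<in> Om \<longrightarrow>
        sc (real n) (lw n) 0 t x = u (x, s) - pen (real n) (lw n) 0 (s - t) \<longrightarrow> s \<le> t)"
      by (rule backward_slopes) blast
    then show thesis using that by blast
  qed
  obtain W where W: "W \<in> null_sets (lborel :: ('a \<times> real) measure)"
    "\<And>x t. x \<in> Om \<Longrightarrow> 0 < t \<Longrightarrow> (x, t) \<notin> W \<Longrightarrow> \<exists>n\<ge>n0. 2 * B < real n * t \<and> sc (real n) (lw n) 0 t x = u (x, t)"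
  proof -
    have "\<exists>W \<in> null_sets (lborel :: ('a \<times> real) measure). \<forall>x t. x \<in> Om \<longrightarrow> 0 < t \<longrightarrow> (x, t) \<notin> W \<longrightarrow>
      (\<exists>n\<ge>n0. 2 * B < real n * t \<and> sc (real n) (lw n) 0 t x = u (x, t))"
    proof (rule contact_ae[OF n0 pos le lim])
      show "s \<le> t" if "n0 \<le> n" "2 * B < real n * t" "x \<in> Om"
        "sc (real n) (lw n) 0 t x = u (x, s) - pen (real n) (lw n) 0 (s - t)" for n t x s by (rule bwd[OF that])
    qed blast+
    then show thesis using that by blast
  qed
  define P where "P n k = {p \<in> Om \<times> {t. 2 * B < real n * t}. sc (real n) (lw n) 0 (snd p) (fst p) = u p \<and>
    (\<forall>\<delta>>0. \<exists>q\<in>cl \<times> {0..}. dist q p < \<delta> \<and> inverse (real (Suc k)) * dist q p < sc (real n) (lw n) 0 (snd q) (fst q) - u q)}"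
    for n k :: nat
  have P: "negligible (P n k)" if n: "n0 \<le> n" for n k
  proof -
    obtain K where K: "1 \<le> K" and lip: "\<And>t x y. 2 * B < real n * t \<Longrightarrow> x \<in> cl \<Longrightarrow> y \<in> cl \<Longrightarrow>
        \<bar>sc (real n) (lw n) 0 t x - sc (real n) (lw n) 0 t y\<bar> \<le> K * dist x y"
      using sc_space_lipschitz[OF pos[of n] le[OF n]] by blast
    show ?thesis unfolding P_def by (rule steep_gap_negligible[OF pos le[OF n] K lip]) simp_all
  qed
  have "negligible (\<Union>j. P (n0 + fst (prod_decode j)) (snd (prod_decode j)))"
    by (intro negligible_Union_nat P) simp
  moreover have "negligible W" unfolding negligible_iff_null_sets by (rule null_sets_completionI[OF W(1)])
  ultimately have "negligible (W \<union> (\<Union>j. P (n0 + fst (prod_decode j)) (snd (prod_decode j))))" by (rule negligible_Un[rotated])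
  then obtain S where S: "S \<in> null_sets lborel" "W \<union> (\<Union>j. P (n0 + fst (prod_decode j)) (snd (prod_decode j))) \<subseteq> S"
    unfolding negligible_iff_null_sets null_sets_completion_iff2 by blast
  show thesis
  proof (rule that[OF S(1)])
    fix x t assume x: "x \<in> Om" and t: "0 < t" and w: "u (x, t) - v (x, t) = M" and nS: "(x, t) \<notin> S"
    have xc: "x \<in> cl" using x Om_cl by blast
    obtain n where n: "n0 \<le> n" "2 * B < real n * t" "sc (real n) (lw n) 0 t x = u (x, t)" using W(2)[OF x t] nS S(2) by blast
    let ?L = "real (Suc n)" and ?l = "lw (Suc n)"
    have Sn: "n0 \<le> Suc n" using n by simp
    have big: "2 * B < ?L * t" using n(2) t by (simp add: distrib_right)
    \<comment> \<open>Steeper penalties lower the sup-convolution, and \<open>u\<close> remains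
      below it, so contact persists.\<close>
    have eq: "sc ?L ?l 0 t x = u (x, t)"
    proof (rule antisym)
      obtain s where s: "0 \<le> s" "sc ?L ?l 0 t x = u (x, s) - pen ?L ?l 0 (s - t)"
        using sc_attained[OF pos le[OF Sn] order_refl xc less_imp_le[OF t]] .
      have "pen (real n) (lw n) 0 (s - t) \<le> pen ?L ?l 0 (s - t)"
      proof (cases "s - t \<le> 0")
        case True
        then have "- real n * (s - t) \<le> - ?L * (s - t)" by (intro mult_right_mono_neg) auto
        then show ?thesis using True by (simp only: pen_zero if_True)
      next
        case False
        then have "lw n * (s - t) \<le> ?l * (s - t)" using inc[of n] by (intro mult_right_mono) auto
        then show ?thesis using False by (simp only: pen_zero if_False)
      qed
      moreover have "u (x, s) - pen (real n) (lw n) 0 (s - t) \<le> sc (real n) (lw n) 0 t x"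
        by (rule sc_ge[OF pos le[OF n(1)] order_refl xc less_imp_le[OF t] s(1)])
      ultimately show "sc ?L ?l 0 t x \<le> u (x, t)" using s(2) n(3) by linarith
      show "u (x, t) \<le> sc ?L ?l 0 t x" by (rule sc_bounds(1)[OF pos le[OF Sn] order_refl xc less_imp_le[OF t]])
    qed
    have nP: "(x, t) \<notin> P (Suc n) k" for k
    proof
      assume "(x, t) \<in> P (Suc n) k"
      then have "(x, t) \<in> P (n0 + fst (prod_decode (prod_encode (Suc n - n0, k)))) (snd (prod_decode (prod_encode (Suc n - n0, k))))"
        using Sn by simp
      then show False using nS S(2) by blast
    qed
    show "good t x"
    proof (rule dense_contact_good[OF pos le[OF Sn] pos le[OF n(1)] inc _ xc t big w eq n(3)])
      fix \<eta> :: real assume "0 < \<eta>"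
      then obtain k where k: "inverse (real (Suc k)) < \<eta>" using reals_Archimedean by blast
      have "\<not> (\<forall>\<delta>>0. \<exists>q\<in>cl \<times> {0..}. dist q (x, t) < \<delta> \<and> inverse (real (Suc k)) * dist q (x, t) < sc ?L ?l 0 (snd q) (fst q) - u q)"
        using nP[of k] x big eq by (simp add: P_def)
      then obtain \<delta> where \<delta>: "0 < \<delta>" "\<And>q. q \<in> cl \<times> {0..} \<Longrightarrow> dist q (x, t) < \<delta> \<Longrightarrow>
        sc ?L ?l 0 (snd q) (fst q) - u q \<le> inverse (real (Suc k)) * dist q (x, t)" by (meson not_less)
      have "sc ?L ?l 0 (snd q) (fst q) - u q \<le> \<eta> * dist q (x, t)" if "q \<in> cl \<times> {0..}" "dist q (x, t) < \<delta>" for q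
        using \<delta>(2)[OF that] mult_right_mono[OF less_imp_le[OF k], of "dist q (x, t)"] by simp
      then show "\<exists>\<delta>>0. \<forall>q\<in>cl \<times> {0..}. dist q (x, t) < \<delta> \<longrightarrow> sc ?L ?l 0 (snd q) (fst q) - u q \<le> \<eta> * dist q (x, t)"
        using \<delta>(1) by blast
    qed simp
  qed
qed

text \<open>The exceptional set is null in space-time, so by Fubini its slices are null in space for
  almost every time. At these times the maximum propagates over the whole closure; all other times
  up to \<open>t0\<close>, including \<open>0\<close>, follow by upper semicontinuity.\<close>

theorem contact_everywhere:
  assumes cover: "iterative_covering Om nu" and x: "x \<in> cl" and t: "0 \<le> t" "t \<le> t0"
  shows "u (x, t) - v (x, t) = M"
proof -
  obtain S where S: "S \<in> null_sets (lborel :: ('a \<times> real) measure)"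
    "\<And>x t. x \<in> Om \<Longrightarrow> 0 < t \<Longrightarrow> u (x, t) - v (x, t) = M \<Longrightarrow> (x, t) \<notin> S \<Longrightarrow> good t x"
    using bad_contacts_null by blast
  have Sb: "S \<in> sets (lborel \<Otimes>\<^sub>M lborel)" unfolding lborel_prod using S(1) by (rule null_setsD2)
  have "emeasure (lborel \<Otimes>\<^sub>M lborel) S = (\<integral>\<^sup>+t. emeasure lborel ((\<lambda>x. (x, t)) -` S) \<partial>lborel)"
    by (rule lborel_pair.emeasure_pair_measure_alt2[OF Sb])
  then have "(\<integral>\<^sup>+t. emeasure lborel ((\<lambda>x. (x, t)) -` S) \<partial>lborel) = 0"
    using S(1) by (simp add: lborel_prod null_sets_def)
  then have ae: "AE t in lborel. emeasure lborel ((\<lambda>x. (x, t)) -` S) = 0"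
    using nn_integral_0_iff_AE[OF lborel_pair.measurable_emeasure_Pair2[OF Sb]] by simp
  \<comment> \<open>Goodness is known off the null set only for points of \<open>Om\<close>; the
    frontier is added to the exceptional set, which is allowed because it is negligible.\<close>
  have fr: "frontier Om \<in> null_sets lborel"
    using negligible_frontier_Om by (auto simp: negligible_iff_null_sets null_sets_def)
  have good_t: "u (x, s) - v (x, s) = M" if s: "0 < s" "s \<le> t0" and z: "emeasure lborel ((\<lambda>x. (x, s)) -` S) = 0" and x: "x \<in> cl" for x s
  proof (rule good_everywhere[OF s cover _ _ x])
    have "(\<lambda>x. (x, s)) -` S \<in> sets borel"
      using sets_Pair2[OF Sb, of s] by simp
    then show "(\<lambda>x. (x, s)) -` S \<union> frontier Om \<in> null_sets lborel"
      using z fr by (intro null_sets.Un) (auto simp: null_sets_def)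
    fix y assume y: "y \<in> cl" "u (y, s) - v (y, s) = M" "y \<notin> (\<lambda>x. (x, s)) -` S \<union> frontier Om"
    have "y \<in> Om" using y open_Om by (auto simp: frontier_def interior_open)
    then show "good s y" using S(2)[OF _ s(1) y(2)] y by auto
  qed
  have near: "\<exists>s. 0 < s \<and> s \<le> t0 \<and> \<bar>s - t\<bar> < e \<and> emeasure lborel ((\<lambda>x. (x, s)) -` S) = 0" if e: "0 < e" for e
  proof (rule ccontr)
    assume n: "\<not> ?thesis"
    define a where "a = max 0 (t - e)"
    define b where "b = min t0 (t + e)"
    have ab: "a < b" using t t0 e by (auto simp: a_def b_def)
    have "AE s in lborel. s \<notin> {a<..<b}"
      using ae
    proof (rule eventually_mono)
      fix s assume "emeasure lborel ((\<lambda>x. (x, s)) -` S) = 0"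
      then show "s \<notin> {a<..<b}" using n by (auto simp: a_def b_def abs_less_iff)
    qed
    then have "emeasure lborel {a<..<b} = 0"
      by (subst (asm) AE_iff_measurable[where N = "{a<..<b}"]) auto
    then show False using ab by simp
  qed
  have "\<exists>s. \<forall>n. 0 < s n \<and> s n \<le> t0 \<and> \<bar>s n - t\<bar> < inverse (real (Suc n)) \<and> emeasure lborel ((\<lambda>x. (x, s n)) -` S) = 0"
    by (intro choice allI near) simp
  then obtain s where s: "\<And>n. 0 < s n" "\<And>n. s n \<le> t0" "\<And>n. \<bar>s n - t\<bar> < inverse (real (Suc n))"
    "\<And>n. emeasure lborel ((\<lambda>x. (x, s n)) -` S) = 0" by blast
  have "s \<longlonglongrightarrow> t"
    by (rule metric_tendsto_imp_tendsto[OF LIMSEQ_inverse_real_of_nat]) (use s(3) in \<open>auto simp: dist_real_def intro!: always_eventually less_imp_le\<close>)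
  then have lim: "(\<lambda>n. (x, s n)) \<longlonglongrightarrow> (x, t)" by (intro tendsto_Pair tendsto_const)
  have "M \<le> u (x, t) - v (x, t)"
    by (rule usc_on_seq_le[OF w_usc _ lim _ tendsto_const]) (use x t s good_t[OF s(1,2,4) x] in \<open>auto simp: less_imp_le\<close>)
  then show ?thesis using wM[of "(x, t)"] x t by simp
qed

end


section \<open>The theorem\<close>

lemma C1_gradient_slices:
  fixes \<phi> :: "'a::euclidean_space \<times> real \<Rightarrow> real"
  assumes \<phi>: "has_C1_gradient (S \<times> {0..}) \<phi> G" and t: "0 < t"
  shows "has_C1_gradient S (\<lambda>y. \<phi> (y, t)) (\<lambda>y. fst (G (y, t)))"
    and "x \<in> S \<Longrightarrow> ((\<lambda>s. \<phi> (x, s)) has_real_derivative snd (G (x, t))) (at t)"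
proof -
  have d: "(\<phi> has_derivative (\<lambda>h. G (y, t) \<bullet> h)) (at (y, t) within S \<times> {0..})" if "y \<in> S" for y
    using \<phi> t that by (auto simp: has_C1_gradient_def)
  show "has_C1_gradient S (\<lambda>y. \<phi> (y, t)) (\<lambda>y. fst (G (y, t)))"
    unfolding has_C1_gradient_def
  proof (intro conjI ballI)
    have "continuous_on (S \<times> {0..}) G" using \<phi> by (simp add: has_C1_gradient_def)
    then have "continuous_on S (\<lambda>y. G (y, t))"
      by (rule continuous_on_compose2) (use t in \<open>auto intro!: continuous_intros\<close>)
    then show "continuous_on S (\<lambda>y. fst (G (y, t)))" by (rule continuous_on_fst)
    fix y assume y: "y \<in> S"
    have "((\<lambda>y. (y, t)) has_derivative (\<lambda>h. (h, 0))) (at y within S)" by (auto intro!: derivative_eq_intros)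
    moreover have "(\<phi> has_derivative (\<lambda>h. G (y, t) \<bullet> h)) (at (y, t) within (\<lambda>y. (y, t)) ` S)"
      by (rule has_derivative_subset[OF d[OF y]]) (use t in auto)
    ultimately have "((\<lambda>y. \<phi> (y, t)) has_derivative (\<lambda>h. G (y, t) \<bullet> (h, 0))) (at y within S)"
      by (rule has_derivative_in_compose)
    then show "((\<lambda>y. \<phi> (y, t)) has_derivative (\<lambda>h. fst (G (y, t)) \<bullet> h)) (at y within S)"
      by (simp add: inner_prod_def)
  qed
  assume x: "x \<in> S"
  \<comment> \<open>On the open half-line the derivative within \<open>{0..}\<close> becomes
    two-sided at \<open>t > 0\<close>, as the criterion for local extrema requires.\<close>
  have "((\<lambda>s. (x, s)) has_derivative (\<lambda>h. (0, h))) (at t within {0<..})" by (auto intro!: derivative_eq_intros)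
  moreover have "(\<phi> has_derivative (\<lambda>h. G (x, t) \<bullet> h)) (at (x, t) within (\<lambda>s. (x, s)) ` {0<..})"
    by (rule has_derivative_subset[OF d[OF x]]) (use x in auto)
  ultimately have "((\<lambda>s. \<phi> (x, s)) has_derivative (\<lambda>h. G (x, t) \<bullet> (0, h))) (at t within {0<..})"
    by (rule has_derivative_in_compose)
  then have "((\<lambda>s. \<phi> (x, s)) has_derivative (\<lambda>h. snd (G (x, t)) * h)) (at t)"
    using t at_within_open[of t "{0<..}"] by (simp add: inner_prod_def)
  then show "((\<lambda>s. \<phi> (x, s)) has_real_derivative snd (G (x, t))) (at t)" by (simp add: has_field_derivative_def)
qed

text \<open>For a function constant in time, touching at \<open>(x, t)\<close> makes the test
  function minimal in time there, so its time derivative vanishes and its slice is an admissible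
  stationary test function.\<close>

lemma stationary_imp_parabolic_subsolution:
  assumes "stationary_subsolution Om nu H c u"
  shows "parabolic_subsolution Om nu H c (\<lambda>q. u (fst q))"
  unfolding parabolic_subsolution_def
proof (intro conjI allI impI ballI)
  show "usc_on (closure Om \<times> {0..}) (\<lambda>q::'a \<times> real. u (fst q))"
    by (rule usc_on_compose[of "closure Om"]) (use assms in \<open>auto simp: stationary_subsolution_def intro!: continuous_intros\<close>)
  fix \<phi> :: "'a \<times> real \<Rightarrow> real" and G x and t \<delta> :: real
  assume \<phi>: "has_C1_gradient (closure Om \<times> {0..}) \<phi> G" and x: "x \<in> Om" and t: "0 < t" and \<delta>: "0 < \<delta>"
    and mx: "\<forall>q\<in>closure Om \<times> {0..}. u (fst q) - \<phi> q \<le> u (fst (x, t)) - \<phi> (x, t)"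
  have xc: "x \<in> closure Om" using x closure_subset by blast
  have "snd (G (x, t)) = 0"
    by (rule DERIV_local_min[OF C1_gradient_slices(2)[OF \<phi> t xc] t]) (use mx xc in \<open>force simp: abs_less_iff\<close>)
  moreover have "\<forall>y\<in>closure Om. u y - \<phi> (y, t) \<le> u x - \<phi> (x, t)" using mx t by force
  then have "stationary_E Om nu H c \<delta> u (\<lambda>y. \<phi> (y, t)) (\<lambda>y. fst (G (y, t))) x \<le> 0"
    using assms C1_gradient_slices(1)[OF \<phi> t] x \<delta> unfolding stationary_subsolution_def by blast
  ultimately show "parabolic_E Om nu H c \<delta> (\<lambda>q. u (fst q)) \<phi> G x t \<le> 0"
    by (simp add: parabolic_E_def stationary_E_def)
qed

lemma stationary_imp_parabolic_supersolution:
  assumes "stationary_supersolution Om nu H c v"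
  shows "parabolic_supersolution Om nu H c (\<lambda>q. v (fst q))"
  unfolding parabolic_supersolution_def
proof (intro conjI allI impI ballI)
  have "usc_on (closure Om) (\<lambda>x. - v x)" using assms by (simp add: stationary_supersolution_def lsc_on_iff_usc_on_minus)
  then have "usc_on (closure Om \<times> {0..}) (\<lambda>q::'a \<times> real. - v (fst q))"
    by (rule usc_on_compose) (auto intro!: continuous_intros)
  then show "lsc_on (closure Om \<times> {0..}) (\<lambda>q::'a \<times> real. v (fst q))" by (simp add: lsc_on_iff_usc_on_minus)
  fix \<phi> :: "'a \<times> real \<Rightarrow> real" and G x and t \<delta> :: real
  assume \<phi>: "has_C1_gradient (closure Om \<times> {0..}) \<phi> G" and x: "x \<in> closure Om" and t: "0 < t" and \<delta>: "0 < \<delta>"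
    and mn: "\<forall>q\<in>closure Om \<times> {0..}. v (fst q) - \<phi> q \<ge> v (fst (x, t)) - \<phi> (x, t)"
  have "snd (G (x, t)) = 0"
    by (rule DERIV_local_max[OF C1_gradient_slices(2)[OF \<phi> t x] t]) (use mn x in \<open>force simp: abs_less_iff\<close>)
  moreover have "\<forall>y\<in>closure Om. v y - \<phi> (y, t) \<ge> v x - \<phi> (x, t)" using mn t by force
  then have "stationary_E Om nu H c \<delta> v (\<lambda>y. \<phi> (y, t)) (\<lambda>y. fst (G (y, t))) x \<ge> 0"
    using assms C1_gradient_slices(1)[OF \<phi> t] x \<delta> unfolding stationary_supersolution_def by blast
  ultimately show "parabolic_E Om nu H c \<delta> (\<lambda>q. v (fst q)) \<phi> G x t \<ge> 0"
    by (simp add: parabolic_E_def stationary_E_def)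
qed

text \<open>As \<open>x\<close> is not in \<open>S\<close>, puncturing at \<open>x\<close> or at
  \<open>(x, t)\<close> removes nothing from the two sets, so the two limits see the same
  values.\<close>

lemma Limsup_time_independent:
  fixes f :: "'a::metric_space \<Rightarrow> ereal"
  assumes x: "x \<notin> S" and t: "0 < (t::real)"
  shows "Limsup (at (x, t) within S \<times> {0..}) (\<lambda>q. f (fst q)) = Limsup (at x within S) f"
proof -
  have ev: "(\<forall>\<^sub>F q in at (x, t) within S \<times> {0..}. f (fst q) < a) \<longleftrightarrow> (\<forall>\<^sub>F y in at x within S. f y < a)" for a
  proof
    assume "\<forall>\<^sub>F q in at (x, t) within S \<times> {0..}. f (fst q) < a"
    then obtain d where d: "d > 0" "\<And>q. q \<in> S \<times> {0..} \<Longrightarrow> q \<noteq> (x, t) \<Longrightarrow> dist q (x, t) < d \<Longrightarrow> f (fst q) < a"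
      unfolding eventually_at by blast
    have "f y < a" if "y \<in> S" "dist y x < d" for y
      using d(2)[of "(y, t)"] that x t by (auto simp: dist_Pair_Pair)
    then show "\<forall>\<^sub>F y in at x within S. f y < a" unfolding eventually_at using d(1) by blast
  next
    assume "\<forall>\<^sub>F y in at x within S. f y < a"
    then obtain d where d: "d > 0" "\<And>y. y \<in> S \<Longrightarrow> y \<noteq> x \<Longrightarrow> dist y x < d \<Longrightarrow> f y < a"
      unfolding eventually_at by blast
    have "f (fst q) < a" if "q \<in> S \<times> {0..}" "dist q (x, t) < d" for q
    proof (rule d(2))
      show "fst q \<in> S" "fst q \<noteq> x" using that(1) x by auto
      show "dist (fst q) x < d" using that(2) dist_fst_le[of q "(x, t)"] by simp
    qed
    then show "\<forall>\<^sub>F q in at (x, t) within S \<times> {0..}. f (fst q) < a" unfolding eventually_at using d(1) by blast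
  qed
  have "Limsup (at (x, t) within S \<times> {0..}) (\<lambda>q. f (fst q)) \<le> C \<longleftrightarrow> Limsup (at x within S) f \<le> C" for C
    unfolding Limsup_le_iff ev ..
  then show ?thesis by (meson order_refl antisym)
qed

section \<open>Uniform constants from the hypotheses and the final assembly\<close>

lemma jump_kernel_exists:
  assumes dom: "bounded_C1_domain Om" and reg: "\<And>x. x \<in> closure Om \<Longrightarrow> regular_jump_measure (nu x)"
    and sg: "0 < sg" "sg < 1" and M0: "M0 Om nu" and M1: "M1 Om nu sg" and M2: "M2 Om nu sg" and M3: "M3 Om nu sg"
  obtains N where "jump_kernel Om nu sg N"
proof -
  obtain C1 where C1: "0 < C1" "\<forall>b\<in>{0..2}. \<forall>d>0.
      (SUP x\<in>closure Om. \<integral>\<^sup>+z\<in>- ball 0 d. ennreal (min 1 (norm z powr b)) \<partial>nu x) \<le> ennreal (C1 * h_rate b sg d)"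
    using M1 unfolding M1_def by blast
  obtain C2 where C2: "0 < C2" "\<forall>b\<in>{sg<..2}. \<forall>d\<in>{0<..<1}.
      (SUP x\<in>closure Om. \<integral>\<^sup>+z\<in>ball 0 d. ennreal (norm z powr b) \<partial>nu x) \<le> ennreal (C2 * d powr (b - sg))"
    using M2 unfolding M2_def by blast
  have "bounded (closure Om)" using dom unfolding bounded_C1_domain_def by blast
  then obtain D where D: "\<And>x y. x \<in> closure Om \<Longrightarrow> y \<in> closure Om \<Longrightarrow> dist x y \<le> D" by (auto simp: bounded_two_points)
  define N where "N = C1 + C2 + \<bar>D\<bar> + 1"
  have N: "C1 \<le> N" "C2 \<le> N" "D \<le> N" "1 \<le> N" using C1(1) C2(1) by (auto simp: N_def)
  have tl: "(\<integral>\<^sup>+z\<in>- ball 0 d. ennreal (min 1 (norm z powr b)) \<partial>nu x) \<le> ennreal (N * h_rate b sg d)"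
    if "x \<in> closure Om" "0 \<le> b" "b \<le> 2" "0 < d" "0 \<le> h_rate b sg d" for x b d
  proof -
    have "(\<integral>\<^sup>+z\<in>- ball 0 d. ennreal (min 1 (norm z powr b)) \<partial>nu x) \<le> ennreal (C1 * h_rate b sg d)"
      by (rule order_trans[OF SUP_upper C1(2)[rule_format]]) (use that in auto)
    also have "\<dots> \<le> ennreal (N * h_rate b sg d)" using N that by (intro ennreal_leI mult_right_mono) auto
    finally show ?thesis .
  qed
  have "jump_kernel Om nu sg N"
  proof
    fix x d b assume x: "x \<in> closure Om" and d: "0 < (d::real)"
    show "(\<integral>\<^sup>+z\<in>- ball 0 d. ennreal (min 1 (norm z powr b)) \<partial>nu x) \<le> ennreal (N * d powr (b - sg))"
      if "0 \<le> b" "b < sg" using tl[OF x that(1) _ d] that sg by (simp add: h_rate_def)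
    show "(\<integral>\<^sup>+z\<in>- ball 0 d. ennreal (min 1 (norm z powr b)) \<partial>nu x) \<le> ennreal N"
      if "sg < b" "b \<le> 1" using tl[OF x _ _ d, of b] that sg by (simp add: h_rate_def)
    assume d1: "d < 1"
    have "(\<integral>\<^sup>+z\<in>ball 0 d. ennreal (norm z) \<partial>nu x) = (\<integral>\<^sup>+z\<in>ball 0 d. ennreal (norm z powr 1) \<partial>nu x)" by simp
    also have "\<dots> \<le> ennreal (C2 * d powr (1 - sg))"
      by (rule order_trans[OF SUP_upper C2(2)[rule_format]]) (use x d d1 sg in auto)
    also have "\<dots> \<le> ennreal (N * d powr (1 - sg))" using N by (intro ennreal_leI mult_right_mono) auto
    finally show "(\<integral>\<^sup>+z\<in>ball 0 d. ennreal (norm z) \<partial>nu x) \<le> ennreal (N * d powr (1 - sg))" .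
  qed (use assms N(4) D order_trans[OF D N(3)] in auto)
  then show thesis by (rule that)
qed

lemma H2_superlinear:
  assumes H2: "H2 Om H m" and m: "1 < m"
  shows "\<exists>C\<ge>0. \<forall>x\<in>closure Om. \<forall>p. A * norm p - C \<le> H x p"
proof -
  obtain c0 C where c0: "0 < c0" "0 \<le> C" "\<And>x p. x \<in> closure Om \<Longrightarrow> c0 * norm p powr m - C \<le> H x p"
    using H2 unfolding H2_def by blast
  \<comment> \<open>Beyond this radius \<open>c0 * norm p powr (m - 1)\<close> exceeds the absolute
    value of \<open>A\<close>; within it the linear term is bounded by a constant. Here
    \<open>m > 1\<close> is used.\<close>
  define R where "R = (max 1 (\<bar>A\<bar> / c0)) powr (1 / (m - 1))"
  have R: "0 < R" "R powr (m - 1) = max 1 (\<bar>A\<bar> / c0)" using m by (auto simp: R_def powr_powr)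
  have "A * norm p - (C + \<bar>A\<bar> * R) \<le> H x p" if x: "x \<in> closure Om" for x p
  proof (cases "norm p \<le> R")
    case True
    have "A * norm p \<le> \<bar>A\<bar> * norm p" by (rule mult_right_mono) auto
    also have "\<dots> \<le> \<bar>A\<bar> * R" using True by (rule mult_left_mono) simp
    finally have "A * norm p \<le> \<bar>A\<bar> * R" .
    moreover have "0 \<le> c0 * norm p powr m" using c0(1) by simp
    ultimately show ?thesis using c0(3)[OF x, of p] by linarith
  next
    case False
    then have p: "0 < norm p" using R by linarith
    have "\<bar>A\<bar> / c0 \<le> R powr (m - 1)" unfolding R(2) by simp
    also have "\<dots> \<le> norm p powr (m - 1)" using False R(1) m by (intro powr_mono2) auto
    finally have "\<bar>A\<bar> \<le> c0 * norm p powr (m - 1)" using c0(1) by (simp add: field_simps)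
    then have "\<bar>A\<bar> * norm p \<le> c0 * norm p powr (m - 1) * norm p" using p by (intro mult_right_mono) auto
    also have "\<dots> = c0 * norm p powr m" using p by (simp add: powr_diff)
    finally have "\<bar>A\<bar> * norm p \<le> c0 * norm p powr m" .
    moreover have "A * norm p \<le> \<bar>A\<bar> * norm p" by (rule mult_right_mono) auto
    moreover have "0 \<le> \<bar>A\<bar> * R" using R(1) by simp
    ultimately show ?thesis using c0(3)[OF x, of p] by linarith
  qed
  moreover have "0 \<le> C + \<bar>A\<bar> * R" using c0(2) R(1) by simp
  ultimately show ?thesis by blast
qed

context hj_pair
begin

lemma slice_max:
  assumes t: "0 \<le> t"
  shows "\<exists>x\<in>cl. \<forall>y\<in>cl. u (y, t) - v (y, t) \<le> u (x, t) - v (x, t)"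
proof -
  obtain x0 where x0: "x0 \<in> cl" using Om_ne Om_cl by blast
  have us: "usc_on cl (\<lambda>y. u (y, t) + - v (y, t))"
    using t by (intro usc_on_add usc_slice[OF uusc] usc_slice[OF vlsc]) auto
  have "bounded {x\<in>cl. u (x0, t) + - v (x0, t) \<le> u (x, t) + - v (x, t)}"
    by (rule bounded_subset[OF compact_imp_bounded[OF compact_cl]]) auto
  from usc_attains_max[OF us closed_closure x0 this] show ?thesis by (metis diff_conv_add_uminus)
qed

end

theorem proposition5p5:
  fixes \<Omega> :: "'a::euclidean_space set"
    and \<nu> :: "'a \<Rightarrow> 'a measure"
    and H\<^sub>0 :: "'a \<Rightarrow> 'a \<Rightarrow> real"
    and \<sigma> m c :: real
  assumes "bounded_C1_domain \<Omega>"
    and "\<And>x. x \<in> closure \<Omega> \<Longrightarrow> regular_jump_measure (\<nu> x)"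
    and "0 < \<sigma>" and "\<sigma> < 1"
    and "M0 \<Omega> \<nu>" and "M1 \<Omega> \<nu> \<sigma>" and "M2 \<Omega> \<nu> \<sigma>" and "M3 \<Omega> \<nu> \<sigma>"
    and "iterative_covering \<Omega> \<nu>"
    and "continuous_on (closure \<Omega> \<times> UNIV) (\<lambda>(x, p). H\<^sub>0 x p)"
    and "1 < m" and "H2 \<Omega> H\<^sub>0 m"
  shows "(\<forall>(u :: 'a \<times> real \<Rightarrow> real) v \<kappa> t\<^sub>0.
            bounded (u ` (closure \<Omega> \<times> {0..})) \<and> bounded (v ` (closure \<Omega> \<times> {0..})) \<and>
            parabolic_subsolution \<Omega> \<nu> H\<^sub>0 c u \<and> parabolic_supersolution \<Omega> \<nu> H\<^sub>0 c v \<and>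
            (\<forall>x\<in>frontier \<Omega>. \<forall>t>0.
               ereal (u (x, t)) = Limsup (at (x, t) within \<Omega> \<times> {0..}) (\<lambda>q. ereal (u q))) \<and>
            (\<forall>t\<ge>0. \<kappa> t = (SUP x\<in>closure \<Omega>. u (x, t) - v (x, t))) \<and>
            0 < t\<^sub>0 \<and> \<kappa> t\<^sub>0 = (SUP t\<in>{0..}. \<kappa> t) \<longrightarrow>
            (\<lambda>q. u q - v q) constant_on closure \<Omega> \<times> {0..t\<^sub>0} \<and>
            (\<forall>x\<in>closure \<Omega>. \<forall>t\<in>{0..t\<^sub>0}. u (x, t) - v (x, t) = \<kappa> 0)) \<and>
         (\<forall>(u :: 'a \<Rightarrow> real) v.
            bounded (u ` closure \<Omega>) \<and> bounded (v ` closure \<Omega>) \<and>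
            stationary_subsolution \<Omega> \<nu> H\<^sub>0 c u \<and> stationary_supersolution \<Omega> \<nu> H\<^sub>0 c v \<and>
            (\<forall>x\<in>frontier \<Omega>. ereal (u x) = Limsup (at x within \<Omega>) (\<lambda>y. ereal (u y))) \<longrightarrow>
            (\<lambda>x. u x - v x) constant_on closure \<Omega>)"
proof -
  obtain N where N: "jump_kernel \<Omega> \<nu> \<sigma> N" using jump_kernel_exists[OF assms(1-8)] by blast
  have super: "\<exists>C\<ge>0. \<forall>x\<in>closure \<Omega>. \<forall>p. A * norm p - C \<le> H\<^sub>0 x p" for A
    by (rule H2_superlinear[OF assms(12,11)])
  have pair: "\<exists>B. hj_pair \<Omega> \<nu> \<sigma> N H\<^sub>0 c B u v"
    if bu: "bounded (u ` (closure \<Omega> \<times> {0..}))" and bv: "bounded (v ` (closure \<Omega> \<times> {0..}))"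
      and sub: "parabolic_subsolution \<Omega> \<nu> H\<^sub>0 c u" and super': "parabolic_supersolution \<Omega> \<nu> H\<^sub>0 c v"
      and fr: "\<And>x t. x \<in> frontier \<Omega> \<Longrightarrow> 0 < t \<Longrightarrow> ereal (u (x, t)) = Limsup (at (x, t) within \<Omega> \<times> {0..}) (\<lambda>q. ereal (u q))"
    for u v
  proof -
    obtain Bu where Bu: "\<And>q. q \<in> closure \<Omega> \<times> {0..} \<Longrightarrow> \<bar>u q\<bar> \<le> Bu" using bu unfolding bounded_iff by auto
    obtain Bv where Bv: "\<And>q. q \<in> closure \<Omega> \<times> {0..} \<Longrightarrow> \<bar>v q\<bar> \<le> Bv" using bv unfolding bounded_iff by auto
    define B where "B = \<bar>Bu\<bar> + \<bar>Bv\<bar> + 1"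
    have "hj_pair \<Omega> \<nu> \<sigma> N H\<^sub>0 c B u v"
    proof (rule hj_pair.intro[OF N], unfold_locales)
      show "0 < B" by (simp add: B_def)
      show "\<bar>u q\<bar> \<le> B" if "q \<in> closure \<Omega> \<times> {0..}" for q using Bu[OF that] by (simp add: B_def)
      show "\<bar>v q\<bar> \<le> B" if "q \<in> closure \<Omega> \<times> {0..}" for q using Bv[OF that] by (simp add: B_def)
    qed (fact assms(10) super sub super' fr)+
    then show ?thesis ..
  qed
  have par: "u (x, t) - v (x, t) = M"
    if hj: "hj_pair \<Omega> \<nu> \<sigma> N H\<^sub>0 c B u v" and wM: "\<And>q. q \<in> closure \<Omega> \<times> {0..} \<Longrightarrow> u q - v q \<le> M"
      and t0: "0 < t\<^sub>0" and ct: "\<exists>x\<in>closure \<Omega>. u (x, t\<^sub>0) - v (x, t\<^sub>0) = M"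
      and x: "x \<in> closure \<Omega>" and t: "0 \<le> t" "t \<le> t\<^sub>0" for B u v M t\<^sub>0 x t
  proof -
    interpret hj_contact \<Omega> \<nu> \<sigma> N H\<^sub>0 c B u v M t\<^sub>0
      by (rule hj_contact.intro[OF hj], unfold_locales) (fact wM t0 ct)+
    show ?thesis by (rule contact_everywhere[OF assms(9) x t])
  qed
  show ?thesis
  proof (intro conjI allI impI)
    fix u v :: "'a \<times> real \<Rightarrow> real" and \<kappa> :: "real \<Rightarrow> real" and t\<^sub>0 :: real
    assume "bounded (u ` (closure \<Omega> \<times> {0..})) \<and> bounded (v ` (closure \<Omega> \<times> {0..})) \<and>
            parabolic_subsolution \<Omega> \<nu> H\<^sub>0 c u \<and> parabolic_supersolution \<Omega> \<nu> H\<^sub>0 c v \<and>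
            (\<forall>x\<in>frontier \<Omega>. \<forall>t>0.
               ereal (u (x, t)) = Limsup (at (x, t) within \<Omega> \<times> {0..}) (\<lambda>q. ereal (u q))) \<and>
            (\<forall>t\<ge>0. \<kappa> t = (SUP x\<in>closure \<Omega>. u (x, t) - v (x, t))) \<and>
            0 < t\<^sub>0 \<and> \<kappa> t\<^sub>0 = (SUP t\<in>{0..}. \<kappa> t)"
    then have bu: "bounded (u ` (closure \<Omega> \<times> {0..}))" and bv: "bounded (v ` (closure \<Omega> \<times> {0..}))"
      and sub: "parabolic_subsolution \<Omega> \<nu> H\<^sub>0 c u" and super': "parabolic_supersolution \<Omega> \<nu> H\<^sub>0 c v"
      and fr: "\<And>x t. x \<in> frontier \<Omega> \<Longrightarrow> 0 < t \<Longrightarrow> ereal (u (x, t)) = Limsup (at (x, t) within \<Omega> \<times> {0..}) (\<lambda>q. ereal (u q))"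
      and \<kappa>: "\<And>t. 0 \<le> t \<Longrightarrow> \<kappa> t = (SUP x\<in>closure \<Omega>. u (x, t) - v (x, t))"
      and t0: "0 < t\<^sub>0" and \<kappa>0: "\<kappa> t\<^sub>0 = (SUP t\<in>{0..}. \<kappa> t)"
      by blast+
    obtain B where hj: "hj_pair \<Omega> \<nu> \<sigma> N H\<^sub>0 c B u v" using pair[OF bu bv sub super' fr] by blast
    interpret hj_pair \<Omega> \<nu> \<sigma> N H\<^sub>0 c B u v by (rule hj)
    have w2: "u (x, t) - v (x, t) \<le> 2 * B" if "x \<in> cl" "0 \<le> t" for x t
      using uB[of "(x, t)"] vB[of "(x, t)"] that by auto
    have w\<kappa>: "u (x, t) - v (x, t) \<le> \<kappa> t" if "x \<in> cl" "0 \<le> t" for x t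
      unfolding \<kappa>[OF that(2)] by (rule cSUP_upper[OF that(1)]) (intro bdd_aboveI2[of _ _ "2 * B"] w2 that(2))
    have \<kappa>B: "\<kappa> t \<le> 2 * B" if "0 \<le> t" for t
      unfolding \<kappa>[OF that] by (rule cSUP_least) (use Om_ne w2 that in auto)
    have \<kappa>max: "\<kappa> t \<le> \<kappa> t\<^sub>0" if "0 \<le> t" for t
      unfolding \<kappa>0 by (rule cSUP_upper) (use that \<kappa>B in \<open>auto intro!: bdd_aboveI2[of _ _ "2 * B"]\<close>)
    \<comment> \<open>The hypothesis on \<open>\<kappa>\<close> gives a supremum over time that is
      attained at \<open>t\<^sub>0\<close>; semicontinuity on the compact closure makes the supremum
      in space attained as well, which yields an actual contact point.\<close>
    obtain x0 where x0: "x0 \<in> cl" "\<And>y. y \<in> cl \<Longrightarrow> u (y, t\<^sub>0) - v (y, t\<^sub>0) \<le> u (x0, t\<^sub>0) - v (x0, t\<^sub>0)"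
      using slice_max[OF less_imp_le[OF t0]] by blast
    have "\<kappa> t\<^sub>0 \<le> u (x0, t\<^sub>0) - v (x0, t\<^sub>0)"
      unfolding \<kappa>[OF less_imp_le[OF t0]] by (rule cSUP_least) (use Om_ne x0(2) in auto)
    then have c0: "u (x0, t\<^sub>0) - v (x0, t\<^sub>0) = \<kappa> t\<^sub>0" using w\<kappa>[OF x0(1) less_imp_le[OF t0]] by simp
    have all: "u (x, t) - v (x, t) = \<kappa> t\<^sub>0" if "x \<in> cl" "t \<in> {0..t\<^sub>0}" for x t
    proof (rule par[OF hj _ t0 _ that(1)])
      show "u q - v q \<le> \<kappa> t\<^sub>0" if "q \<in> cl \<times> {0..}" for q
        using w\<kappa>[of "fst q" "snd q"] \<kappa>max[of "snd q"] that by (auto intro: order_trans)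
    qed (use c0 x0(1) that in auto)
    \<comment> \<open>The difference is constant up to and including time \<open>0\<close>, so
      \<open>\<kappa> 0\<close> is the supremum of that constant.\<close>
    have "\<kappa> 0 = (SUP x\<in>cl. \<kappa> t\<^sub>0)" using all t0 by (simp add: \<kappa>)
    then have k0: "\<kappa> 0 = \<kappa> t\<^sub>0" using Om_ne by simp
    show "(\<lambda>q. u q - v q) constant_on closure \<Omega> \<times> {0..t\<^sub>0}"
      unfolding constant_on_def using all by auto
    show "\<forall>x\<in>closure \<Omega>. \<forall>t\<in>{0..t\<^sub>0}. u (x, t) - v (x, t) = \<kappa> 0" using all k0 by simp
  next
    fix u v :: "'a \<Rightarrow> real"
    assume A: "bounded (u ` closure \<Omega>) \<and> bounded (v ` closure \<Omega>) \<and>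
            stationary_subsolution \<Omega> \<nu> H\<^sub>0 c u \<and> stationary_supersolution \<Omega> \<nu> H\<^sub>0 c v \<and>
            (\<forall>x\<in>frontier \<Omega>. ereal (u x) = Limsup (at x within \<Omega>) (\<lambda>y. ereal (u y)))"
    let ?u = "\<lambda>q::'a \<times> real. u (fst q)" and ?v = "\<lambda>q::'a \<times> real. v (fst q)"
    have im: "bounded ((\<lambda>q. f (fst q)) ` (closure \<Omega> \<times> {0::real..}))" if "bounded (f ` closure \<Omega>)" for f :: "'a \<Rightarrow> real"
      by (rule bounded_subset[OF that]) auto
    have "open \<Omega>" using assms(1) by (simp add: bounded_C1_domain_def)
    then have nO: "x \<notin> \<Omega>" if "x \<in> frontier \<Omega>" for x using that by (simp add: frontier_def interior_open)
    obtain B where hj: "hj_pair \<Omega> \<nu> \<sigma> N H\<^sub>0 c B ?u ?v"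
    proof -
      have "\<exists>B. hj_pair \<Omega> \<nu> \<sigma> N H\<^sub>0 c B ?u ?v"
      proof (rule pair)
        show "bounded (?u ` (closure \<Omega> \<times> {0..}))" "bounded (?v ` (closure \<Omega> \<times> {0..}))"
          using A im by blast+
        show "ereal (?u (x, t)) = Limsup (at (x, t) within \<Omega> \<times> {0..}) (\<lambda>q. ereal (?u q))" if "x \<in> frontier \<Omega>" "0 < t" for x t
          using A that Limsup_time_independent[OF nO[OF that(1)] that(2), of "\<lambda>y. ereal (u y)"] by simp
      qed (use A stationary_imp_parabolic_subsolution stationary_imp_parabolic_supersolution in blast)+
      then show thesis using that by blast
    qed
    interpret hj_pair \<Omega> \<nu> \<sigma> N H\<^sub>0 c B ?u ?v by (rule hj)
    obtain x0 where x0: "x0 \<in> cl" "\<And>y. y \<in> cl \<Longrightarrow> u y - v y \<le> u x0 - v x0"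
      using slice_max[of 1] by auto
    \<comment> \<open>The maximal difference of the time-independent extensions is attained at every
      time; time \<open>1\<close> serves as the contact time.\<close>
    have "?u (x, 1) - ?v (x, 1) = u x0 - v x0" if "x \<in> cl" for x
    proof (rule par[OF hj _ zero_less_one _ that])
      show "\<exists>x\<in>closure \<Omega>. ?u (x, 1) - ?v (x, 1) = u x0 - v x0" by (rule bexI[OF _ x0(1)]) simp
    qed (use x0(2) in auto)
    then show "(\<lambda>x. u x - v x) constant_on closure \<Omega>" unfolding constant_on_def by auto
  qed
qed

end
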